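(* Fix $p\in(1,2)$ and $r>1$. Assuming the Small Set Expansion Hypothesis, there is no $r$-approximation algorithm running in time $\mathrm{poly}(n)$ for rank-$k$ approximation in the entrywise $\ell_p$ norm of a matrix $A\in\mathbb{R}^{n\times d}$ with $n\ge d$ and $k=d-1$. Consequently, additionally assuming the Exponential Time Hypothesis, there exists $\delta=\delta(p,r)>0$ such that there is no $r$-approximation algorithm for this problem (with $n\ge d$, $k=d-1$) running in time $2^{n^{\delta}}$.
   Context: Rank-$k$ approximation in the entrywise $\ell_p$ norm: given $A\in\mathbb{R}^{n\times d}$ and $k$, find $U\in\mathbb{R}^{n\times k}$, $V\in\mathbb{R}^{k\times d}$ minimizing $\|UV-A\|_p^p=\sum_{i,j}|(UV-A)_{i,j}|^p$; an $r$-approximation outputs $U,V$ whose objective is at most $r$ times the minimum. Small Set Expansion Hypothesis: for a regular graph $G=(V,E)$ and $S\subseteq V$ let $\mu(S)=|S|/|V|$ and $\Phi_G(S)$ be the probability that a uniformly random neighbor of a uniformly random vertex of $S$ lies outside $S$; $\Phi_G(\delta)=\min_{\mu(S)\le\delta}\Phi_G(S)$; the hypothesis states that for every $\varepsilon>0$ there is $\delta>0$ such that it is NP-hard to decide whether $\Phi_G(\delta)\le\varepsilon$ or $\Phi_G(\delta)\ge1-\varepsilon$. Exponential Time Hypothesis: 3-SAT on $n$ variables cannot be solved in time $2^{o(n)}$.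
   Formalization: The first claim (no poly(n)-time r-approximation) is proved assuming P ≠ NP besides the Small Set Expansion Hypothesis: the latter is stated as NP-hardness, which holds trivially if P = NP and then excludes no algorithm. The second claim, under ETH, needs no such premise. *)

theory Defs
  imports
    "HOL-Probability.Probability_Mass_Function"
    "HOL-Library.Landau_Symbols"
    "Jordan_Normal_Form.Matrix"
begin

section \<open>Multitape Turing machines\<close>

text \<open>
  Deterministic machines with finitely many tapes, each infinite in both directions.  The alphabet
  is \<open>{..<tm_syms M}\<close>; symbol 0 is the blank, and 1 and 2 stand for the bits \<open>False\<close> and \<open>True\<close>.
  The working states are \<open>{..<tm_states M}\<close>, the initial state is 0, and the number
  \<open>tm_states M\<close> itself serves as the halting state.  The transition function maps a state and the
  list of scanned symbols to the next state and, for every tape, the symbol to be written and the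
  head movement.
\<close>

record tm =
  tm_tapes :: nat
  tm_syms :: nat
  tm_states :: nat
  tm_trans :: "nat \<Rightarrow> nat list \<Rightarrow> nat \<times> (nat \<times> int) list"

definition turing_machine :: "tm \<Rightarrow> bool" where
  "turing_machine M \<longleftrightarrow> 1 \<le> tm_tapes M \<and> 3 \<le> tm_syms M \<and>
     (\<forall>q < tm_states M. \<forall>ss. length ss = tm_tapes M \<and> set ss \<subseteq> {..<tm_syms M} \<longrightarrow>
        fst (tm_trans M q ss) \<le> tm_states M \<and>
        length (snd (tm_trans M q ss)) = tm_tapes M \<and>
        set (snd (tm_trans M q ss)) \<subseteq> {..<tm_syms M} \<times> {-1, 0, 1})"

type_synonym tape = "(int \<Rightarrow> nat) \<times> int"  \<comment> \<open>contents and head position\<close>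
type_synonym config = "nat \<times> tape list"

fun tape_act :: "nat \<times> int \<Rightarrow> tape \<Rightarrow> tape" where
  "tape_act (s, m) (f, h) = (f(h := s), h + m)"

fun tm_step :: "tm \<Rightarrow> config \<Rightarrow> config" where
  "tm_step M (q, ts) =
     (if q = tm_states M then (q, ts)
      else let (q', as) = tm_trans M q (map (\<lambda>(f, h). f h) ts) in (q', map2 tape_act as ts))"

definition word_tape :: "bool list \<Rightarrow> int \<Rightarrow> nat" where
  "word_tape w i = (if 0 \<le> i \<and> i < int (length w) then (if w ! nat i then 2 else 1) else 0)"

definition tm_init :: "tm \<Rightarrow> bool list \<Rightarrow> config" where
  "tm_init M x = (0, (word_tape x, 0) # replicate (tm_tapes M - 1) (word_tape [], 0))"

text \<open>On input \<open>x\<close> (on the first tape), \<open>M\<close> halts after at most \<open>t\<close> steps, and the last tape then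
  contains the word \<open>y\<close> and nothing else.\<close>

definition tm_outputs :: "tm \<Rightarrow> bool list \<Rightarrow> bool list \<Rightarrow> real \<Rightarrow> bool" where
  "tm_outputs M x y t \<longleftrightarrow>
     (\<exists>s q ts. real s \<le> t \<and> (tm_step M ^^ s) (tm_init M x) = (q, ts) \<and>
        q = tm_states M \<and> fst (last ts) = word_tape y)"

section \<open>Complexity classes and NP-hardness\<close>

definition poly_bound :: "nat \<Rightarrow> nat \<Rightarrow> nat" where
  "poly_bound c n = c * n ^ c + c"

definition poly_time_fun :: "(bool list \<Rightarrow> bool list) \<Rightarrow> bool" where
  "poly_time_fun f \<longleftrightarrow>
     (\<exists>M c. turing_machine M \<and> (\<forall>x. tm_outputs M x (f x) (poly_bound c (length x))))"

type_synonym lang = "bool list set"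

definition class_P :: "lang set" where
  "class_P = {L. poly_time_fun (\<lambda>x. [x \<in> L])}"

text \<open>Prefix-free code of a list, from a prefix-free code of its elements.\<close>

definition enc_list :: "('a \<Rightarrow> bool list) \<Rightarrow> 'a list \<Rightarrow> bool list" where
  "enc_list e xs = concat (map (\<lambda>x. True # e x) xs) @ [False]"

definition enc_word :: "bool list \<Rightarrow> bool list" where
  "enc_word w = enc_list (\<lambda>b. [b]) w"

definition class_NP :: "lang set" where
  "class_NP = {L. \<exists>R \<in> class_P. \<exists>c. \<forall>x. x \<in> L \<longleftrightarrow>
     (\<exists>w. length w \<le> poly_bound c (length x) \<and> enc_word x @ w \<in> R)}"

text \<open>A promise problem is given by its sets of yes- and no-instances; NP-hardness is with respect
  to polynomial-time many-one reductions.\<close>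

definition NP_hard_promise :: "lang \<Rightarrow> lang \<Rightarrow> bool" where
  "NP_hard_promise Yes No \<longleftrightarrow>
     (\<forall>L \<in> class_NP. \<exists>f. poly_time_fun f \<and>
        (\<forall>x. (x \<in> L \<longrightarrow> f x \<in> Yes) \<and> (x \<notin> L \<longrightarrow> f x \<in> No)))"

section \<open>Binary encodings\<close>

text \<open>Binary digits, least significant first.\<close>

fun nat_bits :: "nat \<Rightarrow> bool list" where
  "nat_bits n = (if n = 0 then [] else odd n # nat_bits (n div 2))"

declare nat_bits.simps [simp del]

definition enc_nat :: "nat \<Rightarrow> bool list" where
  "enc_nat n = enc_word (nat_bits n)"

definition enc_int :: "int \<Rightarrow> bool list" where
  "enc_int i = (i < 0) # enc_nat (nat \<bar>i\<bar>)"

definition enc_rat :: "rat \<Rightarrow> bool list" where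
  "enc_rat x = (case quotient_of x of (a, b) \<Rightarrow> enc_int a @ enc_int b)"

definition enc_mat :: "rat mat \<Rightarrow> bool list" where
  "enc_mat A = enc_nat (dim_row A) @ enc_nat (dim_col A) @
     enc_list (enc_list enc_rat) (mat_to_list A)"

section \<open>The Small Set Expansion Hypothesis\<close>

text \<open>Simple undirected graphs, given by a symmetric irreflexive adjacency relation.  The degree is
  positive, so that a random neighbour exists.\<close>

definition regular_graph :: "'a set \<Rightarrow> 'a rel \<Rightarrow> bool" where
  "regular_graph V E \<longleftrightarrow> finite V \<and> V \<noteq> {} \<and> E \<subseteq> V \<times> V \<and> sym E \<and> irrefl E \<and>
     (\<exists>k > 0. \<forall>v \<in> V. card (E `` {v}) = k)"

definition set_measure :: "'a set \<Rightarrow> 'a set \<Rightarrow> real" where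
  "set_measure V S = real (card S) / real (card V)"

definition expansion :: "'a rel \<Rightarrow> 'a set \<Rightarrow> real" where
  "expansion E S =
     measure_pmf.prob (bind_pmf (pmf_of_set S) (\<lambda>u. pmf_of_set (E `` {u}))) (- S)"

definition small_set_expansion :: "'a set \<Rightarrow> 'a rel \<Rightarrow> real \<Rightarrow> real" where
  "small_set_expansion V E \<delta> =
     Min {expansion E S | S. S \<subseteq> V \<and> S \<noteq> {} \<and> set_measure V S \<le> \<delta>}"

definition enc_graph :: "nat \<Rightarrow> nat rel \<Rightarrow> bool list" where
  "enc_graph n E = enc_nat n @ map (\<lambda>e. e \<in> E) (List.product [0..<n] [0..<n])"

text \<open>The condition \<open>1 \<le> \<delta> * n\<close> says that there is a nonempty set of measure at most \<open>\<delta>\<close>, so that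
  the minimum in \<^const>\<open>small_set_expansion\<close> is over a nonempty set.  It excludes only finitely many
  graphs for each \<open>\<delta>\<close>.\<close>

definition SSE_yes :: "real \<Rightarrow> real \<Rightarrow> lang" where
  "SSE_yes \<epsilon> \<delta> = {enc_graph n E | n E. regular_graph {..<n} E \<and> 1 \<le> \<delta> * real n \<and>
     small_set_expansion {..<n} E \<delta> \<le> \<epsilon>}"

definition SSE_no :: "real \<Rightarrow> real \<Rightarrow> lang" where
  "SSE_no \<epsilon> \<delta> = {enc_graph n E | n E. regular_graph {..<n} E \<and> 1 \<le> \<delta> * real n \<and>
     small_set_expansion {..<n} E \<delta> \<ge> 1 - \<epsilon>}"

text \<open>The hypothesis asserts NP-hardness only; consequences of the form ``no polynomial-time
  algorithm'' need \<open>class_P \<noteq> class_NP\<close> in addition, which \<open>ETH\<close> below implies.\<close>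

definition SSEH :: bool where
  "SSEH \<longleftrightarrow> (\<forall>\<epsilon> > 0. \<exists>\<delta> > 0. NP_hard_promise (SSE_yes \<epsilon> \<delta>) (SSE_no \<epsilon> \<delta>))"

section \<open>The Exponential Time Hypothesis\<close>

type_synonym literal = "bool \<times> nat"  \<comment> \<open>sign (\<open>True\<close> for positive) and variable\<close>
type_synonym cnf = "literal list list"

definition cnf3 :: "cnf \<Rightarrow> bool" where
  "cnf3 \<phi> \<longleftrightarrow> (\<forall>C \<in> set \<phi>. length C \<le> 3)"

definition cnf_vars :: "cnf \<Rightarrow> nat set" where
  "cnf_vars \<phi> = (\<Union>C \<in> set \<phi>. snd ` set C)"

definition cnf_sat :: "cnf \<Rightarrow> bool" where
  "cnf_sat \<phi> \<longleftrightarrow> (\<exists>\<alpha>. \<forall>C \<in> set \<phi>. \<exists>(b, v) \<in> set C. \<alpha> v = b)"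

definition enc_cnf :: "cnf \<Rightarrow> bool list" where
  "enc_cnf \<phi> = enc_list (enc_list (\<lambda>(b, v). b # enc_nat v)) \<phi>"

text \<open>The number of variables does not bound the length of a formula (clauses may be repeated and
  variables may have large indices), so a bound in the number of variables alone would be violated
  by every machine that reads its input.  Hence the factor polynomial in the input length.\<close>

definition ETH :: bool where
  "ETH \<longleftrightarrow> \<not> (\<exists>M c. \<exists>g :: nat \<Rightarrow> real. turing_machine M \<and> g \<in> o(\<lambda>n. real n) \<and>
     (\<forall>\<phi>. cnf3 \<phi> \<longrightarrow>
        tm_outputs M (enc_cnf \<phi>) [cnf_sat \<phi>]
          (2 powr g (card (cnf_vars \<phi>)) * poly_bound c (length (enc_cnf \<phi>)))))"

section \<open>Low rank approximation in the entrywise p-norm\<close>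

definition lp_cost :: "real \<Rightarrow> real mat \<Rightarrow> real mat \<Rightarrow> real mat \<Rightarrow> real" where
  "lp_cost p A U V =
     (\<Sum>i < dim_row A. \<Sum>j < dim_col A. \<bar>(U * V - A) $$ (i, j)\<bar> powr p)"

definition lp_opt :: "real \<Rightarrow> nat \<Rightarrow> real mat \<Rightarrow> real" where
  "lp_opt p k A =
     (INF (U, V) \<in> carrier_mat (dim_row A) k \<times> carrier_mat k (dim_col A). lp_cost p A U V)"

definition lp_approx :: "real \<Rightarrow> real \<Rightarrow> nat \<Rightarrow> real mat \<Rightarrow> real mat \<Rightarrow> real mat \<Rightarrow> bool" where
  "lp_approx p r k A U V \<longleftrightarrow>
     U \<in> carrier_mat (dim_row A) k \<and> V \<in> carrier_mat k (dim_col A) \<and>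
     lp_cost p A U V \<le> r * lp_opt p k A"

text \<open>
  Existence of an \<open>r\<close>-approximation algorithm for matrices with \<open>n\<close> rows and \<open>d \<le> n\<close> columns and
  \<open>k = d - 1\<close>, in time \<open>T n\<close>.  Entries are rational numbers in binary, both in the input and in the
  output; the optimum is over real factors.  As the number of rows does not bound the bit length of
  the entries, time \<open>T n\<close> is understood up to a factor polynomial in the input length, which is at
  least \<open>n\<close>.
\<close>

definition lp_approx_alg_in_time :: "real \<Rightarrow> real \<Rightarrow> (nat \<Rightarrow> real) \<Rightarrow> bool" where
  "lp_approx_alg_in_time p r T \<longleftrightarrow>
     (\<exists>M c. turing_machine M \<and>
        (\<forall>n d A. 1 \<le> d \<and> d \<le> n \<and> A \<in> carrier_mat n d \<longrightarrow>
           (\<exists>U V. tm_outputs M (enc_mat A) (enc_mat U @ enc_mat V)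
                    (T n * poly_bound c (length (enc_mat A))) \<and>
                  lp_approx p r (d - 1) (map_mat of_rat A) (map_mat of_rat U) (map_mat of_rat V))))"

end

theory Submission
  imports Defs "Jordan_Normal_Form.Determinant" "HOL-Real_Asymp.Real_Asymp"
begin

text \<open>
  For \<open>k = d - 1\<close> a product \<open>U V\<close> annihilates some vector \<open>z\<close>, so that by Hoelder's inequality the
  optimum is the smallest ratio \<open>|A z|_p / |z|_q\<close>, where \<open>1/p + 1/q = 1\<close>.
  Since \<open>q > 2\<close>, this encodes the norm of an operator from \<open>l_p\<close> to \<open>l_q\<close>, and for a projection to
  the large eigenvalues of a graph this norm distinguishes graphs with a small nonexpanding set,
  whose indicator vector nearly survives the projection, from small set expanders, where the
  projection is hypercontractive.  The projection is replaced by the matrix polynomial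
  \<open>1 - (1 - G^a)^b\<close> in the normalized adjacency matrix \<open>G\<close>; after scaling it has integer entries, of
  polynomial length when \<open>a\<close> is logarithmic and \<open>b\<close> polynomial.  A block of constant rows is part
  of the instance, and an approximate factorization reproduces its entries well on average if and
  only if the optimum is small; the reduction only has to sum up entries of the output and never
  evaluates \<open>p\<close>-th powers.

  For the second part, satisfiability of 3-CNF formulas, after renaming variables and deleting
  repeated clauses, is a problem in NP whose inputs have length polynomial in the number of
  variables; composing its reduction with the approximation algorithm contradicts ETH as soon as
  \<open>\<delta>\<close> is smaller than the inverse of the degree of the polynomial.

  Polynomial time is established in a calculus of functions on tree-coded data, which are
  computed by stack programs; these are compiled to Turing machines.
\<close>

section \<open>Spectral analysis of the walk operator\<close>

subsection \<open>Random walks on regular graphs\<close>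

text \<open>The obstacle is the size of the gap. Hypercontractivity holds only up to a constant
  factor, the factor \<open>r\<close> has to be absorbed too, and the hypothesis supplies
  \<open>\<delta>\<close> after \<open>\<epsilon>\<close>, without control over it. The way out is
  to compare two scales: a nonexpanding set has at most \<open>\<delta> n\<close> vertices, while
  expansion of all sets of this size carries over to sets \<open>M\<close> times as large, at the
  price of \<open>8 M \<epsilon>\<close> in place of \<open>\<epsilon>\<close>. The two norms then
  differ by a power of \<open>M\<close> whose exponent is positive because \<open>p < 2\<close>;
  \<open>\<delta>\<close> cancels, so \<open>M\<close> and hence \<open>\<epsilon>\<close> can be
  fixed in advance.

  The polynomial has rational entries, which a spectral projection lacks in general, and it is
  divisible by \<open>G^a\<close>. Divisibility replaces an inverse of \<open>G\<close> on the large
  eigenvalues: the filtered vector has iterated preimages under \<open>G\<close>, and expansion is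
  exploited at one well-chosen preimage. As \<open>a\<close> exceeds \<open>log n\<close>, comparing
  norms in dimension \<open>n\<close> costs only a constant factor per preimage; as \<open>a\<close>
  is even, \<open>G^a\<close> is positive semidefinite.\<close>

definition ip :: "nat \<Rightarrow> (nat \<Rightarrow> real) \<Rightarrow> (nat \<Rightarrow> real) \<Rightarrow> real" where
  "ip n x y = (\<Sum>u<n. x u * y u)"

locale regular_walk =
  fixes n k :: nat and E :: "nat rel"
  assumes E_sub: "E \<subseteq> {..<n} \<times> {..<n}" and E_sym: "sym E" and k_pos: "0 < k"
    and E_deg: "\<And>v. v < n \<Longrightarrow> card (E `` {v}) = k"
begin

definition G :: "(nat \<Rightarrow> real) \<Rightarrow> nat \<Rightarrow> real" where
  "G x u = (\<Sum>v\<in>E `` {u}. x v) / k"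

lemma finite_E: "finite E"
  using E_sub finite_subset by blast

lemma finite_nbrs: "finite (E `` {u})"
  using finite_E by auto

lemma sum_E: "(\<Sum>u<n. \<Sum>v\<in>E `` {u}. f u v) = (\<Sum>(u,v)\<in>E. f u v)"
proof -
  have "Sigma {..<n} (\<lambda>u. E `` {u}) = E" using E_sub by auto
  moreover have "(\<Sum>u<n. \<Sum>v\<in>E `` {u}. f u v) = (\<Sum>(u,v)\<in>Sigma {..<n} (\<lambda>u. E `` {u}). f u v)"
    by (rule sum.Sigma) (use finite_nbrs in auto)
  ultimately show ?thesis by simp
qed

lemma sum_E_swap: "(\<Sum>(u,v)\<in>E. f u v) = (\<Sum>(u,v)\<in>E. f v u)"
proof -
  have "bij_betw prod.swap E E"
    using E_sym by (intro bij_betwI[where g=prod.swap]) (auto simp: sym_def)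
  then have "(\<Sum>p\<in>E. case prod.swap p of (u,v) \<Rightarrow> f u v) = (\<Sum>(u,v)\<in>E. f u v)"
    by (rule sum.reindex_bij_betw)
  moreover have "(\<Sum>p\<in>E. case prod.swap p of (u,v) \<Rightarrow> f u v) = (\<Sum>(u,v)\<in>E. f v u)"
    by (intro sum.cong) auto
  ultimately show ?thesis by simp
qed

lemma sum_E_fst: "(\<Sum>(u,v)\<in>E. f u) = k * (\<Sum>u<n. f u :: real)"
  by (simp add: sum_E[symmetric] E_deg sum_distrib_left)

lemma sum_E_snd: "(\<Sum>(u,v)\<in>E. f v) = k * (\<Sum>u<n. f u :: real)"
  using sum_E_swap[of "\<lambda>u v. f v"] sum_E_fst by simp

lemma G_add: "G (\<lambda>u. x u + y u) = (\<lambda>u. G x u + G y u)"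
  by (auto simp: G_def sum.distrib add_divide_distrib)

lemma G_diff: "G (\<lambda>u. x u - y u) = (\<lambda>u. G x u - G y u)"
  by (auto simp: G_def sum_subtractf diff_divide_distrib)

lemma G_scale: "G (\<lambda>u. c * x u) = (\<lambda>u. c * G x u)"
  by (auto simp: G_def sum_distrib_left)

lemma G_sum: "finite J \<Longrightarrow> G (\<lambda>u. \<Sum>j\<in>J. x j u) = (\<lambda>u. \<Sum>j\<in>J. G (x j) u)"
proof (induction J rule: finite_induct)
  case empty
  then show ?case by (auto simp: G_def)
next
  case (insert j J)
  then show ?case by (simp add: G_add)
qed

lemma ip_G: "ip n x (G y) = (\<Sum>(u,v)\<in>E. x u * y v) / k"
proof -
  have "ip n x (G y) = (\<Sum>u<n. \<Sum>v\<in>E `` {u}. x u * y v) / k"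
    by (simp add: ip_def G_def sum_divide_distrib sum_distrib_left)
  then show ?thesis by (simp add: sum_E)
qed

lemma ip_sym: "ip n x y = ip n y x"
  by (simp add: ip_def mult.commute)

lemma ip_G_sym: "ip n (G x) y = ip n x (G y)"
  using sum_E_swap[of "\<lambda>u v. y u * x v"]
  by (simp add: ip_sym[of "G x"] ip_G mult.commute)

lemma ip_diff_left: "ip n (\<lambda>u. x u - y u) z = ip n x z - ip n y z"
  by (simp add: ip_def left_diff_distrib sum_subtractf)

lemma ip_nonneg: "0 \<le> ip n x x"
  by (simp add: ip_def sum_nonneg)

text \<open>The square of an average is at most the average of the squares; summed over all
  \<open>u\<close>, regularity makes every vertex count exactly \<open>k\<close> times.\<close>

lemma ip_G_contraction: "ip n (G x) (G x) \<le> ip n x x"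
proof -
  have "(\<Sum>u<n. (G x u)\<^sup>2) \<le> (\<Sum>u<n. (\<Sum>v\<in>E `` {u}. (x v)\<^sup>2) / k)"
  proof (rule sum_mono)
    fix u assume u: "u \<in> {..<n}"
    have "(\<Sum>v\<in>E `` {u}. x v)\<^sup>2 \<le> k * (\<Sum>v\<in>E `` {u}. (x v)\<^sup>2)"
      using sum_squared_le_sum_of_squares[of x "E `` {u}"] finite_nbrs E_deg u by (simp add: mult.commute)
    then have "(\<Sum>v\<in>E `` {u}. x v)\<^sup>2 / k\<^sup>2 \<le> (k * (\<Sum>v\<in>E `` {u}. (x v)\<^sup>2)) / k\<^sup>2"
      by (rule divide_right_mono) simp
    also have "\<dots> = (\<Sum>v\<in>E `` {u}. (x v)\<^sup>2) / k"
      using k_pos by (simp add: power2_eq_square[of "real k"])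
    finally show "(G x u)\<^sup>2 \<le> (\<Sum>v\<in>E `` {u}. (x v)\<^sup>2) / k"
      by (simp add: G_def power_divide)
  qed
  also have "\<dots> = (\<Sum>(u,v)\<in>E. (x v)\<^sup>2) / k"
    by (simp add: sum_divide_distrib[symmetric] sum_E)
  also have "\<dots> = (\<Sum>u<n. (x u)\<^sup>2)"
    using k_pos by (simp only: sum_E_snd) simp
  finally show ?thesis by (simp add: ip_def power2_eq_square)
qed

text \<open>The inequality of arithmetic and geometric means on every edge. It confines the spectrum
  of \<open>G\<close> to [-1, 1].\<close>

lemma abs_ip_G_le: "\<bar>ip n x (G x)\<bar> \<le> ip n x x"
proof -
  have "\<bar>\<Sum>(u,v)\<in>E. x u * x v\<bar> \<le> (\<Sum>(u,v)\<in>E. ((x u)\<^sup>2 + (x v)\<^sup>2) / 2)"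
  proof (intro order_trans[OF sum_abs] sum_mono)
    fix p assume "p \<in> E"
    show "\<bar>case p of (u, v) \<Rightarrow> x u * x v\<bar> \<le> (case p of (u, v) \<Rightarrow> ((x u)\<^sup>2 + (x v)\<^sup>2) / 2)"
      using sum_squares_bound[of "\<bar>x (fst p)\<bar>" "\<bar>x (snd p)\<bar>"] by (simp add: case_prod_unfold abs_mult)
  qed
  also have "\<dots> = (\<Sum>(u,v)\<in>E. (x u)\<^sup>2) / 2 + (\<Sum>(u,v)\<in>E. (x v)\<^sup>2) / 2"
    by (simp add: sum_divide_distrib case_prod_unfold add_divide_distrib sum.distrib)
  also have "\<dots> = k * (\<Sum>u<n. (x u)\<^sup>2)"
    unfolding sum_E_fst sum_E_snd by simp
  also have "\<dots> = ip n x x * k" by (simp add: ip_def power2_eq_square)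
  finally show ?thesis
    using k_pos by (simp add: ip_G pos_divide_le_eq)
qed

lemma Gpow_diff: "(G ^^ j) (\<lambda>u. x u - y u) = (\<lambda>u. (G ^^ j) x u - (G ^^ j) y u)"
  by (induction j) (auto simp: G_diff)

lemma Gpow_sum: "finite J \<Longrightarrow> (G ^^ i) (\<lambda>u. \<Sum>j\<in>J. x j u) = (\<lambda>u. \<Sum>j\<in>J. (G ^^ i) (x j) u)"
  by (induction i) (auto simp: G_sum)

text \<open>For even \<open>a\<close> its spectrum lies in [0, 1]: it nearly fixes eigenvectors of
  \<open>G\<close> with small eigenvalue and damps those with eigenvalue close to 1 or -1.\<close>

definition Q :: "nat \<Rightarrow> (nat \<Rightarrow> real) \<Rightarrow> nat \<Rightarrow> real" where
  "Q a x = (\<lambda>u. x u - (G ^^ a) x u)"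

lemma Q_Gpow: "Q a ((G ^^ j) x) = (G ^^ j) (Q a x)"
  by (simp add: Q_def Gpow_diff funpow_add[symmetric, THEN fun_cong, unfolded comp_def] add.commute)

end

text \<open>Applied to the inner product and to the Dirichlet form \<open>\<langle>x, (1 - G) y\<rangle>\<close>.\<close>

locale walk_form = regular_walk +
  fixes B :: "(nat \<Rightarrow> real) \<Rightarrow> (nat \<Rightarrow> real) \<Rightarrow> real"
  assumes B_sym: "B x y = B y x" and B_nonneg: "0 \<le> B x x"
    and B_diff: "B (\<lambda>u. x u - y u) z = B x z - B y z"
    and B_G: "B (G x) y = B x (G y)" and B_contr: "B (G x) (G x) \<le> B x x"
begin

lemma B_diff_right: "B z (\<lambda>u. x u - y u) = B z x - B z y"
  using B_diff B_sym by metis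

lemma B_Gpow: "B ((G ^^ j) x) y = B x ((G ^^ j) y)"
  by (induction j arbitrary: x y) (simp_all add: B_G funpow_swap1)

lemma B_Gpow_contr: "B ((G ^^ j) x) ((G ^^ j) x) \<le> B x x"
  by (induction j) (auto intro: order_trans[OF B_contr])

lemma B_Gpow_double: "B x ((G ^^ (2 * c)) x) = B ((G ^^ c) x) ((G ^^ c) x)"
  by (simp add: B_Gpow mult_2 funpow_add)

lemma B_Gpow_le: "B ((G ^^ (2 * c)) x) ((G ^^ (2 * c)) x) \<le> B ((G ^^ c) x) ((G ^^ c) x)"
  using B_Gpow_contr[of c "(G ^^ c) x"] by (simp add: mult_2 funpow_add)

text \<open>The even exponent turns the cross term into the square \<open>B (G^c x) (G^c x)\<close>,
  which also bounds the last square. One application of the filter thus costs at least this much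
  energy.\<close>

lemma B_Q_le: "B (Q (2 * c) x) (Q (2 * c) x) \<le> B x x - B ((G ^^ c) x) ((G ^^ c) x)"
proof -
  have "B (Q (2 * c) x) (Q (2 * c) x)
      = B x x - 2 * B x ((G ^^ (2 * c)) x) + B ((G ^^ (2 * c)) x) ((G ^^ (2 * c)) x)"
    by (simp add: Q_def B_diff B_diff_right B_sym[of "(G ^^ (2 * c)) x" x])
  then show ?thesis
    using B_Gpow_double[of x c] B_Gpow_le[of c x] by linarith
qed

lemma B_Q_contr: "B (Q (2 * c) x) (Q (2 * c) x) \<le> B x x"
  using B_Q_le[of c x] B_nonneg[of "(G ^^ c) x"] by linarith

lemma B_Qpow_contr: "B ((Q (2 * c) ^^ j) x) ((Q (2 * c) ^^ j) x) \<le> B x x"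
  by (induction j) (auto intro: order_trans[OF B_Q_contr])

lemma B_Q: "B (Q a x) y = B x (Q a y)"
  by (simp add: Q_def B_diff B_diff_right B_Gpow)

lemma B_Qpow: "B ((Q a ^^ j) x) y = B x ((Q a ^^ j) y)"
  by (induction j arbitrary: x y) (simp_all add: B_Q funpow_swap1)

end

context regular_walk
begin

sublocale inner: walk_form n k E "ip n"
  by unfold_locales (fact ip_sym ip_nonneg ip_diff_left ip_G_sym ip_G_contraction)+

definition dirichlet :: "(nat \<Rightarrow> real) \<Rightarrow> (nat \<Rightarrow> real) \<Rightarrow> real" where
  "dirichlet x y = ip n x y - ip n x (G y)"

sublocale dirich: walk_form n k E dirichlet
proof unfold_locales
  fix x y z :: "nat \<Rightarrow> real"
  show "dirichlet x y = dirichlet y x"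
    using ip_G_sym ip_sym by (metis dirichlet_def)
  show "0 \<le> dirichlet x x"
    using abs_ip_G_le[of x] by (simp add: dirichlet_def)
  show "dirichlet (\<lambda>u. x u - y u) z = dirichlet x z - dirichlet y z"
    by (simp add: dirichlet_def ip_diff_left)
  show "dirichlet (G x) y = dirichlet x (G y)"
    by (simp add: dirichlet_def ip_G_sym)
  \<comment> \<open>All operators commute, so the difference is the form of
    \<open>(1 - G) (1 - G^2) = (1 - G)^2 (1 + G)\<close> at \<open>x\<close>; with
    \<open>v = (1 - G) x\<close> it becomes \<open><v, (1 + G) v>\<close>, which is
    nonnegative.\<close>
  define v where "v = (\<lambda>u. x u - G x u)"
  have Gv: "G v = (\<lambda>u. G x u - G (G x) u)" by (simp add: v_def G_diff)
  have "ip n v v = ip n x x - 2 * ip n x (G x) + ip n (G x) (G x)"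
    by (simp add: v_def ip_diff_left inner.B_diff_right ip_sym[of "G x" x])
  moreover have "ip n v (G v) = ip n x (G x) - ip n (G x) (G x) - ip n (G x) (G x) + ip n (G x) (G (G x))"
    unfolding Gv by (simp add: v_def ip_diff_left inner.B_diff_right) (simp add: ip_G_sym)
  ultimately have "dirichlet x x - dirichlet (G x) (G x) = ip n v v + ip n v (G v)"
    by (simp add: dirichlet_def)
  moreover have "0 \<le> ip n v v + ip n v (G v)" using abs_ip_G_le[of v] by linarith
  ultimately show "dirichlet (G x) (G x) \<le> dirichlet x x" by linarith
qed

text \<open>The geometric sum \<open>1 - (1 - t)^b = t * sum (1 - t)^j\<close> for
  \<open>t = G^a\<close>. It exhibits the filtered vector as an element of the range of
  \<open>G^a\<close>.\<close>

lemma Qpow_telescope: "x u - (Q a ^^ b) x u = (\<Sum>j<b. (G ^^ a) ((Q a ^^ j) x) u)"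
proof (induction b)
  case (Suc b)
  have "(Q a ^^ Suc b) x u = (Q a ^^ b) x u - (G ^^ a) ((Q a ^^ b) x) u"
    by (simp add: Q_def)
  then show ?case using Suc by simp
qed simp

end

text \<open>Log-convexity makes the ratios of successive terms nondecreasing, so a ratio above
  \<open>c\<close> persists. It serves two purposes: with \<open>c < 1\<close> as a bound on decay
  under powers of \<open>G\<close>, with \<open>c > 1\<close> as a bound on growth along a chain of
  preimages.\<close>

lemma log_convex_growth:
  fixes m :: "nat \<Rightarrow> real"
  assumes "\<And>j. 0 \<le> m j" and conv: "\<And>j. Suc j < N \<Longrightarrow> (m (Suc j))\<^sup>2 \<le> m j * m (Suc (Suc j))"
    and "0 < c" and "l < N" and "c * m l < m (Suc l)" and "l \<le> r" and "r \<le> j" and "j \<le> N"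
  shows "c ^ (j - r) * m r \<le> m j"
proof -
  have step: "c * m i < m (Suc i)" if "l \<le> i" "i < N" for i
    using that
  proof (induction i rule: dec_induct)
    case base
    then show ?case using assms by simp
  next
    case (step i)
    have lt: "c * m i < m (Suc i)" using step by simp
    then have pos: "0 < m (Suc i)"
      using assms(1)[of i] \<open>0 < c\<close> by (meson le_less_trans mult_nonneg_nonneg less_imp_le)
    have sq: "(m (Suc i))\<^sup>2 \<le> m i * m (Suc (Suc i))" using conv step by simp
    then have "0 < m i * m (Suc (Suc i))" using pos by (smt (verit) zero_less_power)
    then have pi: "0 < m i" using assms(1)[of i] by (smt (verit) mult_eq_0_iff)
    have "c * m (Suc i) * m i < m (Suc i) * m (Suc i)"
      using lt pos by (simp add: mult.commute mult.left_commute)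
    then have "c * m (Suc i) * m i < m (Suc (Suc i)) * m i"
      using sq by (simp add: power2_eq_square mult.commute)
    then show ?case using pi by simp
  qed
  show ?thesis using assms(7,8)
  proof (induction j rule: dec_induct)
    case (step i)
    have "c ^ (Suc i - r) * m r = c * (c ^ (i - r) * m r)"
      using step by (simp add: Suc_diff_le)
    also have "\<dots> \<le> c * m i" using step \<open>0 < c\<close> by simp
    also have "\<dots> \<le> m (Suc i)" using \<open>\<And>i. \<lbrakk>l \<le> i; i < N\<rbrakk> \<Longrightarrow> c * m i < m (Suc i)\<close>[of i] step \<open>l \<le> r\<close> by simp
    finally show ?case .
  qed simp
qed

context regular_walk
begin

lemma ip_cauchy: "(ip n x y)\<^sup>2 \<le> ip n x x * ip n y y"
  using Cauchy_Schwarz_ineq_sum[of x y "{..<n}"] by (simp add: ip_def power2_eq_square)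

text \<open>Moving one \<open>G\<close> across the inner product rewrites the middle square norm as
  \<open><G^j x, G^(j+2) x>\<close>; then Cauchy-Schwarz.\<close>

lemma Gpow_log_convex:
  "(ip n ((G ^^ Suc j) x) ((G ^^ Suc j) x))\<^sup>2
    \<le> ip n ((G ^^ j) x) ((G ^^ j) x) * ip n ((G ^^ Suc (Suc j)) x) ((G ^^ Suc (Suc j)) x)"
  using ip_cauchy[of "(G ^^ j) x" "(G ^^ Suc (Suc j)) x"] by (simp add: ip_G_sym)

text \<open>The part removed, \<open>w = (1 - G^a)^(b/2) u\<close>, has small Dirichlet form, and hardly any component
  with eigenvalue above 1/2.\<close>

lemma low_frequency_part:
  assumes diri: "dirichlet u u \<le> \<epsilon> * ip n u u" and \<epsilon>: "\<epsilon> \<le> 1/8" and c: "2 \<le> c"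
  shows "ip n u u / 2 \<le> ip n u (\<lambda>v. u v - (Q (2 * c) ^^ (2 * 4 ^ (2 * c))) u v)"
proof -
  \<comment> \<open>Half of the exponent of the filter, since \<open><u, Q^(2 N) u>\<close> is the
    square norm of \<open>Q^N u\<close>.\<close>
  define N where "N = (4::nat) ^ (2 * c)"
  define wj where "wj j = (Q (2 * c) ^^ j) u" for j
  define w where "w = wj N"
  have wj_Suc: "wj (Suc j) = Q (2 * c) (wj j)" for j by (simp add: wj_def)
  \<comment> \<open>Step \<open>j\<close> of the filter costs at least the square norm of
    \<open>G^c (wj j)\<close>, and these costs decrease along the iteration. Hence the last one,
    taken \<open>J\<close> times, is at most the energy lost in total.\<close>
  have tel: "real J * ip n ((G ^^ c) (wj J)) ((G ^^ c) (wj J)) \<le> ip n u u - ip n (wj J) (wj J)" for J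
  proof (induction J)
    case 0
    then show ?case by (simp add: wj_def)
  next
    case (Suc J)
    have dec: "ip n ((G ^^ c) (wj (Suc J))) ((G ^^ c) (wj (Suc J))) \<le> ip n ((G ^^ c) (wj J)) ((G ^^ c) (wj J))"
      using inner.B_Q_contr[of c "(G ^^ c) (wj J)"] by (simp add: wj_Suc Q_Gpow)
    then have "real J * ip n ((G ^^ c) (wj (Suc J))) ((G ^^ c) (wj (Suc J)))
        \<le> real J * ip n ((G ^^ c) (wj J)) ((G ^^ c) (wj J))"
      by (intro mult_left_mono) auto
    moreover have "ip n (wj (Suc J)) (wj (Suc J)) \<le> ip n (wj J) (wj J) - ip n ((G ^^ c) (wj J)) ((G ^^ c) (wj J))"
      using inner.B_Q_le[of c "wj J"] by (simp add: wj_Suc)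
    ultimately show ?case using Suc dec by (simp add: algebra_simps)
  qed
  have small: "real N * ip n ((G ^^ c) w) ((G ^^ c) w) \<le> ip n u u"
    using tel[of N] ip_nonneg[of "wj N"] by (simp add: w_def)
  have dw: "dirichlet w w \<le> \<epsilon> * ip n u u"
    using dirich.B_Qpow_contr[of N c u] diri by (simp add: w_def wj_def)
  have half: "ip n w w \<le> ip n u u / 2"
  proof (rule ccontr)
    assume "\<not> ?thesis"
    then have big: "ip n u u < 2 * ip n w w" by simp
    then have wpos: "0 < ip n w w" using ip_nonneg[of u] by linarith
    have "\<epsilon> * ip n u u \<le> 1/8 * ip n u u" using \<epsilon> ip_nonneg[of u] by (intro mult_right_mono)
    \<comment> \<open>The Dirichlet form of \<open>w\<close> is at most \<open>1/8 * 2\<close> times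
      its square norm, so the Rayleigh quotient of \<open>w\<close> is at least 3/4.\<close>
    then have "3/4 * ip n w w \<le> ip n w (G w)"
      using dw big by (simp add: dirichlet_def)
    then have "(3/4 * ip n w w)\<^sup>2 \<le> (ip n w (G w))\<^sup>2"
      using wpos by (intro power_mono) auto
    also have "\<dots> \<le> ip n w w * ip n (G w) (G w)" by (rule ip_cauchy)
    finally have "(9/16 * ip n w w) * ip n w w \<le> ip n (G w) (G w) * ip n w w"
      by (simp add: power2_eq_square mult.commute)
    then have m1: "9/16 * ip n w w \<le> ip n (G w) (G w)" using wpos by simp
    \<comment> \<open>The first ratio is at least 9/16 and so exceeds 1/2; hence
      \<open>G^c w\<close> keeps a fraction \<open>2^-c\<close> of the square norm of
      \<open>w\<close>. The telescoped bound leaves less than \<open>2 * 16^-c\<close>, which is the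
      contradiction.\<close>
    have "(1/2) ^ (c - 0) * ip n ((G ^^ 0) w) ((G ^^ 0) w) \<le> ip n ((G ^^ c) w) ((G ^^ c) w)"
    proof (rule log_convex_growth[where N=c and j=c and l=0 and r=0 and m="\<lambda>j. ip n ((G ^^ j) w) ((G ^^ j) w)"])
      show "1/2 * ip n ((G ^^ 0) w) ((G ^^ 0) w) < ip n ((G ^^ Suc 0) w) ((G ^^ Suc 0) w)"
        using m1 wpos by simp
    qed (use c ip_nonneg Gpow_log_convex in auto)
    then have "real N * ((1/2) ^ c * ip n w w) \<le> real N * ip n ((G ^^ c) w) ((G ^^ c) w)"
      by (intro mult_left_mono) auto
    also have "\<dots> < 2 * ip n w w" using small big by linarith
    finally have "real N * (1/2) ^ c < 2" using wpos by simp
    moreover have "real N * (1/2) ^ c = 8 ^ c"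
      by (simp add: N_def power_mult power_mult_distrib[symmetric])
    moreover have "(8::real) ^ 1 \<le> 8 ^ c" using c by (intro power_increasing) auto
    ultimately show False by simp
  qed
  have "ip n u ((Q (2 * c) ^^ (2 * N)) u) = ip n w w"
    by (simp add: w_def wj_def inner.B_Qpow mult_2 funpow_add)
  then show ?thesis using half by (simp add: N_def inner.B_diff_right)
qed

end

section \<open>Norms on finite sets and hypercontractivity of small set expanders\<close>

subsection \<open>Small set expanders\<close>

definition psum :: "nat \<Rightarrow> real \<Rightarrow> (nat \<Rightarrow> real) \<Rightarrow> real" where
  "psum n p x = (\<Sum>u<n. \<bar>x u\<bar> powr p)"

definition pnorm :: "nat \<Rightarrow> real \<Rightarrow> (nat \<Rightarrow> real) \<Rightarrow> real" where
  "pnorm n p x = psum n p x powr (1 / p)"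

lemma psum_nonneg: "0 \<le> psum n p x"
  by (simp add: psum_def sum_nonneg)

lemma pnorm_nonneg: "0 \<le> pnorm n p x"
  by (simp add: pnorm_def)

lemma pnorm_powr: "0 < p \<Longrightarrow> pnorm n p x powr p = psum n p x"
  by (simp add: pnorm_def powr_powr psum_nonneg)

lemma psum_le_powr_iff: "0 < p \<Longrightarrow> 0 \<le> c \<Longrightarrow> psum n p x \<le> c powr p \<longleftrightarrow> pnorm n p x \<le> c"
  by (metis pnorm_powr pnorm_nonneg not_le powr_less_mono2 powr_mono2 less_imp_le)

lemma abs_le_pnorm:
  assumes "0 < p" "u < n"
  shows "\<bar>x u\<bar> \<le> pnorm n p x"
proof -
  have "\<bar>x u\<bar> powr p \<le> psum n p x"
    unfolding psum_def by (rule member_le_sum) (use assms in auto)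
  then have "(\<bar>x u\<bar> powr p) powr (1/p) \<le> pnorm n p x"
    unfolding pnorm_def by (intro powr_mono2) (use assms in auto)
  then show ?thesis using assms by (simp add: powr_powr)
qed

text \<open>The measure is counting measure, so norms decrease in the exponent: split off
  \<open>|x u|^(q-p)\<close> and bound it through the largest entry.\<close>

lemma pnorm_mono:
  assumes "0 < p" "p \<le> q"
  shows "pnorm n q x \<le> pnorm n p x"
proof -
  let ?N = "pnorm n p x"
  have "psum n q x \<le> (\<Sum>u<n. \<bar>x u\<bar> powr p * ?N powr (q - p))"
    unfolding psum_def
  proof (rule sum_mono)
    fix u assume u: "u \<in> {..<n}"
    have "\<bar>x u\<bar> powr q = \<bar>x u\<bar> powr p * \<bar>x u\<bar> powr (q - p)"
      by (simp add: powr_add[symmetric])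
    also have "\<dots> \<le> \<bar>x u\<bar> powr p * ?N powr (q - p)"
      using abs_le_pnorm[of p u n x] u assms by (intro mult_left_mono powr_mono2) auto
    finally show "\<bar>x u\<bar> powr q \<le> \<bar>x u\<bar> powr p * ?N powr (q - p)" .
  qed
  also have "\<dots> = psum n p x * ?N powr (q - p)"
    by (simp add: psum_def sum_distrib_right)
  also have "\<dots> = ?N powr p * ?N powr (q - p)"
    using assms by (simp add: pnorm_powr)
  also have "\<dots> = ?N powr q" by (simp add: powr_add[symmetric])
  finally show ?thesis using assms by (simp add: psum_le_powr_iff pnorm_nonneg)
qed

lemma pnorm_eq_0: "0 < p \<Longrightarrow> pnorm n p x = 0 \<Longrightarrow> u < n \<Longrightarrow> x u = 0"
  by (metis abs_le_pnorm abs_le_zero_iff)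

lemma holder:
  assumes "1 < p" "1 < q" "1/p + 1/q = 1"
  shows "\<bar>ip n x y\<bar> \<le> pnorm n q x * pnorm n p y"
proof (cases "pnorm n q x = 0 \<or> pnorm n p y = 0")
  case True
  moreover have "0 < p" "0 < q" using assms by auto
  ultimately have "x u * y u = 0" if "u < n" for u
    using pnorm_eq_0[of q n x u] pnorm_eq_0[of p n y u] that by auto
  then have "ip n x y = 0"
    unfolding ip_def by (intro sum.neutral) auto
  then show ?thesis by (simp add: pnorm_nonneg)
next
  case False
  define X Y where "X = pnorm n q x" and "Y = pnorm n p y"
  have pos: "0 < X" "0 < Y"
    using False pnorm_nonneg[of n q x] pnorm_nonneg[of n p y] by (auto simp: X_def Y_def)
  have "\<bar>ip n x y\<bar> / (X * Y) \<le> (\<Sum>u<n. \<bar>x u\<bar> * \<bar>y u\<bar>) / (X * Y)"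
    unfolding ip_def abs_mult[symmetric] using pos
    by (intro divide_right_mono sum_abs) auto
  also have "\<dots> = (\<Sum>u<n. (\<bar>y u\<bar> / Y) * (\<bar>x u\<bar> / X))"
    by (simp add: sum_divide_distrib mult.commute)
  also have "\<dots> \<le> (\<Sum>u<n. (\<bar>y u\<bar> / Y) powr p / p + (\<bar>x u\<bar> / X) powr q / q)"
    using assms pos by (intro sum_mono Youngs_inequality) auto
  also have "\<dots> = psum n p y / Y powr p / p + psum n q x / X powr q / q"
    using pos by (simp add: sum.distrib psum_def powr_divide sum_divide_distrib)
  also have "\<dots> = 1"
    using assms pos unfolding X_def Y_def by (simp add: pnorm_powr[symmetric])
  finally show ?thesis using pos by (simp add: divide_simps X_def Y_def)
qed

lemma pnorm_2: "pnorm n 2 x = sqrt (ip n x x)"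
  by (simp add: pnorm_def psum_def ip_def powr_half_sqrt sum_nonneg power2_eq_square[symmetric])

lemma ip_le_pnorm:
  assumes "0 < q"
  shows "ip n x x \<le> n * (pnorm n q x)\<^sup>2"
proof -
  have "ip n x x \<le> (\<Sum>u<n. (pnorm n q x)\<^sup>2)"
    unfolding ip_def power2_eq_square[symmetric]
    using abs_le_pnorm[of q _ n x] assms
    by (intro sum_mono) (metis lessThan_iff abs_le_square_iff abs_of_nonneg pnorm_nonneg)
  then show ?thesis by simp
qed

text \<open>If \<open>a\<close> and \<open>h\<close> differ by more than the factor
  \<open>1/\<eta>\<close>, the larger one absorbs the product with a factor \<open>\<eta>\<close>;
  otherwise both are comparable to the smaller one. The minimum is the shape in which expansion can
  be applied, since an edge has small minimum unless both its ends are large.\<close>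

lemma mixed_power_le:
  fixes a h \<eta> q :: real
  assumes "0 \<le> a" "0 \<le> h" "0 < \<eta>" "\<eta> \<le> 1" "2 < q"
  shows "a powr (q - 1) * h \<le> \<eta> * (a powr q + h powr q) + \<eta> powr (1 - q) * min (a powr q) (h powr q)"
proof -
  consider "h \<le> \<eta> * a" | "a \<le> \<eta> * h" | "\<eta> * a < h" "\<eta> * h < a" by linarith
  then show ?thesis
  proof cases
    case 1
    then have "a powr (q - 1) * h \<le> a powr (q - 1) * (\<eta> * a)" by (intro mult_left_mono) auto
    also have "\<dots> = \<eta> * a powr q" using assms powr_mult_base[of a "q - 1"] by (simp add: mult_ac)
    finally show ?thesis using assms by (smt (verit) mult_nonneg_nonneg powr_ge_zero distrib_left min_def)
  next
    case 2
    then have "a powr (q - 1) * h \<le> (\<eta> * h) powr (q - 1) * h"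
      using assms by (intro mult_right_mono powr_mono2) auto
    also have "\<dots> = \<eta> powr (q - 1) * h powr q"
      using assms powr_mult_base[of h "q - 1"] by (simp add: powr_mult mult_ac)
    also have "\<dots> \<le> \<eta> powr 1 * h powr q"
      using assms by (intro mult_right_mono powr_mono') auto
    finally have "a powr (q - 1) * h \<le> \<eta> * h powr q" using assms by simp
    then show ?thesis using assms by (smt (verit) mult_nonneg_nonneg powr_ge_zero distrib_left min_def)
  next
    case 3
    have inv: "1 / \<eta> \<le> \<eta> powr (1 - q)"
    proof -
      have "\<eta> powr (-1) \<le> \<eta> powr (1 - q)" using assms by (intro powr_mono') auto
      then show ?thesis using assms by (simp add: powr_minus divide_inverse)
    qed
    have "a powr (q - 1) * h \<le> \<eta> powr (1 - q) * min (a powr q) (h powr q)"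
    proof (cases "a \<le> h")
      case True
      have "a powr (q - 1) * h \<le> a powr (q - 1) * (a / \<eta>)"
        using 3 assms by (intro mult_left_mono) (auto simp: field_simps)
      also have "\<dots> = (1 / \<eta>) * a powr q" using assms powr_mult_base[of a "q - 1"] by (simp add: mult_ac)
      also have "\<dots> \<le> \<eta> powr (1 - q) * a powr q" using inv by (intro mult_right_mono) auto
      finally show ?thesis using True assms powr_mono2[of q a h] by (simp add: min_def)
    next
      case False
      have "a powr (q - 1) * h \<le> (h / \<eta>) powr (q - 1) * h"
        using 3 assms by (intro mult_right_mono powr_mono2) (auto simp: field_simps)
      also have "\<dots> = \<eta> powr (1 - q) * h powr q"
      proof -
        have "\<eta> powr (1 - q) = inverse (\<eta> powr (q - 1))"
          by (metis minus_diff_eq powr_minus)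
        then show ?thesis
          using assms powr_mult_base[of h "q - 1"] by (simp add: powr_divide) (simp add: divide_inverse mult_ac)
      qed
      finally show ?thesis using False assms powr_mono2[of q h a] by (simp add: min_def)
    qed
    then show ?thesis using assms by (smt (verit) mult_nonneg_nonneg powr_ge_zero)
  qed
qed

text \<open>Edges are counted as ordered pairs, so for nonempty \<open>T\<close> the condition says
  that the expansion of \<open>T\<close> is at least \<open>1 - \<epsilon>\<close>. The bound
  \<open>R\<close> is real, because it is later compared with powers of \<open>n\<close>.\<close>

locale small_set_expander = regular_walk +
  fixes R \<epsilon> :: real
  assumes R_pos: "0 < R" and \<epsilon>_nonneg: "0 \<le> \<epsilon>"
    and sse: "\<And>T. T \<subseteq> {..<n} \<Longrightarrow> real (card T) \<le> R \<Longrightarrow> real (card (E \<inter> T \<times> T)) \<le> \<epsilon> * k * card T"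
begin

text \<open>Layer-cake argument: \<open>min (d u) (d v)\<close> counts the superlevel sets of
  \<open>d\<close> containing both ends of an edge, and every superlevel set lies in the support and
  hence is small. The induction peels off the lowest layer, of height \<open>m\<close> on the
  support \<open>T\<close>.\<close>

lemma sum_min_small:
  assumes "\<And>u. 0 \<le> d u" and "real (card {u. u < n \<and> 0 < d u}) \<le> R"
  shows "(\<Sum>(u,v)\<in>E. min (d u) (d v)) \<le> \<epsilon> * k * (\<Sum>u<n. d u :: real)"
  using assms
proof (induction "card {u. u < n \<and> 0 < d u}" arbitrary: d rule: less_induct)
  case less
  define T where "T = {u. u < n \<and> 0 < d u}"
  have fT: "finite T" "T \<subseteq> {..<n}" by (auto simp: T_def)
  show ?case
  proof (cases "T = {}")
    case True
    then have z: "d u = 0" if "u < n" for u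
      using that less.prems(1)[of u] by (force simp: T_def)
    have "(\<Sum>(u,v)\<in>E. min (d u) (d v)) = 0"
      using E_sub z by (intro sum.neutral) auto
    moreover have "(\<Sum>u<n. d u) = 0" using z by (intro sum.neutral) auto
    ultimately show ?thesis by simp
  next
    case False
    define m where "m = Min (d ` T)"
    have m_in: "m \<in> d ` T" unfolding m_def using False fT by (intro Min_in) auto
    have m_le: "m \<le> d u" if "u \<in> T" for u unfolding m_def using that fT by (intro Min_le) auto
    have m_pos: "0 < m" using m_in by (auto simp: T_def)
    define d' where "d' u = (if u \<in> T then d u - m else 0)" for u
    have d'0: "0 \<le> d' u" for u using m_le by (simp add: d'_def)
    have out: "d u = 0" if "u < n" "u \<notin> T" for u
      using that less.prems(1)[of u] by (force simp: T_def)
    obtain t where t: "t \<in> T" "d t = m" using m_in by auto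
    have "{u. u < n \<and> 0 < d' u} \<subseteq> T - {t}" using t by (auto simp: d'_def split: if_splits)
    then have "card {u. u < n \<and> 0 < d' u} \<le> card (T - {t})" using fT by (intro card_mono) auto
    also have "\<dots> < card T" using t fT by (meson card_Diff1_less)
    finally have lt: "card {u. u < n \<and> 0 < d' u} < card {u. u < n \<and> 0 < d u}" by (simp add: T_def)
    have IH: "(\<Sum>(u,v)\<in>E. min (d' u) (d' v)) \<le> \<epsilon> * k * (\<Sum>u<n. d' u)"
      using less.hyps[OF lt d'0] lt less.prems(2) by linarith
    have "(\<Sum>(u,v)\<in>E. min (d u) (d v))
        = (\<Sum>(u,v)\<in>E. (if (u,v) \<in> T \<times> T then m else 0) + min (d' u) (d' v))"
    proof (intro sum.cong refl, clarify)
      fix u v assume uv: "(u, v) \<in> E"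
      then have "u < n" "v < n" using E_sub by auto
      then show "min (d u) (d v) = (if (u, v) \<in> T \<times> T then m else 0) + min (d' u) (d' v)"
        using m_le[of u] m_le[of v] out[of u] out[of v] less.prems(1)[of u] less.prems(1)[of v]
        by (cases "u \<in> T"; cases "v \<in> T") (simp_all add: d'_def min_def)
    qed
    also have "\<dots> = (\<Sum>(u,v)\<in>E. if (u,v) \<in> T \<times> T then m else 0) + (\<Sum>(u,v)\<in>E. min (d' u) (d' v))"
      by (simp add: sum.distrib case_prod_unfold)
    also have "(\<Sum>(u,v)\<in>E. if (u,v) \<in> T \<times> T then m else 0) = (\<Sum>e\<in>E. if e \<in> T \<times> T then m else 0)"
      by (rule sum.cong) (auto split: if_splits)
    also have "(\<Sum>e\<in>E. if e \<in> T \<times> T then m else 0) = card (E \<inter> T \<times> T) * m"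
      using finite_E by (simp add: sum.If_cases)
    also have "\<dots> \<le> \<epsilon> * k * card T * m"
      using sse[of T] fT less.prems(2) m_pos by (intro mult_right_mono) (auto simp: T_def)
    also have "\<epsilon> * k * card T * m + (\<Sum>(u,v)\<in>E. min (d' u) (d' v))
        \<le> \<epsilon> * k * (card T * m + (\<Sum>u<n. d' u))"
      using IH by (simp add: distrib_left)
    also have "card T * m + (\<Sum>u<n. d' u) = (\<Sum>u<n. d u)"
    proof -
      have "(\<Sum>u<n. d u) = (\<Sum>u<n. (if u \<in> T then m else 0) + d' u)"
        using out by (intro sum.cong) (auto simp: d'_def)
      also have "\<dots> = (\<Sum>u<n. if u \<in> T then m else 0) + (\<Sum>u<n. d' u)" by (rule sum.distrib)
      also have "(\<Sum>u<n. if u \<in> T then m else 0) = card T * m"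
        using fT by (simp add: sum.If_cases Int_absorb1)
      finally show ?thesis by simp
    qed
    finally show ?thesis by simp
  qed
qed

text \<open>Small values of \<open>y = G g\<close> are controlled by the 2-norm; on the large values of \<open>y\<close> and \<open>g\<close>,
  which live on a small set, \<open>G\<close> is a strong contraction.\<close>

lemma level_set_bound:
  assumes q: "2 < q" and yg: "y = G g" and gy: "psum n q g \<le> L * psum n q y"
    and \<eta>: "0 < \<eta>" "\<eta> \<le> 1" and small: "(\<eta> + \<eta> powr (1 - q) * \<epsilon>) * (1 + L) \<le> 1/4"
    and Z: "Z = ip n y y + ip n g g"
  shows "psum n q y \<le> 2 * (4 * sqrt (Z / R)) powr (q - 2) * ip n y y"
proof (cases "Z = 0")
  case True
  then have "ip n y y = 0" using Z ip_nonneg[of y] ip_nonneg[of g] by linarith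
  then have "y u = 0" if "u < n" for u
    using that by (simp add: ip_def sum_nonneg_eq_0_iff)
  then have "psum n q y = 0" by (simp add: psum_def)
  then show ?thesis by (simp add: \<open>ip n y y = 0\<close>)
next
  case False
  then have Zpos: "0 < Z" using Z ip_nonneg[of y] ip_nonneg[of g] by linarith
  \<comment> \<open>Chebyshev threshold: at most \<open>Z / \<tau>^2 = R\<close> vertices have
    \<open>|y u|\<close> or \<open>|g u|\<close> above it.\<close>
  define \<tau> where "\<tau> = sqrt (Z / R)"
  have \<tau>: "0 < \<tau>" "\<tau>\<^sup>2 = Z / R" using Zpos R_pos by (auto simp: \<tau>_def)
  define a where "a u = (if \<bar>y u\<bar> > 4 * \<tau> then \<bar>y u\<bar> else 0)" for u
  define h where "h u = (if \<bar>g u\<bar> > \<tau> then \<bar>g u\<bar> else 0)" for u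
  define d where "d u = max (a u powr q) (h u powr q)" for u
  have a0: "0 \<le> a u" and h0: "0 \<le> h u" and d0: "0 \<le> d u" for u
    by (auto simp: a_def h_def d_def le_max_iff_disj)
  define c where "c = (4 * \<tau>) powr (q - 2)"
  have pw: "x powr q = x powr (q - 1) * x" if "0 \<le> x" for x :: real
    using powr_mult_base[OF that, of "q - 1"] by (simp add: mult.commute)
  \<comment> \<open>For \<open>|y u|\<close> up to \<open>4 \<tau>\<close> the power
    \<open>q\<close> is traded for a square. Above that, the small values of \<open>g\<close>
    contribute at most \<open>\<tau>\<close>, less than a quarter of \<open>|y u|\<close>, to the
    average over the neighbours; the rest is an average of \<open>h\<close>.\<close>
  have pointwise: "\<bar>y u\<bar> powr q \<le> c * (y u)\<^sup>2 + \<bar>y u\<bar> powr q / 4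
      + (\<Sum>v\<in>E `` {u}. a u powr (q - 1) * h v) / k" if u: "u < n" for u
  proof (cases "\<bar>y u\<bar> > 4 * \<tau>")
    case False
    have "\<bar>y u\<bar> powr q = \<bar>y u\<bar> powr (q - 2) * (y u)\<^sup>2"
    proof (cases "y u = 0")
      case False
      have "\<bar>y u\<bar> powr (q - 2 + 2) = \<bar>y u\<bar> powr (q - 2) * \<bar>y u\<bar> powr 2" by (rule powr_add)
      then show ?thesis using False by simp
    qed simp
    also have "\<dots> \<le> c * (y u)\<^sup>2"
      unfolding c_def using False q by (intro mult_right_mono powr_mono2) auto
    finally have "\<bar>y u\<bar> powr q \<le> c * (y u)\<^sup>2" .
    moreover have "0 \<le> (\<Sum>v\<in>E `` {u}. a u powr (q - 1) * h v) / k" using h0 by (simp add: sum_nonneg)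
    ultimately show ?thesis by (smt (verit) powr_ge_zero divide_nonneg_pos)
  next
    case True
    have "\<bar>y u\<bar> \<le> (\<Sum>v\<in>E `` {u}. \<bar>g v\<bar>) / k"
      unfolding yg G_def by (simp add: divide_right_mono)
    also have "\<dots> \<le> (\<Sum>v\<in>E `` {u}. \<tau> + h v) / k"
      using \<tau> by (intro divide_right_mono sum_mono) (auto simp: h_def)
    also have "\<dots> = \<tau> + (\<Sum>v\<in>E `` {u}. h v) / k"
      using E_deg[OF u] k_pos by (simp add: sum.distrib add_divide_distrib)
    finally have "\<bar>y u\<bar> powr (q - 1) * \<bar>y u\<bar> \<le> \<bar>y u\<bar> powr (q - 1) * (\<tau> + (\<Sum>v\<in>E `` {u}. h v) / k)"
      by (intro mult_left_mono) auto
    also have "\<dots> = \<bar>y u\<bar> powr (q - 1) * \<tau> + (\<Sum>v\<in>E `` {u}. a u powr (q - 1) * h v) / k"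
      using True by (simp add: a_def sum_distrib_left distrib_left)
    also have "\<bar>y u\<bar> powr (q - 1) * \<tau> \<le> \<bar>y u\<bar> powr (q - 1) * (\<bar>y u\<bar> / 4)"
      using True by (intro mult_left_mono) auto
    finally have "\<bar>y u\<bar> powr q \<le> \<bar>y u\<bar> powr q / 4 + (\<Sum>v\<in>E `` {u}. a u powr (q - 1) * h v) / k"
      using pw[of "\<bar>y u\<bar>"] by simp
    moreover have "0 \<le> c * (y u)\<^sup>2" by (simp add: c_def)
    ultimately show ?thesis by linarith
  qed
  have "psum n q y \<le> (\<Sum>u<n. c * (y u)\<^sup>2 + \<bar>y u\<bar> powr q / 4
      + (\<Sum>v\<in>E `` {u}. a u powr (q - 1) * h v) / k)"
    unfolding psum_def using pointwise by (intro sum_mono) auto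
  also have "\<dots> = c * ip n y y + psum n q y / 4 + (\<Sum>(u,v)\<in>E. a u powr (q - 1) * h v) / k"
    by (simp add: sum.distrib psum_def ip_def sum_distrib_left sum_divide_distrib[symmetric] sum_E power2_eq_square)
  finally have main: "psum n q y \<le> c * ip n y y + psum n q y / 4 + (\<Sum>(u,v)\<in>E. a u powr (q - 1) * h v) / k" .
  have aY: "(\<Sum>u<n. a u powr q) \<le> psum n q y" and hG: "(\<Sum>u<n. h u powr q) \<le> psum n q g"
    unfolding psum_def by (intro sum_mono; simp add: a_def h_def)+
  have supp: "real (card {u. u < n \<and> 0 < d u}) \<le> R"
  proof -
    let ?T = "{u. u < n \<and> 0 < d u}"
    have "real (card ?T) * \<tau>\<^sup>2 = (\<Sum>u\<in>?T. \<tau>\<^sup>2)" by simp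
    also have "\<dots> \<le> (\<Sum>u\<in>?T. y u * y u + g u * g u)"
    proof (rule sum_mono)
      fix u assume "u \<in> ?T"
      then have "4 * \<tau> < \<bar>y u\<bar> \<or> \<tau> < \<bar>g u\<bar>" by (auto simp: d_def a_def h_def split: if_splits)
      then have "\<tau> \<le> \<bar>y u\<bar> \<or> \<tau> \<le> \<bar>g u\<bar>" using \<tau> by auto
      then have "\<tau>\<^sup>2 \<le> (y u)\<^sup>2 \<or> \<tau>\<^sup>2 \<le> (g u)\<^sup>2"
        using \<tau> by (metis abs_le_square_iff abs_of_pos)
      then show "\<tau>\<^sup>2 \<le> y u * y u + g u * g u"
        by (smt (verit) power2_eq_square zero_le_power2)
    qed
    also have "\<dots> \<le> (\<Sum>u<n. y u * y u + g u * g u)" by (rule sum_mono2) auto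
    also have "\<dots> = Z" by (simp add: Z ip_def sum.distrib)
    finally show ?thesis using \<tau> R_pos Zpos by (simp add: divide_simps mult.commute)
  qed
  define Y where "Y = psum n q y"
  have Y0: "0 \<le> Y" by (simp add: Y_def psum_nonneg)
  have d_sum: "(\<Sum>u<n. d u) \<le> (1 + L) * Y"
  proof -
    have "(\<Sum>u<n. d u) \<le> (\<Sum>u<n. a u powr q + h u powr q)"
      by (intro sum_mono) (auto simp: d_def)
    also have "\<dots> \<le> Y + L * Y" using aY hG gy by (simp add: sum.distrib Y_def)
    finally show ?thesis by (simp add: algebra_simps)
  qed
  have "(\<Sum>(u,v)\<in>E. a u powr (q - 1) * h v) \<le>
      (\<Sum>(u,v)\<in>E. \<eta> * (a u powr q + h v powr q) + \<eta> powr (1 - q) * min (d u) (d v))"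
  proof (intro sum_mono, clarify)
    fix u v
    have "a u powr (q - 1) * h v \<le> \<eta> * (a u powr q + h v powr q) + \<eta> powr (1 - q) * min (a u powr q) (h v powr q)"
      using mixed_power_le[OF a0 h0 \<eta> q] .
    also have "min (a u powr q) (h v powr q) \<le> min (d u) (d v)" by (auto simp: d_def)
    finally show "a u powr (q - 1) * h v \<le> \<eta> * (a u powr q + h v powr q) + \<eta> powr (1 - q) * min (d u) (d v)"
      by (simp add: mult_left_mono)
  qed
  also have "\<dots> = \<eta> * ((\<Sum>(u,v)\<in>E. a u powr q) + (\<Sum>(u,v)\<in>E. h v powr q))
      + \<eta> powr (1 - q) * (\<Sum>(u,v)\<in>E. min (d u) (d v))"
    by (simp add: sum.distrib sum_distrib_left case_prod_unfold distrib_left)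
  also have "\<dots> = \<eta> * (k * ((\<Sum>u<n. a u powr q) + (\<Sum>u<n. h u powr q)))
      + \<eta> powr (1 - q) * (\<Sum>(u,v)\<in>E. min (d u) (d v))"
    unfolding sum_E_fst sum_E_snd by (simp add: distrib_left)
  also have "\<dots> \<le> \<eta> * (k * ((1 + L) * Y)) + \<eta> powr (1 - q) * (\<epsilon> * k * ((1 + L) * Y))"
  proof (intro add_mono mult_left_mono)
    show "(\<Sum>u<n. a u powr q) + (\<Sum>u<n. h u powr q) \<le> (1 + L) * Y"
      using aY hG gy by (simp add: Y_def algebra_simps)
    show "(\<Sum>(u,v)\<in>E. min (d u) (d v)) \<le> \<epsilon> * k * ((1 + L) * Y)"
      using sum_min_small[OF d0 supp] d_sum \<epsilon>_nonneg
      by (meson mult_left_mono mult_nonneg_nonneg of_nat_0_le_iff order_trans)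
  qed (use \<eta> in auto)
  also have "\<dots> = k * ((\<eta> + \<eta> powr (1 - q) * \<epsilon>) * (1 + L) * Y)" by (simp add: algebra_simps)
  also have "\<dots> \<le> k * (1/4 * Y)"
    using small Y0 by (intro mult_left_mono mult_right_mono) auto
  finally have "(\<Sum>(u,v)\<in>E. a u powr (q - 1) * h v) / k \<le> Y / 4"
    using k_pos by (simp add: divide_simps mult.commute)
  \<comment> \<open>One quarter of \<open>Y\<close> comes from the pointwise bound and one from the
    edges between large values; moving both to the left leaves the factor 2.\<close>
  then have "Y \<le> 2 * c * ip n y y" using main unfolding Y_def by linarith
  then show ?thesis by (simp add: Y_def c_def \<tau>_def)
qed

end

context small_set_expander
begin

text \<open>\<open>B f = f - (1 - G^a)^b f\<close> is an approximate projection to the high eigenvalues of \<open>G\<close>.  It factors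
  as \<open>G^a h(G)\<close>, so \<open>x_j = G^(a - j) h(G) f\<close> is a chain of preimages of \<open>B f = x_0\<close> under \<open>G\<close>;
  the level set bound is applied at the first step at which the q-norm does not grow.\<close>

lemma hypercontractive:
  assumes pq: "1 < p" "p < 2" "1 / p + 1 / q = 1" and Rn: "R \<le> n" and n: "n \<le> 2 ^ (2 * c)" and c: "0 < c"
    and \<eta>: "0 < \<eta>" "\<eta> \<le> 1" "(\<eta> + \<eta> powr (1 - q) * \<epsilon>) * (1 + 16 powr q) \<le> 1/4"
  shows "pnorm n q (\<lambda>u. f u - (Q (2 * c) ^^ (2 * 4 ^ (2 * c))) f u)
    \<le> 2592 * (1 / R) powr (1 - 2 / q) * pnorm n p f"
proof -
  have q: "2 < q"
  proof -
    have "1/q = 1 - 1/p" using pq(3) by linarith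
    moreover have "1/2 < 1/p" "1/p < 1" using pq by (auto simp: divide_simps)
    ultimately have "0 < 1/q" "1/q < 1/2" by linarith+
    then show ?thesis by (simp add: divide_simps split: if_splits)
  qed
  define a where "a = 2 * c"
  define b where "b = 2 * (4::nat) ^ a"
  define H where "H u = (\<Sum>j<b. (Q a ^^ j) f u)" for u
  define x where "x j = (G ^^ (a - j)) H" for j
  define m where "m j = ip n (x j) (x j)" for j
  define F where "F = pnorm n p f"
  define P where "P = pnorm n q (x 0)"
  have m0: "0 \<le> m j" for j by (simp add: m_def ip_nonneg)
  have F0: "0 \<le> F" and P0: "0 \<le> P" by (simp_all add: F_def P_def pnorm_nonneg)
  have npos: "0 < n" using R_pos Rn by (cases n) auto
  have x0: "x 0 = (\<lambda>u. f u - (Q a ^^ b) f u)"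
    by (auto simp: x_def H_def[abs_def] Gpow_sum Qpow_telescope)
  have xG: "x j = G (x (Suc j))" if "j < a" for j
    using that by (simp add: x_def Suc_diff_Suc[symmetric])
  have conv: "(m (Suc j))\<^sup>2 \<le> m j * m (Suc (Suc j))" if ja: "Suc j < a" for j
  proof -
    obtain i where i: "a = Suc (Suc (j + i))"
      using less_imp_Suc_add[OF ja] by auto
    have "x (Suc j) = (G ^^ Suc i) H" "x j = (G ^^ Suc (Suc i)) H" "x (Suc (Suc j)) = (G ^^ i) H"
      unfolding x_def i by simp_all
    then show ?thesis using Gpow_log_convex[of i H] by (simp only: m_def mult.commute)
  qed
  \<comment> \<open>With \<open>w = f - x_0\<close>, the product \<open><x_0, w>\<close> is
    nonnegative because \<open>x_0\<close> and \<open>w\<close> are images of \<open>f\<close> under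
    commuting positive semidefinite operators. Hence the square norm of \<open>x_0\<close> is at
    most \<open><x_0, f>\<close>.\<close>
  have m0_le: "m 0 \<le> P * F"
  proof -
    define v where "v = (Q a ^^ 4 ^ a) f"
    define w where "w = (Q a ^^ b) f"
    have wv: "w = (Q a ^^ 4 ^ a) v" by (simp add: w_def v_def b_def mult_2 funpow_add)
    have "ip n w w \<le> ip n v v"
      unfolding wv a_def by (rule inner.B_Qpow_contr)
    moreover have "ip n f w = ip n v v"
      by (simp add: wv v_def inner.B_Qpow[symmetric])
    ultimately have "0 \<le> ip n (x 0) w"
      unfolding x0 w_def[symmetric] by (simp add: ip_diff_left)
    moreover have "ip n (x 0) f = ip n (x 0) (x 0) + ip n (x 0) w"
      unfolding x0 w_def[symmetric] by (simp add: ip_diff_left inner.B_diff_right)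
    ultimately have "m 0 \<le> \<bar>ip n (x 0) f\<bar>" by (simp add: m_def)
    also have "\<dots> \<le> P * F" unfolding P_def F_def using pq q by (intro holder) auto
    finally show ?thesis .
  qed
  have ma: "m a \<le> b\<^sup>2 * ip n f f"
  proof -
    have "m a = (\<Sum>u<n. (H u)\<^sup>2)" by (simp add: m_def x_def ip_def power2_eq_square)
    also have "\<dots> \<le> (\<Sum>u<n. b * (\<Sum>j<b. ((Q a ^^ j) f u)\<^sup>2))"
      unfolding H_def using sum_squared_le_sum_of_squares[of "\<lambda>j. (Q a ^^ j) f _" "{..<b}"]
      by (intro sum_mono) (simp add: mult.commute)
    also have "\<dots> = b * (\<Sum>j<b. \<Sum>u<n. ((Q a ^^ j) f u)\<^sup>2)"
      unfolding sum_distrib_left[symmetric] by (subst sum.swap) simp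
    also have "\<dots> \<le> b * (\<Sum>j<b. ip n f f)"
      using inner.B_Qpow_contr[of _ c f]
      by (intro mult_left_mono sum_mono) (simp_all add: ip_def power2_eq_square a_def)
    finally show ?thesis by (simp add: power2_eq_square)
  qed
  have "P \<le> 2592 * (1 / R) powr (1 - 2 / q) * F"
  \<comment> \<open>If the square norm grows by more than 64 per step on average, \<open>x_0\<close>
    is tiny: \<open>m a\<close> is at most \<open>b^2 = 4 * 16^a\<close> times the square norm of
    \<open>f\<close>, and the remaining \<open>4^a\<close> is at least \<open>n^2\<close>. The
    trivial comparison of norms then suffices.\<close>
  proof (cases "64 ^ a * m 0 < m a")
    case True
    have e: "(1/R) powr (1 - 2/q) \<ge> 1 / n"
    proof -
      have "1 / n = (1 / n) powr 1" using npos by simp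
      also have "\<dots> \<le> (1 / n) powr (1 - 2/q)" using npos q by (intro powr_mono') auto
      also have "\<dots> \<le> (1 / R) powr (1 - 2/q)"
        using npos q Rn R_pos by (intro powr_mono2) (auto simp: frac_le)
      finally show ?thesis .
    qed
    have b2: "(real b)\<^sup>2 = 4 * 16 ^ a"
    proof -
      have "((4::real) ^ a)\<^sup>2 = 16 ^ a" by (simp add: power_mult[symmetric] mult.commute[of a]) (simp add: power_mult)
      then show ?thesis by (simp add: b_def power_mult_distrib)
    qed
    have "(64::real) ^ a = 16 ^ a * 4 ^ a" by (simp add: power_mult_distrib[symmetric])
    then have "16 ^ a * (4 ^ a * m 0) \<le> m a" using True by simp
    also have "\<dots> \<le> 16 ^ a * (4 * ip n f f)" using ma b2 by simp
    finally have "16 ^ a * (4 ^ a * m 0) \<le> 16 ^ a * (4 * ip n f f)" .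
    then have "4 ^ a * m 0 \<le> 4 * ip n f f" by simp
    moreover have "(real n)\<^sup>2 \<le> 4 ^ a"
    proof -
      have "real n \<le> 2 ^ a" using n unfolding a_def by (metis of_nat_le_iff of_nat_numeral of_nat_power)
      then have "(real n)\<^sup>2 \<le> (2 ^ a)\<^sup>2" by (intro power_mono) auto
      also have "\<dots> = 4 ^ a" by (simp add: power_mult[symmetric] mult.commute[of a]) (simp add: power_mult)
      finally show ?thesis .
    qed
    ultimately have "(real n)\<^sup>2 * m 0 \<le> 4 * ip n f f"
      using m0[of 0] by (meson mult_right_mono order_trans)
    then have "sqrt ((real n)\<^sup>2 * m 0) \<le> sqrt (2\<^sup>2 * ip n f f)" by simp
    then have le: "n * pnorm n 2 (x 0) \<le> 2 * pnorm n 2 f"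
      unfolding real_sqrt_mult by (simp add: pnorm_2 m_def)
    have "n * P \<le> n * pnorm n 2 (x 0)" unfolding P_def using q by (intro mult_left_mono pnorm_mono) auto
    also note le
    also have "2 * pnorm n 2 f \<le> 2 * F" unfolding F_def using pq pnorm_mono[of p 2 n f] by simp
    finally have "P \<le> 2 * (1 / n) * F" using npos by (simp add: field_simps)
    also have "\<dots> \<le> 2592 * (1 / R) powr (1 - 2 / q) * F"
    proof (rule mult_right_mono[OF _ F0])
      have "0 \<le> 1 / real n" by simp
      then show "2 * (1 / real n) \<le> 2592 * (1 / R) powr (1 - 2 / q)" using e by linarith
    qed
    finally show ?thesis .
  next
    case False
    then have ma0: "m a \<le> 64 ^ a * m 0" by simp
    \<comment> \<open>A violation at one index means a ratio above 64 there, which by log-convexity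
      would persist up to index \<open>a\<close>.\<close>
    have mj: "m j \<le> 64 ^ j * m 0" if "j \<le> a" for j
      using that
    proof (induction j)
      case (Suc j)
      show ?case
      proof (rule ccontr)
        assume neg: "\<not> ?thesis"
        have "64 * m j \<le> 64 ^ Suc j * m 0" using Suc by simp
        then have "64 * m j < m (Suc j)" using neg by linarith
        then have "64 ^ (a - Suc j) * m (Suc j) \<le> m a"
          using Suc.prems m0 conv by (intro log_convex_growth[where N=a and l=j]) auto
        moreover have "64 ^ (a - Suc j) * (64 ^ Suc j * m 0) < 64 ^ (a - Suc j) * m (Suc j)"
          using neg by (intro mult_strict_left_mono) auto
        moreover have "(64::real) ^ (a - Suc j) * (64 ^ Suc j * m 0) = 64 ^ a * m 0"
          using Suc.prems by (metis le_add_diff_inverse2 mult.assoc power_add)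
        ultimately show False using ma0 by linarith
      qed
    qed simp
    \<comment> \<open>The rate is 16 = 8 * 2: the 2-norm gains at most 8 per step, and passing from
      the q-norm of \<open>x_0\<close> to its 2-norm costs \<open>sqrt n\<close>, at most
      \<open>2^a\<close> over \<open>a\<close> steps.\<close>
    have "\<exists>i<a. pnorm n q (x (Suc i)) \<le> 16 * pnorm n q (x i)"
    proof (rule ccontr)
      assume "\<not> ?thesis"
      then have no: "16 * pnorm n q (x i) < pnorm n q (x (Suc i))" if "i < a" for i
        using that by (meson not_less)
      have "16 ^ i * P \<le> pnorm n q (x i)" if "i \<le> a" for i
        using that
      proof (induction i)
        case (Suc i)
        then show ?case using no[of i] by simp
      qed (simp add: P_def)
      moreover have "a \<noteq> 0" using c by (simp add: a_def)
      moreover obtain a' where a': "a = Suc a'" using \<open>a \<noteq> 0\<close> not0_implies_Suc by blast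
      ultimately have "16 ^ a' * P \<le> pnorm n q (x a')" by simp
      then have "16 ^ a * P < pnorm n q (x a)" using no[of a'] a' by simp
      also have "\<dots> \<le> pnorm n 2 (x a)" using q by (intro pnorm_mono) auto
      also have "\<dots> \<le> sqrt (64 ^ a * m 0)" using ma0 by (simp add: pnorm_2 m_def)
      also have "\<dots> \<le> sqrt ((8 ^ a)\<^sup>2 * (n * P\<^sup>2))"
      proof -
        have "m 0 \<le> n * P\<^sup>2" unfolding m_def P_def using q by (intro ip_le_pnorm) auto
        moreover have "(64::real) ^ a = (8 ^ a)\<^sup>2" by (simp add: power_mult[symmetric] mult.commute[of a]) (simp add: power_mult)
        ultimately show ?thesis by (simp add: mult_left_mono)
      qed
      also have "\<dots> = 8 ^ a * sqrt n * P" using P0 by (simp add: real_sqrt_mult)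
      also have "\<dots> \<le> 8 ^ a * 2 ^ a * P"
      proof -
        have "sqrt n \<le> sqrt ((real n)\<^sup>2)" using npos by (intro real_sqrt_le_mono) (simp add: power2_eq_square)
        also have "\<dots> = n" by simp
        also have "\<dots> \<le> 2 ^ a" using n unfolding a_def by (metis of_nat_le_iff of_nat_numeral of_nat_power)
        finally show ?thesis using P0 by (intro mult_right_mono mult_left_mono) auto
      qed
      also have "\<dots> = 16 ^ a * P" by (simp add: power_mult_distrib[symmetric])
      finally show False by simp
    qed
    then obtain i where i: "i < a" "pnorm n q (x (Suc i)) \<le> 16 * pnorm n q (x i)"
      and before: "\<And>j. j < i \<Longrightarrow> 16 * pnorm n q (x j) < pnorm n q (x (Suc j))"
      using exists_least_iff[of "\<lambda>i. i < a \<and> pnorm n q (x (Suc i)) \<le> 16 * pnorm n q (x i)"]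
      by (meson less_trans not_le)
    have growth: "16 ^ j * P \<le> pnorm n q (x j)" if "j \<le> i" for j
      using that
    proof (induction j)
      case (Suc j)
      then show ?case using before[of j] by simp
    qed (simp add: P_def)
    define Z where "Z = m i + m (Suc i)"
    have "psum n q (x (Suc i)) \<le> 16 powr q * psum n q (x i)"
      using i q psum_le_powr_iff[of q "16 * pnorm n q (x i)" n "x (Suc i)"]
      by (simp add: pnorm_nonneg powr_mult pnorm_powr)
    then have lev: "psum n q (x i) \<le> 2 * (4 * sqrt (Z / R)) powr (q - 2) * m i"
      unfolding m_def by (rule level_set_bound[OF q xG[OF i(1)] _ \<eta>]) (simp add: Z_def m_def)
    \<comment> \<open>The constant 9 is chosen since 1 + 64 is at most 81.\<close>
    define s where "s = 9 * sqrt (m 0)"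
    have s0: "0 \<le> s" by (simp add: s_def m0)
    have Zs: "Z \<le> (8 ^ i * s)\<^sup>2"
    proof -
      have "Z \<le> 64 ^ i * m 0 + 64 ^ Suc i * m 0"
        unfolding Z_def using i(1) by (intro add_mono mj) auto
      also have "\<dots> = 65 * (64 ^ i * m 0)" by simp
      also have "\<dots> \<le> 81 * (64 ^ i * m 0)" using m0[of 0] by (intro mult_right_mono) auto
      also have "\<dots> = 64 ^ i * (81 * m 0)" by simp
      also have "\<dots> = (8 ^ i * s)\<^sup>2"
      proof -
        have "(64::real) ^ i = (8 ^ i)\<^sup>2" by (simp add: power_mult[symmetric] mult.commute[of i]) (simp add: power_mult)
        then show ?thesis by (simp add: s_def power_mult_distrib m0)
      qed
      finally show ?thesis .
    qed
    \<comment> \<open>Weakening 16 to 8 matches the growth rate of the 2-norm; both sides are then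
      homogeneous of degree \<open>q\<close> in \<open>8^i\<close>, and the unknown depth
      \<open>i\<close> cancels.\<close>
    have "(8 ^ i * P) powr q \<le> (16 ^ i * P) powr q"
      using P0 q by (intro powr_mono2 mult_right_mono power_mono) auto
    also have "\<dots> \<le> pnorm n q (x i) powr q"
      using growth[of i] q P0 by (intro powr_mono2) auto
    also have "\<dots> = psum n q (x i)" using q by (simp add: pnorm_powr)
    also note lev
    also have "2 * (4 * sqrt (Z / R)) powr (q - 2) * m i
        \<le> 2 * (4 * ((8 ^ i * s) / sqrt R)) powr (q - 2) * (8 ^ i * s)\<^sup>2"
    proof -
      have Z0: "0 \<le> Z" using m0 by (simp add: Z_def)
      have "sqrt Z \<le> 8 ^ i * s" using Zs s0 by (simp add: real_le_lsqrt)
      then have "4 * sqrt (Z / R) \<le> 4 * ((8 ^ i * s) / sqrt R)"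
        using R_pos by (simp add: real_sqrt_divide divide_right_mono)
      moreover have "m i \<le> (8 ^ i * s)\<^sup>2" using Zs m0[of "Suc i"] by (simp add: Z_def)
      ultimately show ?thesis using Z0 R_pos q m0[of i]
        by (intro mult_mono powr_mono2) auto
    qed
    finally have "(8 ^ i * P) powr q
        \<le> 2 * (4 * ((8 ^ i * s) / sqrt R)) powr (q - 2) * (8 ^ i * s)\<^sup>2" .
    also have "\<dots> = 2 * (4 / sqrt R) powr (q - 2) * (8 ^ i * s) powr q"
    proof (cases "s = 0")
      case False
      then have "(8 ^ i * s)\<^sup>2 = (8 ^ i * s) powr 2" using s0 by simp
      moreover have "(4 * ((8 ^ i * s) / sqrt R)) powr (q - 2) = (4 / sqrt R) powr (q - 2) * (8 ^ i * s) powr (q - 2)"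
        using s0 R_pos powr_mult[of "4 / sqrt R" "8 ^ i * s" "q - 2"] by simp
      moreover have "(8 ^ i * s) powr (q - 2) * (8 ^ i * s) powr 2 = (8 ^ i * s) powr q"
        using powr_add[of "8 ^ i * s" "q - 2" 2] by simp
      ultimately show ?thesis by (metis mult.assoc)
    qed simp
    finally have "(8 ^ i) powr q * P powr q \<le> (8 ^ i) powr q * (2 * (4 / sqrt R) powr (q - 2) * s powr q)"
      using P0 s0 by (simp add: powr_mult mult_ac)
    then have "P powr q \<le> 2 * (4 / sqrt R) powr (q - 2) * s powr q"
      by simp
    also have "s powr q \<le> 9 powr q * ((P * F) powr (1/2)) powr q"
    proof -
      have "s \<le> 9 * (P * F) powr (1/2)"
        using m0_le P0 F0 by (simp add: s_def powr_half_sqrt)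
      then have "s powr q \<le> (9 * (P * F) powr (1/2)) powr q" using s0 q by (intro powr_mono2) auto
      then show ?thesis by (simp add: powr_mult)
    qed
    finally have "P powr q \<le> 2 * (4 / sqrt R) powr (q - 2) * (9 powr q * ((P * F) powr (1/2)) powr q)"
      by (simp add: mult_left_mono)
    also have "((P * F) powr (1/2)) powr q = P powr (q/2) * F powr (q/2)"
      using P0 F0 by (simp add: powr_powr powr_mult)
    \<comment> \<open>The bound is self-improving: the 2-norm of \<open>x_0\<close> was controlled
      by \<open>P\<close> and \<open>F\<close> together, so half of the power of \<open>P\<close> on
      the left cancels.\<close>
    finally have main: "P powr q \<le> P powr (q/2) * (2 * (4 / sqrt R) powr (q - 2) * 9 powr q * F powr (q/2))"
      by (simp add: mult_ac)
    show ?thesis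
    proof (cases "P = 0")
      case True
      then show ?thesis using F0 by simp
    next
      case False
      then have Ppos: "0 < P powr (q/2)" using P0 by simp
      have "P powr (q/2) * P powr (q/2) = P powr q" using powr_add[of P "q/2" "q/2"] by simp
      then have "P powr (q/2) \<le> 2 * (4 / sqrt R) powr (q - 2) * 9 powr q * F powr (q/2)"
        using main Ppos by (metis mult_le_cancel_left_pos)
      then have "(P powr (q/2)) powr (2/q) \<le> (2 * (4 / sqrt R) powr (q - 2) * 9 powr q * F powr (q/2)) powr (2/q)"
        using q by (intro powr_mono2) auto
      also have "\<dots> = 2 powr (2/q) * (4 / sqrt R) powr ((q - 2) * (2/q)) * 81 * F"
        using q F0 R_pos by (simp add: powr_mult powr_powr)
      also have "(4 / sqrt R) powr ((q - 2) * (2/q)) = (16 / R) powr (1 - 2/q)"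
      proof -
        have "4 / sqrt R = (16 / R) powr (1/2)"
          using R_pos by (simp add: powr_half_sqrt real_sqrt_divide)
        moreover have "(1/2) * ((q - 2) * (2/q)) = 1 - 2/q" using q by (simp add: field_simps)
        ultimately show ?thesis using powr_powr[of "16 / R" "1/2" "(q - 2) * (2/q)"] by metis
      qed
      also have "(16 / R) powr (1 - 2/q) = 16 powr (1 - 2/q) * (1 / R) powr (1 - 2/q)"
        using powr_mult[of 16 "1/R" "1 - 2/q"] R_pos by simp
      \<comment> \<open>Origin of the constant: 2 * 16 * 81 = 2592.\<close>
      also have "2 powr (2/q) * (16 powr (1 - 2/q) * (1 / R) powr (1 - 2/q)) * 81 * F
          \<le> 2 powr 1 * (16 powr 1 * (1 / R) powr (1 - 2/q)) * 81 * F"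
        using q F0 by (intro mult_right_mono mult_mono powr_mono) auto
      finally show ?thesis using q P0 by (simp add: powr_powr)
    qed
  qed
  then show ?thesis by (simp add: P_def F_def x0 a_def b_def)
qed

end

section \<open>Expansion at a larger scale, and its translation into edge counts\<close>

subsection \<open>Expansion of unions of blocks\<close>

context regular_walk
begin

text \<open>Cut \<open>T\<close> into at most \<open>4 M\<close> blocks of at most
  \<open>s div 2\<close> vertices. Every edge inside \<open>T\<close> lies inside the union of two
  blocks, which is small enough for the hypothesis; summing over all ordered pairs of blocks counts
  each vertex \<open>2 m\<close> times, whence the factor \<open>8 M\<close>.\<close>

lemma block_union_bound:
  fixes \<epsilon> :: real and M s :: nat
  assumes small: "\<And>T. T \<subseteq> {..<n} \<Longrightarrow> card T \<le> s \<Longrightarrow> real (card (E \<inter> T \<times> T)) \<le> \<epsilon> * k * card T"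
    and s: "2 \<le> s" and M: "1 \<le> M" and \<epsilon>: "0 \<le> \<epsilon>" and T: "T \<subseteq> {..<n}" "card T \<le> M * s"
  shows "real (card (E \<inter> T \<times> T)) \<le> 8 * M * \<epsilon> * k * card T"
proof -
  \<comment> \<open>Two blocks of size \<open>h\<close> together have at most \<open>s\<close>
    vertices; \<open>s\<close> at least 2 keeps \<open>h\<close> positive and \<open>s\<close> below
    \<open>3 h\<close>.\<close>
  define h where "h = s div 2"
  have h: "1 \<le> h" "2 * h \<le> s" "s \<le> 3 * h" using s by (auto simp: h_def)
  have fT: "finite T" using T finite_subset by blast
  obtain idx where idx: "bij_betw idx T {0..<card T}" using ex_bij_betw_finite_nat[OF fT] by blast
  define B where "B i = {v \<in> T. idx v div h = i}" for i
  define m where "m = card T div h + 1"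
  have BT: "B i \<subseteq> T" for i by (auto simp: B_def)
  have card_B: "card (B i) \<le> h" for i
  proof -
    have "card (B i) = card (idx ` B i)"
      using idx BT by (metis bij_betw_imp_inj_on card_image inj_on_subset)
    also have "\<dots> \<le> card {i * h..<i * h + h}"
    proof (intro card_mono subsetI)
      fix y assume "y \<in> idx ` B i"
      then have "y div h = i" by (auto simp: B_def)
      then show "y \<in> {i * h..<i * h + h}"
        using h(1) dividend_less_div_times[of h y] by (auto simp: add.commute)
    qed simp
    finally show ?thesis by simp
  qed
  have B_m: "idx v div h < m" if "v \<in> T" for v
  proof -
    have "idx v < card T" using idx that by (auto simp: bij_betw_def)
    then have "idx v div h \<le> card T div h" by (intro div_le_mono) simp
    then show ?thesis by (simp add: m_def)
  qed
  have sumB: "(\<Sum>i<m. card (B i)) = card T"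
  proof -
    have "T = (\<Union>i<m. B i)" using B_m by (auto simp: B_def)
    moreover have "card (\<Union>i<m. B i) = (\<Sum>i<m. card (B i))"
      using fT by (intro card_UN_disjoint) (auto simp: B_def)
    ultimately show ?thesis by simp
  qed
  have "m \<le> 4 * M"
  proof -
    have "card T \<le> 3 * M * h" using T(2) h(3) by (metis mult.assoc mult.commute mult_le_mono1 order_trans)
    then have "card T div h \<le> 3 * M" using h(1) by (metis div_le_mono nonzero_mult_div_cancel_right not_one_le_zero)
    then show ?thesis using M by (simp add: m_def)
  qed
  have pair: "real (card (E \<inter> (B i \<union> B j) \<times> (B i \<union> B j))) \<le> \<epsilon> * k * (card (B i) + card (B j))" for i j
  proof -
    have le: "card (B i \<union> B j) \<le> card (B i) + card (B j)" by (rule card_Un_le)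
    then have "card (B i \<union> B j) \<le> s" using card_B[of i] card_B[of j] h by linarith
    then have "real (card (E \<inter> (B i \<union> B j) \<times> (B i \<union> B j))) \<le> \<epsilon> * k * card (B i \<union> B j)"
      using BT T by (intro small) auto
    also have "\<dots> \<le> \<epsilon> * k * (card (B i) + card (B j))"
      using le \<epsilon> by (intro mult_left_mono) auto
    finally show ?thesis .
  qed
  have "E \<inter> T \<times> T \<subseteq> (\<Union>i<m. \<Union>j<m. E \<inter> (B i \<union> B j) \<times> (B i \<union> B j))"
    using B_m by (fastforce simp: B_def)
  then have "card (E \<inter> T \<times> T) \<le> card (\<Union>i<m. \<Union>j<m. E \<inter> (B i \<union> B j) \<times> (B i \<union> B j))"
    using finite_E by (intro card_mono) auto
  also have "\<dots> \<le> (\<Sum>i<m. card (\<Union>j<m. E \<inter> (B i \<union> B j) \<times> (B i \<union> B j)))"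
    by (rule card_UN_le) simp
  also have "\<dots> \<le> (\<Sum>i<m. \<Sum>j<m. card (E \<inter> (B i \<union> B j) \<times> (B i \<union> B j)))"
    by (intro sum_mono card_UN_le) simp
  finally have "real (card (E \<inter> T \<times> T)) \<le> (\<Sum>i<m. \<Sum>j<m. real (card (E \<inter> (B i \<union> B j) \<times> (B i \<union> B j))))"
    by (simp flip: of_nat_sum)
  also have "\<dots> \<le> (\<Sum>i<m. \<Sum>j<m. \<epsilon> * k * (card (B i) + card (B j)))"
    using pair by (intro sum_mono) auto
  also have "\<dots> = \<epsilon> * k * real (\<Sum>i<m. \<Sum>j<m. card (B i) + card (B j))"
    by (simp add: sum_distrib_left)
  also have "(\<Sum>i<m. \<Sum>j<m. card (B i) + card (B j)) = 2 * m * card T"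
    unfolding sum.distrib by (simp add: sumB sum_distrib_left[symmetric])
  also have "\<epsilon> * k * real (2 * m * card T) \<le> \<epsilon> * k * real (2 * (4 * M) * card T)"
    using \<open>m \<le> 4 * M\<close> \<epsilon> by (intro mult_left_mono) (auto simp del: of_nat_mult)
  finally show ?thesis by (simp add: mult_ac)
qed

lemma small_set_expander_blocks:
  fixes \<epsilon> :: real and M s :: nat
  assumes small: "\<And>T. T \<subseteq> {..<n} \<Longrightarrow> card T \<le> s \<Longrightarrow> real (card (E \<inter> T \<times> T)) \<le> \<epsilon> * k * card T"
    and s: "2 \<le> s" and M: "1 \<le> M" and \<epsilon>: "0 \<le> \<epsilon>"
  shows "small_set_expander n k E (M * s) (8 * M * \<epsilon>)"
proof unfold_locales
  fix T assume T: "T \<subseteq> {..<n}" and "real (card T) \<le> real (M * s)"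
  then have "card T \<le> M * s" by (simp only: of_nat_le_iff)
  with T show "real (card (E \<inter> T \<times> T)) \<le> real (8 * M) * \<epsilon> * real k * real (card T)"
    using block_union_bound[of s \<epsilon> M T] small s M \<epsilon> by simp
qed (use s M \<epsilon> in auto)

lemma dirichlet_indicator:
  assumes S: "S \<subseteq> {..<n}"
  shows "ip n (\<lambda>u. if u \<in> S then 1 else 0) (\<lambda>u. if u \<in> S then 1 else 0) = card S"
    and "dirichlet (\<lambda>u. if u \<in> S then 1 else 0) (\<lambda>u. if u \<in> S then 1 else 0)
      = card S - card (E \<inter> S \<times> S) / k"
proof -
  let ?u = "\<lambda>u. if u \<in> S then 1 else (0::real)"
  have "ip n ?u ?u = (\<Sum>u<n. ?u u)" unfolding ip_def by (intro sum.cong) auto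
  also have "\<dots> = card S" using S by (simp add: sum.If_cases Int_absorb1)
  finally show 1: "ip n ?u ?u = card S" .
  have "(\<Sum>(u,v)\<in>E. ?u u * ?u v) = (\<Sum>e\<in>E. if e \<in> S \<times> S then 1 else 0)"
    by (intro sum.cong) (auto split: if_splits)
  also have "\<dots> = card (E \<inter> S \<times> S)" using finite_E by (simp add: sum.If_cases)
  finally have "ip n ?u (G ?u) = card (E \<inter> S \<times> S) / k" by (simp only: ip_G)
  then show "dirichlet ?u ?u = card S - card (E \<inter> S \<times> S) / k" by (simp add: dirichlet_def 1)
qed

text \<open>By regularity, a uniform vertex of \<open>S\<close> followed by a uniform neighbour is a
  uniform ordered edge starting in \<open>S\<close>. This is where the random choice is evaluated;
  afterwards only edges are counted.\<close>

lemma expansion_eq: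
  assumes S: "S \<subseteq> {..<n}" "S \<noteq> {}"
  shows "expansion E S = 1 - card (E \<inter> S \<times> S) / (k * card S)"
proof -
  have fS: "finite S" using S finite_subset by blast
  have cS: "0 < card S" using S fS by (simp add: card_gt_0_iff)
  have ne: "E `` {u} \<noteq> {}" if "u \<in> S" for u
    using that S E_deg[of u] k_pos by force
  have nb: "measure_pmf.prob (pmf_of_set (E `` {u})) (- S) = 1 - card (E `` {u} \<inter> S) / k" if u: "u \<in> S" for u
  proof -
    have un: "u < n" using S u by auto
    have "card (E `` {u} \<inter> S) + card (E `` {u} \<inter> - S) = card (E `` {u} \<inter> S \<union> E `` {u} \<inter> - S)"
      using finite_nbrs by (intro card_Un_disjoint[symmetric]) auto
    also have "E `` {u} \<inter> S \<union> E `` {u} \<inter> - S = E `` {u}" by auto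
    finally have "real (card (E `` {u} \<inter> - S)) = real k - real (card (E `` {u} \<inter> S))"
      using E_deg[OF un] by linarith
    then show ?thesis
      using measure_pmf_of_set[OF ne[OF u] finite_nbrs, of "- S"] E_deg[OF un] k_pos
      by (simp add: diff_divide_distrib)
  qed
  have "expansion E S = measure_pmf.expectation (bind_pmf (pmf_of_set S) (\<lambda>u. pmf_of_set (E `` {u}))) (indicat_real (- S))"
    by (simp add: expansion_def)
  also have "\<dots> = (\<Sum>u\<in>S. measure_pmf.expectation (pmf_of_set (E `` {u})) (indicat_real (- S)) /\<^sub>R card S)"
    using S fS ne finite_nbrs by (intro pmf_expectation_bind_pmf_of_set) auto
  also have "\<dots> = (\<Sum>u\<in>S. (1 - card (E `` {u} \<inter> S) / k) / card S)"
    using nb by (intro sum.cong) (auto simp: divide_inverse mult.commute)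
  also have "\<dots> = (card S - (\<Sum>u\<in>S. card (E `` {u} \<inter> S)) / k) / card S"
    by (simp add: sum_divide_distrib[symmetric] sum_subtractf)
  also have "(\<Sum>u\<in>S. card (E `` {u} \<inter> S)) = card (E \<inter> S \<times> S)"
  proof -
    have "E \<inter> S \<times> S = Sigma S (\<lambda>u. E `` {u} \<inter> S)" by auto
    then show ?thesis using fS by simp
  qed
  finally show ?thesis using cS by (simp add: diff_divide_distrib mult.commute)
qed

end

text \<open>The degree is read off at vertex 0, as the reduction will do. The second vertex comes
  from a neighbour of vertex 0, there being no loops.\<close>

lemma regular_graph_walk:
  assumes "regular_graph {..<n} E"
  shows "regular_walk n (card (E `` {0})) E" and "2 \<le> n"
proof -
  obtain k where k: "0 < k" "\<forall>v\<in>{..<n}. card (E `` {v}) = k" and n: "0 < n" and E: "E \<subseteq> {..<n} \<times> {..<n}" "sym E" "irrefl E"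
    using assms by (auto simp: regular_graph_def)
  then have "card (E `` {0}) = k" by auto
  then show "regular_walk n (card (E `` {0})) E"
    using k E by unfold_locales auto
  have "E `` {0} \<noteq> {}" using k(1) \<open>card (E `` {0}) = k\<close> by (metis card.empty less_irrefl)
  then obtain v where v: "(0, v) \<in> E" by auto
  then have "v < n" using E by auto
  moreover have "v \<noteq> 0" using E(3) v by (metis irrefl_def)
  ultimately show "2 \<le> n" by simp
qed

lemma finite_expansions: "finite {expansion E S | S. S \<subseteq> {..<n::nat} \<and> S \<noteq> {} \<and> set_measure {..<n} S \<le> \<delta>}"
proof -
  have "{expansion E S | S. S \<subseteq> {..<n} \<and> S \<noteq> {} \<and> set_measure {..<n} S \<le> \<delta>} \<subseteq> expansion E ` Pow {..<n}" by auto
  then show ?thesis using finite_subset by blast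
qed

lemma sse_yesD:
  fixes n :: nat and \<delta> \<epsilon> :: real
  assumes "regular_graph {..<n} E" "1 \<le> \<delta> * real n" "small_set_expansion {..<n} E \<delta> \<le> \<epsilon>"
  obtains S where "S \<subseteq> {..<n}" "S \<noteq> {}" "card S \<le> \<delta> * n" "expansion E S \<le> \<epsilon>"
proof -
  let ?X = "{expansion E S | S. S \<subseteq> {..<n} \<and> S \<noteq> {} \<and> set_measure {..<n} S \<le> \<delta>}"
  have n: "0 < n" using assms(1) by (auto simp: regular_graph_def)
  have "set_measure {..<n} {0} \<le> \<delta>" using assms(2) n by (simp add: set_measure_def divide_simps)
  then have "?X \<noteq> {}" using n by blast
  then have "Min ?X \<in> ?X" using finite_expansions by (intro Min_in) auto
  then have "\<exists>S. Min ?X = expansion E S \<and> S \<subseteq> {..<n} \<and> S \<noteq> {} \<and> set_measure {..<n} S \<le> \<delta>"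
    by (rule CollectD)
  then obtain S where "Min ?X = expansion E S" "S \<subseteq> {..<n}" "S \<noteq> {}" "set_measure {..<n} S \<le> \<delta>"
    by blast
  then show ?thesis using that[of S] assms(3) n
    by (simp add: small_set_expansion_def set_measure_def divide_simps)
qed

lemma sse_noD:
  fixes n :: nat and \<delta> \<epsilon> :: real
  assumes "regular_graph {..<n} E" "1 - \<epsilon> \<le> small_set_expansion {..<n} E \<delta>"
    and "S \<subseteq> {..<n}" "S \<noteq> {}" "card S \<le> \<delta> * n"
  shows "1 - \<epsilon> \<le> expansion E S"
proof -
  let ?X = "{expansion E S | S. S \<subseteq> {..<n} \<and> S \<noteq> {} \<and> set_measure {..<n} S \<le> \<delta>}"
  have n: "0 < n" using assms(1) by (auto simp: regular_graph_def)
  have "expansion E S \<in> ?X" using assms n by (auto simp: set_measure_def divide_simps)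
  then have "Min ?X \<le> expansion E S" using finite_expansions by (intro Min_le) auto
  then show ?thesis using assms(2) by (simp add: small_set_expansion_def)
qed

section \<open>From operator norms to low rank approximation\<close>

subsection \<open>The low rank approximation instance\<close>

lemma lp_cost_eq:
  assumes "A \<in> carrier_mat N d" "W \<in> carrier_mat N d" "U * V = W"
  shows "lp_cost p A U V = (\<Sum>i<N. psum d p (\<lambda>j. W $$ (i,j) - A $$ (i,j)))"
  using assms by (auto simp: lp_cost_def psum_def intro!: sum.cong)

lemma lp_cost_nonneg: "0 \<le> lp_cost p A U V"
  by (simp add: lp_cost_def sum_nonneg)

lemma lp_opt_le:
  assumes "U \<in> carrier_mat (dim_row A) k" "V \<in> carrier_mat k (dim_col A)"
  shows "lp_opt p k A \<le> lp_cost p A U V"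
proof -
  define X :: "(real mat \<times> real mat) set" where "X = carrier_mat (dim_row A) k \<times> carrier_mat k (dim_col A)"
  define f where "f = (\<lambda>(U, V). lp_cost p A U V)"
  have "bdd_below (f ` X)"
    by (rule bdd_belowI2[where m=0]) (simp add: f_def case_prod_unfold lp_cost_nonneg)
  moreover have "(U, V) \<in> X" using assms by (simp add: X_def)
  ultimately have "(INF x\<in>X. f x) \<le> f (U, V)" by (rule cINF_lower)
  then show ?thesis by (simp add: lp_opt_def f_def X_def)
qed

text \<open>Delete the column \<open>js\<close>: the kernel relation, divided by
  \<open>z js\<close>, expresses it through the remaining columns. Thus rank \<open>d - 1\<close>
  can be certified by a kernel vector alone.\<close>

lemma rank_factorization:
  fixes B :: "real mat"
  assumes B: "B \<in> carrier_mat N d" and js: "js < d" "z js \<noteq> 0"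
    and ker: "\<And>i. i < N \<Longrightarrow> (\<Sum>j<d. B $$ (i,j) * z j) = 0"
  shows "\<exists>U \<in> carrier_mat N (d - 1). \<exists>V \<in> carrier_mat (d - 1) d. U * V = B"
proof -
  define sk where "sk l = (if l < js then l else Suc l)" for l
  have bij: "bij_betw sk {..<d - 1} ({..<d} - {js})"
  proof (rule bij_betwI[where g="\<lambda>j. if j < js then j else j - 1"])
    show "sk \<in> {..<d - 1} \<rightarrow> {..<d} - {js}"
    proof
      fix l assume "l \<in> {..<d - 1}"
      then have "Suc l < d" by simp
      then show "sk l \<in> {..<d} - {js}" by (cases "l < js") (simp_all add: sk_def)
    qed
    show "(\<lambda>j. if j < js then j else j - 1) \<in> {..<d} - {js} \<rightarrow> {..<d - 1}"
    proof
      fix j assume "j \<in> {..<d} - {js}"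
      then have "j < d" "j \<noteq> js" by simp_all
      then show "(if j < js then j else j - 1) \<in> {..<d - 1}" using js(1) by (cases "j < js") simp_all
    qed
  qed (auto simp: sk_def)
  define \<phi> where "\<phi> l j = (if j = js then - z l / z js else if l = j then 1 else 0)" for l j
  define U where "U = mat N (d - 1) (\<lambda>(i,l). B $$ (i, sk l))"
  define V where "V = mat (d - 1) d (\<lambda>(l,j). \<phi> (sk l) j)"
  have "(U * V) $$ (i,j) = B $$ (i,j)" if i: "i < N" and j: "j < d" for i j
  proof -
    have "(U * V) $$ (i,j) = (\<Sum>l<d - 1. B $$ (i, sk l) * \<phi> (sk l) j)"
      using i j by (simp add: U_def V_def scalar_prod_def atLeast0LessThan)
    also have "\<dots> = (\<Sum>l\<in>{..<d} - {js}. B $$ (i, l) * \<phi> l j)"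
      using sum.reindex_bij_betw[OF bij] .
    also have "\<dots> = B $$ (i,j)"
    proof (cases "j = js")
      case True
      have "(\<Sum>l\<in>{..<d} - {js}. B $$ (i, l) * z l) = - (B $$ (i,js) * z js)"
        using ker[OF i] js by (simp add: sum.remove[of "{..<d}" js])
      moreover have "(\<Sum>l\<in>{..<d} - {js}. B $$ (i, l) * \<phi> l j) = - (\<Sum>l\<in>{..<d} - {js}. B $$ (i, l) * z l) / z js"
        by (simp add: \<phi>_def True sum_divide_distrib sum_negf)
      ultimately show ?thesis using js True by simp
    next
      case False
      then have "(\<Sum>l\<in>{..<d} - {js}. B $$ (i, l) * \<phi> l j) = (\<Sum>l\<in>{..<d} - {js}. if l = j then B $$ (i, l) else 0)"
        by (intro sum.cong) (auto simp: \<phi>_def)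
      then show ?thesis using False j by (simp add: sum.delta)
    qed
    finally show ?thesis .
  qed
  then have "U * V = B" using B by (intro eq_matI) (auto simp: U_def V_def)
  moreover have "U \<in> carrier_mat N (d - 1)" "V \<in> carrier_mat (d - 1) d" by (simp_all add: U_def V_def)
  ultimately show ?thesis by blast
qed

text \<open>Padding \<open>V\<close> with a zero row makes it square and singular, so it kills a
  nonzero vector, and then so does \<open>U * V\<close>.\<close>

lemma low_rank_kernel:
  fixes U V :: "real mat"
  assumes U: "U \<in> carrier_mat N (d - 1)" and V: "V \<in> carrier_mat (d - 1) d" and d: "0 < d"
  shows "\<exists>z. (\<exists>j<d. z j \<noteq> 0) \<and> (\<forall>i<N. (\<Sum>j<d. (U * V) $$ (i,j) * z j) = 0)"
proof -
  define V' where "V' = mat d d (\<lambda>(l,j). if l < d - 1 then V $$ (l,j) else 0)"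
  have V': "V' \<in> carrier_mat d d" by (simp add: V'_def)
  have V'_rows: "V' = mat\<^sub>r d d (\<lambda>i. if i = d - 1 then 0\<^sub>v d else row V' i)"
    by (intro eq_matI) (auto simp: V'_def split: if_splits)
  have "row V' \<in> {0..<d} \<rightarrow> carrier_vec d" by (simp add: V'_def)
  then have "det V' = 0"
    using d by (subst V'_rows) (intro det_row_0, auto)
  then have "\<exists>v. v \<in> carrier_vec d \<and> v \<noteq> 0\<^sub>v d \<and> V' *\<^sub>v v = 0\<^sub>v d"
    using det_0_iff_vec_prod_zero[OF V'] by simp
  then obtain v where v: "v \<in> carrier_vec d" "v \<noteq> 0\<^sub>v d" "V' *\<^sub>v v = 0\<^sub>v d" by blast
  have rows: "(\<Sum>j<d. V $$ (l,j) * v $ j) = 0" if l: "l < d - 1" for l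
  proof -
    have "(V' *\<^sub>v v) $ l = 0" using v l by simp
    then show ?thesis using l v V' by (simp add: V'_def scalar_prod_def atLeast0LessThan)
  qed
  obtain js where js: "js < d" "v $ js \<noteq> 0"
    using v by (metis carrier_vecD eq_vecI index_zero_vec)
  have "(\<Sum>j<d. (U * V) $$ (i,j) * v $ j) = 0" if i: "i < N" for i
  proof -
    have "(\<Sum>j<d. (U * V) $$ (i,j) * v $ j) = (\<Sum>j<d. \<Sum>l<d - 1. U $$ (i,l) * (V $$ (l,j) * v $ j))"
      using U V i by (intro sum.cong) (auto simp: scalar_prod_def atLeast0LessThan sum_distrib_right mult.assoc)
    also have "\<dots> = (\<Sum>l<d - 1. U $$ (i,l) * (\<Sum>j<d. V $$ (l,j) * v $ j))"
      by (subst sum.swap) (simp add: sum_distrib_left)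
    also have "\<dots> = 0" using rows by simp
    finally show ?thesis .
  qed
  then show ?thesis using js by (intro exI[of _ "\<lambda>j. v $ j"]) blast
qed

text \<open>The columns stand for \<open>x\<close>, for \<open>f' = f / (n D)\<close>, and for one extra coordinate.  The
  second block of rows forces \<open>x = B f\<close>, where \<open>B = S / D\<close>, so that the best ratio of the first two
  blocks is governed by the largest possible \<open>|B f|_q / |f|_p\<close>; the last \<open>n^2\<close> rows, whose optimum
  is \<open>n^2\<close>, serve as a yardstick for it.\<close>

definition lp_entry :: "nat \<Rightarrow> nat \<Rightarrow> int \<Rightarrow> (nat \<Rightarrow> nat \<Rightarrow> int) \<Rightarrow> nat \<Rightarrow> nat \<Rightarrow> int" where
  "lp_entry n K D S i j =
    (if i < n then (if j = n + i then int K * int n ^ 2 * D else 0)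
     else if i < 2 * n then
       (if j < n then (if j = i - n then int K * int n ^ 2 else 0)
        else if j < 2 * n then - (int K * int n ^ 3 * S (i - n) (j - n)) else 0)
     else (if j = 2 * n then 1 else 0))"

definition lp_matrix :: "nat \<Rightarrow> nat \<Rightarrow> int \<Rightarrow> (nat \<Rightarrow> nat \<Rightarrow> int) \<Rightarrow> real mat" where
  "lp_matrix n K D S = mat (2 * n + n ^ 2) (2 * n + 1) (\<lambda>(i,j). real_of_int (lp_entry n K D S i j))"

lemma sum_if_mem: "finite X \<Longrightarrow> T \<subseteq> X \<Longrightarrow> (\<Sum>j\<in>X. if j \<in> T then c else 0) = card T * (c::real)"
  by (simp add: sum.If_cases Int_absorb1)

lemma sum_lessThan_add:
  fixes a b :: nat
  shows "(\<Sum>i<a + b. f i) = (\<Sum>i<a. f i) + (\<Sum>i<b. f (a + i) :: real)"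
proof (induction b)
  case (Suc b)
  then show ?case by simp
qed simp

definition yardstick :: "nat \<Rightarrow> real mat \<Rightarrow> real" where
  "yardstick n W = (\<Sum>t<n\<^sup>2. W $$ (2 * n + t, 2 * n))"

locale lp_instance =
  fixes n K :: nat and D :: int and S :: "nat \<Rightarrow> nat \<Rightarrow> int" and p q :: real
    and B :: "(nat \<Rightarrow> real) \<Rightarrow> nat \<Rightarrow> real"
  assumes n: "1 \<le> n" and D: "1 \<le> D" and pq: "1 < p" "p < 2" "1 / p + 1 / q = 1"
    and B: "\<And>(f :: nat \<Rightarrow> real) u. u < n \<Longrightarrow> B f u = (\<Sum>v<n. S u v * f v) / D"
begin

abbreviation "A \<equiv> lp_matrix n K D S"
abbreviation "N \<equiv> 2 * n + n\<^sup>2"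
abbreviation "d \<equiv> 2 * n + 1"
abbreviation "Dr \<equiv> real_of_int D"

lemma A_carrier: "A \<in> carrier_mat N d"
  by (simp add: lp_matrix_def)

lemma q: "2 < q"
proof -
  have "1/q = 1 - 1/p" using pq(3) by linarith
  moreover have "1/2 < 1/p" "1/p < 1" using pq by (auto simp: divide_simps)
  ultimately have "0 < 1/q" "1/q < 1/2" by linarith+
  then show ?thesis by (simp add: divide_simps split: if_splits)
qed

lemma sum_cols: "(\<Sum>j<d. f j) = (\<Sum>u<n. f u) + (\<Sum>u<n. f (n + u)) + (f (2 * n) :: real)"
  using sum_lessThan_add[of f n n] by (simp add: mult_2)

lemma sum_rows: "(\<Sum>i<N. f i) = (\<Sum>u<n. f u) + (\<Sum>u<n. f (n + u)) + (\<Sum>t<n\<^sup>2. f (2 * n + t) :: real)"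
  using sum_lessThan_add[of f "2 * n" "n\<^sup>2"] sum_lessThan_add[of f n n] by (simp add: mult_2)

text \<open>In terms of \<open>f = n D z(n + _)\<close> these rows charge \<open>K n\<close> times
  \<open>f\<close>. The factor \<open>n D\<close> hidden in the substitution keeps the coordinates
  \<open>z (n + u)\<close> themselves negligible in the q-norm of \<open>z\<close>.\<close>

lemma A_row1:
  fixes z :: "nat \<Rightarrow> real"
  assumes "u < n"
  shows "(\<Sum>j<d. A $$ (u,j) * z j) = K * n * (n * Dr * z (n + u))"
proof -
  have "(\<Sum>j<d. A $$ (u,j) * z j) = (\<Sum>j<d. if j = n + u then K * (real n)\<^sup>2 * Dr * z (n + u) else 0)"
    using assms by (intro sum.cong) (auto simp: lp_matrix_def lp_entry_def)
  also have "\<dots> = K * (real n)\<^sup>2 * Dr * z (n + u)" using assms by (subst sum.delta) auto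
  finally show ?thesis by (simp add: power2_eq_square)
qed

text \<open>The substitution also clears denominators: \<open>B f\<close> equals \<open>n S\<close>
  applied to the coordinates \<open>z (n + v)\<close>, so the entries are integers. The weight
  \<open>K n^2\<close> makes a residual \<open>z - B f\<close> expensive, since
  \<open>n^(2/p)\<close> is at most \<open>n^2\<close>.\<close>

lemma A_row2:
  fixes z :: "nat \<Rightarrow> real"
  assumes u: "u < n"
  shows "(\<Sum>j<d. A $$ (n + u,j) * z j) = K * (real n)\<^sup>2 * (z u - B (\<lambda>v. n * Dr * z (n + v)) u)"
proof -
  have 1: "(\<Sum>j<n. A $$ (n + u,j) * z j) = (\<Sum>j<n. if j = u then K * (real n)\<^sup>2 * z u else 0)"
    using u by (intro sum.cong) (auto simp: lp_matrix_def lp_entry_def)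
  have 2: "(\<Sum>v<n. A $$ (n + u,n + v) * z (n + v)) = (\<Sum>v<n. - (K * real n ^ 3 * (S u v * z (n + v))))"
    using u by (intro sum.cong) (auto simp: lp_matrix_def lp_entry_def)
  have 3: "A $$ (n + u, 2 * n) * z (2 * n) = 0"
    using u by (simp add: lp_matrix_def lp_entry_def)
  have "(\<Sum>v<n. S u v * (n * Dr * z (n + v))) = Dr * (n * (\<Sum>v<n. S u v * z (n + v)))"
    by (simp add: sum_distrib_left mult_ac)
  then have "B (\<lambda>v. n * Dr * z (n + v)) u = n * (\<Sum>v<n. S u v * z (n + v))"
    using D by (simp add: B[OF u])
  then have 4: "(\<Sum>v<n. - (K * real n ^ 3 * (S u v * z (n + v)))) = - (K * (real n)\<^sup>2 * B (\<lambda>v. n * Dr * z (n + v)) u)"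
    by (simp add: sum_negf sum_distrib_left[symmetric] power3_eq_cube power2_eq_square)
  have "(\<Sum>j<n. if j = u then K * (real n)\<^sup>2 * z u else 0) = K * (real n)\<^sup>2 * z u"
    using u by (subst sum.delta) auto
  then show ?thesis unfolding sum_cols 1 2 3 4 by (simp add: algebra_simps)
qed

lemma A_row3: "t < n\<^sup>2 \<Longrightarrow> j < d \<Longrightarrow> A $$ (2 * n + t, j) = (if j = 2 * n then 1 else 0)"
  by (simp add: lp_matrix_def lp_entry_def)

lemma abs_powr_young:
  fixes w :: real
  shows "\<bar>w\<bar> \<le> 1/8 + 8 powr (p - 1) * \<bar>w\<bar> powr p"
proof (cases "\<bar>w\<bar> \<le> 1/8")
  case False
  have "\<bar>w\<bar> = \<bar>w\<bar> powr (1 - p) * \<bar>w\<bar> powr p" using False by (simp add: powr_add[symmetric])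
  also have "\<dots> \<le> (1/8) powr (1 - p) * \<bar>w\<bar> powr p"
    using False pq by (intro mult_right_mono powr_mono2') auto
  also have "(1/8::real) powr (1 - p) = 8 powr (p - 1)"
    using powr_minus_divide[of 8 "1 - p"] by (simp add: powr_divide)
  finally show ?thesis by simp
next
  case True
  moreover have "0 \<le> 8 powr (p - 1) * \<bar>w\<bar> powr p" by simp
  ultimately show ?thesis by linarith
qed

text \<open>Converts p-th powers into absolute values: entries below 1/8 contribute 1/8 on average,
  larger ones are dominated by their p-th power. A mean error of 1/4 is enough to tell a column of
  ones from a column of zeros by its sum.\<close>

lemma sum_abs_young:
  assumes "(\<Sum>t<n\<^sup>2. \<bar>w t\<bar> powr p) \<le> \<rho> * (real n)\<^sup>2" and "8 powr p * \<rho> \<le> 1"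
  shows "(\<Sum>t<n\<^sup>2. \<bar>w t\<bar>) \<le> (real n)\<^sup>2 / 4"
proof -
  have "(\<Sum>t<n\<^sup>2. \<bar>w t\<bar>) \<le> (\<Sum>t<n\<^sup>2. 1/8 + 8 powr (p - 1) * \<bar>w t\<bar> powr p)"
    by (intro sum_mono abs_powr_young)
  also have "\<dots> = (real n)\<^sup>2 / 8 + 8 powr (p - 1) * (\<Sum>t<n\<^sup>2. \<bar>w t\<bar> powr p)"
    by (simp add: sum.distrib sum_distrib_left)
  also have "\<dots> \<le> (real n)\<^sup>2 / 8 + 8 powr (p - 1) * (\<rho> * (real n)\<^sup>2)"
    using assms by (intro add_left_mono mult_left_mono) auto
  also have "8 powr (p - 1) * (\<rho> * (real n)\<^sup>2) \<le> (real n)\<^sup>2 / 8"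
  proof -
    have "8 powr (p - 1) = 8 powr p / 8" by (simp add: powr_diff)
    then have "8 powr (p - 1) * (\<rho> * (real n)\<^sup>2) = 8 powr p * \<rho> * (real n)\<^sup>2 / 8" by simp
    moreover have "8 powr p * \<rho> * (real n)\<^sup>2 \<le> 1 * (real n)\<^sup>2" using assms by (intro mult_right_mono) auto
    ultimately show ?thesis by linarith
  qed
  finally show ?thesis by simp
qed

lemma opt_le_rank:
  assumes W: "W \<in> carrier_mat N d" and "js < d" "z js \<noteq> 0"
    and "\<And>i. i < N \<Longrightarrow> (\<Sum>j<d. W $$ (i,j) * z j) = 0"
  shows "lp_opt p (2 * n) A \<le> (\<Sum>i<N. psum d p (\<lambda>j. W $$ (i,j) - A $$ (i,j)))"
proof -
  obtain U V where UV: "U \<in> carrier_mat N (d - 1)" "V \<in> carrier_mat (d - 1) d" "U * V = W"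
    using rank_factorization[OF assms] by blast
  have "lp_opt p (2 * n) A \<le> lp_cost p A U V"
    using UV A_carrier by (intro lp_opt_le) auto
  then show ?thesis using lp_cost_eq[OF A_carrier W UV(3)] by simp
qed

text \<open>The vector \<open>z\<close> with parts \<open>B f\<close>, \<open>f / (n D)\<close> and
  0 is sent by \<open>A\<close> to \<open>K n f\<close> in the first block and to 0 elsewhere.
  Subtracting the rank one matrix \<open>K n f f^T / s\<close> there puts \<open>z\<close> into the
  kernel, and this correction is cheap. So an approximate solution must be accurate on the last
  block, whose entries are 1.\<close>

lemma yes_instance:
  assumes T: "T \<subseteq> {..<n}" "T \<noteq> {}"
    and large: "card T / 2 \<le> (\<Sum>u\<in>T. B (\<lambda>v. if v \<in> T then 1 else 0) u)"
    and small: "8 powr p * (r * ((2 * K) powr p * (card T / n) powr (2 - p))) \<le> 1"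
    and app: "lp_approx p r (2 * n) A U V" and r: "1 < r"
  shows "(real n)\<^sup>2 / 2 < yardstick n (U * V)"
proof -
  define f where "f v = (if v \<in> T then 1 else 0 :: real)" for v
  define z where "z j = (if j < n then B f j else if j < 2 * n then f (j - n) / (n * Dr) else 0)" for j
  have fT: "finite T" using T finite_subset by blast
  have cT: "0 < card T" using T fT by (simp add: card_gt_0_iff)
  have Dn: "0 < n * Dr" using n D by simp
  define s where "s = (\<Sum>u\<in>T. B f u)"
  have s: "card T / 2 \<le> s" "0 < s" using large cT by (auto simp: s_def f_def[abs_def])
  define W where "W = mat N d (\<lambda>(i,j). A $$ (i,j) - (if i < n \<and> j < n then K * n * f i * f j / s else 0))"
  have Wc: "W \<in> carrier_mat N d" by (simp add: W_def)
  have yz: "(\<Sum>j<n. f j * z j) = s"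
  proof -
    have "(\<Sum>j<n. f j * z j) = (\<Sum>j<n. if j \<in> T then B f j else 0)"
      by (intro sum.cong) (auto simp: f_def z_def)
    then show ?thesis using T by (simp add: sum.If_cases Int_absorb1 s_def)
  qed
  have fz: "(\<lambda>v. n * Dr * z (n + v)) u = f u" if "u < n" for u
    using that D n by (simp add: z_def)
  have Bz: "B (\<lambda>v. n * Dr * z (n + v)) u = B f u" if "u < n" for u
  proof -
    have "(\<Sum>v<n. S u v * (n * Dr * z (n + v))) = (\<Sum>v<n. S u v * f v)"
      using fz by (intro sum.cong) auto
    then show ?thesis using B[OF that] by simp
  qed
  have ker: "(\<Sum>j<d. W $$ (i,j) * z j) = 0" if i: "i < N" for i
  proof -
    have "(\<Sum>j<d. W $$ (i,j) * z j) = (\<Sum>j<d. A $$ (i,j) * z j)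
        - (\<Sum>j<d. (if i < n \<and> j < n then K * n * f i * f j / s else 0) * z j)"
      using i by (simp add: W_def left_diff_distrib sum_subtractf)
    also have "(\<Sum>j<d. (if i < n \<and> j < n then K * n * f i * f j / s else 0) * z j)
        = (if i < n then K * n * f i else 0)"
    proof (cases "i < n")
      case True
      have "(\<Sum>j<d. (if i < n \<and> j < n then K * n * f i * f j / s else 0) * z j)
          = (\<Sum>j<n. K * n * f i / s * (f j * z j))"
        unfolding sum_cols using True by (simp add: mult_ac)
      also have "\<dots> = K * n * f i / s * s" unfolding yz[symmetric] by (simp only: sum_distrib_left)
      finally show ?thesis using s True by simp
    qed simp
    also have "(\<Sum>j<d. A $$ (i,j) * z j) = (if i < n then K * n * f i else 0)"
    proof -
      consider "i < n" | u where "i = n + u" "u < n" | t where "i = 2 * n + t" "t < n\<^sup>2"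
        using i by (metis add_diff_inverse_nat mult_2 nat_add_left_cancel_less)
      then show ?thesis
      proof cases
        case 1
        then show ?thesis using A_row1[of i z] fz[of i] by simp
      next
        case 2
        then show ?thesis using A_row2[of u z] Bz[of u] by (simp add: z_def)
      next
        case 3
        have "(\<Sum>j<d. A $$ (i,j) * z j) = 0"
          using 3 A_row3 by (intro sum.neutral) (auto simp: z_def)
        then show ?thesis using 3 by simp
      qed
    qed
    finally show ?thesis by simp
  qed
  obtain v0 where v0: "v0 \<in> T" "v0 < n" using T by blast
  have "lp_opt p (2 * n) A \<le> (\<Sum>i<N. psum d p (\<lambda>j. W $$ (i,j) - A $$ (i,j)))"
    using v0 Dn by (intro opt_le_rank[where js="n + v0" and z=z] Wc ker) (auto simp: z_def f_def)
  also have "\<dots> = (\<Sum>i<N. \<Sum>j<d. if i \<in> T \<and> j \<in> T then (K * n / s) powr p else 0)"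
    unfolding psum_def using T s pq
    by (intro sum.cong) (auto simp: W_def f_def powr_divide)
  also have "\<dots> = (\<Sum>i<N. if i \<in> T then card T * (K * n / s) powr p else 0)"
  proof (rule sum.cong[OF refl])
    fix i
    have "T \<subseteq> {..<d}" using T by auto
    from sum_if_mem[OF finite_lessThan this, of "(K * n / s) powr p"]
    show "(\<Sum>j<d. if i \<in> T \<and> j \<in> T then (K * n / s) powr p else 0)
        = (if i \<in> T then card T * (K * n / s) powr p else 0)"
      by (cases "i \<in> T") (simp_all del: sum.lessThan_Suc)
  qed
  also have "\<dots> = card T * (card T * (K * n / s) powr p)"
    by (rule sum_if_mem) (use T in auto)
  also have "\<dots> \<le> card T * (card T * (2 * K * n / card T) powr p)"
  proof -
    have "K * n / s \<le> 2 * K * n / card T"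
    proof -
      have "K * n / s \<le> K * n / (card T / 2)" using s cT by (intro divide_left_mono) auto
      then show ?thesis by (simp add: mult_ac)
    qed
    then show ?thesis using s pq by (intro mult_left_mono powr_mono2) auto
  qed
  \<comment> \<open>Here \<open>p < 2\<close> matters: the cost relative to \<open>n^2\<close>
    carries a positive power of the density of \<open>T\<close>.\<close>
  also have "\<dots> = (2 * K) powr p * (card T / n) powr (2 - p) * (real n)\<^sup>2"
  proof -
    define x where "x = card T / real n"
    have x: "0 < x" "card T = x * n" using n cT by (simp_all add: x_def)
    have "x\<^sup>2 * x powr (- p) = x powr (2 - p)" using powr_add[of x 2 "-p"] x by simp
    moreover have "(2 * K * n / card T) powr p = (2 * K) powr p * x powr (- p)"
    proof -
      have "2 * K * n / card T = 2 * K / x" using x n by (simp add: x(2))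
      then show ?thesis using x by (simp add: powr_divide powr_minus_divide)
    qed
    moreover have "card T * (card T * ((2 * K) powr p * x powr (- p))) = (2 * K) powr p * (x\<^sup>2 * x powr (- p)) * (real n)\<^sup>2"
      unfolding x(2) by (simp add: power2_eq_square)
    ultimately show ?thesis by (simp add: x_def)
  qed
  finally have "r * lp_opt p (2 * n) A \<le> r * ((2 * K) powr p * (card T / n) powr (2 - p)) * (real n)\<^sup>2"
    using r by simp
  moreover have "U \<in> carrier_mat N (2 * n)" "V \<in> carrier_mat (2 * n) d"
    using app A_carrier by (auto simp: lp_approx_def)
  then have UVc: "U * V \<in> carrier_mat N d" by simp
  ultimately have cost: "(\<Sum>i<N. psum d p (\<lambda>j. (U * V) $$ (i,j) - A $$ (i,j)))
      \<le> r * ((2 * K) powr p * (card T / n) powr (2 - p)) * (real n)\<^sup>2"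
    using app lp_cost_eq[OF A_carrier UVc refl] by (simp add: lp_approx_def)
  have "(\<Sum>t<n\<^sup>2. \<bar>(U * V) $$ (2 * n + t, 2 * n) - 1\<bar> powr p)
      \<le> (\<Sum>i<N. psum d p (\<lambda>j. (U * V) $$ (i,j) - A $$ (i,j)))"
  proof -
    have "(\<Sum>t<n\<^sup>2. \<bar>(U * V) $$ (2 * n + t, 2 * n) - 1\<bar> powr p)
        \<le> (\<Sum>t<n\<^sup>2. psum d p (\<lambda>j. (U * V) $$ (2 * n + t,j) - A $$ (2 * n + t,j)))"
    proof (rule sum_mono)
      fix t assume "t \<in> {..<n\<^sup>2}"
      then have "\<bar>(U * V) $$ (2 * n + t, 2 * n) - 1\<bar> powr p
          = \<bar>(U * V) $$ (2 * n + t, 2 * n) - A $$ (2 * n + t, 2 * n)\<bar> powr p" by (simp add: A_row3)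
      also have "\<dots> \<le> psum d p (\<lambda>j. (U * V) $$ (2 * n + t,j) - A $$ (2 * n + t,j))"
        unfolding psum_def by (rule member_le_sum) auto
      finally show "\<bar>(U * V) $$ (2 * n + t, 2 * n) - 1\<bar> powr p
          \<le> psum d p (\<lambda>j. (U * V) $$ (2 * n + t,j) - A $$ (2 * n + t,j))" .
    qed
    also have "\<dots> \<le> (\<Sum>i<N. psum d p (\<lambda>j. (U * V) $$ (i,j) - A $$ (i,j)))"
      unfolding sum_rows by (simp add: psum_nonneg sum_nonneg)
    finally show ?thesis .
  qed
  then have "(\<Sum>t<n\<^sup>2. \<bar>(U * V) $$ (2 * n + t, 2 * n) - 1\<bar>) \<le> (real n)\<^sup>2 / 4"
    by (intro sum_abs_young[OF order_trans[OF _ cost] small])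
  moreover have "(real n)\<^sup>2 - yardstick n (U * V) \<le> (\<Sum>t<n\<^sup>2. \<bar>(U * V) $$ (2 * n + t, 2 * n) - 1\<bar>)"
  proof -
    have "(real n)\<^sup>2 - yardstick n (U * V) = (\<Sum>t<n\<^sup>2. 1 - (U * V) $$ (2 * n + t, 2 * n))"
      by (simp add: yardstick_def sum_subtractf)
    also have "\<dots> \<le> (\<Sum>t<n\<^sup>2. \<bar>(U * V) $$ (2 * n + t, 2 * n) - 1\<bar>)" by (intro sum_mono) auto
    finally show ?thesis .
  qed
  moreover have "0 < (real n)\<^sup>2" using n by simp
  ultimately show ?thesis by linarith
qed

text \<open>Delete the last column; the last unit vector becomes a kernel vector, and only the
  \<open>n^2\<close> ones are lost.\<close>

lemma opt_le_square: "lp_opt p (2 * n) A \<le> (real n)\<^sup>2"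
proof -
  define W where "W = mat N d (\<lambda>(i,j). if j = 2 * n then 0 else A $$ (i,j))"
  have W: "W \<in> carrier_mat N d" by (simp add: W_def)
  have "lp_opt p (2 * n) A \<le> (\<Sum>i<N. psum d p (\<lambda>j. W $$ (i,j) - A $$ (i,j)))"
    by (rule opt_le_rank[OF W, where js="2 * n" and z="\<lambda>j. if j = 2 * n then 1 else 0"])
      (auto simp: W_def intro!: sum.neutral)
  also have "\<dots> = (\<Sum>i<N. if 2 * n \<le> i then 1 else 0)"
  proof (intro sum.cong refl)
    fix i assume i: "i \<in> {..<N}"
    have "psum d p (\<lambda>j. W $$ (i,j) - A $$ (i,j)) = (\<Sum>j<d. if j = 2 * n then \<bar>A $$ (i,j)\<bar> powr p else 0)"
      unfolding psum_def using i pq by (intro sum.cong) (auto simp: W_def)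
    also have "\<dots> = \<bar>A $$ (i, 2 * n)\<bar> powr p" by (subst sum.delta) auto
    also have "\<dots> = (if 2 * n \<le> i then 1 else 0)"
      using i pq by (auto simp: lp_matrix_def lp_entry_def)
    finally show "psum d p (\<lambda>j. W $$ (i,j) - A $$ (i,j)) = (if 2 * n \<le> i then 1 else 0)" .
  qed
  also have "\<dots> = (real n)\<^sup>2" unfolding sum_rows by simp
  finally show ?thesis .
qed

text \<open>Let \<open>z\<close> be a kernel vector of \<open>W\<close>. Hoelder's inequality in
  every row bounds the p-norm of \<open>A z\<close> by the error times the q-norm of
  \<open>z\<close>. Hypercontractivity makes any substantial mass of \<open>z\<close> on the first
  \<open>2 n\<close> coordinates too expensive, so the last coordinate dominates, and the kernel
  relation in the last block forces the last column of \<open>W\<close> to be small there.\<close>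

lemma no_instance:
  assumes hyper: "\<And>f. pnorm n q (B f) \<le> Kc * (1 / n) powr (2 / p - 1) * pnorm n p f"
    and Kc: "1 \<le> Kc" and K: "64 * Kc * r powr (2 / p) \<le> K" and r: "1 < r"
    and app: "lp_approx p r (2 * n) A U V"
  shows "yardstick n (U * V) < (real n)\<^sup>2 / 2"
proof -
  define W where "W = U * V"
  have Uc: "U \<in> carrier_mat N (d - 1)" "V \<in> carrier_mat (d - 1) d"
    using app A_carrier by (auto simp: lp_approx_def)
  then have Wc: "W \<in> carrier_mat N d" by (simp add: W_def)
  define Er where "Er i j = W $$ (i,j) - A $$ (i,j)" for i j
  have cost: "(\<Sum>i<N. psum d p (Er i)) \<le> r * (real n)\<^sup>2"
  proof -
    have "(\<Sum>i<N. psum d p (Er i)) \<le> r * lp_opt p (2 * n) A"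
      using app lp_cost_eq[OF A_carrier Wc W_def[symmetric]] by (simp add: lp_approx_def Er_def[abs_def])
    also have "\<dots> \<le> r * (real n)\<^sup>2" using opt_le_square r by (intro mult_left_mono) auto
    finally show ?thesis .
  qed
  obtain z js where z0: "js < d" "z js \<noteq> 0"
    and ker: "\<And>i. i < N \<Longrightarrow> (\<Sum>j<d. W $$ (i,j) * z j) = 0"
    using low_rank_kernel[OF Uc] unfolding W_def by auto
  define zq where "zq = pnorm d q z"
  have q0: "0 < q" "1 < q" using q by auto
  have p0: "0 < p" using pq by auto
  have zq: "0 < zq"
    using pnorm_eq_0[OF q0(1), of d z js] z0 pnorm_nonneg[of d q z] unfolding zq_def by linarith
  define f where "f v = n * Dr * z (n + v)" for v
  define e where "e u = z u - B f u" for u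
  define c1 where "c1 = r powr (1 / p)"
  have c1: "1 \<le> c1" using r p0 by (simp add: c1_def ge_one_powr_ge_zero)
  have rowbound: "\<bar>\<Sum>j<d. A $$ (i,j) * z j\<bar> powr p \<le> psum d p (Er i) * zq powr p" if i: "i < N" for i
  proof -
    have "(\<Sum>j<d. A $$ (i,j) * z j) = - ip d z (Er i)"
      using ker[OF i] by (simp add: ip_def Er_def right_diff_distrib sum_subtractf mult.commute)
    then have "\<bar>\<Sum>j<d. A $$ (i,j) * z j\<bar> \<le> zq * pnorm d p (Er i)"
      using holder[OF pq(1) q0(2) pq(3), of d z "Er i"] by (simp add: zq_def)
    then have "\<bar>\<Sum>j<d. A $$ (i,j) * z j\<bar> powr p \<le> (zq * pnorm d p (Er i)) powr p"
      using p0 by (intro powr_mono2) auto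
    then show ?thesis using zq p0 by (simp add: powr_mult pnorm_nonneg pnorm_powr mult.commute)
  qed
  have tot: "(\<Sum>i<N. \<bar>\<Sum>j<d. A $$ (i,j) * z j\<bar> powr p) \<le> (c1 * zq) powr p * (real n)\<^sup>2"
  proof -
    have "(\<Sum>i<N. \<bar>\<Sum>j<d. A $$ (i,j) * z j\<bar> powr p) \<le> (\<Sum>i<N. psum d p (Er i) * zq powr p)"
      using rowbound by (intro sum_mono) auto
    also have "\<dots> \<le> r * (real n)\<^sup>2 * zq powr p"
      unfolding sum_distrib_right[symmetric] using cost by (intro mult_right_mono) auto
    also have "\<dots> = (c1 * zq) powr p * (real n)\<^sup>2"
      using r p0 zq by (simp add: c1_def powr_mult powr_powr)
    finally show ?thesis .
  qed
  have Kpos: "0 < real K"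
  proof -
    have "0 < 64 * Kc * r powr (2 / p)" using Kc r by simp
    then show ?thesis using K by linarith
  qed
  have npos: "0 < real n" using n by simp
  have n_powr: "(n powr (2/p)) powr p = (real n)\<^sup>2" using npos p0 by (simp add: powr_powr)
  have "psum n p (\<lambda>u. K * n * f u) + psum n p (\<lambda>u. K * (real n)\<^sup>2 * e u)
      \<le> (\<Sum>i<N. \<bar>\<Sum>j<d. A $$ (i,j) * z j\<bar> powr p)"
  proof -
    have rowf: "(\<Sum>j<d. A $$ (u,j) * z j) = K * n * f u" if "u < n" for u
      using A_row1[OF that, of z] by (simp add: f_def)
    have rowe: "(\<Sum>j<d. A $$ (n + u,j) * z j) = K * (real n)\<^sup>2 * e u" if "u < n" for u
      using A_row2[OF that, of z] by (simp add: e_def f_def[abs_def])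
    have "psum n p (\<lambda>u. K * n * f u) = (\<Sum>u<n. \<bar>\<Sum>j<d. A $$ (u,j) * z j\<bar> powr p)"
      unfolding psum_def by (intro sum.cong refl) (simp only: rowf lessThan_iff)
    moreover have "psum n p (\<lambda>u. K * (real n)\<^sup>2 * e u) = (\<Sum>u<n. \<bar>\<Sum>j<d. A $$ (n + u,j) * z j\<bar> powr p)"
      unfolding psum_def by (intro sum.cong refl) (simp only: rowe lessThan_iff)
    ultimately show ?thesis unfolding sum_rows by (simp add: sum_nonneg)
  qed
  then have both: "psum n p (\<lambda>u. K * n * f u) \<le> (c1 * zq * n powr (2/p)) powr p"
      "psum n p (\<lambda>u. K * (real n)\<^sup>2 * e u) \<le> (c1 * zq * n powr (2/p)) powr p"
    using tot psum_nonneg[of n p "\<lambda>u. K * n * f u"] psum_nonneg[of n p "\<lambda>u. K * (real n)\<^sup>2 * e u"] c1 zq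
    by (simp_all add: powr_mult n_powr)
  have scale: "psum n s (\<lambda>u. c * x u) = c powr s * psum n s x" if "0 \<le> c" for c s and x :: "nat \<Rightarrow> real"
    using that by (simp add: psum_def abs_mult powr_mult sum_distrib_left)
  have pscale: "pnorm n s (\<lambda>u. c * x u) = c * pnorm n s x" if "0 \<le> c" "0 < s" for c s and x :: "nat \<Rightarrow> real"
    using that by (simp add: pnorm_def scale powr_mult psum_nonneg powr_powr)
  have rhs0: "0 \<le> c1 * zq * n powr (2/p)" using c1 zq by simp
  have fb: "K * n * pnorm n p f \<le> c1 * zq * n powr (2/p)"
    using both(1) psum_le_powr_iff[OF p0 rhs0] pscale[of "K * n" p f] p0 by simp
  have eb: "K * (real n)\<^sup>2 * pnorm n p e \<le> c1 * zq * n powr (2/p)"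
    using both(2) psum_le_powr_iff[OF p0 rhs0] pscale[of "K * (real n)\<^sup>2" p e] p0 by simp
  \<comment> \<open>Common bound on the q-norms of \<open>B f\<close>, of the residual
    \<open>e\<close> and of the second group of coordinates.\<close>
  define t where "t = Kc * c1 * zq / K"
  have t0: "0 < t" using Kc c1 zq Kpos by (simp add: t_def)
  have np2: "n powr (2/p) \<le> (real n)\<^sup>2"
  proof -
    have "n powr (2/p) \<le> n powr 2" using n pq by (intro powr_mono) (auto simp: divide_simps)
    then show ?thesis using npos by simp
  qed
  have c1t: "c1 * zq \<le> t * K" using Kc c1 zq Kpos by (simp add: t_def)
  have bB: "pnorm n q (B f) \<le> t"
  proof -
    have "K * n * pnorm n q (B f) \<le> K * n * (Kc * (1 / n) powr (2 / p - 1) * pnorm n p f)"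
      using hyper Kpos npos by (intro mult_left_mono) auto
    also have "\<dots> = Kc * (1 / n) powr (2 / p - 1) * (K * n * pnorm n p f)" by simp
    also have "\<dots> \<le> Kc * (1 / n) powr (2 / p - 1) * (c1 * zq * n powr (2/p))"
      using fb Kc by (intro mult_left_mono) auto
    also have "\<dots> = Kc * c1 * zq * ((1 / n) powr (2 / p - 1) * n powr (2/p))" by simp
    \<comment> \<open>The powers of \<open>n\<close> balance exactly; this is why the first block
      has weight \<open>K n\<close>.\<close>
    also have "(1 / n) powr (2 / p - 1) * n powr (2/p) = n"
    proof -
      have "(1 / real n) powr (2 / p - 1) = n powr (- (2 / p - 1))"
        using powr_minus_divide[of "real n" "2 / p - 1"] by (simp add: powr_divide)
      then have "(1 / n) powr (2 / p - 1) * n powr (2/p) = n powr (- (2 / p - 1) + 2 / p)"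
        by (simp only: powr_add)
      then show ?thesis using npos by simp
    qed
    also have "Kc * c1 * zq * n = K * n * t" using Kpos by (simp add: t_def)
    finally show ?thesis using Kpos npos by simp
  qed
  have be: "pnorm n q e \<le> t"
  proof -
    have "K * (real n)\<^sup>2 * pnorm n q e \<le> K * (real n)\<^sup>2 * pnorm n p e"
      using q pq by (intro mult_left_mono pnorm_mono) auto
    also note eb
    also have "c1 * zq * n powr (2/p) \<le> t * K * (real n)\<^sup>2"
      using t0 Kpos by (intro mult_mono[OF c1t np2]) auto
    finally show ?thesis using Kpos npos by (simp add: mult_ac)
  qed
  have bf: "pnorm n q (\<lambda>u. z (n + u)) \<le> t"
  proof -
    have Dr: "1 \<le> Dr" using D by simp
    have "n * Dr * pnorm n q (\<lambda>u. z (n + u)) = pnorm n q f"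
      using pscale[of "n * Dr" q "\<lambda>u. z (n + u)"] Dr q0 unfolding f_def by simp
    also have "\<dots> \<le> pnorm n p f" using q pq by (intro pnorm_mono) auto
    finally have "K * n * (n * Dr * pnorm n q (\<lambda>u. z (n + u))) \<le> K * n * pnorm n p f"
      using Kpos npos by (intro mult_left_mono) auto
    also note fb
    also have "c1 * zq * n powr (2/p) \<le> t * K * (real n)\<^sup>2"
      using t0 Kpos by (intro mult_mono[OF c1t np2]) auto
    finally have "Dr * pnorm n q (\<lambda>u. z (n + u)) \<le> t"
      using Kpos npos by (simp add: power2_eq_square mult_ac)
    moreover have "1 * pnorm n q (\<lambda>u. z (n + u)) \<le> Dr * pnorm n q (\<lambda>u. z (n + u))"
      using Dr by (intro mult_right_mono pnorm_nonneg)
    ultimately show ?thesis by simp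
  qed
  have z'q: "psum (2 * n) q z \<le> (4 * t) powr q"
  proof -
    have "psum (2 * n) q z = psum n q z + psum n q (\<lambda>u. z (n + u))"
      using sum_lessThan_add[of "\<lambda>u. \<bar>z u\<bar> powr q" n n] by (simp add: psum_def mult_2)
    also have "psum n q z \<le> (\<Sum>u<n. 2 powr q * (\<bar>B f u\<bar> powr q + \<bar>e u\<bar> powr q))"
      unfolding psum_def
    proof (rule sum_mono)
      fix u
      have "\<bar>z u\<bar> \<le> \<bar>B f u\<bar> + \<bar>e u\<bar>" by (simp add: e_def)
      then have "\<bar>z u\<bar> \<le> 2 * max \<bar>B f u\<bar> \<bar>e u\<bar>" by linarith
      then have "\<bar>z u\<bar> powr q \<le> (2 * max \<bar>B f u\<bar> \<bar>e u\<bar>) powr q" using q by (intro powr_mono2) auto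
      also have "\<dots> = 2 powr q * max \<bar>B f u\<bar> \<bar>e u\<bar> powr q" by (simp add: powr_mult)
      also have "\<dots> \<le> 2 powr q * (\<bar>B f u\<bar> powr q + \<bar>e u\<bar> powr q)"
        by (intro mult_left_mono) (auto simp: max_def)
      finally show "\<bar>z u\<bar> powr q \<le> 2 powr q * (\<bar>B f u\<bar> powr q + \<bar>e u\<bar> powr q)" .
    qed
    also have "\<dots> = 2 powr q * (psum n q (B f) + psum n q e)"
      unfolding psum_def sum.distrib[symmetric] by (rule sum_distrib_left[symmetric])
    also have "\<dots> \<le> 2 powr q * (t powr q + t powr q)"
      using bB be t0 q0 by (intro mult_left_mono add_mono) (auto simp: psum_le_powr_iff)
    also have "psum n q (\<lambda>u. z (n + u)) \<le> t powr q" using bf t0 q0 by (simp add: psum_le_powr_iff)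
    finally have "psum (2 * n) q z \<le> (2 * 2 powr q + 1) * t powr q" by (simp add: algebra_simps)
    also have "\<dots> \<le> (2 powr q * 2 powr q) * t powr q"
    proof (rule mult_right_mono)
      have "(2::real) powr 2 \<le> 2 powr q" using q by (intro powr_mono) auto
      then have "4 \<le> (2::real) powr q" by simp
      then have "4 * 2 powr q \<le> (2::real) powr q * 2 powr q" by (intro mult_right_mono) auto
      then show "2 * 2 powr q + 1 \<le> (2::real) powr q * 2 powr q" using \<open>4 \<le> 2 powr q\<close> by linarith
    qed simp
    also have "\<dots> = (4 * t) powr q" using t0 powr_mult[of 2 2 q] powr_mult[of 4 t q] by simp
    finally show ?thesis .
  qed
  define \<theta> where "\<theta> = 4 * t / zq"
  \<comment> \<open>The 64 in the hypothesis on \<open>K\<close> is 4 * 8 * 2: a factor 4 from the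
    three pieces of \<open>z\<close>, 8 from \<open>sum_abs_young\<close>, 2 from the last
    coordinate being at least half of the norm. One factor \<open>c1\<close> stems from the kernel
    vector, the other from the error on the last block.\<close>
  have \<theta>: "0 < \<theta>" "16 * \<theta> * c1 \<le> 1"
  proof -
    show "0 < \<theta>" using t0 zq by (simp add: \<theta>_def)
    have "r powr (2/p) = c1 * c1" using powr_add[of r "1/p" "1/p"] by (simp add: c1_def)
    then have "64 * Kc * (c1 * c1) \<le> K" using K by simp
    moreover have "16 * \<theta> * c1 = 64 * Kc * (c1 * c1) / K" using zq by (simp add: \<theta>_def t_def)
    ultimately show "16 * \<theta> * c1 \<le> 1" using Kpos by simp
  qed
  have \<theta>16: "\<theta> \<le> 1/16"
  proof -
    have "16 * \<theta> * 1 \<le> 16 * \<theta> * c1" using \<theta>(1) c1 by (intro mult_left_mono) auto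
    then show ?thesis using \<theta>(2) by linarith
  qed
  have z'n: "pnorm (2 * n) q z \<le> \<theta> * zq"
    using z'q psum_le_powr_iff[OF q0(1), of "4 * t" "2 * n" z] t0 zq by (simp add: \<theta>_def)
  have \<tau>: "zq / 2 \<le> \<bar>z (2 * n)\<bar>"
  proof (rule ccontr)
    assume "\<not> ?thesis"
    then have small: "\<bar>z (2 * n)\<bar> \<le> zq / 2" by simp
    have "zq powr q = psum (2 * n) q z + \<bar>z (2 * n)\<bar> powr q"
      using pnorm_powr[OF q0(1), of d z] by (simp add: zq_def psum_def)
    also have "\<dots> < (1/4 * zq) powr q + (zq / 2) powr q"
    proof (rule add_less_le_mono)
      have "psum (2 * n) q z \<le> (\<theta> * zq) powr q"
        using z'n psum_le_powr_iff[OF q0(1), of "\<theta> * zq" "2 * n" z] \<theta> zq by simp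
      also have "\<dots> < (1/4 * zq) powr q"
        using \<theta>16 \<theta> zq q0 by (intro powr_less_mono2) auto
      finally show "psum (2 * n) q z < (1/4 * zq) powr q" .
      show "\<bar>z (2 * n)\<bar> powr q \<le> (zq / 2) powr q" using small q0 by (intro powr_mono2) auto
    qed
    also have "\<dots> = ((1/4) powr q + (1/2) powr q) * zq powr q"
      using powr_mult[of "1/4" zq q] powr_mult[of "1/2" zq q] zq by (simp add: distrib_right)
    also have "\<dots> \<le> ((1/4) powr 1 + (1/2) powr 1) * zq powr q"
      using q0 by (intro mult_right_mono add_mono powr_mono') auto
    also have "\<dots> \<le> 1 * zq powr q" by (intro mult_right_mono) auto
    finally show False by simp
  qed
  \<comment> \<open>In these rows \<open>A\<close> vanishes on the first \<open>2 n\<close> columns,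
    so the entries of \<open>W\<close> there are errors. The kernel relation expresses the remaining
    entry by their inner product with the small part of \<open>z\<close>.\<close>
  have wb: "\<bar>W $$ (2 * n + t, 2 * n)\<bar> powr p \<le> (2 * \<theta>) powr p * psum d p (Er (2 * n + t))" if t: "t < n\<^sup>2" for t
  proof -
    let ?i = "2 * n + t"
    have "(\<Sum>j<2 * n. W $$ (?i,j) * z j) + W $$ (?i, 2 * n) * z (2 * n) = 0"
      using ker[of ?i] t by simp
    moreover have "(\<Sum>j<2 * n. W $$ (?i,j) * z j) = ip (2 * n) z (Er ?i)"
      unfolding ip_def using A_row3[OF t] by (intro sum.cong) (auto simp: Er_def)
    ultimately have "\<bar>W $$ (?i, 2 * n)\<bar> * \<bar>z (2 * n)\<bar> = \<bar>ip (2 * n) z (Er ?i)\<bar>"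
      by (simp add: abs_mult[symmetric])
    also have "\<dots> \<le> pnorm (2 * n) q z * pnorm (2 * n) p (Er ?i)"
      using holder[OF pq(1) q0(2) pq(3)] .
    also have "\<dots> \<le> \<theta> * zq * pnorm (2 * n) p (Er ?i)"
      using z'n by (intro mult_right_mono pnorm_nonneg)
    finally have "\<bar>W $$ (?i, 2 * n)\<bar> * (zq / 2) \<le> \<theta> * zq * pnorm (2 * n) p (Er ?i)"
      using \<tau> by (meson abs_ge_zero mult_left_mono order_trans)
    then have "\<bar>W $$ (?i, 2 * n)\<bar> \<le> 2 * \<theta> * pnorm (2 * n) p (Er ?i)" using zq by simp
    then have "\<bar>W $$ (?i, 2 * n)\<bar> powr p \<le> (2 * \<theta> * pnorm (2 * n) p (Er ?i)) powr p"
      using p0 by (intro powr_mono2) auto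
    also have "\<dots> = (2 * \<theta>) powr p * psum (2 * n) p (Er ?i)"
      using \<theta> p0 by (simp add: powr_mult pnorm_nonneg pnorm_powr)
    also have "\<dots> \<le> (2 * \<theta>) powr p * psum d p (Er ?i)"
      by (intro mult_left_mono) (auto simp: psum_def)
    finally show ?thesis .
  qed
  have "(\<Sum>t<n\<^sup>2. \<bar>W $$ (2 * n + t, 2 * n)\<bar> powr p) \<le> (\<Sum>t<n\<^sup>2. (2 * \<theta>) powr p * psum d p (Er (2 * n + t)))"
    using wb by (intro sum_mono) auto
  also have "\<dots> \<le> (2 * \<theta>) powr p * (\<Sum>i<N. psum d p (Er i))"
    unfolding sum_distrib_left[symmetric] sum_rows
    by (intro mult_left_mono) (simp_all add: sum_nonneg psum_nonneg)
  also have "\<dots> \<le> (2 * \<theta>) powr p * (r * (real n)\<^sup>2)"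
    using cost by (intro mult_left_mono) auto
  finally have "(\<Sum>t<n\<^sup>2. \<bar>W $$ (2 * n + t, 2 * n)\<bar> powr p) \<le> ((2 * \<theta>) powr p * r) * (real n)\<^sup>2" by simp
  moreover have "8 powr p * ((2 * \<theta>) powr p * r) \<le> 1"
  proof -
    have "r = c1 powr p" using r p0 by (simp add: c1_def powr_powr)
    then have "8 powr p * ((2 * \<theta>) powr p * r) = (16 * \<theta> * c1) powr p"
      using \<theta> c1 powr_mult[of 8 "2 * \<theta>" p] powr_mult[of "16 * \<theta>" c1 p] by simp
    also have "\<dots> \<le> 1 powr p" using \<theta> c1 p0 by (intro powr_mono2) auto
    finally show ?thesis by simp
  qed
  ultimately have "(\<Sum>t<n\<^sup>2. \<bar>W $$ (2 * n + t, 2 * n)\<bar>) \<le> (real n)\<^sup>2 / 4"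
    by (rule sum_abs_young)
  moreover have "yardstick n W \<le> (\<Sum>t<n\<^sup>2. \<bar>W $$ (2 * n + t, 2 * n)\<bar>)"
    unfolding yardstick_def by (intro sum_mono) auto
  moreover have "0 < (real n)\<^sup>2" using n by simp
  ultimately show ?thesis unfolding W_def by linarith
qed

end

section \<open>Choice of the constants\<close>

subsection \<open>The gap\<close>

text \<open>If \<open>M \<delta> \<ge> 2\<close>, there are no no-instances at all, and \<open>K = 0\<close> will do.\<close>

definition sse_scale :: "real \<Rightarrow> real \<Rightarrow> nat \<Rightarrow> real \<Rightarrow> nat" where
  "sse_scale p r M \<delta> = (if 2 \<le> M * \<delta> then 0
     else nat \<lceil>64 * (2592 * (2 / (M * \<delta>)) powr (2 / p - 1)) * r powr (2 / p)\<rceil>)"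

text \<open>In the bound for yes-instances, \<open>K^p\<close> contributes
  \<open>(M \<delta>)^(p-2)\<close> and the small set \<open>\<delta>^(2-p)\<close>. The product is
  \<open>M^(p-2)\<close> up to constants depending on \<open>p\<close> and \<open>r\<close> alone,
  so a large \<open>M\<close> settles every \<open>\<delta>\<close> at once; only then are
  \<open>\<eta>\<close> and \<open>\<epsilon>\<close> chosen.\<close>

lemma exists_gap_constants:
  fixes p r :: real
  assumes pq: "1 < p" "p < 2" "1 / p + 1 / q = 1" and r: "1 < r"
  obtains M :: nat and \<eta> \<epsilon> :: real where "1 \<le> M" "0 < \<eta>" "\<eta> \<le> 1" "0 < \<epsilon>" "\<epsilon> \<le> 1/8" "8 * M * \<epsilon> < 1"
    "(\<eta> + \<eta> powr (1 - q) * (8 * M * \<epsilon>)) * (1 + 16 powr q) \<le> 1/4"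
    "\<And>\<delta> x. 0 < \<delta> \<Longrightarrow> 0 \<le> x \<Longrightarrow> x \<le> \<delta> \<Longrightarrow>
      8 powr p * (r * ((2 * sse_scale p r M \<delta>) powr p * x powr (2 - p))) \<le> 1"
proof -
  define C where "C = 8 powr p * r * ((256 * 2592 * r powr (2 / p)) powr p * 2 powr (2 - p))"
  have C: "0 < C" using r by (simp add: C_def)
  define M where "M = nat \<lceil>C powr (1 / (2 - p))\<rceil> + 1"
  have M1: "1 \<le> M" by (simp add: M_def)
  have MC: "C \<le> M powr (2 - p)"
  proof -
    have "C powr (1 / (2 - p)) \<le> M" using real_nat_ceiling_ge[of "C powr (1 / (2 - p))"] unfolding M_def by linarith
    then have "(C powr (1 / (2 - p))) powr (2 - p) \<le> M powr (2 - p)" using pq by (intro powr_mono2) auto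
    then show ?thesis using pq C by (simp add: powr_powr)
  qed
  \<comment> \<open>Uses up one half of the allowance 1/4 of the level set bound; the other half
    goes to the term with \<open>\<epsilon>\<close>.\<close>
  define \<eta> :: real where "\<eta> = 1 / (8 * (1 + 16 powr q))"
  have pos: "0 < 1 + (16::real) powr q" by (simp add: add_pos_nonneg)
  have \<eta>: "0 < \<eta>" "\<eta> \<le> 1" "\<eta> * (1 + 16 powr q) = 1/8"
  proof -
    show "0 < \<eta>" using pos by (simp add: \<eta>_def)
    show "\<eta> * (1 + 16 powr q) = 1/8" using pos by (simp add: \<eta>_def)
    have "1 * 1 \<le> 8 * (1 + (16::real) powr q)" by (intro mult_mono) auto
    then show "\<eta> \<le> 1" using pos by (simp add: \<eta>_def)
  qed
  \<comment> \<open>The three terms serve in turn the low frequency estimate, the bound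
    \<open>8 M \<epsilon> < 1\<close>, and the second half of the level set allowance.\<close>
  define \<epsilon> where "\<epsilon> = min (1/8) (min (1 / (16 * M)) (1 / (64 * M * \<eta> powr (1 - q) * (1 + 16 powr q))))"
  have den: "0 < 64 * M * \<eta> powr (1 - q) * (1 + 16 powr q)" using M1 \<eta> pos by simp
  have \<epsilon>: "0 < \<epsilon>" "\<epsilon> \<le> 1/8" "\<epsilon> \<le> 1 / (16 * M)" "\<epsilon> \<le> 1 / (64 * M * \<eta> powr (1 - q) * (1 + 16 powr q))"
    using den M1 unfolding \<epsilon>_def by auto
  have 1: "8 * M * \<epsilon> < 1"
  proof -
    have "8 * M * \<epsilon> \<le> 8 * M * (1 / (16 * M))" using \<epsilon> by (intro mult_left_mono) auto
    also have "\<dots> < 1" using M1 by simp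
    finally show ?thesis .
  qed
  have 2: "(\<eta> + \<eta> powr (1 - q) * (8 * M * \<epsilon>)) * (1 + 16 powr q) \<le> 1/4"
  proof -
    have "64 * M * \<eta> powr (1 - q) * (1 + 16 powr q) * \<epsilon> \<le> 1"
      using \<epsilon>(4) den by (simp add: pos_le_divide_eq mult.commute)
    then have "\<eta> powr (1 - q) * (8 * M * \<epsilon>) * (1 + 16 powr q) \<le> 1/8" by (simp add: mult_ac)
    then show ?thesis using \<eta>(3) by (simp add: distrib_right)
  qed
  have 3: "8 powr p * (r * ((2 * sse_scale p r M \<delta>) powr p * x powr (2 - p))) \<le> 1"
    if \<delta>: "0 < \<delta>" and x: "0 \<le> x" "x \<le> \<delta>" for \<delta> x
  proof (cases "2 \<le> M * \<delta>")
    case True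
    then show ?thesis by (simp add: sse_scale_def)
  next
    case False
    have Md: "0 < M * \<delta>" using M1 \<delta> by simp
    define Y where "Y = 2 / (M * \<delta>)"
    have Y: "1 \<le> Y" using False Md by (simp add: Y_def)
    define Z where "Z = 64 * (2592 * Y powr (2 / p - 1)) * r powr (2 / p)"
    have e0: "0 < 2 / p - 1" using pq by simp
    have "1 \<le> Y powr (2 / p - 1)" "1 \<le> r powr (2 / p)"
      using Y r pq e0 by (auto intro!: ge_one_powr_ge_zero)
    then have "1 * 1 \<le> Y powr (2 / p - 1) * r powr (2 / p)" by (intro mult_mono) auto
    then have Z1: "1 \<le> Z" by (simp add: Z_def)
    have "sse_scale p r M \<delta> = nat \<lceil>Z\<rceil>" using False by (simp add: sse_scale_def Z_def Y_def)
    \<comment> \<open>Rounding up costs at most a factor 2, as \<open>Z\<close> is at least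
      1.\<close>
    then have "real (sse_scale p r M \<delta>) \<le> 2 * Z" using Z1 by (simp add: ) linarith
    then have "real (2 * sse_scale p r M \<delta>) \<le> 256 * 2592 * r powr (2 / p) * Y powr (2 / p - 1)"
      by (simp add: Z_def mult_ac)
    then have "(2 * sse_scale p r M \<delta>) powr p \<le> (256 * 2592 * r powr (2 / p) * Y powr (2 / p - 1)) powr p"
      using pq by (intro powr_mono2) auto
    also have "\<dots> = (256 * 2592 * r powr (2 / p)) powr p * Y powr (2 - p)"
    proof -
      have "(2 / p - 1) * p = 2 - p" using pq by (simp add: field_simps)
      then have "(Y powr (2 / p - 1)) powr p = Y powr (2 - p)" by (simp add: powr_powr)
      then show ?thesis using r by (subst powr_mult) auto
    qed
    finally have K: "(2 * sse_scale p r M \<delta>) powr p \<le> (256 * 2592 * r powr (2 / p)) powr p * Y powr (2 - p)" .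
    have "x powr (2 - p) \<le> \<delta> powr (2 - p)" using x pq by (intro powr_mono2) auto
    with K have "(2 * sse_scale p r M \<delta>) powr p * x powr (2 - p)
        \<le> (256 * 2592 * r powr (2 / p)) powr p * Y powr (2 - p) * \<delta> powr (2 - p)"
      by (intro mult_mono) auto
    also have "\<dots> = (256 * 2592 * r powr (2 / p)) powr p * (2 powr (2 - p) / M powr (2 - p))"
    proof -
      have "Y powr (2 - p) * \<delta> powr (2 - p) = (Y * \<delta>) powr (2 - p)" using Y \<delta> by (simp add: powr_mult)
      also have "Y * \<delta> = 2 / M" using M1 \<delta> by (simp add: Y_def)
      finally show ?thesis using M1 by (simp add: powr_divide mult.assoc)
    qed
    finally have "8 powr p * (r * ((2 * sse_scale p r M \<delta>) powr p * x powr (2 - p)))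
        \<le> 8 powr p * (r * ((256 * 2592 * r powr (2 / p)) powr p * (2 powr (2 - p) / M powr (2 - p))))"
      using r by (intro mult_left_mono) auto
    also have "\<dots> = C / M powr (2 - p)" by (simp add: C_def)
    also have "\<dots> \<le> 1" using MC M1 by simp
    finally show ?thesis .
  qed
  show ?thesis using that[OF M1 \<eta>(1,2) \<epsilon>(1,2) 1 2 3] .
qed

text \<open>The bit length of \<open>n\<close> exceeds \<open>log n\<close>, so \<open>n\<close> is
  below \<open>2^a\<close>, as hypercontractivity demands. At the same time \<open>4^a\<close> is
  polynomial in \<open>n\<close>, which keeps the power \<open>b\<close> affordable.\<close>

definition approx_projection :: "nat \<Rightarrow> nat rel \<Rightarrow> (nat \<Rightarrow> real) \<Rightarrow> nat \<Rightarrow> real" where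
  "approx_projection n E f =
    (let a = 2 * length (nat_bits n) in
       (\<lambda>u. f u - (regular_walk.Q (card (E `` {0})) E a ^^ (2 * 4 ^ a)) f u))"

lemma nat_bits_less: "n < 2 ^ length (nat_bits n)"
proof (induction n rule: nat_bits.induct)
  case (1 n)
  show ?case
  proof (cases "n = 0")
    case False
    then have "n div 2 < 2 ^ length (nat_bits (n div 2))" by (rule 1)
    then show ?thesis using False by (subst nat_bits.simps) auto
  qed (simp add: nat_bits.simps)
qed

text \<open>The condition \<open>2 \<le> \<delta> * real n\<close> is a conclusion for yes-instances
  and a hypothesis for no-instances: splitting into blocks needs two vertices, and a graph violating
  it can safely be rejected.\<close>

lemma sse_gap:
  fixes p r :: real
  assumes p: "1 < p" "p < 2" and r: "1 < r"
  obtains \<epsilon> :: real and K :: "real \<Rightarrow> nat" where "0 < \<epsilon>"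
    and "\<And>\<delta> n E D S U V. 0 < \<delta> \<Longrightarrow> regular_graph {..<n} E \<Longrightarrow> 1 \<le> \<delta> * real n \<Longrightarrow>
      small_set_expansion {..<n} E \<delta> \<le> \<epsilon> \<Longrightarrow> 1 \<le> D \<Longrightarrow>
      (\<And>f u. u < n \<Longrightarrow> approx_projection n E f u = (\<Sum>v<n. real_of_int (S u v) * f v) / real_of_int D) \<Longrightarrow>
      lp_approx p r (2 * n) (lp_matrix n (K \<delta>) D S) U V \<Longrightarrow>
      2 \<le> \<delta> * real n \<and> (real n)\<^sup>2 / 2 < yardstick n (U * V)"
    and "\<And>\<delta> n E D S U V. 0 < \<delta> \<Longrightarrow> regular_graph {..<n} E \<Longrightarrow> 2 \<le> \<delta> * real n \<Longrightarrow>
      1 - \<epsilon> \<le> small_set_expansion {..<n} E \<delta> \<Longrightarrow> 1 \<le> D \<Longrightarrow>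
      (\<And>f u. u < n \<Longrightarrow> approx_projection n E f u = (\<Sum>v<n. real_of_int (S u v) * f v) / real_of_int D) \<Longrightarrow>
      lp_approx p r (2 * n) (lp_matrix n (K \<delta>) D S) U V \<Longrightarrow>
      yardstick n (U * V) < (real n)\<^sup>2 / 2"
proof -
  define q where "q = p / (p - 1)"
  have pq: "1 / p + 1 / q = 1" using p by (simp add: q_def field_simps)
  obtain M :: nat and \<eta> \<epsilon> :: real where M: "1 \<le> M" and \<eta>: "0 < \<eta>" "\<eta> \<le> 1" and \<epsilon>: "0 < \<epsilon>" "\<epsilon> \<le> 1/8"
    and M\<epsilon>: "8 * M * \<epsilon> < 1" and small: "(\<eta> + \<eta> powr (1 - q) * (8 * M * \<epsilon>)) * (1 + 16 powr q) \<le> 1/4"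
    and yes: "\<And>\<delta> x. 0 < \<delta> \<Longrightarrow> 0 \<le> x \<Longrightarrow> x \<le> \<delta> \<Longrightarrow>
      8 powr p * (r * ((2 * sse_scale p r M \<delta>) powr p * x powr (2 - p))) \<le> 1"
    using exists_gap_constants[OF p pq r] by blast
  show ?thesis
  proof (rule that[of \<epsilon> "sse_scale p r M"])
    fix \<delta> :: real and n E D S U V
    assume \<delta>: "0 < \<delta>" and reg: "regular_graph {..<n} E" and \<delta>n: "1 \<le> \<delta> * real n"
      and sse: "small_set_expansion {..<n} E \<delta> \<le> \<epsilon>" and D: "1 \<le> D"
      and B: "\<And>f u. u < n \<Longrightarrow> approx_projection n E f u = (\<Sum>v<n. real_of_int (S u v) * f v) / real_of_int D"
      and app: "lp_approx p r (2 * n) (lp_matrix n (sse_scale p r M \<delta>) D S) U V"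
    define k where "k = card (E `` {0})"
    interpret regular_walk n k E using regular_graph_walk(1)[OF reg] by (simp add: k_def)
    have n2: "2 \<le> n" using regular_graph_walk(2)[OF reg] .
    interpret lp: lp_instance n "sse_scale p r M \<delta>" D S p q "approx_projection n E"
      using n2 D p pq B by unfold_locales auto
    obtain T where T: "T \<subseteq> {..<n}" "T \<noteq> {}" "card T \<le> \<delta> * n" "expansion E T \<le> \<epsilon>"
      using sse_yesD[OF reg \<delta>n sse] .
    have fT: "finite T" using T(1) finite_subset by blast
    have cT: "0 < card T" using T fT by (simp add: card_gt_0_iff)
    have cE: "card T - card (E \<inter> T \<times> T) / k \<le> \<epsilon> * card T"
    proof -
      have "1 - \<epsilon> \<le> card (E \<inter> T \<times> T) / (k * card T)" using expansion_eq[OF T(1,2)] T(4) by linarith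
      then have "(1 - \<epsilon>) * card T \<le> card (E \<inter> T \<times> T) / (k * card T) * card T"
        by (intro mult_right_mono) auto
      also have "\<dots> = card (E \<inter> T \<times> T) / k" using cT by simp
      finally show ?thesis by (simp add: algebra_simps)
    qed
    define u where "u v = (if v \<in> T then 1 else 0 :: real)" for v
    define c where "c = length (nat_bits n)"
    have c2: "2 \<le> c"
    proof (rule ccontr)
      assume "\<not> ?thesis"
      then have "c = 0 \<or> c = 1" by auto
      then show False using nat_bits_less[of n] n2 by (auto simp: c_def)
    qed
    have ipu: "ip n u u = card T" and "dirichlet u u = card T - card (E \<inter> T \<times> T) / k"
      unfolding u_def using dirichlet_indicator[OF T(1)] by auto
    then have diri: "dirichlet u u \<le> \<epsilon> * ip n u u" using cE by simp
    have "ip n u u / 2 \<le> ip n u (\<lambda>v. u v - (Q (2 * c) ^^ (2 * 4 ^ (2 * c))) u v)"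
      by (rule low_frequency_part[OF diri \<epsilon>(2) c2])
    also have "(\<lambda>v. u v - (Q (2 * c) ^^ (2 * 4 ^ (2 * c))) u v) = approx_projection n E u"
      by (simp add: approx_projection_def c_def k_def Let_def)
    also have "ip n u (approx_projection n E u) = (\<Sum>v\<in>T. approx_projection n E u v)"
    proof -
      have "ip n u (approx_projection n E u) = (\<Sum>v<n. if v \<in> T then approx_projection n E u v else 0)"
        unfolding ip_def by (intro sum.cong) (auto simp: u_def)
      then show ?thesis using T(1) by (simp add: sum.If_cases Int_absorb1)
    qed
    finally have large: "card T / 2 \<le> (\<Sum>v\<in>T. approx_projection n E (\<lambda>v. if v \<in> T then 1 else 0) v)"
      unfolding ipu by (simp add: u_def[abs_def])
    have "card T / n \<le> \<delta>" using T(3) n2 by (simp add: divide_simps)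
    then have "(real n)\<^sup>2 / 2 < yardstick n (U * V)"
      using lp.yes_instance[OF T(1,2) large _ app r] yes[OF \<delta>] by simp
    moreover have "2 \<le> \<delta> * real n"
    proof -
      \<comment> \<open>A single vertex has no loop, hence expansion 1, which exceeds
        \<open>\<epsilon>\<close>.\<close>
      have "card T \<noteq> 1"
      proof
        assume "card T = 1"
        then obtain t where t: "T = {t}" by (rule card_1_singletonE)
        then have "E \<inter> T \<times> T = {}" using reg by (auto simp: regular_graph_def irrefl_def)
        then show False using cE \<epsilon> \<open>card T = 1\<close> by simp
      qed
      then have "2 \<le> real (card T)" using cT by linarith
      then show ?thesis using T(3) by linarith
    qed
    ultimately show "2 \<le> \<delta> * real n \<and> (real n)\<^sup>2 / 2 < yardstick n (U * V)" by simp
  next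
    fix \<delta> :: real and n E D S U V
    assume \<delta>: "0 < \<delta>" and reg: "regular_graph {..<n} E" and \<delta>n: "2 \<le> \<delta> * real n"
      and sse: "1 - \<epsilon> \<le> small_set_expansion {..<n} E \<delta>" and D: "1 \<le> D"
      and B: "\<And>f u. u < n \<Longrightarrow> approx_projection n E f u = (\<Sum>v<n. real_of_int (S u v) * f v) / real_of_int D"
      and app: "lp_approx p r (2 * n) (lp_matrix n (sse_scale p r M \<delta>) D S) U V"
    define k where "k = card (E `` {0})"
    interpret rw: regular_walk n k E using regular_graph_walk(1)[OF reg] by (simp add: k_def)
    have n2: "2 \<le> n" using regular_graph_walk(2)[OF reg] .
    interpret lp: lp_instance n "sse_scale p r M \<delta>" D S p q "approx_projection n E"
      using n2 D p pq B by unfold_locales auto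
    define s where "s = nat \<lfloor>\<delta> * n\<rfloor>"
    have s2: "2 \<le> s" using \<delta>n by (simp add: s_def le_nat_iff le_floor_iff)
    have s\<delta>: "real s \<le> \<delta> * n" "\<delta> * n \<le> 2 * s"
    proof -
      show "real s \<le> \<delta> * n" using \<delta>n by (simp add: s_def)
      have "\<delta> * n < s + 1" using \<delta>n unfolding s_def by linarith
      then show "\<delta> * n \<le> 2 * s" using s2 by linarith
    qed
    have "real (card (E \<inter> T \<times> T)) \<le> \<epsilon> * k * card T" if T: "T \<subseteq> {..<n}" "card T \<le> s" for T
    proof (cases "T = {}")
      case False
      have fT: "finite T" using T(1) finite_subset by blast
      have cT: "0 < card T" using False fT by (simp add: card_gt_0_iff)
      have "real (card T) \<le> \<delta> * n" using T(2) s\<delta> by linarith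
      then have "1 - \<epsilon> \<le> expansion E T" using sse_noD[OF reg sse T(1) False] by simp
      then have "card (E \<inter> T \<times> T) / (k * card T) \<le> \<epsilon>" using rw.expansion_eq[OF T(1) False] by linarith
      then show ?thesis using cT rw.k_pos by (simp add: pos_divide_le_eq mult_ac)
    qed simp
    then interpret ex: small_set_expander n k E "M * s" "8 * M * \<epsilon>"
      using rw.small_set_expander_blocks[OF _ s2 M, of \<epsilon>] \<epsilon> by simp
    \<comment> \<open>The full vertex set contains all edges and so cannot satisfy the expander
      bound with \<open>8 M \<epsilon> < 1\<close>; it must be larger than the scale
      \<open>M s\<close>.\<close>
    have Ms: "real M * s < n"
    proof (rule ccontr)
      assume "\<not> ?thesis"
      then have "real (card (E \<inter> {..<n} \<times> {..<n})) \<le> (8 * M * \<epsilon>) * k * card {..<n}"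
        using ex.sse[of "{..<n}"] by simp
      moreover have "E \<inter> {..<n} \<times> {..<n} = E" using rw.E_sub by auto
      moreover have "real (card E) = k * n"
        using rw.sum_E_fst[of "\<lambda>_. 1"] by simp
      ultimately have "real k * n \<le> (8 * M * \<epsilon>) * (real k * n)" by simp
      moreover have "(8 * M * \<epsilon>) * (real k * n) < 1 * (real k * n)"
        using M\<epsilon> rw.k_pos n2 by (intro mult_strict_right_mono) auto
      ultimately show False by simp
    qed
    \<comment> \<open>Excludes the degenerate branch of \<open>sse_scale\<close>, and makes
      \<open>2 / (M \<delta>)\<close> exceed 1.\<close>
    have M\<delta>: "M * \<delta> < 2"
    proof -
      have "M * (\<delta> * n) \<le> real M * (2 * real s)" using s\<delta> by (intro mult_left_mono) auto
      also have "\<dots> < 2 * n" using Ms by simp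
      finally have "M * \<delta> * n < 2 * n" by simp
      then show ?thesis using n2 by simp
    qed
    define Kc where "Kc = 2592 * (2 / (M * \<delta>)) powr (2 / p - 1)"
    have M\<delta>0: "0 < M * \<delta>" using M \<delta> by simp
    have e: "0 < 2 / p - 1" "1 - 2 / q = 2 / p - 1"
    proof -
      show "0 < 2 / p - 1" using p by simp
      have "2 / q = 2 * (1 / q)" "2 / p = 2 * (1 / p)" by simp_all
      then show "1 - 2 / q = 2 / p - 1" using pq by linarith
    qed
    have Kc1: "1 \<le> Kc"
    proof -
      have "1 \<le> (2 / (M * \<delta>)) powr (2 / p - 1)" using M\<delta> M\<delta>0 e by (intro ge_one_powr_ge_zero) auto
      then show ?thesis by (simp add: Kc_def)
    qed
    define c where "c = length (nat_bits n)"
    have nc: "n \<le> 2 ^ (2 * c)" "0 < c"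
    proof -
      have "n < 2 ^ c" using nat_bits_less[of n] by (simp add: c_def)
      also have "\<dots> \<le> 2 ^ (2 * c)" by (intro power_increasing) auto
      finally show "n \<le> 2 ^ (2 * c)" by simp
      show "0 < c" using \<open>n < 2 ^ c\<close> n2 by (cases c) auto
    qed
    have hyper: "pnorm n q (approx_projection n E f) \<le> Kc * (1 / n) powr (2 / p - 1) * pnorm n p f" for f
    proof -
      have "pnorm n q (\<lambda>u. f u - (rw.Q (2 * c) ^^ (2 * 4 ^ (2 * c))) f u)
          \<le> 2592 * (1 / (real M * s)) powr (1 - 2 / q) * pnorm n p f"
        using ex.hypercontractive[OF p pq _ nc \<eta> small, of f] Ms by simp
      also have "\<dots> \<le> 2592 * ((2 / (M * \<delta>)) powr (2 / p - 1) * (1 / n) powr (2 / p - 1)) * pnorm n p f"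
      proof (intro mult_right_mono mult_left_mono pnorm_nonneg)
        have "M * \<delta> * n \<le> 2 * (real M * s)" using mult_left_mono[OF s\<delta>(2), of "real M"] by simp
        then have "2 / (2 * (real M * s)) \<le> 2 / (M * \<delta> * n)" using M\<delta>0 n2 s2 M by (intro divide_left_mono) auto
        then have "1 / (real M * s) \<le> 2 / (M * \<delta>) * (1 / n)" by simp
        then have "(1 / (real M * s)) powr (1 - 2 / q) \<le> (2 / (M * \<delta>) * (1 / n)) powr (1 - 2 / q)"
          using e by (intro powr_mono2) auto
        also have "\<dots> = (2 / (M * \<delta>)) powr (2 / p - 1) * (1 / n) powr (2 / p - 1)"
          unfolding e(2) by (simp only: powr_mult)
        finally show "(1 / (real M * s)) powr (1 - 2 / q)
            \<le> (2 / (M * \<delta>)) powr (2 / p - 1) * (1 / n) powr (2 / p - 1)" .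
      qed simp
      finally show ?thesis by (simp add: approx_projection_def c_def k_def Let_def Kc_def)
    qed
    have "64 * Kc * r powr (2 / p) \<le> sse_scale p r M \<delta>"
      using M\<delta> real_nat_ceiling_ge[of "64 * Kc * r powr (2 / p)"] by (simp add: sse_scale_def Kc_def)
    then show "yardstick n (U * V) < (real n)\<^sup>2 / 2"
      using lp.no_instance[OF hyper Kc1 _ r app] by simp
  qed (use \<epsilon> in simp)
qed

section \<open>Composition of Turing machines\<close>

subsection \<open>Well-formed configurations\<close>

definition wf_tapes :: "nat \<Rightarrow> tape list \<Rightarrow> bool" where
  "wf_tapes g ts \<longleftrightarrow> (\<forall>(f, h) \<in> set ts. \<forall>i. f i < g)"

abbreviation scan :: "tape list \<Rightarrow> nat list" where
  "scan ts \<equiv> map (\<lambda>(f, h). f h) ts"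

lemma wf_tapes_append [simp]: "wf_tapes g (xs @ ys) \<longleftrightarrow> wf_tapes g xs \<and> wf_tapes g ys"
  by (auto simp: wf_tapes_def)

lemma wf_tapes_Nil [simp]: "wf_tapes g []"
  by (simp add: wf_tapes_def)

lemma wf_tapes_Cons [simp]: "wf_tapes g ((f, h) # ts) \<longleftrightarrow> (\<forall>i. f i < g) \<and> wf_tapes g ts"
  by (auto simp: wf_tapes_def)

lemma wf_tapes_scan: "wf_tapes g ts \<Longrightarrow> set (scan ts) \<subseteq> {..<g}"
  by (auto simp: wf_tapes_def)

lemma wf_tapes_act:
  assumes "wf_tapes g ts" "set as \<subseteq> {..<g} \<times> X"
  shows "wf_tapes g (map2 tape_act as ts)"
  unfolding wf_tapes_def
proof (clarify, goal_cases)
  case (1 f h i)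
  then obtain w m f0 h0 where "(w, m) \<in> set as" "(f0, h0) \<in> set ts" "(f, h) = tape_act (w, m) (f0, h0)"
    by (auto dest!: set_zip_leftD set_zip_rightD elim!: in_set_zipE)
  then show ?case using assms by (auto simp: wf_tapes_def)
qed

lemma tm_transD:
  assumes "turing_machine M" "q < tm_states M" "length ss = tm_tapes M" "set ss \<subseteq> {..<tm_syms M}"
    and "tm_trans M q ss = (q', as)"
  shows "q' \<le> tm_states M" "length as = tm_tapes M" "set as \<subseteq> {..<tm_syms M} \<times> {-1, 0, 1}"
proof -
  have "fst (tm_trans M q ss) \<le> tm_states M \<and> length (snd (tm_trans M q ss)) = tm_tapes M \<and>
      set (snd (tm_trans M q ss)) \<subseteq> {..<tm_syms M} \<times> {-1, 0, 1}"
    using assms(1-4) unfolding turing_machine_def by blast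
  then show "q' \<le> tm_states M" "length as = tm_tapes M" "set as \<subseteq> {..<tm_syms M} \<times> {-1, 0, 1}"
    using assms(5) by auto
qed

definition wf_config :: "tm \<Rightarrow> config \<Rightarrow> bool" where
  "wf_config M c \<longleftrightarrow> fst c \<le> tm_states M \<and> length (snd c) = tm_tapes M \<and> wf_tapes (tm_syms M) (snd c)"

lemma tm_step_running:
  assumes "q \<noteq> tm_states M" "tm_trans M q (scan ts) = (q', as)"
  shows "tm_step M (q, ts) = (q', map2 tape_act as ts)"
  using assms by simp

lemma tm_step_halted: "q = tm_states M \<Longrightarrow> tm_step M (q, ts) = (q, ts)"
  by simp

declare tm_step.simps [simp del]

text \<open>\<open>turing_machine\<close> restricts the transition function only on legal states and
  symbols, so every simulation below carries this invariant along.\<close>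

lemma wf_config_step:
  assumes "turing_machine M" "wf_config M c"
  shows "wf_config M (tm_step M c)"
proof -
  obtain q ts where c: "c = (q, ts)" by (cases c)
  show ?thesis
  proof (cases "q = tm_states M")
    case True
    then show ?thesis using assms by (simp add: c tm_step_halted)
  next
    case False
    obtain q' as where tr: "tm_trans M q (scan ts) = (q', as)" by fastforce
    have w: "q < tm_states M" "length ts = tm_tapes M" "wf_tapes (tm_syms M) ts"
      using assms(2) False by (auto simp: wf_config_def c)
    then have "q' \<le> tm_states M" "length as = tm_tapes M" "set as \<subseteq> {..<tm_syms M} \<times> {-1, 0, 1}"
      using tm_transD[OF assms(1) w(1) _ wf_tapes_scan[OF w(3)] tr] by auto
    then show ?thesis
      using w wf_tapes_act unfolding c tm_step_running[OF False tr] wf_config_def by auto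
  qed
qed

lemma wf_config_steps: "turing_machine M \<Longrightarrow> wf_config M c \<Longrightarrow> wf_config M ((tm_step M ^^ s) c)"
  by (induction s) (auto intro: wf_config_step)

lemma wf_config_init:
  assumes "turing_machine M"
  shows "wf_config M (tm_init M x)"
proof -
  have "3 \<le> tm_syms M" "1 \<le> tm_tapes M" using assms by (auto simp: turing_machine_def)
  then show ?thesis
    by (auto simp: wf_config_def tm_init_def wf_tapes_def word_tape_def)
qed

definition reaches :: "tm \<Rightarrow> config \<Rightarrow> nat \<Rightarrow> config \<Rightarrow> bool" where
  "reaches M c t c' \<longleftrightarrow> (\<exists>s\<le>t. (tm_step M ^^ s) c = c')"

lemma reaches_refl: "reaches M c 0 c"
  by (simp add: reaches_def)

lemma reaches_trans: "reaches M c t c' \<Longrightarrow> reaches M c' t' c'' \<Longrightarrow> reaches M c (t + t') c''"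
proof -
  assume "reaches M c t c'" "reaches M c' t' c''"
  then obtain s s' where "s \<le> t" "(tm_step M ^^ s) c = c'" "s' \<le> t'" "(tm_step M ^^ s') c' = c''"
    by (auto simp: reaches_def)
  then have "(tm_step M ^^ (s' + s)) c = c''" "s' + s \<le> t + t'" by (simp_all add: funpow_add)
  then show ?thesis by (auto simp: reaches_def)
qed

lemma reaches_step: "tm_step M c = c' \<Longrightarrow> reaches M c 1 c'"
  unfolding reaches_def by (intro exI[of _ 1]) simp

lemma halted_steps: "fst c = tm_states M \<Longrightarrow> (tm_step M ^^ s) c = c"
  by (induction s) (cases c, auto simp: tm_step_halted)+

text \<open>\<open>tm_step\<close> idles after halting, but a machine built on top of
  \<open>M\<close> goes on to do something else; a simulation is therefore faithful only up to the
  first halt.\<close>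

lemma first_halt:
  assumes "(tm_step M ^^ s) c = c'" "fst c' = tm_states M"
  obtains r where "r \<le> s" "(tm_step M ^^ r) c = c'" "\<And>j. j < r \<Longrightarrow> fst ((tm_step M ^^ j) c) \<noteq> tm_states M"
proof -
  define r where "r = (LEAST r. fst ((tm_step M ^^ r) c) = tm_states M)"
  have "fst ((tm_step M ^^ s) c) = tm_states M" using assms by simp
  then have r: "fst ((tm_step M ^^ r) c) = tm_states M" "r \<le> s"
    unfolding r_def by (rule LeastI, rule Least_le)
  have "(tm_step M ^^ s) c = (tm_step M ^^ (s - r)) ((tm_step M ^^ r) c)"
    using r(2) by (simp add: funpow_add[symmetric, THEN fun_cong, unfolded comp_def])
  also have "\<dots> = (tm_step M ^^ r) c" using r(1) by (rule halted_steps)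
  finally have "(tm_step M ^^ r) c = c'" using assms by simp
  moreover have "fst ((tm_step M ^^ j) c) \<noteq> tm_states M" if "j < r" for j
    using not_less_Least[OF that[unfolded r_def]] .
  ultimately show ?thesis using that r(2) by blast
qed

subsection \<open>Returning the head of the output tape to the origin\<close>

text \<open>The origin of the last tape is marked by adding \<open>g\<close>, the old number of symbols, to the symbol
  there; the parity of the state records on which side of the origin the head is.\<close>

definition home_trans :: "tm \<Rightarrow> nat \<Rightarrow> nat list \<Rightarrow> nat \<times> (nat \<times> int) list" where
  "home_trans M q ss =
    (let n = tm_states M; g = tm_syms M; s = last ss; idle = map (\<lambda>s. (s, 0)) (butlast ss) in
     if q = 0 then (1, idle @ [(s mod g + g, 0)])
     else if q \<le> 2 * n then
       let sg = (q - 1) mod 2; (q', as) = tm_trans M ((q - 1) div 2) (map (\<lambda>s. s mod g) ss); (w, m) = last as in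
         if g \<le> s then (1 + 2 * q' + (if m = 1 then 1 else if m = -1 then 0 else sg), butlast as @ [(w + g, m)])
         else (1 + 2 * q' + sg, butlast as @ [(w, m)])
     else if g \<le> s then (2 * n + 3, idle @ [(s - g, 0)])
     else (q, idle @ [(s, if q = 2 * n + 1 then 1 else -1)]))"

definition home_tm :: "tm \<Rightarrow> tm" where
  "home_tm M = \<lparr>tm_tapes = tm_tapes M, tm_syms = 2 * tm_syms M, tm_states = 2 * tm_states M + 3,
     tm_trans = home_trans M\<rparr>"

lemma home_tm_simps [simp]:
  "tm_states (home_tm M) = 2 * tm_states M + 3" "tm_trans (home_tm M) = home_trans M"
  "tm_tapes (home_tm M) = tm_tapes M"
  by (simp_all add: home_tm_def)

lemma set_map_mod: "0 < g \<Longrightarrow> set (map (\<lambda>s. s mod g) ss) \<subseteq> {..<g :: nat}"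
  by auto

lemma turing_machine_home:
  assumes M: "turing_machine M"
  shows "turing_machine (home_tm M)"
proof -
  let ?n = "tm_states M" and ?g = "tm_syms M" and ?K = "tm_tapes M"
  have g: "3 \<le> ?g" and K: "1 \<le> ?K" using M by (auto simp: turing_machine_def)
  have main: "fst (home_trans M q ss) \<le> 2 * ?n + 3 \<and> length (snd (home_trans M q ss)) = ?K \<and>
      set (snd (home_trans M q ss)) \<subseteq> {..<2 * ?g} \<times> {-1, 0, 1}"
    if q: "q < 2 * ?n + 3" and l: "length ss = ?K" and s: "set ss \<subseteq> {..<2 * ?g}" for q ss
  proof -
    have ne: "ss \<noteq> []" using l K by auto
    have last: "last ss < 2 * ?g" using s ne by (meson last_in_set lessThan_iff subsetD)
    have idle: "set (map (\<lambda>s. (s, 0)) (butlast ss)) \<subseteq> {..<2 * ?g} \<times> {-1, 0, 1::int}"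
      using s by (auto dest: in_set_butlastD)
    consider "q = 0" | "0 < q" "q \<le> 2 * ?n" | "2 * ?n < q" by linarith
    then show ?thesis
    proof cases
      case 1
      have "last ss mod ?g + ?g < 2 * ?g" using g by simp
      then show ?thesis using 1 idle l K by (auto simp: home_trans_def Let_def)
    next
      case 2
      obtain q' as where tr: "tm_trans M ((q - 1) div 2) (map (\<lambda>s. s mod ?g) ss) = (q', as)" by fastforce
      have "(q - 1) div 2 < ?n" using 2 by linarith
      from tm_transD[OF M this _ _ tr] have as: "q' \<le> ?n" "length as = ?K" "set as \<subseteq> {..<?g} \<times> {-1, 0, 1}"
        using l set_map_mod[of "?g" ss] g by (simp_all del: set_map)
      have asne: "as \<noteq> []" using as K by auto
      obtain w m where wm: "last as = (w, m)" by fastforce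
      then have wm': "w < ?g" "m \<in> {-1, 0, 1}" using as(3) asne last_in_set[OF asne] by auto
      have bl: "set (butlast as) \<subseteq> {..<2 * ?g} \<times> {-1, 0, 1}"
        using as(3) by (fastforce dest: in_set_butlastD)
      have sg: "(q - 1) mod 2 \<le> 1" by simp
      show ?thesis using 2 tr wm wm' bl as K sg
        by (auto simp: home_trans_def Let_def)
    next
      case 3
      then show ?thesis using idle l K q last g by (auto simp: home_trans_def Let_def)
    qed
  qed
  then show ?thesis using g K by (simp add: turing_machine_def home_tm_def)
qed

definition marked :: "nat \<Rightarrow> tape \<Rightarrow> tape" where
  "marked g = (\<lambda>(f, h). (f(0 := f 0 + g), h))"

lemma map_mod_scan: "wf_tapes g ts \<Longrightarrow> map (\<lambda>s. s mod g) (scan ts) = scan ts"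
  by (induction ts) (auto simp: wf_tapes_def)

lemma idle_tapes: "map2 tape_act (map (\<lambda>s. (s, 0)) (scan ts)) ts = ts"
    "map2 tape_act (map ((\<lambda>s. (s, 0)) \<circ> (\<lambda>(f, h). f h)) ts) ts = ts"
  by (induction ts) auto

text \<open>State \<open>1 + 2 * q + sg\<close> simulates \<open>q\<close> with the head on side
  \<open>sg\<close>. The side can change only when the head leaves the origin, that is, when the
  mark is scanned, so one bit of memory suffices. At the origin either value is correct.\<close>

lemma home_sim_step:
  assumes M: "turing_machine M" and wf: "wf_config M (q, us @ [(f, h)])" and q: "q < tm_states M"
    and sg: "sg \<le> 1" "sg = 1 \<longrightarrow> 0 \<le> h" "sg = 0 \<longrightarrow> h \<le> 0"
  shows "\<exists>q' us' f' h' sg'. tm_step M (q, us @ [(f, h)]) = (q', us' @ [(f', h')]) \<and>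
    tm_step (home_tm M) (1 + 2 * q + sg, us @ [marked (tm_syms M) (f, h)])
      = (1 + 2 * q' + sg', us' @ [marked (tm_syms M) (f', h')]) \<and>
    sg' \<le> 1 \<and> (sg' = 1 \<longrightarrow> 0 \<le> h') \<and> (sg' = 0 \<longrightarrow> h' \<le> 0) \<and> \<bar>h'\<bar> \<le> \<bar>h\<bar> + 1"
proof -
  let ?g = "tm_syms M"
  have K: "length us + 1 = tm_tapes M" using wf by (simp add: wf_config_def)
  have wft: "wf_tapes ?g us" "\<And>i. f i < ?g" using wf by (auto simp: wf_config_def)
  obtain q' as where tr: "tm_trans M q (scan (us @ [(f, h)])) = (q', as)" by fastforce
  have as: "q' \<le> tm_states M" "length as = tm_tapes M" "set as \<subseteq> {..<?g} \<times> {-1, 0, 1}"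
    using tm_transD[OF M q _ wf_tapes_scan tr] K wft by auto
  have asne: "as \<noteq> []" using as K by auto
  obtain w m where wm: "last as = (w, m)" by fastforce
  define bs where "bs = butlast as"
  have as_eq: "as = bs @ [(w, m)]" using asne wm by (metis append_butlast_last_id bs_def)
  have lbs: "length bs = length us" using as K by (simp add: bs_def)
  have m: "m \<in> {-1, 0, 1}" using as(3) by (simp add: as_eq)
  have step1: "tm_step M (q, us @ [(f, h)]) = (q', map2 tape_act bs us @ [(f(h := w), h + m)])"
    using q lbs by (subst tm_step_running[OF _ tr]) (auto simp: as_eq)
  define mk where "mk = (h = 0)"
  define sg' where "sg' = (if mk then if m = 1 then 1 else if m = -1 then 0 else sg else sg)"
  have sc: "(f(0 := f 0 + ?g)) h = f h + (if mk then ?g else 0)" by (simp add: mk_def)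
  have scm: "map (\<lambda>s. s mod ?g) (scan (us @ [marked ?g (f, h)])) = scan (us @ [(f, h)])"
    using map_mod_scan[OF wft(1)] wft(2) by (simp add: marked_def)
  have ge: "?g \<le> last (scan (us @ [marked ?g (f, h)])) \<longleftrightarrow> mk"
    using wft(2)[of h] by (simp add: marked_def mk_def not_le)
  have tr': "home_trans M (1 + 2 * q + sg) (scan (us @ [marked ?g (f, h)]))
      = (1 + 2 * q' + sg', bs @ [(w + (if mk then ?g else 0), m)])"
  proof -
    obtain p where p: "p = 1 + 2 * q + sg" "p \<noteq> 0" "p \<le> 2 * tm_states M" "(p - 1) div 2 = q" "(p - 1) mod 2 = sg"
      using q sg(1) by auto
    have "home_trans M p (scan (us @ [marked ?g (f, h)]))
        = (1 + 2 * q' + sg', bs @ [(w + (if mk then ?g else 0), m)])"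
      unfolding home_trans_def Let_def scm p(4,5) tr ge using p(2,3) by (simp add: wm bs_def sg'_def)
    then show ?thesis by (simp only: p(1))
  qed
  have step2: "tm_step (home_tm M) (1 + 2 * q + sg, us @ [marked ?g (f, h)])
      = (1 + 2 * q' + sg', map2 tape_act (bs @ [(w + (if mk then ?g else 0), m)]) (us @ [marked ?g (f, h)]))"
  proof (rule tm_step_running)
    show "1 + 2 * q + sg \<noteq> tm_states (home_tm M)" using q sg(1) by simp
    show "tm_trans (home_tm M) (1 + 2 * q + sg) (scan (us @ [marked ?g (f, h)]))
        = (1 + 2 * q' + sg', bs @ [(w + (if mk then ?g else 0), m)])"
      using tr' by simp
  qed
  have "map2 tape_act (bs @ [(w + (if mk then ?g else 0), m)]) (us @ [marked ?g (f, h)])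
      = map2 tape_act bs us @ [marked ?g (f(h := w), h + m)]"
    using lbs by (auto simp: marked_def mk_def fun_eq_iff)
  moreover have "sg' \<le> 1" "sg' = 1 \<longrightarrow> 0 \<le> h + m" "sg' = 0 \<longrightarrow> h + m \<le> 0" "\<bar>h + m\<bar> \<le> \<bar>h\<bar> + 1"
    using sg m by (auto simp: sg'_def mk_def)
  ultimately show ?thesis using step1 step2 by auto
qed

text \<open>After the simulated halt, the two states left over by the parity walk right and left,
  respectively, until they meet the mark, which is then removed.\<close>

lemma home_return:
  assumes wf: "\<And>i. f i < tm_syms M" and sg: "sg \<le> 1" "sg = 1 \<longrightarrow> 0 \<le> h" "sg = 0 \<longrightarrow> h \<le> 0"
  shows "reaches (home_tm M) (1 + 2 * tm_states M + sg, us @ [marked (tm_syms M) (f, h)])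
    (nat \<bar>h\<bar> + 1) (tm_states (home_tm M), us @ [(f, 0)])"
  using sg
proof (induction "nat \<bar>h\<bar>" arbitrary: h)
  let ?g = "tm_syms M"
  case 0
  then have h: "h = 0" by simp
  let ?ts = "us @ [marked ?g (f, 0)]"
  have "home_trans M (1 + 2 * tm_states M + sg) (scan ?ts)
      = (2 * tm_states M + 3, map (\<lambda>s. (s, 0)) (scan us) @ [(f 0, 0)])"
    by (simp add: home_trans_def Let_def marked_def)
  then have "tm_step (home_tm M) (1 + 2 * tm_states M + sg, ?ts)
      = (2 * tm_states M + 3, map2 tape_act (map (\<lambda>s. (s, 0)) (scan us) @ [(f 0, 0)]) ?ts)"
    using 0 by (intro tm_step_running) auto
  also have "map2 tape_act (map (\<lambda>s. (s, 0)) (scan us) @ [(f 0, 0)]) ?ts = us @ [(f, 0)]"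
    by (simp add: idle_tapes marked_def)
  finally have "reaches (home_tm M) (1 + 2 * tm_states M + sg, ?ts) 1 (2 * tm_states M + 3, us @ [(f, 0)])"
    by (rule reaches_step)
  then show ?case using h by simp
next
  let ?g = "tm_syms M"
  case (Suc x)
  then have h: "h \<noteq> 0" by auto
  let ?ts = "us @ [marked ?g (f, h)]" and ?m = "if sg = 0 then 1 else - 1 :: int"
  have "home_trans M (1 + 2 * tm_states M + sg) (scan ?ts)
      = (1 + 2 * tm_states M + sg, map (\<lambda>s. (s, 0)) (scan us) @ [(f h, ?m)])"
    using h wf[of h] by (auto simp: home_trans_def Let_def marked_def not_le)
  then have "tm_step (home_tm M) (1 + 2 * tm_states M + sg, ?ts)
      = (1 + 2 * tm_states M + sg, map2 tape_act (map (\<lambda>s. (s, 0)) (scan us) @ [(f h, ?m)]) ?ts)"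
    using Suc by (intro tm_step_running) auto
  also have "map2 tape_act (map (\<lambda>s. (s, 0)) (scan us) @ [(f h, ?m)]) ?ts = us @ [marked ?g (f, h + ?m)]"
    using h by (auto simp: idle_tapes marked_def fun_eq_iff)
  finally have 1: "reaches (home_tm M) (1 + 2 * tm_states M + sg, ?ts) 1
      (1 + 2 * tm_states M + sg, us @ [marked ?g (f, h + ?m)])" by (rule reaches_step)
  have "x = nat \<bar>h + ?m\<bar>" using Suc h by (cases "sg = 0") auto
  moreover have "sg = 1 \<longrightarrow> 0 \<le> h + ?m" "sg = 0 \<longrightarrow> h + ?m \<le> 0" using Suc h by auto
  ultimately have "reaches (home_tm M) (1 + 2 * tm_states M + sg, us @ [marked ?g (f, h + ?m)])
      (nat \<bar>h + ?m\<bar> + 1) (tm_states (home_tm M), us @ [(f, 0)])"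
    using Suc.hyps(1)[of "h + ?m"] Suc.prems(1) by simp
  from reaches_trans[OF 1 this] show ?case using \<open>x = nat \<bar>h + ?m\<bar>\<close> Suc.hyps(2) by simp
qed

text \<open>\<open>tm_outputs\<close> prescribes the content of the last tape but not its head,
  whereas a second machine has to start at the origin. The head has moved at most once per step, so
  returning at most doubles the time; marking and unmarking cost two more steps.\<close>

lemma home_outputs:
  assumes M: "turing_machine M" and out: "tm_outputs M x y t"
  shows "\<exists>r ts. real r \<le> 2 * t + 2 \<and> reaches (home_tm M) (tm_init (home_tm M) x) r (tm_states (home_tm M), ts) \<and>
    length ts = tm_tapes M \<and> last ts = (word_tape y, 0)"
proof -
  let ?g = "tm_syms M" and ?n = "tm_states M"
  obtain s0 ts0 where s0: "real s0 \<le> t" "(tm_step M ^^ s0) (tm_init M x) = (?n, ts0)" "fst (last ts0) = word_tape y"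
    using out by (auto simp: tm_outputs_def)
  then obtain s where s: "s \<le> s0" "(tm_step M ^^ s) (tm_init M x) = (?n, ts0)"
    and before: "\<And>j. j < s \<Longrightarrow> fst ((tm_step M ^^ j) (tm_init M x)) \<noteq> ?n"
    using first_halt[OF s0(2)] by auto
  have g: "3 \<le> ?g" and K: "1 \<le> tm_tapes M" using M by (auto simp: turing_machine_def)
  have sim: "\<exists>q us f h sg. (tm_step M ^^ j) (tm_init M x) = (q, us @ [(f, h)]) \<and> \<bar>h\<bar> \<le> int j \<and>
      reaches (home_tm M) (tm_init (home_tm M) x) (j + 1) (1 + 2 * q + sg, us @ [marked ?g (f, h)]) \<and>
      sg \<le> 1 \<and> (sg = 1 \<longrightarrow> 0 \<le> h) \<and> (sg = 0 \<longrightarrow> h \<le> 0)" if "j \<le> s" for j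
    using that
  proof (induction j)
    case 0
    obtain q ts where i: "tm_init M x = (q, ts)" by fastforce
    have q: "q = 0" and ts: "ts \<noteq> []" using i by (auto simp: tm_init_def)
    define us where "us = butlast ts"
    obtain f h where fh: "last ts = (f, h)" by fastforce
    have ts_eq: "ts = us @ [(f, h)]" using ts fh by (metis append_butlast_last_id us_def)
    have "\<forall>(f, h) \<in> set ts. h = 0" using i by (auto simp: tm_init_def)
    then have h0: "h = 0" using fh last_in_set[OF ts] by fastforce
    have i': "tm_init (home_tm M) x = (0, ts)" using i by (auto simp: tm_init_def)
    have wf: "wf_config M (q, ts)" using wf_config_init[OF M, of x] i by simp
    have f0: "f 0 < ?g" using wf by (simp add: wf_config_def ts_eq)
    have "home_trans M 0 (scan ts) = (1, map (\<lambda>s. (s, 0)) (scan us) @ [(f 0 + ?g, 0)])"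
      using f0 by (simp add: home_trans_def Let_def ts_eq h0)
    then have "tm_step (home_tm M) (0, ts) = (1, map2 tape_act (map (\<lambda>s. (s, 0)) (scan us) @ [(f 0 + ?g, 0)]) ts)"
      by (intro tm_step_running) auto
    also have "map2 tape_act (map (\<lambda>s. (s, 0)) (scan us) @ [(f 0 + ?g, 0)]) ts = us @ [marked ?g (f, h)]"
      by (simp add: idle_tapes marked_def ts_eq h0)
    finally have "reaches (home_tm M) (0, ts) 1 (1, us @ [marked ?g (f, h)])" by (rule reaches_step)
    then have "reaches (home_tm M) (tm_init (home_tm M) x) 1 (1 + 2 * q + 0, us @ [marked ?g (f, h)])"
      unfolding i' q by simp
    then show ?case using i ts_eq h0 by (intro exI[of _ q] exI[of _ us] exI[of _ f] exI[of _ h] exI[of _ 0]) simp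
  next
    case (Suc j)
    then obtain q us f h sg where IH: "(tm_step M ^^ j) (tm_init M x) = (q, us @ [(f, h)])" "\<bar>h\<bar> \<le> int j"
      "reaches (home_tm M) (tm_init (home_tm M) x) (j + 1) (1 + 2 * q + sg, us @ [marked ?g (f, h)])"
      "sg \<le> 1" "sg = 1 \<longrightarrow> 0 \<le> h" "sg = 0 \<longrightarrow> h \<le> 0" by auto
    have wf: "wf_config M (q, us @ [(f, h)])"
      using wf_config_steps[OF M wf_config_init[OF M], of j x] IH(1) by simp
    have "q \<noteq> ?n" using before[of j] IH(1) Suc.prems by simp
    then have q: "q < ?n" using wf by (simp add: wf_config_def)
    from home_sim_step[OF M wf q IH(4-6)] obtain q' us' f' h' sg' where
      st: "tm_step M (q, us @ [(f, h)]) = (q', us' @ [(f', h')])"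
      "tm_step (home_tm M) (1 + 2 * q + sg, us @ [marked ?g (f, h)]) = (1 + 2 * q' + sg', us' @ [marked ?g (f', h')])"
      "sg' \<le> 1" "sg' = 1 \<longrightarrow> 0 \<le> h'" "sg' = 0 \<longrightarrow> h' \<le> 0" "\<bar>h'\<bar> \<le> \<bar>h\<bar> + 1" by blast
    have "reaches (home_tm M) (tm_init (home_tm M) x) (j + 1 + 1) (1 + 2 * q' + sg', us' @ [marked ?g (f', h')])"
      using reaches_trans[OF IH(3) reaches_step[OF st(2)]] .
    moreover have "(tm_step M ^^ Suc j) (tm_init M x) = (q', us' @ [(f', h')])" using IH(1) st(1) by simp
    moreover have "\<bar>h'\<bar> \<le> int (Suc j)" using st(6) IH(2) by simp
    ultimately show ?case using st(3-5) by (intro exI conjI) auto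
  qed
  obtain us f h sg where fin: "ts0 = us @ [(f, h)]" "\<bar>h\<bar> \<le> int s"
    "reaches (home_tm M) (tm_init (home_tm M) x) (s + 1) (1 + 2 * ?n + sg, us @ [marked ?g (f, h)])"
    "sg \<le> 1" "sg = 1 \<longrightarrow> 0 \<le> h" "sg = 0 \<longrightarrow> h \<le> 0"
    using sim[of s] s(2) by auto
  have wf: "wf_config M (?n, us @ [(f, h)])"
    using wf_config_steps[OF M wf_config_init[OF M], of s x] s(2) fin(1) by simp
  have "reaches (home_tm M) (tm_init (home_tm M) x) (s + 1 + (nat \<bar>h\<bar> + 1)) (tm_states (home_tm M), us @ [(f, 0)])"
    using wf fin by (intro reaches_trans[OF fin(3) home_return]) (auto simp: wf_config_def)
  moreover have "real (s + 1 + (nat \<bar>h\<bar> + 1)) \<le> 2 * t + 2"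
  proof -
    have "nat \<bar>h\<bar> \<le> s" using fin(2) by linarith
    then have "real (s + 1 + (nat \<bar>h\<bar> + 1)) \<le> 2 * real s + 2" by linarith
    moreover have "real s \<le> t" using s(1) s0(1) by linarith
    ultimately show ?thesis by linarith
  qed
  moreover have "length (us @ [(f, 0::int)]) = tm_tapes M" using wf by (simp add: wf_config_def)
  moreover have "last (us @ [(f, 0::int)]) = (word_tape y, 0)" using s0(3) fin(1) by simp
  ultimately show ?thesis by blast
qed

subsection \<open>Composition\<close>

text \<open>The last tape of the first machine is the first tape of the second.\<close>

definition seq_trans :: "tm \<Rightarrow> tm \<Rightarrow> nat \<Rightarrow> nat list \<Rightarrow> nat \<times> (nat \<times> int) list" where
  "seq_trans M1 M2 q ss =
    (if q < tm_states M1 then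
       let (q', as) = tm_trans M1 q (map (\<lambda>s. s mod tm_syms M1) (take (tm_tapes M1) ss)) in
         (q', as @ map (\<lambda>s. (s, 0)) (drop (tm_tapes M1) ss))
     else
       let (q', as) = tm_trans M2 (q - tm_states M1) (map (\<lambda>s. s mod tm_syms M2) (drop (tm_tapes M1 - 1) ss)) in
         (tm_states M1 + q', map (\<lambda>s. (s, 0)) (take (tm_tapes M1 - 1) ss) @ as))"

definition seq_tm :: "tm \<Rightarrow> tm \<Rightarrow> tm" where
  "seq_tm M1 M2 = \<lparr>tm_tapes = tm_tapes M1 - 1 + tm_tapes M2, tm_syms = max (tm_syms M1) (tm_syms M2),
     tm_states = tm_states M1 + tm_states M2, tm_trans = seq_trans M1 M2\<rparr>"

lemma turing_machine_seq:
  assumes M1: "turing_machine M1" and M2: "turing_machine M2"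
  shows "turing_machine (seq_tm M1 M2)"
proof -
  let ?g = "max (tm_syms M1) (tm_syms M2)"
  have g: "3 \<le> tm_syms M1" "3 \<le> tm_syms M2" and K: "1 \<le> tm_tapes M1" "1 \<le> tm_tapes M2"
    using M1 M2 by (auto simp: turing_machine_def)
  have main: "fst (seq_trans M1 M2 q ss) \<le> tm_states M1 + tm_states M2 \<and>
      length (snd (seq_trans M1 M2 q ss)) = tm_tapes M1 - 1 + tm_tapes M2 \<and>
      set (snd (seq_trans M1 M2 q ss)) \<subseteq> {..<?g} \<times> {-1, 0, 1}"
    if q: "q < tm_states M1 + tm_states M2" and l: "length ss = tm_tapes M1 - 1 + tm_tapes M2"
      and s: "set ss \<subseteq> {..<?g}" for q ss
  proof (cases "q < tm_states M1")
    case True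
    obtain q' as where tr: "tm_trans M1 q (map (\<lambda>s. s mod tm_syms M1) (take (tm_tapes M1) ss)) = (q', as)" by fastforce
    from tm_transD[OF M1 True _ _ tr] have as: "q' \<le> tm_states M1" "length as = tm_tapes M1"
      "set as \<subseteq> {..<tm_syms M1} \<times> {-1, 0, 1}"
      using l g K set_map_mod[of "tm_syms M1"] by (simp_all del: set_map)
    moreover have "set (map (\<lambda>s. (s, 0)) (drop (tm_tapes M1) ss)) \<subseteq> {..<?g} \<times> {-1, 0, 1::int}"
      using s by (auto dest: in_set_dropD)
    moreover have "{..<tm_syms M1} \<times> {-1, 0, 1::int} \<subseteq> {..<?g} \<times> {-1, 0, 1}" by auto
    ultimately show ?thesis using True tr l K by (auto simp: seq_trans_def)
  next
    case False
    obtain q' as where tr: "tm_trans M2 (q - tm_states M1) (map (\<lambda>s. s mod tm_syms M2) (drop (tm_tapes M1 - 1) ss)) = (q', as)"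
      by fastforce
    have "q - tm_states M1 < tm_states M2" using q False by linarith
    from tm_transD[OF M2 this _ _ tr] have as: "q' \<le> tm_states M2" "length as = tm_tapes M2"
      "set as \<subseteq> {..<tm_syms M2} \<times> {-1, 0, 1}"
      using l g K set_map_mod[of "tm_syms M2"] by (simp_all del: set_map)
    moreover have "set (map (\<lambda>s. (s, 0)) (take (tm_tapes M1 - 1) ss)) \<subseteq> {..<?g} \<times> {-1, 0, 1::int}"
      using s by (auto dest: in_set_takeD)
    moreover have "{..<tm_syms M2} \<times> {-1, 0, 1::int} \<subseteq> {..<?g} \<times> {-1, 0, 1}" by auto
    ultimately show ?thesis using False tr l K by (auto simp: seq_trans_def)
  qed
  moreover have "1 \<le> tm_tapes M1 - 1 + tm_tapes M2" "3 \<le> ?g" using g K by auto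
  ultimately show ?thesis unfolding turing_machine_def seq_tm_def by simp
qed

text \<open>The reductions modulo the alphabet size keep the combined transition function legal on
  the joint alphabet; on tapes that are legal for \<open>M1\<close> they change nothing.\<close>

lemma seq_first_step:
  assumes wf: "wf_config M1 (q, ts)" and q: "q < tm_states M1" and M1: "turing_machine M1"
  shows "tm_step (seq_tm M1 M2) (q, ts @ zs) = (case tm_step M1 (q, ts) of (q', ts') \<Rightarrow> (q', ts' @ zs))"
proof -
  obtain q' as where tr: "tm_trans M1 q (scan ts) = (q', as)" by fastforce
  have l: "length ts = tm_tapes M1" and w: "wf_tapes (tm_syms M1) ts" using wf by (auto simp: wf_config_def)
  have as: "length as = tm_tapes M1" using tm_transD(2)[OF M1 q _ wf_tapes_scan[OF w] tr] l by simp
  have "seq_trans M1 M2 q (scan (ts @ zs)) = (q', as @ map (\<lambda>s. (s, 0)) (scan zs))"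
    using q l tr by (simp add: seq_trans_def map_mod_scan[OF w] del: map_map)
  then have "tm_step (seq_tm M1 M2) (q, ts @ zs) = (q', map2 tape_act (as @ map (\<lambda>s. (s, 0)) (scan zs)) (ts @ zs))"
    using q by (intro tm_step_running) (auto simp: seq_tm_def)
  also have "map2 tape_act (as @ map (\<lambda>s. (s, 0)) (scan zs)) (ts @ zs) = map2 tape_act as ts @ zs"
    using as l by (simp add: idle_tapes)
  finally show ?thesis using tm_step_running[OF _ tr] q by simp
qed

lemma seq_second_step:
  assumes wf: "wf_config M2 (q, ts)" and us: "length us = tm_tapes M1 - 1" and M2: "turing_machine M2"
  shows "tm_step (seq_tm M1 M2) (tm_states M1 + q, us @ ts)
    = (case tm_step M2 (q, ts) of (q', ts') \<Rightarrow> (tm_states M1 + q', us @ ts'))"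
proof (cases "q = tm_states M2")
  case True
  then show ?thesis by (simp add: tm_step_halted seq_tm_def)
next
  case False
  obtain q' as where tr: "tm_trans M2 q (scan ts) = (q', as)" by fastforce
  have l: "length ts = tm_tapes M2" and w: "wf_tapes (tm_syms M2) ts" using wf by (auto simp: wf_config_def)
  have "seq_trans M1 M2 (tm_states M1 + q) (scan (us @ ts)) = (tm_states M1 + q', map (\<lambda>s. (s, 0)) (scan us) @ as)"
    using us tr by (simp add: seq_trans_def map_mod_scan[OF w] del: map_map)
  then have "tm_step (seq_tm M1 M2) (tm_states M1 + q, us @ ts)
      = (tm_states M1 + q', map2 tape_act (map (\<lambda>s. (s, 0)) (scan us) @ as) (us @ ts))"
    using False by (intro tm_step_running) (auto simp: seq_tm_def)
  also have "map2 tape_act (map (\<lambda>s. (s, 0)) (scan us) @ as) (us @ ts) = us @ map2 tape_act as ts"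
    by (simp add: idle_tapes)
  finally show ?thesis using tm_step_running[OF False tr] by simp
qed

text \<open>The halting state of \<open>M1\<close> has the same number as the shifted initial state
  of \<open>M2\<close>, and the shared tape is already an initial tape of \<open>M2\<close>; the
  handover takes no step.\<close>

lemma seq_outputs:
  assumes M1: "turing_machine M1" and M2: "turing_machine M2"
    and r: "reaches M1 (tm_init M1 x) r (tm_states M1, ts)" and y: "last ts = (word_tape y, 0)"
    and out: "tm_outputs M2 y z t2" and t: "real r \<le> t1"
  shows "tm_outputs (seq_tm M1 M2) x z (t1 + t2)"
proof -
  let ?M = "seq_tm M1 M2"
  define zs :: "tape list" where "zs = replicate (tm_tapes M2 - 1) (word_tape [], 0)"
  have K: "1 \<le> tm_tapes M1" "1 \<le> tm_tapes M2" using M1 M2 by (auto simp: turing_machine_def)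
  obtain s0 where s0: "s0 \<le> r" "(tm_step M1 ^^ s0) (tm_init M1 x) = (tm_states M1, ts)"
    using r by (auto simp: reaches_def)
  obtain s where s: "s \<le> s0" "(tm_step M1 ^^ s) (tm_init M1 x) = (tm_states M1, ts)"
    and before: "\<And>j. j < s \<Longrightarrow> fst ((tm_step M1 ^^ j) (tm_init M1 x)) \<noteq> tm_states M1"
    using first_halt[OF s0(2)] by auto
  define tag1 where "tag1 = (\<lambda>(q :: nat, ts :: tape list). (q, ts @ zs))"
  have init: "tm_init ?M x = tag1 (tm_init M1 x)"
  proof -
    have "tm_tapes M1 - 1 + tm_tapes M2 - 1 = (tm_tapes M1 - 1) + (tm_tapes M2 - 1)" using K by simp
    then show ?thesis by (simp add: tm_init_def tag1_def zs_def seq_tm_def replicate_add)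
  qed
  have first: "(tm_step ?M ^^ j) (tm_init ?M x) = tag1 ((tm_step M1 ^^ j) (tm_init M1 x))" if "j \<le> s" for j
    using that
  proof (induction j)
    case (Suc j)
    obtain q us where c: "(tm_step M1 ^^ j) (tm_init M1 x) = (q, us)" by fastforce
    have wf: "wf_config M1 (q, us)" using wf_config_steps[OF M1 wf_config_init[OF M1], of j x] c by simp
    have "q < tm_states M1" using before[of j] Suc.prems c wf by (simp add: wf_config_def)
    from seq_first_step[OF wf this M1, of M2 zs] show ?case using Suc c by (simp add: tag1_def)
  qed (simp add: init)
  define us where "us = butlast ts"
  have wf: "wf_config M1 (tm_states M1, ts)"
    using wf_config_steps[OF M1 wf_config_init[OF M1], of s x] s(2) by simp
  then have lts: "length ts = tm_tapes M1" by (simp add: wf_config_def)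
  then have "ts \<noteq> []" using K by auto
  then have "ts = us @ [(word_tape y, 0)]" using y by (metis append_butlast_last_id us_def)
  then have mid: "tag1 (tm_states M1, ts) = (tm_states M1 + fst (tm_init M2 y), us @ snd (tm_init M2 y))"
    by (simp add: tag1_def tm_init_def zs_def)
  have lus: "length us = tm_tapes M1 - 1" using lts by (simp add: us_def)
  define tag2 where "tag2 = (\<lambda>(q, ts). (tm_states M1 + q, us @ ts))"
  have second: "(tm_step ?M ^^ j) (tag2 (tm_init M2 y)) = tag2 ((tm_step M2 ^^ j) (tm_init M2 y))" for j
  proof (induction j)
    case (Suc j)
    obtain q vs where c: "(tm_step M2 ^^ j) (tm_init M2 y) = (q, vs)" by fastforce
    have "wf_config M2 (q, vs)" using wf_config_steps[OF M2 wf_config_init[OF M2], of j y] c by simp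
    from seq_second_step[OF this lus M2] show ?case using Suc c by (simp add: tag2_def case_prod_unfold)
  qed simp
  obtain s2 ts2 where s2: "real s2 \<le> t2" "(tm_step M2 ^^ s2) (tm_init M2 y) = (tm_states M2, ts2)" "fst (last ts2) = word_tape z"
    using out by (auto simp: tm_outputs_def)
  have "(tm_step ?M ^^ (s2 + s)) (tm_init ?M x) = tag2 (tm_states M2, ts2)"
    using first[of s] s(2) mid second[of s2] s2(2) by (simp add: funpow_add tag2_def case_prod_unfold)
  moreover have "ts2 \<noteq> []"
    using wf_config_steps[OF M2 wf_config_init[OF M2], of s2 y] s2(2) K by (auto simp: wf_config_def)
  moreover have "real (s2 + s) \<le> t1 + t2" using s(1) s0(1) t s2(1) by linarith
  ultimately show ?thesis unfolding tm_outputs_def using s2(3)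
    by (intro exI[of _ "s2 + s"] exI[of _ "tm_states M1 + tm_states M2"] exI[of _ "us @ ts2"])
      (simp add: tag2_def seq_tm_def)
qed

theorem tm_compose:
  assumes "turing_machine M1" "turing_machine M2"
  obtains M where "turing_machine M"
    and "\<And>x y z t1 t2. tm_outputs M1 x y t1 \<Longrightarrow> tm_outputs M2 y z t2 \<Longrightarrow> tm_outputs M x z (2 * t1 + 2 + t2)"
proof (rule that[of "seq_tm (home_tm M1) M2"])
  show "turing_machine (seq_tm (home_tm M1) M2)"
    using assms by (intro turing_machine_seq turing_machine_home)
  fix x y z t1 t2 assume o: "tm_outputs M1 x y t1" "tm_outputs M2 y z t2"
  from home_outputs[OF assms(1) o(1)] obtain r ts where "real r \<le> 2 * t1 + 2"
    "reaches (home_tm M1) (tm_init (home_tm M1) x) r (tm_states (home_tm M1), ts)" "last ts = (word_tape y, 0)" by blast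
  then show "tm_outputs (seq_tm (home_tm M1) M2) x z (2 * t1 + 2 + t2)"
    using seq_outputs[OF turing_machine_home[OF assms(1)] assms(2) _ _ o(2)] by blast
qed

lemma tm_outputs_mono: "tm_outputs M x y t \<Longrightarrow> t \<le> t' \<Longrightarrow> tm_outputs M x y t'"
  unfolding tm_outputs_def by (meson order_trans)

section \<open>A programming language on stacks and its compiler\<close>

subsection \<open>Stack programs\<close>

type_synonym store = "nat \<Rightarrow> bool list"

datatype com = SKIP | PUSH nat bool | SEQ com com (infixr ";;" 60)
  | CASE nat com com com
  | LOOP nat com com

text \<open>Costs are steps of the compiled code: a push moves and writes, a branch or a loop round
  pays for a pop and a jump, leaving a loop only for the failed pop. Tests consume the bit they
  inspect, so anything needed twice must be duplicated beforehand.\<close>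

inductive exec :: "com \<Rightarrow> store \<Rightarrow> nat \<Rightarrow> store \<Rightarrow> bool" where
  SKIP: "exec SKIP s 0 s"
| PUSH: "s' = s(r := b # s r) \<Longrightarrow> exec (PUSH r b) s 2 s'"
| SEQ: "exec c1 s t1 s1 \<Longrightarrow> exec c2 s1 t2 s2 \<Longrightarrow> exec (c1 ;; c2) s (t1 + t2) s2"
| CASE_Nil: "s r = [] \<Longrightarrow> exec c0 s t s' \<Longrightarrow> exec (CASE r c0 c1 c2) s (t + 2) s'"
| CASE_False: "s r = False # w \<Longrightarrow> exec c1 (s(r := w)) t s' \<Longrightarrow> exec (CASE r c0 c1 c2) s (t + 2) s'"
| CASE_True: "s r = True # w \<Longrightarrow> exec c2 (s(r := w)) t s' \<Longrightarrow> exec (CASE r c0 c1 c2) s (t + 2) s'"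
| LOOP_Nil: "s r = [] \<Longrightarrow> exec (LOOP r c1 c2) s 1 s"
| LOOP_False: "s r = False # w \<Longrightarrow> exec c1 (s(r := w)) t1 s1 \<Longrightarrow> exec (LOOP r c1 c2) s1 t2 s2 \<Longrightarrow>
    exec (LOOP r c1 c2) s (t1 + t2 + 2) s2"
| LOOP_True: "s r = True # w \<Longrightarrow> exec c2 (s(r := w)) t1 s1 \<Longrightarrow> exec (LOOP r c1 c2) s1 t2 s2 \<Longrightarrow>
    exec (LOOP r c1 c2) s (t1 + t2 + 2) s2"

fun reg_bound :: "com \<Rightarrow> nat" where
  "reg_bound SKIP = 0"
| "reg_bound (PUSH r b) = Suc r"
| "reg_bound (c1 ;; c2) = max (reg_bound c1) (reg_bound c2)"
| "reg_bound (CASE r c0 c1 c2) = max (Suc r) (max (reg_bound c0) (max (reg_bound c1) (reg_bound c2)))"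
| "reg_bound (LOOP r c1 c2) = max (Suc r) (max (reg_bound c1) (reg_bound c2))"

subsection \<open>Compilation\<close>

text \<open>An instruction acts on one tape; the scanned symbol determines the symbol written, the
  movement, and the next instruction.  A stack is kept on a tape with its top under the head.\<close>

type_synonym instr = "nat \<times> (nat \<Rightarrow> nat \<times> int \<times> nat)"

definition bit_sym :: "bool \<Rightarrow> nat" where
  "bit_sym b = (if b then 2 else 1)"

definition JMP :: "nat \<Rightarrow> instr" where
  "JMP l = (0, \<lambda>s. (s, 0, l))"

definition POP :: "nat \<Rightarrow> nat \<Rightarrow> nat \<Rightarrow> nat \<Rightarrow> instr" where
  "POP r l0 l1 l2 = (r, \<lambda>s. if s = 0 then (0, 0, l0) else (0, 1, if s = 1 then l1 else l2))"

fun com_size :: "com \<Rightarrow> nat" where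
  "com_size SKIP = 0"
| "com_size (PUSH r b) = 2"
| "com_size (c1 ;; c2) = com_size c1 + com_size c2"
| "com_size (CASE r c0 c1 c2) = com_size c0 + com_size c1 + com_size c2 + 4"
| "com_size (LOOP r c1 c2) = com_size c1 + com_size c2 + 3"

fun compile :: "com \<Rightarrow> nat \<Rightarrow> instr list" where
  "compile SKIP l = []"
| "compile (PUSH r b) l = [(r, \<lambda>s. (s, -1, l + 1)), (r, \<lambda>s. (bit_sym b, 0, l + 2))]"
| "compile (c1 ;; c2) l = compile c1 l @ compile c2 (l + com_size c1)"
| "compile (CASE r c0 c1 c2) l =
    (let l0 = l + 1; l1 = l0 + com_size c0 + 1; l2 = l1 + com_size c1 + 1; e = l2 + com_size c2 + 1 in
       POP r l0 l1 l2 # compile c0 l0 @ JMP e # compile c1 l1 @ JMP e # compile c2 l2 @ [JMP e])"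
| "compile (LOOP r c1 c2) l =
    (let l1 = l + 1; l2 = l1 + com_size c1 + 1; e = l2 + com_size c2 + 1 in
       POP r e l1 l2 # compile c1 l1 @ JMP l # compile c2 l2 @ [JMP l])"

lemma length_compile [simp]: "length (compile c l) = com_size c"
  by (induction c arbitrary: l) (auto simp: Let_def)

definition instr_trans :: "instr list \<Rightarrow> nat \<Rightarrow> nat list \<Rightarrow> nat \<times> (nat \<times> int) list" where
  "instr_trans P q ss =
    (let (r, act) = P ! q; (w, m, n) = act (ss ! r) in (n, (map (\<lambda>s. (s, 0)) ss)[r := (w, m)]))"

definition instr_tm :: "nat \<Rightarrow> instr list \<Rightarrow> tm" where
  "instr_tm k P = \<lparr>tm_tapes = k, tm_syms = 3, tm_states = length P, tm_trans = instr_trans P\<rparr>"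

definition wf_instr :: "nat \<Rightarrow> nat \<Rightarrow> instr \<Rightarrow> bool" where
  "wf_instr k e i \<longleftrightarrow> fst i < k \<and> (\<forall>s<3. case snd i s of (w, m, n) \<Rightarrow> w < 3 \<and> m \<in> {-1, 0, 1} \<and> n \<le> e)"

lemma turing_machine_instr:
  assumes k: "1 \<le> k" and P: "\<forall>i \<in> set P. wf_instr k (length P) i"
  shows "turing_machine (instr_tm k P)"
proof -
  have "fst (instr_trans P q ss) \<le> length P \<and> length (snd (instr_trans P q ss)) = k \<and>
      set (snd (instr_trans P q ss)) \<subseteq> {..<3} \<times> {-1, 0, 1}"
    if q: "q < length P" and l: "length ss = k" and s: "set ss \<subseteq> {..<3}" for q ss
  proof -
    obtain r act where i: "P ! q = (r, act)" by fastforce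
    have wf: "wf_instr k (length P) (r, act)" using P q i by (metis nth_mem)
    then have r: "r < k" by (simp add: wf_instr_def)
    then have "ss ! r < 3" using s l by (meson lessThan_iff nth_mem subsetD)
    moreover obtain w m n where a: "act (ss ! r) = (w, m, n)" by (metis prod_cases3)
    ultimately have "w < 3" "m \<in> {-1, 0, 1}" "n \<le> length P" using wf by (auto simp: wf_instr_def)
    moreover have "set (map (\<lambda>s. (s, 0)) ss) \<subseteq> {..<3} \<times> {-1, 0, 1::int}" using s by auto
    ultimately show ?thesis
      using i a l set_update_subset_insert[of "map (\<lambda>s. (s, 0)) ss" r "(w, m)"]
      by (auto simp: instr_trans_def simp del: set_map)
  qed
  then show ?thesis using k by (simp add: turing_machine_def instr_tm_def)
qed

lemma instr_step:
  assumes q: "q < length P" and i: "P ! q = (r, act)" and r: "r < length ts" "ts ! r = (f, h)"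
    and a: "act (f h) = (w, m, n)"
  shows "tm_step (instr_tm k P) (q, ts) = (n, ts[r := (f(h := w), h + m)])"
proof -
  have "scan ts ! r = f h" using r by simp
  then have "instr_trans P q (scan ts) = (n, (map (\<lambda>s. (s, 0)) (scan ts))[r := (w, m)])"
    using i a by (simp add: instr_trans_def)
  then have "tm_step (instr_tm k P) (q, ts) = (n, map2 tape_act ((map (\<lambda>s. (s, 0)) (scan ts))[r := (w, m)]) ts)"
    using q by (intro tm_step_running) (auto simp: instr_tm_def)
  also have "map2 tape_act ((map (\<lambda>s. (s, 0)) (scan ts))[r := (w, m)]) ts = ts[r := (f(h := w), h + m)]"
  proof (rule nth_equalityI)
    fix j assume "j < length (map2 tape_act ((map (\<lambda>s. (s, 0)) (scan ts))[r := (w, m)]) ts)"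
    then have j: "j < length ts" by simp
    obtain f' h' where "ts ! j = (f', h')" by fastforce
    then show "map2 tape_act ((map (\<lambda>s. (s, 0)) (scan ts))[r := (w, m)]) ts ! j = ts[r := (f(h := w), h + m)] ! j"
      using j r by (cases "j = r") simp_all
  qed simp
  finally show ?thesis .
qed

definition stack_tape :: "bool list \<Rightarrow> tape \<Rightarrow> bool" where
  "stack_tape w t \<longleftrightarrow> fst t = (\<lambda>i. word_tape w (i - snd t))"

definition stores :: "nat \<Rightarrow> tape \<Rightarrow> store \<Rightarrow> tape list \<Rightarrow> bool" where
  "stores R out s ts \<longleftrightarrow> length ts = Suc R \<and> (\<forall>r<R. stack_tape (s r) (ts ! r)) \<and> ts ! R = out"

lemma word_tape_Cons: "word_tape (b # w) i = (if i = 0 then bit_sym b else word_tape w (i - 1))"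
proof (cases "i \<le> 0")
  case False
  then obtain j where "i = int (Suc j)" by (metis not_le pos_int_cases Suc_pred')
  then show ?thesis by (auto simp: word_tape_def nat_add_distrib)
qed (auto simp: word_tape_def bit_sym_def)

lemma word_tape_Nil: "word_tape [] = (\<lambda>_. 0)"
  by (auto simp: word_tape_def)

lemma stack_tape_push:
  "stack_tape w (f, h) \<Longrightarrow> stack_tape (b # w) (f(h - 1 := bit_sym b), h - 1)"
  by (auto simp: stack_tape_def word_tape_Cons)

lemma stack_tape_pop:
  "stack_tape (b # w) (f, h) \<Longrightarrow> f h = bit_sym b \<and> stack_tape w (f(h := 0), h + 1)"
proof -
  assume st: "stack_tape (b # w) (f, h)"
  then have f: "f = (\<lambda>i. if i = h then bit_sym b else word_tape w (i - h - 1))"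
    by (auto simp: stack_tape_def word_tape_Cons)
  have "word_tape w (-1) = 0" by (simp add: word_tape_def)
  then show ?thesis unfolding f by (auto simp: stack_tape_def fun_eq_iff algebra_simps)
qed

lemma stores_upd:
  "stores R out s ts \<Longrightarrow> r < R \<Longrightarrow> stack_tape w t \<Longrightarrow> stores R out (s(r := w)) (ts[r := t])"
  by (auto simp: stores_def nth_list_update)

lemma stores_tape:
  assumes "stores R out s ts" "r < R"
  obtains f h where "ts ! r = (f, h)" "stack_tape (s r) (f, h)" "r < length ts"
  using assms by (cases "ts ! r") (auto simp: stores_def)

definition code_at :: "instr list \<Rightarrow> nat \<Rightarrow> instr list \<Rightarrow> bool" where
  "code_at P l cs \<longleftrightarrow> (\<exists>xs ys. P = xs @ cs @ ys \<and> length xs = l)"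

lemma code_at_append: "code_at P l (xs @ ys) \<Longrightarrow> code_at P l xs \<and> code_at P (l + length xs) ys"
  unfolding code_at_def by (metis append.assoc length_append)

lemma code_at_Cons: "code_at P l (x # xs) \<Longrightarrow> l < length P \<and> P ! l = x \<and> code_at P (Suc l) xs"
proof -
  assume "code_at P l (x # xs)"
  then obtain us vs where P: "P = us @ x # xs @ vs" "length us = l" by (auto simp: code_at_def)
  then have "code_at P (Suc l) xs"
    unfolding code_at_def by (intro exI[of _ "us @ [x]"] exI[of _ vs]) simp
  then show ?thesis using P by (auto simp: nth_append)
qed

context
  fixes R :: nat and P :: "instr list" and out :: tape
  assumes R: "1 \<le> R"
begin

abbreviation "machine \<equiv> instr_tm (Suc R) P"

lemma step_JMP:
  assumes "l < length P" "P ! l = JMP e" "stores R out s ts"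
  shows "reaches machine (l, ts) 1 (e, ts)"
proof -
  obtain f h where t: "ts ! 0 = (f, h)" by fastforce
  have "tm_step machine (l, ts) = (e, ts[0 := (f(h := f h), h + 0)])"
    using assms R t by (intro instr_step) (auto simp: JMP_def stores_def)
  also have "ts[0 := (f(h := f h), h + 0)] = ts" using t by (metis add_0_right fun_upd_triv list_update_id)
  finally show ?thesis by (rule reaches_step)
qed

lemma step_POP_Nil:
  assumes "l < length P" "P ! l = POP r l0 l1 l2" "stores R out s ts" "r < R" "s r = []"
  shows "reaches machine (l, ts) 1 (l0, ts)"
proof -
  obtain f h where t: "ts ! r = (f, h)" "stack_tape (s r) (f, h)" "r < length ts"
    using stores_tape[OF assms(3,4)] .
  have f0: "f h = 0" using t(2) assms(5) by (simp add: stack_tape_def word_tape_Nil)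
  have "tm_step machine (l, ts) = (l0, ts[r := (f(h := 0), h + 0)])"
    using assms t f0 by (intro instr_step[where act="snd (POP r l0 l1 l2)"]) (auto simp: POP_def)
  also have "ts[r := (f(h := 0), h + 0)] = ts" using t f0 by (metis add_0_right fun_upd_triv list_update_id)
  finally show ?thesis by (rule reaches_step)
qed

lemma step_POP_Cons:
  assumes "l < length P" "P ! l = POP r l0 l1 l2" "stores R out s ts" "r < R" "s r = b # w"
  obtains ts' where "stores R out (s(r := w)) ts'" "reaches machine (l, ts) 1 (if b then l2 else l1, ts')"
proof -
  obtain f h where t: "ts ! r = (f, h)" "stack_tape (s r) (f, h)" "r < length ts"
    using stores_tape[OF assms(3,4)] .
  have f0: "f h = bit_sym b" "stack_tape w (f(h := 0), h + 1)" using stack_tape_pop t(2) assms(5) by auto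
  have "tm_step machine (l, ts) = (if b then l2 else l1, ts[r := (f(h := 0), h + 1)])"
    using assms t f0 by (intro instr_step[where act="snd (POP r l0 l1 l2)"]) (auto simp: POP_def bit_sym_def)
  then have "reaches machine (l, ts) 1 (if b then l2 else l1, ts[r := (f(h := 0), h + 1)])" by (rule reaches_step)
  then show ?thesis using that stores_upd[OF assms(3,4) f0(2)] by blast
qed

text \<open>Induction over executions rather than programs: after one round, a loop jumps back to
  its own address \<open>l\<close>, and the hypothesis for the remaining execution applies to the
  very same piece of code.\<close>

lemma compile_correct:
  "exec c s t s' \<Longrightarrow> code_at P l (compile c l) \<Longrightarrow> reg_bound c \<le> R \<Longrightarrow> stores R out s ts \<Longrightarrow>
    \<exists>ts'. stores R out s' ts' \<and> reaches machine (l, ts) t (l + com_size c, ts')"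
proof (induction arbitrary: l ts rule: exec.induct)
  case (SKIP s)
  then show ?case using reaches_refl by fastforce
next
  case (PUSH s' s r b)
  have r: "r < R" using PUSH by simp
  have 1: "l < length P" "P ! l = (r, \<lambda>s. (s, -1, l + 1))" "Suc l < length P" "P ! Suc l = (r, \<lambda>s. (bit_sym b, 0, l + 2))"
    using PUSH.prems(1) by (auto dest!: code_at_Cons)
  obtain f h where t: "ts ! r = (f, h)" "stack_tape (s r) (f, h)" "r < length ts"
    using stores_tape[OF PUSH.prems(3) r] .
  have "tm_step machine (l, ts) = (l + 1, ts[r := (f(h := f h), h + -1)])"
    using t by (intro instr_step[OF 1(1,2)]) auto
  moreover have "tm_step machine (l + 1, ts[r := (f(h := f h), h + -1)])
      = (l + 2, (ts[r := (f(h := f h), h + -1)])[r := (f(h - 1 := bit_sym b), h - 1 + 0)])"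
    using t by (intro instr_step[where act="\<lambda>s. (bit_sym b, 0, l + 2)"]) (use 1 in auto)
  ultimately have "reaches machine (l, ts) (1 + 1) (l + 2, ts[r := (f(h - 1 := bit_sym b), h - 1)])"
    by (intro reaches_trans[OF reaches_step reaches_step]) auto
  then have "reaches machine (l, ts) 2 (l + com_size (PUSH r b), ts[r := (f(h - 1 := bit_sym b), h - 1)])"
    by (simp add: numeral_2_eq_2)
  moreover have "stores R out s' (ts[r := (f(h - 1 := bit_sym b), h - 1)])"
    using stores_upd[OF PUSH.prems(3) r stack_tape_push[OF t(2)]] PUSH.hyps by simp
  ultimately show ?case by blast
next
  case (SEQ c1 s t1 s1 c2 t2 s2)
  have c: "code_at P l (compile c1 l)" "code_at P (l + com_size c1) (compile c2 (l + com_size c1))"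
    using SEQ.prems(1) code_at_append by fastforce+
  obtain ts1 where 1: "stores R out s1 ts1" "reaches machine (l, ts) t1 (l + com_size c1, ts1)"
    using SEQ.IH(1)[OF c(1) _ SEQ.prems(3)] SEQ.prems(2) by auto
  obtain ts2 where 2: "stores R out s2 ts2" "reaches machine (l + com_size c1, ts1) t2 (l + com_size c1 + com_size c2, ts2)"
    using SEQ.IH(2)[OF c(2) _ 1(1)] SEQ.prems(2) by auto
  show ?case using reaches_trans[OF 1(2) 2(2)] 2(1) by (auto simp: add.assoc)
next
  case (CASE_Nil s r c0 t s' c1 c2)
  define l0 l1 l2 e where l: "l0 = l + 1" "l1 = l0 + com_size c0 + 1" "l2 = l1 + com_size c1 + 1" "e = l2 + com_size c2 + 1"
  have c: "l < length P" "P ! l = POP r l0 l1 l2" "code_at P l0 (compile c0 l0)" "l0 + com_size c0 < length P" "P ! (l0 + com_size c0) = JMP e"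
    using CASE_Nil.prems(1) unfolding compile.simps Let_def l
    by (auto dest!: code_at_Cons code_at_append)
  have 1: "reaches machine (l, ts) 1 (l0, ts)"
    using step_POP_Nil[OF c(1,2) CASE_Nil.prems(3) _ CASE_Nil.hyps(1)] CASE_Nil.prems(2) by simp
  obtain ts2 where 2: "stores R out s' ts2" "reaches machine (l0, ts) t (l0 + com_size c0, ts2)"
    using CASE_Nil.IH[OF c(3) _ CASE_Nil.prems(3)] CASE_Nil.prems(2) by auto
  have "reaches machine (l, ts) (1 + t + 1) (e, ts2)"
    using reaches_trans[OF reaches_trans[OF 1 2(2)] step_JMP[OF c(4,5) 2(1)]] .
  moreover have "l + com_size (CASE r c0 c1 c2) = e" "1 + t + 1 = t + 2" by (simp_all add: l)
  ultimately show ?case using 2(1) by metis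
next
  case (CASE_False s r w c1 t s' c0 c2)
  define l0 l1 l2 e where l: "l0 = l + 1" "l1 = l0 + com_size c0 + 1" "l2 = l1 + com_size c1 + 1" "e = l2 + com_size c2 + 1"
  have c: "l < length P" "P ! l = POP r l0 l1 l2" "code_at P l1 (compile c1 l1)" "l1 + com_size c1 < length P" "P ! (l1 + com_size c1) = JMP e"
    using CASE_False.prems(1) unfolding compile.simps Let_def l
    by (auto dest!: code_at_Cons code_at_append)
  obtain ts1 where 1: "stores R out (s(r := w)) ts1" "reaches machine (l, ts) 1 (l1, ts1)"
    using step_POP_Cons[OF c(1,2) CASE_False.prems(3) _ CASE_False.hyps(1)] CASE_False.prems(2) by auto
  obtain ts2 where 2: "stores R out s' ts2" "reaches machine (l1, ts1) t (l1 + com_size c1, ts2)"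
    using CASE_False.IH[OF c(3) _ 1(1)] CASE_False.prems(2) by auto
  have "reaches machine (l, ts) (1 + t + 1) (e, ts2)"
    using reaches_trans[OF reaches_trans[OF 1(2) 2(2)] step_JMP[OF c(4,5) 2(1)]] .
  moreover have "l + com_size (CASE r c0 c1 c2) = e" "1 + t + 1 = t + 2" by (simp_all add: l)
  ultimately show ?case using 2(1) by metis
next
  case (CASE_True s r w c2 t s' c0 c1)
  define l0 l1 l2 e where l: "l0 = l + 1" "l1 = l0 + com_size c0 + 1" "l2 = l1 + com_size c1 + 1" "e = l2 + com_size c2 + 1"
  have c: "l < length P" "P ! l = POP r l0 l1 l2" "code_at P l2 (compile c2 l2)" "l2 + com_size c2 < length P" "P ! (l2 + com_size c2) = JMP e"
    using CASE_True.prems(1) unfolding compile.simps Let_def l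
    by (auto dest!: code_at_Cons code_at_append)
  obtain ts1 where 1: "stores R out (s(r := w)) ts1" "reaches machine (l, ts) 1 (l2, ts1)"
    using step_POP_Cons[OF c(1,2) CASE_True.prems(3) _ CASE_True.hyps(1)] CASE_True.prems(2) by auto
  obtain ts2 where 2: "stores R out s' ts2" "reaches machine (l2, ts1) t (l2 + com_size c2, ts2)"
    using CASE_True.IH[OF c(3) _ 1(1)] CASE_True.prems(2) by auto
  have "reaches machine (l, ts) (1 + t + 1) (e, ts2)"
    using reaches_trans[OF reaches_trans[OF 1(2) 2(2)] step_JMP[OF c(4,5) 2(1)]] .
  moreover have "l + com_size (CASE r c0 c1 c2) = e" "1 + t + 1 = t + 2" by (simp_all add: l)
  ultimately show ?case using 2(1) by metis
next
  case (LOOP_Nil s r c1 c2)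
  define l1 l2 e where l: "l1 = l + 1" "l2 = l1 + com_size c1 + 1" "e = l2 + com_size c2 + 1"
  have c: "l < length P" "P ! l = POP r e l1 l2"
    using LOOP_Nil.prems(1) unfolding compile.simps Let_def l by (auto dest!: code_at_Cons)
  have "reaches machine (l, ts) 1 (e, ts)"
    using step_POP_Nil[OF c LOOP_Nil.prems(3) _ LOOP_Nil.hyps(1)] LOOP_Nil.prems(2) by simp
  moreover have "l + com_size (LOOP r c1 c2) = e" by (simp add: l)
  ultimately show ?case using LOOP_Nil.prems(3) by metis
next
  case (LOOP_False s r w c1 t1 s1 c2 t2 s2)
  define l1 l2 e where l: "l1 = l + 1" "l2 = l1 + com_size c1 + 1" "e = l2 + com_size c2 + 1"
  have c: "l < length P" "P ! l = POP r e l1 l2" "code_at P l1 (compile c1 l1)" "l1 + com_size c1 < length P" "P ! (l1 + com_size c1) = JMP l"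
    using LOOP_False.prems(1) unfolding compile.simps Let_def l
    by (auto dest!: code_at_Cons code_at_append)
  obtain ts1 where 1: "stores R out (s(r := w)) ts1" "reaches machine (l, ts) 1 (l1, ts1)"
    using step_POP_Cons[OF c(1,2) LOOP_False.prems(3) _ LOOP_False.hyps(1)] LOOP_False.prems(2) by auto
  obtain ts2 where 2: "stores R out s1 ts2" "reaches machine (l1, ts1) t1 (l1 + com_size c1, ts2)"
    using LOOP_False.IH(1)[OF c(3) _ 1(1)] LOOP_False.prems(2) by auto
  obtain ts3 where 3: "stores R out s2 ts3" "reaches machine (l, ts2) t2 (l + com_size (LOOP r c1 c2), ts3)"
    using LOOP_False.IH(2)[OF LOOP_False.prems(1,2) 2(1)] by auto
  have "reaches machine (l, ts) (1 + t1 + 1 + t2) (l + com_size (LOOP r c1 c2), ts3)"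
    using reaches_trans[OF reaches_trans[OF reaches_trans[OF 1(2) 2(2)] step_JMP[OF c(4,5) 2(1)]] 3(2)] .
  then show ?case using 3(1) by (auto simp: algebra_simps)
next
  case (LOOP_True s r w c2 t1 s1 c1 t2 s2)
  define l1 l2 e where l: "l1 = l + 1" "l2 = l1 + com_size c1 + 1" "e = l2 + com_size c2 + 1"
  have c: "l < length P" "P ! l = POP r e l1 l2" "code_at P l2 (compile c2 l2)" "l2 + com_size c2 < length P" "P ! (l2 + com_size c2) = JMP l"
    using LOOP_True.prems(1) unfolding compile.simps Let_def l
    by (auto dest!: code_at_Cons code_at_append)
  obtain ts1 where 1: "stores R out (s(r := w)) ts1" "reaches machine (l, ts) 1 (l2, ts1)"
    using step_POP_Cons[OF c(1,2) LOOP_True.prems(3) _ LOOP_True.hyps(1)] LOOP_True.prems(2) by auto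
  obtain ts2 where 2: "stores R out s1 ts2" "reaches machine (l2, ts1) t1 (l2 + com_size c2, ts2)"
    using LOOP_True.IH(1)[OF c(3) _ 1(1)] LOOP_True.prems(2) by auto
  obtain ts3 where 3: "stores R out s2 ts3" "reaches machine (l, ts2) t2 (l + com_size (LOOP r c1 c2), ts3)"
    using LOOP_True.IH(2)[OF LOOP_True.prems(1,2) 2(1)] by auto
  have "reaches machine (l, ts) (1 + t1 + 1 + t2) (l + com_size (LOOP r c1 c2), ts3)"
    using reaches_trans[OF reaches_trans[OF reaches_trans[OF 1(2) 2(2)] step_JMP[OF c(4,5) 2(1)]] 3(2)] .
  then show ?case using 3(1) by (auto simp: algebra_simps)
qed

end

lemma wf_instr_mono: "wf_instr k e i \<Longrightarrow> e \<le> e' \<Longrightarrow> wf_instr k e' i"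
  by (fastforce simp: wf_instr_def)

lemma wf_compile: "reg_bound c \<le> R \<Longrightarrow> 1 \<le> R \<Longrightarrow> i \<in> set (compile c l) \<Longrightarrow> wf_instr (Suc R) (l + com_size c) i"
proof (induction c arbitrary: l)
  case (SEQ c1 c2)
  then consider "i \<in> set (compile c1 l)" | "i \<in> set (compile c2 (l + com_size c1))" by auto
  then show ?case
  proof cases
    case 1
    then show ?thesis using SEQ.IH(1)[of l] SEQ.prems by (auto intro: wf_instr_mono)
  next
    case 2
    then show ?thesis using SEQ.IH(2)[of "l + com_size c1"] SEQ.prems by (auto simp: add.assoc)
  qed
next
  case (CASE r c0 c1 c2)
  define l0 l1 l2 e where l: "l0 = l + 1" "l1 = l0 + com_size c0 + 1" "l2 = l1 + com_size c1 + 1" "e = l2 + com_size c2 + 1"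
  have e: "l + com_size (CASE r c0 c1 c2) = e" by (simp add: l)
  have "i = POP r l0 l1 l2 \<or> i = JMP e \<or> i \<in> set (compile c0 l0) \<or> i \<in> set (compile c1 l1) \<or> i \<in> set (compile c2 l2)"
    using CASE.prems(3) by (auto simp: Let_def l)
  moreover have "wf_instr (Suc R) e (POP r l0 l1 l2)" "wf_instr (Suc R) e (JMP e)"
    using CASE.prems(1) by (auto simp: wf_instr_def POP_def JMP_def l)
  moreover have "i \<in> set (compile c0 l0) \<Longrightarrow> wf_instr (Suc R) e i" "i \<in> set (compile c1 l1) \<Longrightarrow> wf_instr (Suc R) e i"
      "i \<in> set (compile c2 l2) \<Longrightarrow> wf_instr (Suc R) e i"
    using CASE.IH(1)[of l0] CASE.IH(2)[of l1] CASE.IH(3)[of l2] CASE.prems(1,2)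
    by (auto elim!: wf_instr_mono simp: l)
  ultimately show ?case unfolding e by blast
next
  case (LOOP r c1 c2)
  define l1 l2 e where l: "l1 = l + 1" "l2 = l1 + com_size c1 + 1" "e = l2 + com_size c2 + 1"
  have e: "l + com_size (LOOP r c1 c2) = e" by (simp add: l)
  have "i = POP r e l1 l2 \<or> i = JMP l \<or> i \<in> set (compile c1 l1) \<or> i \<in> set (compile c2 l2)"
    using LOOP.prems(3) by (auto simp: Let_def l)
  moreover have "wf_instr (Suc R) e (POP r e l1 l2)" "wf_instr (Suc R) e (JMP l)"
    using LOOP.prems(1) by (auto simp: wf_instr_def POP_def JMP_def l)
  moreover have "i \<in> set (compile c1 l1) \<Longrightarrow> wf_instr (Suc R) e i"
      "i \<in> set (compile c2 l2) \<Longrightarrow> wf_instr (Suc R) e i"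
    using LOOP.IH(1)[of l1] LOOP.IH(2)[of l2] LOOP.prems(1,2)
    by (auto elim!: wf_instr_mono simp: l)
  ultimately show ?case unfolding e by blast
qed (auto simp: wf_instr_def bit_sym_def)

text \<open>After the program proper, the top-level register 0 is copied to the output tape.\<close>

definition output_code :: "nat \<Rightarrow> nat \<Rightarrow> instr list" where
  "output_code R e = [POP 0 (e + 3) (e + 1) (e + 2), (R, \<lambda>s. (1, 1, e)), (R, \<lambda>s. (2, 1, e))]"

lemma word_tape_snoc: "(word_tape w)(int (length w) := bit_sym b) = word_tape (w @ [b])"
  by (auto simp: word_tape_def bit_sym_def nth_append fun_eq_iff)

text \<open>A stack drifts along its tape, while an output has to start at cell 0; hence the
  separate tape. The invariant is that \<open>v\<close> has been written and the head stands just
  behind it.\<close>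

lemma output_correct:
  assumes R: "1 \<le> R" and c: "code_at P e (output_code R e)"
  shows "stores R (word_tape v, int (length v)) s ts \<Longrightarrow>
    \<exists>ts'. reaches (instr_tm (Suc R) P) (e, ts) (2 * length (s 0) + 1) (e + 3, ts') \<and>
      length ts' = Suc R \<and> fst (ts' ! R) = word_tape (v @ s 0)"
proof (induction "s 0" arbitrary: s v ts)
  case Nil
  have "e < length P" "P ! e = POP 0 (e + 3) (e + 1) (e + 2)"
    using c by (auto simp: output_code_def dest!: code_at_Cons)
  from step_POP_Nil[OF R this Nil.prems] show ?case using R Nil by (auto simp: stores_def intro!: exI[of _ ts])
next
  case (Cons b w)
  have c: "e < length P" "P ! e = POP 0 (e + 3) (e + 1) (e + 2)" "Suc e < length P" "P ! Suc e = (R, \<lambda>s. (1, 1, e))"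
      "Suc (Suc e) < length P" "P ! Suc (Suc e) = (R, \<lambda>s. (2, 1, e))"
    using c by (auto simp: output_code_def dest!: code_at_Cons)
  obtain ts1 where 1: "stores R (word_tape v, int (length v)) (s(0 := w)) ts1"
    "reaches (instr_tm (Suc R) P) (e, ts) 1 (if b then e + 2 else e + 1, ts1)"
    using step_POP_Cons[OF R c(1,2) Cons.prems _ Cons.hyps(2)[symmetric]] R by auto
  define ts2 where "ts2 = ts1[R := (word_tape (v @ [b]), int (length (v @ [b])))]"
  have R1: "R < length ts1" "ts1 ! R = (word_tape v, int (length v))" using 1(1) by (auto simp: stores_def)
  have "tm_step (instr_tm (Suc R) P) (if b then e + 2 else e + 1, ts1)
      = (e, ts1[R := ((word_tape v)(int (length v) := bit_sym b), int (length v) + 1)])"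
    using c R1 by (intro instr_step[where act="\<lambda>s. (bit_sym b, 1, e)"]) (auto simp: bit_sym_def)
  then have 2: "reaches (instr_tm (Suc R) P) (if b then e + 2 else e + 1, ts1) 1 (e, ts2)"
    by (intro reaches_step) (simp add: word_tape_snoc ts2_def add.commute)
  have "stores R (word_tape (v @ [b]), int (length (v @ [b]))) (s(0 := w)) ts2"
    using 1(1) by (auto simp: stores_def ts2_def)
  from Cons.hyps(1)[OF _ this] obtain ts' where 3:
    "reaches (instr_tm (Suc R) P) (e, ts2) (2 * length w + 1) (e + 3, ts')" "length ts' = Suc R"
    "fst (ts' ! R) = word_tape ((v @ [b]) @ w)" by auto
  have "reaches (instr_tm (Suc R) P) (e, ts) (1 + 1 + (2 * length w + 1)) (e + 3, ts')"
    using reaches_trans[OF reaches_trans[OF 1(2) 2] 3(1)] .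
  then show ?case using 3 Cons.hyps(2)[symmetric] by auto
qed

theorem com_turing_machine:
  obtains M where "turing_machine M"
    and "\<And>x t s'. exec c (\<lambda>r. if r = 0 then x else []) t s' \<Longrightarrow> tm_outputs M x (s' 0) (t + 2 * length (s' 0) + 1)"
proof -
  define R where "R = max 1 (reg_bound c)"
  define P where "P = compile c 0 @ output_code R (com_size c)"
  have R: "1 \<le> R" "reg_bound c \<le> R" by (auto simp: R_def)
  have lP: "length P = com_size c + 3" by (simp add: P_def output_code_def)
  have "\<forall>i \<in> set (compile c 0). wf_instr (Suc R) (length P) i"
  proof
    fix i assume "i \<in> set (compile c 0)"
    from wf_compile[OF R(2,1) this] show "wf_instr (Suc R) (length P) i"
      by (rule wf_instr_mono) (simp add: lP)
  qed
  moreover have "\<forall>i \<in> set (output_code R (com_size c)). wf_instr (Suc R) (length P) i"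
    using R by (auto simp: output_code_def wf_instr_def POP_def lP)
  ultimately have "\<forall>i \<in> set P. wf_instr (Suc R) (length P) i" by (auto simp: P_def)
  then have M: "turing_machine (instr_tm (Suc R) P)" by (intro turing_machine_instr) auto
  have out: "tm_outputs (instr_tm (Suc R) P) x (s' 0) (t + 2 * length (s' 0) + 1)"
    if ex: "exec c (\<lambda>r. if r = 0 then x else []) t s'" for x t s'
  proof -
    obtain ts where i: "tm_init (instr_tm (Suc R) P) x = (0, ts)" by (simp add: tm_init_def)
    then have ts: "ts = (word_tape x, 0) # replicate R (word_tape [], 0)" by (simp add: tm_init_def instr_tm_def)
    have "stores R (word_tape [], int (length ([] :: bool list))) (\<lambda>r. if r = 0 then x else []) ts"
      using R by (auto simp: stores_def ts stack_tape_def nth_Cons' fun_eq_iff)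
    moreover have "code_at P 0 (compile c 0)" by (auto simp: code_at_def P_def)
    ultimately obtain ts1 where 1: "stores R (word_tape [], int (length ([] :: bool list))) s' ts1"
      "reaches (instr_tm (Suc R) P) (0, ts) t (com_size c, ts1)"
      using compile_correct[OF R(1) ex _ R(2)] by fastforce
    have "code_at P (com_size c) (output_code R (com_size c))"
      unfolding code_at_def P_def by (intro exI[of _ "compile c 0"] exI[of _ "[]"]) simp
    from output_correct[OF R(1) this 1(1)] obtain ts2 where 2:
      "reaches (instr_tm (Suc R) P) (com_size c, ts1) (2 * length (s' 0) + 1) (com_size c + 3, ts2)"
      "length ts2 = Suc R" "fst (ts2 ! R) = word_tape (s' 0)" by auto
    have "last ts2 = ts2 ! R" using 2(2) by (metis diff_Suc_1 last_conv_nth list.size(3) nat.distinct(1))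
    moreover obtain r where "r \<le> t + (2 * length (s' 0) + 1)"
      "(tm_step (instr_tm (Suc R) P) ^^ r) (0, ts) = (com_size c + 3, ts2)"
      using reaches_trans[OF 1(2) 2(1)] by (auto simp: reaches_def)
    ultimately show ?thesis unfolding tm_outputs_def i using 2(3) lP
      by (intro exI[of _ r] exI[of _ "com_size c + 3"] exI[of _ ts2]) (auto simp: instr_tm_def)
  qed
  show ?thesis by (rule that, rule M, erule out)
qed

subsection \<open>Running times\<close>

text \<open>Leaves slack in the time, so that bounds can be added and rounded up, while
  \<open>exec\<close> is exact.\<close>

definition exle :: "com \<Rightarrow> store \<Rightarrow> nat \<Rightarrow> store \<Rightarrow> bool" where
  "exle c s n s' \<longleftrightarrow> (\<exists>t\<le>n. exec c s t s')"

lemma exleI: "exec c s t s' \<Longrightarrow> t \<le> n \<Longrightarrow> exle c s n s'"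
  by (auto simp: exle_def)

lemma exle_mono: "exle c s n s' \<Longrightarrow> n \<le> n' \<Longrightarrow> exle c s n' s'"
  unfolding exle_def using order_trans by blast

lemma exle_SKIP: "exle SKIP s n s"
  by (rule exleI[OF exec.SKIP]) simp

lemma exle_PUSH: "2 \<le> n \<Longrightarrow> exle (PUSH r b) s n (s(r := b # s r))"
  by (rule exleI[OF exec.PUSH]) simp_all

lemma exle_cong: "exle c s n s' \<Longrightarrow> s = r \<Longrightarrow> s' = r' \<Longrightarrow> exle c r n r'"
  by simp

lemma exle_PUSH': "s' = s(r := b # s r) \<Longrightarrow> 2 \<le> n \<Longrightarrow> exle (PUSH r b) s n s'"
  by (simp add: exle_PUSH)

lemma exle_seq: "exle c1 s n1 s1 \<Longrightarrow> exle c2 s1 n2 s2 \<Longrightarrow> exle (c1 ;; c2) s (n1 + n2) s2"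
  unfolding exle_def by (meson add_mono exec.SEQ)

lemma exle_SEQ: "exle c1 s n1 s1 \<Longrightarrow> exle c2 s1 n2 s2 \<Longrightarrow> n1 + n2 \<le> n \<Longrightarrow> exle (c1 ;; c2) s n s2"
  by (rule exle_mono[OF exle_seq])

lemma exle_CASE:
  "s r = [] \<Longrightarrow> exle c0 s n s' \<Longrightarrow> n + 2 \<le> n' \<Longrightarrow> exle (CASE r c0 c1 c2) s n' s'"
  "s r = False # w \<Longrightarrow> exle c1 (s(r := w)) n s' \<Longrightarrow> n + 2 \<le> n' \<Longrightarrow> exle (CASE r c0 c1 c2) s n' s'"
  "s r = True # w \<Longrightarrow> exle c2 (s(r := w)) n s' \<Longrightarrow> n + 2 \<le> n' \<Longrightarrow> exle (CASE r c0 c1 c2) s n' s'"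
proof -
  show "exle (CASE r c0 c1 c2) s n' s'" if c: "s r = []" and e: "exle c0 s n s'" and l: "n + 2 \<le> n'"
  proof -
    obtain t where "t \<le> n" "exec c0 s t s'" using e by (auto simp: exle_def)
    then show ?thesis using exec.CASE_Nil[of s r c0 t s' c1 c2] c l by (intro exleI[of _ s "t + 2"]) auto
  qed
  show "exle (CASE r c0 c1 c2) s n' s'" if c: "s r = False # w" and e: "exle c1 (s(r := w)) n s'" and l: "n + 2 \<le> n'"
  proof -
    obtain t where "t \<le> n" "exec c1 (s(r := w)) t s'" using e by (auto simp: exle_def)
    then show ?thesis using exec.CASE_False[of s r w c1 t s' c0 c2] c l by (intro exleI[of _ s "t + 2"]) auto
  qed
  show "exle (CASE r c0 c1 c2) s n' s'" if c: "s r = True # w" and e: "exle c2 (s(r := w)) n s'" and l: "n + 2 \<le> n'"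
  proof -
    obtain t where "t \<le> n" "exec c2 (s(r := w)) t s'" using e by (auto simp: exle_def)
    then show ?thesis using exec.CASE_True[of s r w c2 t s' c0 c1] c l by (intro exleI[of _ s "t + 2"]) auto
  qed
qed

lemma exle_CASE_False: "exle c1 s1 n s1' \<Longrightarrow> s r = False # w \<Longrightarrow> s1 = s(r := w) \<Longrightarrow> s' = s1' \<Longrightarrow> n + 2 \<le> n' \<Longrightarrow>
    exle (CASE r c0 c1 c2) s n' s'"
  by (rule exle_CASE(2)[of s r w]) simp_all

lemma exle_CASE_True: "exle c2 s1 n s1' \<Longrightarrow> s r = True # w \<Longrightarrow> s1 = s(r := w) \<Longrightarrow> s' = s1' \<Longrightarrow> n + 2 \<le> n' \<Longrightarrow>
    exle (CASE r c0 c1 c2) s n' s'"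
  by (rule exle_CASE(3)[of s r w]) simp_all

lemma exle_LOOP_Nil: "s r = [] \<Longrightarrow> 1 \<le> n \<Longrightarrow> s' = s \<Longrightarrow> exle (LOOP r c1 c2) s n s'"
  by (simp add: exleI[OF exec.LOOP_Nil])

lemma exle_LOOP_Cons:
  assumes "s r = b # w" "exle (if b then c2 else c1) (s(r := w)) n1 s1" "exle (LOOP r c1 c2) s1 n2 s2" "n1 + n2 + 2 \<le> n"
  shows "exle (LOOP r c1 c2) s n s2"
proof -
  obtain t1 t2 where t: "t1 \<le> n1" "exec (if b then c2 else c1) (s(r := w)) t1 s1" "t2 \<le> n2" "exec (LOOP r c1 c2) s1 t2 s2"
    using assms by (auto simp: exle_def)
  have "exec (LOOP r c1 c2) s (t1 + t2 + 2) s2"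
    using assms(1) t(2,4) exec.LOOP_True[of s r w c2 t1 s1 c1 t2 s2] exec.LOOP_False[of s r w c1 t1 s1 c2 t2 s2]
    by (cases b) simp_all
  then show ?thesis by (rule exleI) (use assms(4) t in simp)
qed

lemma exle_LOOP_True:
  assumes "exle c2 s0 n1 s1" "exle (LOOP r c1 c2) s1 n2 s2" "s r = True # w" "s0 = s(r := w)" "n1 + n2 + 2 \<le> n"
  shows "exle (LOOP r c1 c2) s n s2"
  by (rule exle_LOOP_Cons[where s=s, OF assms(3) _ assms(2,5)]) (use assms(1,4) in simp)

lemma exle_LOOP_False:
  assumes "exle c1 s0 n1 s1" "exle (LOOP r c1 c2) s1 n2 s2" "s r = False # w" "s0 = s(r := w)" "n1 + n2 + 2 \<le> n"
  shows "exle (LOOP r c1 c2) s n s2"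
  by (rule exle_LOOP_Cons[where s=s, OF assms(3) _ assms(2,5)]) (use assms(1,4) in simp)

text \<open>Every pushed bit is paid for by steps. Consequently a time bound is also a bound on the
  size of the result.\<close>

lemma exec_length: "exec c s t s' \<Longrightarrow> length (s' r) \<le> length (s r) + t"
proof (induction rule: exec.induct)
  case (LOOP_False s r' w c1 t1 s1 c2 t2 s2)
  have "length ((s(r' := w)) r) \<le> length (s r)" using LOOP_False(1) by simp
  then show ?case using LOOP_False by linarith
next
  case (LOOP_True s r' w c2 t1 s1 c1 t2 s2)
  have "length ((s(r' := w)) r) \<le> length (s r)" using LOOP_True(1) by simp
  then show ?case using LOOP_True by linarith
next
  case (CASE_False s r' w c1 t s' c0 c2)
  have "length ((s(r' := w)) r) \<le> length (s r)" using CASE_False(1) by simp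
  then show ?case using CASE_False by linarith
next
  case (CASE_True s r' w c1 t s' c0 c2)
  have "length ((s(r' := w)) r) \<le> length (s r)" using CASE_True(1) by simp
  then show ?case using CASE_True by linarith
qed auto

text \<open>A move between stacks reverses the word; a second move restores the order, which is why
  moves come in pairs below.\<close>

definition MOV :: "nat \<Rightarrow> nat \<Rightarrow> com" where
  "MOV a b = LOOP a (PUSH b False) (PUSH b True)"

definition DUP :: "nat \<Rightarrow> nat \<Rightarrow> nat \<Rightarrow> com" where
  "DUP a b c = LOOP a (PUSH b False ;; PUSH c False) (PUSH b True ;; PUSH c True)"

definition CLR :: "nat \<Rightarrow> com" where
  "CLR a = LOOP a SKIP SKIP"

fun PUSHES :: "nat \<Rightarrow> bool list \<Rightarrow> com" where
  "PUSHES r [] = SKIP"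
| "PUSHES r (b # bs) = PUSHES r bs ;; PUSH r b"

lemma exle_MOV:
  assumes "a \<noteq> b" "s' = s(a := [], b := rev (s a) @ s b)" "4 * length (s a) + 1 \<le> n"
  shows "exle (MOV a b) s n s'"
proof -
  have "s a = w \<Longrightarrow> exle (MOV a b) s (4 * length w + 1) (s(a := [], b := rev w @ s b))" for w s
  proof (induction w arbitrary: s)
    case Nil
    then show ?case unfolding MOV_def by (intro exle_LOOP_Nil) (simp_all add: fun_eq_iff)
  next
    case (Cons x w)
    let ?s1 = "s(a := w, b := x # s b)"
    have 1: "exle (if x then PUSH b True else PUSH b False) (s(a := w)) 2 ?s1"
      using assms(1) by (cases x) (simp_all add: exle_PUSH')
    have "exle (MOV a b) ?s1 (4 * length w + 1) (?s1(a := [], b := rev w @ ?s1 b))"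
      by (rule Cons.IH) (use assms(1) in simp)
    then have 2: "exle (MOV a b) ?s1 (4 * length w + 1) (s(a := [], b := rev (x # w) @ s b))"
      by (rule exle_cong) (use assms(1) in \<open>simp_all add: fun_eq_iff\<close>)
    show ?case unfolding MOV_def
      by (rule exle_LOOP_Cons[OF Cons.prems 1 2[unfolded MOV_def]]) simp
  qed
  from this[OF refl, of s] show ?thesis unfolding assms(2) by (rule exle_mono) (rule assms(3))
qed

lemma exle_DUP:
  assumes "a \<noteq> b" "a \<noteq> c" "b \<noteq> c" "s' = s(a := [], b := rev (s a) @ s b, c := rev (s a) @ s c)"
    and "6 * length (s a) + 1 \<le> n"
  shows "exle (DUP a b c) s n s'"
proof -
  have "s a = w \<Longrightarrow> exle (DUP a b c) s (6 * length w + 1) (s(a := [], b := rev w @ s b, c := rev w @ s c))" for w s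
  proof (induction w arbitrary: s)
    case Nil
    then show ?case unfolding DUP_def by (intro exle_LOOP_Nil) (simp_all add: fun_eq_iff)
  next
    case (Cons x w)
    let ?s1 = "s(a := w, b := x # s b, c := x # s c)"
    have p: "exle (PUSH b x) (s(a := w)) 2 (s(a := w, b := x # s b))"
      by (rule exle_PUSH') (use assms(1) in simp_all)
    have q: "exle (PUSH c x) (s(a := w, b := x # s b)) 2 ?s1"
      by (rule exle_PUSH') (use assms(1-3) in simp_all)
    have "exle (PUSH b x ;; PUSH c x) (s(a := w)) 4 ?s1" by (rule exle_SEQ[OF p q]) simp
    then have 1: "exle (if x then PUSH b True ;; PUSH c True else PUSH b False ;; PUSH c False) (s(a := w)) 4 ?s1"
      by (cases x) simp_all
    have "exle (DUP a b c) ?s1 (6 * length w + 1) (?s1(a := [], b := rev w @ ?s1 b, c := rev w @ ?s1 c))"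
      by (rule Cons.IH) (use assms(1-3) in simp)
    then have 2: "exle (DUP a b c) ?s1 (6 * length w + 1) (s(a := [], b := rev (x # w) @ s b, c := rev (x # w) @ s c))"
      by (rule exle_cong) (use assms(1-3) in \<open>simp_all add: fun_eq_iff\<close>)
    show ?case unfolding DUP_def
      by (rule exle_LOOP_Cons[OF Cons.prems 1 2[unfolded DUP_def]]) simp
  qed
  from this[OF refl, of s] show ?thesis unfolding assms(4) by (rule exle_mono) (rule assms(5))
qed

lemma exle_CLR:
  assumes "s' = s(a := [])" "2 * length (s a) + 1 \<le> n"
  shows "exle (CLR a) s n s'"
proof -
  have "s a = w \<Longrightarrow> exle (CLR a) s (2 * length w + 1) (s(a := []))" for w s
  proof (induction w arbitrary: s)
    case Nil
    then show ?case unfolding CLR_def by (intro exle_LOOP_Nil) (simp_all add: fun_eq_iff)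
  next
    case (Cons x w)
    have 1: "exle (if x then SKIP else SKIP) (s(a := w)) 0 (s(a := w))" by (simp add: exle_SKIP)
    have "exle (CLR a) (s(a := w)) (2 * length w + 1) ((s(a := w))(a := []))"
      by (rule Cons.IH) simp
    then have 2: "exle (CLR a) (s(a := w)) (2 * length w + 1) (s(a := []))" by simp
    show ?case unfolding CLR_def
      by (rule exle_LOOP_Cons[OF Cons.prems 1 2[unfolded CLR_def]]) simp
  qed
  from this[OF refl, of s] show ?thesis unfolding assms(1) by (rule exle_mono) (rule assms(2))
qed

lemma exle_PUSHES: "s' = s(r := bs @ s r) \<Longrightarrow> 2 * length bs \<le> n \<Longrightarrow> exle (PUSHES r bs) s n s'"
proof (induction bs arbitrary: n s')
  case (Cons b bs)
  have "exle (PUSHES r bs) s (2 * length bs) (s(r := bs @ s r))" by (rule Cons.IH) auto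
  moreover have "exle (PUSH r b) (s(r := bs @ s r)) 2 s'"
    using Cons.prems by (intro exle_PUSH') auto
  ultimately show ?case unfolding PUSHES.simps by (rule exle_SEQ) (use Cons.prems in simp)
qed (auto intro: exle_SKIP)

declare PUSHES.simps [simp del]

section \<open>A calculus of polynomial-time functions on tree codes\<close>

subsection \<open>Encoding as trees\<close>

datatype tree = Lf | Nd tree tree

fun tcode :: "tree \<Rightarrow> bool list" where
  "tcode Lf = [False]"
| "tcode (Nd a b) = True # tcode a @ tcode b"

text \<open>Injectivity lets equality of values be decided on their codes; prefix-freeness of
  \<open>tcode\<close> lets two codes be stored one after the other in a single register.\<close>

class enc =
  fixes code :: "'a \<Rightarrow> tree"
  assumes code_inj: "code x = code y \<Longrightarrow> x = y"

definition sz :: "'a::enc \<Rightarrow> nat" where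
  "sz x = length (tcode (code x))"

instantiation tree :: enc begin
definition "code t = (t :: tree)"
instance by standard (simp add: code_tree_def)
end

instantiation bool :: enc begin
definition "code b = (if b then Nd Lf Lf else Lf)"
instance by standard (simp add: code_bool_def split: if_splits)
end

instantiation prod :: (enc, enc) enc begin
definition "code p = Nd (code (fst p)) (code (snd p))"
instance by standard (auto simp: code_prod_def prod_eq_iff dest: code_inj)
end

primrec code_lst :: "'a::enc list \<Rightarrow> tree" where
  "code_lst [] = Lf"
| "code_lst (x # xs) = Nd (code x) (code_lst xs)"

instantiation list :: (enc) enc begin
definition "code xs = code_lst xs"
instance
proof
  fix xs ys :: "'a list"
  assume "code xs = code ys"
  then have "code_lst xs = code_lst ys" by (simp add: code_list_def)
  then show "xs = ys"
  proof (induction xs arbitrary: ys)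
    case Nil
    then show ?case by (cases ys) auto
  next
    case (Cons x xs)
    then show ?case by (cases ys) (auto dest: code_inj)
  qed
qed
end

lemma code_Nil [simp]: "code [] = Lf" and code_Cons [simp]: "code (x # xs) = Nd (code x) (code xs)"
  by (simp_all add: code_list_def)

lemma code_Pair [simp]: "code (x, y) = Nd (code x) (code y)"
  by (simp add: code_prod_def)

lemma sz_simps [simp]: "sz (x, y) = 1 + sz x + sz y" "sz ([] :: 'a::enc list) = 1" "sz (z # zs) = 1 + sz z + sz zs"
  by (simp_all add: sz_def)

lemma sz_code [simp]: "sz (code x) = sz x"
  by (simp add: sz_def code_tree_def)

lemma sz_ge_1: "1 \<le> sz x"
  unfolding sz_def by (cases "code x") auto

lemma sz_bool: "sz (b :: bool) \<le> 3"
  by (simp add: sz_def code_bool_def)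

subsection \<open>Polynomially bounded functions\<close>

lemma poly_bound_mono: "c \<le> d \<Longrightarrow> m \<le> n \<Longrightarrow> poly_bound c m \<le> poly_bound d n"
proof -
  assume cd: "c \<le> d" and mn: "m \<le> n"
  have "c * m ^ c \<le> d * n ^ d"
  proof (cases "c = 0 \<or> m = 0")
    case True
    have "c * m ^ c = 0"
    proof (cases "c = 0")
      case False
      then show ?thesis using True by (simp add: power_0_left)
    qed simp
    then show ?thesis by linarith
  next
    case False
    have "m ^ c \<le> n ^ c" using mn by (rule power_mono) simp
    also have "\<dots> \<le> n ^ d" using False mn cd by (intro power_increasing) auto
    finally show ?thesis using cd by (intro mult_le_mono)
  qed
  then show ?thesis using cd by (simp add: poly_bound_def)
qed

text \<open>A single \<open>k\<close> serves as coefficient, exponent and additive constant. This is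
  convenient because \<open>sz\<close> is at least 1, so that its powers increase with the
  exponent.\<close>

definition pbd :: "('a::enc \<Rightarrow> nat) \<Rightarrow> bool" where
  "pbd T \<longleftrightarrow> (\<exists>k. \<forall>x. T x \<le> poly_bound k (sz x))"

lemma pbd_le: "pbd S \<Longrightarrow> (\<And>x. T x \<le> S x) \<Longrightarrow> pbd T"
  unfolding pbd_def by (meson order_trans)

lemma pbd_const [intro]: "pbd (\<lambda>_. n)"
  unfolding pbd_def by (rule exI[of _ n]) (simp add: poly_bound_def)

lemma pbd_sz [intro]: "pbd sz"
  unfolding pbd_def by (rule exI[of _ 1]) (simp add: poly_bound_def)

lemma pbd_add [intro]:
  assumes "pbd S" "pbd T"
  shows "pbd (\<lambda>x. S x + T x)"
proof -
  obtain c d where "\<And>x. S x \<le> poly_bound c (sz x)" "\<And>x. T x \<le> poly_bound d (sz x)"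
    using assms by (auto simp: pbd_def)
  moreover have "poly_bound c (sz x) + poly_bound d (sz x) \<le> poly_bound (c + d) (sz x)" for x :: 'a
  proof -
    have "sz x ^ c \<le> sz x ^ (c + d)" "sz x ^ d \<le> sz x ^ (c + d)"
      using sz_ge_1[of x] by (intro power_increasing; simp)+
    then have "c * sz x ^ c + d * sz x ^ d \<le> c * sz x ^ (c + d) + d * sz x ^ (c + d)"
      by (intro add_mono mult_left_mono) auto
    then show ?thesis by (simp add: poly_bound_def distrib_right)
  qed
  ultimately have "S x + T x \<le> poly_bound (c + d) (sz x)" for x by (meson add_mono order_trans)
  then show ?thesis by (auto simp: pbd_def)
qed

lemma pbd_mult [intro]:
  assumes "pbd S" "pbd T"
  shows "pbd (\<lambda>x. S x * T x)"
proof -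
  obtain c d where b: "\<And>x. S x \<le> poly_bound c (sz x)" "\<And>x. T x \<le> poly_bound d (sz x)"
    using assms by (auto simp: pbd_def)
  define k where "k = 4 * c * d + c + d"
  have "poly_bound c (sz x) * poly_bound d (sz x) \<le> poly_bound k (sz x)" for x :: 'a
  proof -
    have p: "1 \<le> sz x ^ i" for i using sz_ge_1[of x] by (rule one_le_power)
    have "poly_bound c (sz x) * poly_bound d (sz x) \<le> (2 * c * sz x ^ c) * (2 * d * sz x ^ d)"
      using p[of c] p[of d] by (intro mult_mono) (auto simp: poly_bound_def)
    also have "\<dots> = 4 * c * d * sz x ^ (c + d)" by (simp add: power_add)
    also have "\<dots> \<le> k * sz x ^ k"
      using sz_ge_1[of x] by (intro mult_mono power_increasing) (auto simp: k_def)
    finally show ?thesis by (simp add: poly_bound_def)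
  qed
  then have "S x * T x \<le> poly_bound k (sz x)" for x using b mult_mono by (meson order_trans zero_le)
  then show ?thesis by (auto simp: pbd_def)
qed

lemma pbd_power: "pbd S \<Longrightarrow> pbd (\<lambda>x. S x ^ n)"
  by (induction n) auto

lemma pbd_poly_bound: "pbd S \<Longrightarrow> pbd (\<lambda>x. poly_bound k (S x))"
  unfolding poly_bound_def by (intro pbd_add pbd_mult pbd_power pbd_const)

lemma pbd_comp:
  assumes T: "pbd T" and S: "pbd (\<lambda>x. sz (f x))"
  shows "pbd (\<lambda>x. T (f x))"
proof -
  obtain k where "\<And>y. T y \<le> poly_bound k (sz y)" using T by (auto simp: pbd_def)
  then show ?thesis by (intro pbd_le[OF pbd_poly_bound[OF S]]) auto
qed

subsection \<open>Polynomial-time functions between encoded types\<close>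

text \<open>Input and output are in register 0, the other registers below \<open>m\<close> are used as scratch space
  and left empty, and the rest of the store is not touched.\<close>

definition runs :: "com \<Rightarrow> nat \<Rightarrow> tree \<Rightarrow> nat \<Rightarrow> tree \<Rightarrow> bool" where
  "runs c m x n y \<longleftrightarrow> (\<forall>s. s 0 = tcode x \<and> (\<forall>i. 0 < i \<and> i < m \<longrightarrow> s i = []) \<longrightarrow> exle c s n (s(0 := tcode y)))"

definition pt :: "('a::enc \<Rightarrow> 'b::enc) \<Rightarrow> bool" where
  "pt f \<longleftrightarrow> (\<exists>c m T. 0 < m \<and> pbd T \<and> (\<forall>x. runs c m (code x) (T x) (code (f x))))"

lemma runs_exle: "runs c m x n y \<Longrightarrow> s 0 = tcode x \<Longrightarrow> (\<And>i. 0 < i \<Longrightarrow> i < m \<Longrightarrow> s i = []) \<Longrightarrow>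
    s' = s(0 := tcode y) \<Longrightarrow> exle c s n s'"
  by (simp add: runs_def)

lemma runs_length: "runs c m x n y \<Longrightarrow> length (tcode y) \<le> length (tcode x) + n"
proof -
  assume "runs c m x n y"
  then have "exle c (\<lambda>i. if i = 0 then tcode x else []) n ((\<lambda>i. if i = 0 then tcode x else [])(0 := tcode y))"
    by (rule runs_exle) auto
  then obtain t where "t \<le> n" "exec c (\<lambda>i. if i = 0 then tcode x else []) t ((\<lambda>i. if i = 0 then tcode x else [])(0 := tcode y))"
    by (auto simp: exle_def)
  from exec_length[OF this(2), of 0] this(1) show ?thesis by simp
qed

lemma pt_pbd: "pt f \<Longrightarrow> pbd (\<lambda>x. sz (f x))"
proof -
  assume "pt f"
  then obtain c m T where T: "pbd T" and r: "\<And>x. runs c m (code x) (T x) (code (f x))" by (auto simp: pt_def)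
  have "sz (f x) \<le> sz x + T x" for x using runs_length[OF r, of x] by (simp add: sz_def)
  then show ?thesis by (rule pbd_le[OF pbd_add[OF pbd_sz T]])
qed

lemma pbd_comp_pt: "pbd T \<Longrightarrow> pt f \<Longrightarrow> pbd (\<lambda>x. T (f x))"
  by (blast intro: pbd_comp pt_pbd)

text \<open>Programs see nothing but codes. This makes it possible to move between types that share
  their codes, such as numbers and their lists of bits.\<close>

lemma pt_coerce: "pt f \<Longrightarrow> (\<And>x. code (g x) = code (f x)) \<Longrightarrow> pt g"
  by (simp add: pt_def)

lemma pt_id: "pt (\<lambda>x. x)"
  unfolding pt_def runs_def
  by (intro exI[of _ SKIP] exI[of _ 1] exI[of _ "\<lambda>_. 0"]) (auto intro: exle_SKIP simp: fun_upd_idem)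

lemma pt_code: "pt code"
  by (rule pt_coerce[OF pt_id]) (simp add: code_tree_def)

lemma pt_comp: "pt g \<Longrightarrow> pt f \<Longrightarrow> pt (\<lambda>x. g (f x))"
proof -
  assume g: "pt g" and f: "pt f"
  obtain c m T where F: "0 < m" "pbd T" "\<And>x. runs c m (code x) (T x) (code (f x))" using f by (auto simp: pt_def)
  obtain c' m' T' where G: "0 < m'" "pbd T'" "\<And>x. runs c' m' (code x) (T' x) (code (g x))" using g by (auto simp: pt_def)
  have "runs (c ;; c') (max m m') (code x) (T x + T' (f x)) (code (g (f x)))" for x
    unfolding runs_def
  proof clarify
    fix s :: store assume s: "s 0 = tcode (code x)" "\<forall>i. 0 < i \<and> i < max m m' \<longrightarrow> s i = []"
    have "exle c s (T x) (s(0 := tcode (code (f x))))" by (rule runs_exle[OF F(3)]) (use s in auto)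
    moreover have "exle c' (s(0 := tcode (code (f x)))) (T' (f x)) (s(0 := tcode (code (g (f x)))))"
      by (rule runs_exle[OF G(3)]) (use s in auto)
    ultimately show "exle (c ;; c') s (T x + T' (f x)) (s(0 := tcode (code (g (f x)))))" by (rule exle_SEQ) simp
  qed
  moreover have "pbd (\<lambda>x. T x + T' (f x))" using F(2) pbd_comp_pt[OF G(2) f] by (rule pbd_add)
  moreover have "0 < max m m'" using F by simp
  ultimately show ?thesis unfolding pt_def by blast
qed

lemma pt_const: "pt (\<lambda>_. c)"
proof -
  have "runs (CLR 0 ;; PUSHES 0 (tcode (code c))) 1 (code x) ((2 * sz x + 1) + 2 * sz c) (code c)" for x :: 'a
    unfolding runs_def
    by (intro allI impI exle_SEQ[OF exle_CLR[OF refl] exle_PUSHES]) (auto simp: sz_def)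
  moreover have "pbd (\<lambda>x :: 'a. (2 * sz x + 1) + 2 * sz c)" by (intro pbd_add pbd_mult pbd_const pbd_sz)
  ultimately show ?thesis unfolding pt_def by (intro exI[of _ "CLR 0 ;; PUSHES 0 (tcode (code c))"] exI[of _ 1]) auto
qed

definition SAVE :: "nat \<Rightarrow> com" where
  "SAVE m = MOV 0 m ;; DUP m 0 (m + 1)"

definition RESTORE :: "nat \<Rightarrow> com" where
  "RESTORE m = MOV (m + 1) (m + 2) ;; MOV (m + 2) 0"

lemma exle_SAVE:
  assumes "0 < m" "s m = []" "s (m + 1) = []" "s' = s(m + 1 := s 0)" "10 * length (s 0) + 2 \<le> n"
  shows "exle (SAVE m) s n s'"
proof -
  have "exle (MOV 0 m) s (4 * length (s 0) + 1) (s(0 := [], m := rev (s 0)))"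
    using assms by (intro exle_MOV) auto
  moreover have "exle (DUP m 0 (m + 1)) (s(0 := [], m := rev (s 0))) (6 * length (s 0) + 1) s'"
    using assms by (intro exle_DUP) (auto simp: fun_eq_iff)
  ultimately show ?thesis unfolding SAVE_def by (rule exle_SEQ) (use assms in simp)
qed

lemma exle_RESTORE:
  assumes "0 < m" "s 0 = []" "s (m + 2) = []" "s' = s(0 := s (m + 1), m + 1 := [])" "8 * length (s (m + 1)) + 2 \<le> n"
  shows "exle (RESTORE m) s n s'"
proof -
  have "exle (MOV (m + 1) (m + 2)) s (4 * length (s (m + 1)) + 1) (s(m + 1 := [], m + 2 := rev (s (m + 1))))"
    using assms by (intro exle_MOV) auto
  moreover have "exle (MOV (m + 2) 0) (s(m + 1 := [], m + 2 := rev (s (m + 1)))) (4 * length (s (m + 1)) + 1) s'"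
    using assms by (intro exle_MOV) (auto simp: fun_eq_iff)
  ultimately show ?thesis unfolding RESTORE_def by (rule exle_SEQ) (use assms in simp)
qed

lemma pt_Pair: "pt f \<Longrightarrow> pt g \<Longrightarrow> pt (\<lambda>x. (f x, g x))"
proof -
  assume f: "pt f" and g: "pt g"
  obtain c m1 T where F: "0 < m1" "pbd T" "\<And>x. runs c m1 (code x) (T x) (code (f x))" using f by (auto simp: pt_def)
  obtain c' m2 T' where G: "0 < m2" "pbd T'" "\<And>x. runs c' m2 (code x) (T' x) (code (g x))" using g by (auto simp: pt_def)
  define m where "m = max m1 m2"
  have m: "m1 \<le> m" "m2 \<le> m" "0 < m" using F by (auto simp: m_def)
  \<comment> \<open>All registers from \<open>m\<close> on lie beyond the scratch space of both
    programs. The first result waits, reversed, in register \<open>m\<close> while the saved input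
    is restored for the second program.\<close>
  define P where "P = SAVE m ;; c ;; MOV 0 m ;; RESTORE m ;; c' ;; MOV m 0 ;; PUSH 0 True"
  define B where "B x = (10 * sz x + 2) + (T x + ((4 * sz (f x) + 1) + ((8 * sz x + 2) + (T' x + ((4 * sz (f x) + 1) + 2)))))" for x
  have "runs P (m + 3) (code x) (B x) (code (f x, g x))" for x
    unfolding runs_def
  proof clarify
    fix s :: store assume s: "s 0 = tcode (code x)" "\<forall>i. 0 < i \<and> i < m + 3 \<longrightarrow> s i = []"
    let ?s1 = "s(m + 1 := tcode (code x))"
    let ?s2 = "?s1(0 := tcode (code (f x)))"
    let ?s3 = "?s1(0 := [], m := rev (tcode (code (f x))))"
    let ?s4 = "s(m := rev (tcode (code (f x))))"
    let ?s5 = "?s4(0 := tcode (code (g x)))"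
    let ?s6 = "s(0 := tcode (code (f x)) @ tcode (code (g x)))"
    have 1: "exle (SAVE m) s (10 * sz x + 2) ?s1" using s m by (intro exle_SAVE) (auto simp: sz_def)
    have 2: "exle c ?s1 (T x) ?s2" by (rule runs_exle[OF F(3)]) (use s m in auto)
    have 3: "exle (MOV 0 m) ?s2 (4 * sz (f x) + 1) ?s3" using s m by (intro exle_MOV) (auto simp: sz_def)
    have 4: "exle (RESTORE m) ?s3 (8 * sz x + 2) ?s4" using s m by (intro exle_RESTORE) (auto simp: sz_def fun_eq_iff)
    have 5: "exle c' ?s4 (T' x) ?s5" by (rule runs_exle[OF G(3)]) (use s m in auto)
    have 6: "exle (MOV m 0) ?s5 (4 * sz (f x) + 1) ?s6" using s m by (intro exle_MOV) (auto simp: sz_def fun_eq_iff)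
    have 7: "exle (PUSH 0 True) ?s6 2 (s(0 := tcode (code (f x, g x))))"
      using exle_PUSH[of 2 0 True ?s6] by simp
    show "exle P s (B x) (s(0 := tcode (code (f x, g x))))"
      unfolding P_def B_def
      by (rule exle_seq[OF 1 exle_seq[OF 2 exle_seq[OF 3 exle_seq[OF 4 exle_seq[OF 5 exle_seq[OF 6 7]]]]]])
  qed
  moreover have "pbd B" unfolding B_def
    by (intro pbd_add pbd_mult pbd_const pbd_sz F(2) G(2) pt_pbd[OF f])
  ultimately show ?thesis unfolding pt_def by (intro exI[of _ P] exI[of _ "m + 3"] exI[of _ B]) auto
qed

lemma pt_if: "pt b \<Longrightarrow> pt f \<Longrightarrow> pt g \<Longrightarrow> pt (\<lambda>x. if b x then f x else g x)"
proof -
  assume b: "pt b" and f: "pt f" and g: "pt g"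
  obtain c0 m0 T0 where H: "0 < m0" "pbd T0" "\<And>x. runs c0 m0 (code x) (T0 x) (code (b x))" using b by (auto simp: pt_def)
  obtain c m1 T where F: "0 < m1" "pbd T" "\<And>x. runs c m1 (code x) (T x) (code (f x))" using f by (auto simp: pt_def)
  obtain c' m2 T' where G: "0 < m2" "pbd T'" "\<And>x. runs c' m2 (code x) (T' x) (code (g x))" using g by (auto simp: pt_def)
  define m where "m = max m0 (max m1 m2)"
  have m: "m0 \<le> m" "m1 \<le> m" "m2 \<le> m" "0 < m" using H by (auto simp: m_def)
  define P where "P = SAVE m ;; c0 ;; CASE 0 SKIP (CLR 0 ;; RESTORE m ;; c') (CLR 0 ;; RESTORE m ;; c)"
  define B where "B x = (10 * sz x + 2) + (T0 x + ((5 + ((8 * sz x + 2) + (T x + T' x))) + 2))" for x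
  have "runs P (m + 3) (code x) (B x) (code (if b x then f x else g x))" for x
    unfolding runs_def
  proof clarify
    fix s :: store assume s: "s 0 = tcode (code x)" "\<forall>i. 0 < i \<and> i < m + 3 \<longrightarrow> s i = []"
    let ?s1 = "s(m + 1 := tcode (code x))"
    let ?s2 = "?s1(0 := tcode (code (b x)))"
    let ?r = "s(0 := tcode (code (if b x then f x else g x)))"
    have 1: "exle (SAVE m) s (10 * sz x + 2) ?s1" using s m by (intro exle_SAVE) (auto simp: sz_def)
    have 2: "exle c0 ?s1 (T0 x) ?s2" by (rule runs_exle[OF H(3)]) (use s m in auto)
    have 3: "exle (CLR 0 ;; RESTORE m ;; d) (?s1(0 := w)) (5 + ((8 * sz x + 2) + n)) ?r"
      if w: "length w \<le> 2" and d: "exle d s n ?r" for w d n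
    proof -
      have a: "exle (CLR 0) (?s1(0 := w)) 5 (?s1(0 := []))" using w by (intro exle_CLR) auto
      have b: "exle (RESTORE m) (?s1(0 := [])) (8 * sz x + 2) s"
        using s m by (intro exle_RESTORE) (auto simp: sz_def fun_eq_iff)
      show ?thesis by (rule exle_seq[OF a exle_seq[OF b d]])
    qed
    have 4: "exle (CASE 0 SKIP (CLR 0 ;; RESTORE m ;; c') (CLR 0 ;; RESTORE m ;; c)) ?s2
        ((5 + ((8 * sz x + 2) + (T x + T' x))) + 2) ?r"
    proof (cases "b x")
      case True
      have "exle c s (T x) ?r" by (rule runs_exle[OF F(3)]) (use s m True in auto)
      then have "exle (CLR 0 ;; RESTORE m ;; c) (?s1(0 := [False, False])) (5 + ((8 * sz x + 2) + T x)) ?r" by (intro 3) auto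
      then show ?thesis using True by (intro exle_CASE(3)[where w="[False, False]"]) (auto simp: code_bool_def)
    next
      case False
      have "exle c' s (T' x) ?r" by (rule runs_exle[OF G(3)]) (use s m False in auto)
      then have "exle (CLR 0 ;; RESTORE m ;; c') (?s1(0 := [])) (5 + ((8 * sz x + 2) + T' x)) ?r" by (intro 3) auto
      then show ?thesis using False by (intro exle_CASE(2)[where w="[]"]) (auto simp: code_bool_def)
    qed
    show "exle P s (B x) ?r" unfolding P_def B_def by (rule exle_seq[OF 1 exle_seq[OF 2 4]])
  qed
  moreover have "pbd B" unfolding B_def by (intro pbd_add pbd_mult pbd_const pbd_sz F(2) G(2) H(2))
  ultimately show ?thesis unfolding pt_def by (intro exI[of _ P] exI[of _ "m + 3"] exI[of _ B]) auto
qed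

fun tfst :: "tree \<Rightarrow> tree" where "tfst Lf = Lf" | "tfst (Nd a b) = a"
fun tsnd :: "tree \<Rightarrow> tree" where "tsnd Lf = Lf" | "tsnd (Nd a b) = b"

definition SPLIT :: com where
  "SPLIT = (let B = CASE 0 SKIP (PUSH 2 False) (PUSH 2 True ;; PUSH 1 True ;; PUSH 1 True) in LOOP 1 B B)"

text \<open>Register 1 counts, in unary, the subtrees that are still to be read.\<close>

lemma exle_SPLIT_tree:
  assumes "exle SPLIT (s(0 := z, 1 := ws, 2 := rev (tcode a) @ y)) n s'" "n + 10 * length (tcode a) \<le> n'"
  shows "exle SPLIT (s(0 := tcode a @ z, 1 := True # ws, 2 := y)) n' s'"
  using assms
proof (induction a arbitrary: z ws y n n')
  case Lf
  let ?B = "CASE 0 SKIP (PUSH 2 False) (PUSH 2 True ;; PUSH 1 True ;; PUSH 1 True)"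
  have "exle (PUSH 2 False) (s(0 := z, 1 := ws, 2 := y)) 2 (s(0 := z, 1 := ws, 2 := False # y))"
    by (rule exle_PUSH') (auto simp: fun_eq_iff)
  then have B: "exle ?B (s(0 := False # z, 1 := ws, 2 := y)) 4 (s(0 := z, 1 := ws, 2 := False # y))"
    by (rule exle_CASE_False[where w=z]) (simp_all add: fun_eq_iff)
  have L: "exle (LOOP 1 ?B ?B) (s(0 := z, 1 := ws, 2 := rev (tcode Lf) @ y)) n s'"
    using Lf(1) unfolding SPLIT_def Let_def .
  then have L': "exle (LOOP 1 ?B ?B) (s(0 := z, 1 := ws, 2 := False # y)) n s'" by simp
  show ?case unfolding SPLIT_def Let_def
    by (rule exle_LOOP_True[OF B L', where w=ws]) (use Lf(2) in \<open>simp_all add: fun_eq_iff\<close>)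
next
  case (Nd a b)
  let ?B = "CASE 0 SKIP (PUSH 2 False) (PUSH 2 True ;; PUSH 1 True ;; PUSH 1 True)"
  let ?z = "tcode a @ tcode b @ z"
  let ?s1 = "s(0 := ?z, 1 := True # True # ws, 2 := True # y)"
  have 1: "exle (PUSH 2 True) (s(0 := ?z, 1 := ws, 2 := y)) 2 (s(0 := ?z, 1 := ws, 2 := True # y))"
    by (rule exle_PUSH') (auto simp: fun_eq_iff)
  have 2: "exle (PUSH 1 True) (s(0 := ?z, 1 := ws, 2 := True # y)) 2 (s(0 := ?z, 1 := True # ws, 2 := True # y))"
    by (rule exle_PUSH') (auto simp: fun_eq_iff)
  have 3: "exle (PUSH 1 True) (s(0 := ?z, 1 := True # ws, 2 := True # y)) 2 ?s1"
    by (rule exle_PUSH') (auto simp: fun_eq_iff)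
  have "exle (PUSH 2 True ;; PUSH 1 True ;; PUSH 1 True) (s(0 := ?z, 1 := ws, 2 := y)) 6 ?s1"
    by (rule exle_mono[OF exle_seq[OF 1 exle_seq[OF 2 3]]]) simp
  then have B: "exle ?B (s(0 := True # ?z, 1 := ws, 2 := y)) 8 ?s1"
    by (rule exle_CASE_True[where w="?z"]) (simp_all add: fun_eq_iff)
  have "exle SPLIT (s(0 := tcode b @ z, 1 := True # ws, 2 := rev (tcode a) @ True # y)) (n + 10 * length (tcode b)) s'"
    by (rule Nd.IH(2)[OF _ order_refl]) (use Nd.prems(1) in simp)
  then have "exle SPLIT ?s1 (n + 10 * length (tcode b) + 10 * length (tcode a)) s'"
    by (rule Nd.IH(1)) simp
  then have L: "exle (LOOP 1 ?B ?B) ?s1 (n + 10 * length (tcode b) + 10 * length (tcode a)) s'"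
    by (simp add: SPLIT_def Let_def)
  show ?case unfolding SPLIT_def Let_def
    by (rule exle_LOOP_True[OF B L, where w=ws]) (use Nd.prems(2) in \<open>simp_all add: fun_eq_iff\<close>)
qed

lemma exle_SPLIT:
  assumes "s 1 = []" "s 2 = []" "10 * length (tcode a) + 3 \<le> n"
  shows "exle (PUSH 1 True ;; SPLIT) (s(0 := tcode a @ z)) n (s(0 := z, 2 := rev (tcode a)))"
proof -
  have "exle SPLIT (s(0 := z, 2 := rev (tcode a))) 1 (s(0 := z, 2 := rev (tcode a)))"
    unfolding SPLIT_def Let_def using assms by (intro exle_LOOP_Nil) auto
  moreover have "s(0 := z, 1 := [], 2 := rev (tcode a) @ []) = s(0 := z, 2 := rev (tcode a))"
    using assms by (auto simp: fun_eq_iff)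
  ultimately have "exle SPLIT (s(0 := tcode a @ z, 1 := [True], 2 := [])) (1 + 10 * length (tcode a)) (s(0 := z, 2 := rev (tcode a)))"
    by (intro exle_SPLIT_tree[where n=1]) auto
  note L = this
  have P: "exle (PUSH 1 True) (s(0 := tcode a @ z)) 2 (s(0 := tcode a @ z, 1 := [True], 2 := []))"
    using assms by (intro exle_PUSH') (auto simp: fun_eq_iff)
  show ?thesis by (rule exle_SEQ[OF P L]) (use assms(3) in simp)
qed

lemma pt_tfst: "pt tfst"
proof -
  define P where "P = CASE 0 SKIP (PUSH 0 False) ((PUSH 1 True ;; SPLIT) ;; CLR 0 ;; MOV 2 0)"
  have "runs P 3 (code x) (16 * sz x + 9) (code (tfst x))" for x
    unfolding runs_def
  proof clarify
    fix s :: store assume s: "s 0 = tcode (code x)" "\<forall>i. 0 < i \<and> i < 3 \<longrightarrow> s i = []"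
    show "exle P s (16 * sz x + 9) (s(0 := tcode (code (tfst x))))"
    proof (cases x)
      case Lf
      have "exle (PUSH 0 False) (s(0 := [])) 2 (s(0 := [False]))" using exle_PUSH[of 2 0 False "s(0 := [])"] by simp
      then show ?thesis unfolding P_def using s Lf
        by (intro exle_CASE(2)[where w="[]"]) (auto simp: code_tree_def)
    next
      case (Nd a b)
      have 1: "exle (PUSH 1 True ;; SPLIT) (s(0 := tcode a @ tcode b)) (10 * length (tcode a) + 3) (s(0 := tcode b, 2 := rev (tcode a)))"
        using s by (intro exle_SPLIT) auto
      have 2: "exle (CLR 0) (s(0 := tcode b, 2 := rev (tcode a))) (2 * length (tcode b) + 1) (s(0 := [], 2 := rev (tcode a)))"
        by (intro exle_CLR) (auto simp: fun_eq_iff)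
      have 3: "exle (MOV 2 0) (s(0 := [], 2 := rev (tcode a))) (4 * length (tcode a) + 1) (s(0 := tcode a))"
        using s by (intro exle_MOV) (auto simp: fun_eq_iff)
      have "exle ((PUSH 1 True ;; SPLIT) ;; CLR 0 ;; MOV 2 0) (s(0 := tcode a @ tcode b)) (14 * sz x + 5) (s(0 := tcode a))"
        by (rule exle_SEQ[OF 1 exle_SEQ[OF 2 3 order_refl]]) (simp add: Nd sz_def code_tree_def)
      then show ?thesis unfolding P_def using s Nd
        by (intro exle_CASE(3)[where w="tcode a @ tcode b"]) (auto simp: code_tree_def)
    qed
  qed
  moreover have "pbd (\<lambda>x :: tree. 16 * sz x + 9)" by (intro pbd_add pbd_mult pbd_const pbd_sz)
  ultimately show ?thesis unfolding pt_def by (intro exI[of _ P] exI[of _ 3]) auto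
qed

lemma pt_tsnd: "pt tsnd"
proof -
  define P where "P = CASE 0 SKIP (PUSH 0 False) ((PUSH 1 True ;; SPLIT) ;; CLR 2)"
  have "runs P 3 (code x) (16 * sz x + 9) (code (tsnd x))" for x
    unfolding runs_def
  proof clarify
    fix s :: store assume s: "s 0 = tcode (code x)" "\<forall>i. 0 < i \<and> i < 3 \<longrightarrow> s i = []"
    show "exle P s (16 * sz x + 9) (s(0 := tcode (code (tsnd x))))"
    proof (cases x)
      case Lf
      have "exle (PUSH 0 False) (s(0 := [])) 2 (s(0 := [False]))" using exle_PUSH[of 2 0 False "s(0 := [])"] by simp
      then show ?thesis unfolding P_def using s Lf
        by (intro exle_CASE(2)[where w="[]"]) (auto simp: code_tree_def)
    next
      case (Nd a b)
      have 1: "exle (PUSH 1 True ;; SPLIT) (s(0 := tcode a @ tcode b)) (10 * length (tcode a) + 3) (s(0 := tcode b, 2 := rev (tcode a)))"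
        using s by (intro exle_SPLIT) auto
      have 2: "exle (CLR 2) (s(0 := tcode b, 2 := rev (tcode a))) (2 * length (tcode a) + 1) (s(0 := tcode b))"
        using s by (intro exle_CLR) (auto simp: fun_eq_iff)
      have "exle ((PUSH 1 True ;; SPLIT) ;; CLR 2) (s(0 := tcode a @ tcode b)) (12 * sz x + 4) (s(0 := tcode b))"
        by (rule exle_SEQ[OF 1 2]) (simp add: Nd sz_def code_tree_def)
      then show ?thesis unfolding P_def using s Nd
        by (intro exle_CASE(3)[where w="tcode a @ tcode b"]) (auto simp: code_tree_def)
    qed
  qed
  moreover have "pbd (\<lambda>x :: tree. 16 * sz x + 9)" by (intro pbd_add pbd_mult pbd_const pbd_sz)
  ultimately show ?thesis unfolding pt_def by (intro exI[of _ P] exI[of _ 3]) auto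
qed

lemma pt_is_Nd: "pt (\<lambda>t. t \<noteq> Lf)"
proof -
  define P where "P = CASE 0 SKIP (PUSH 0 False) (CLR 0 ;; PUSHES 0 [True, False, False])"
  have "runs P 1 (code x) (2 * sz x + 9) (code (x \<noteq> Lf))" for x
    unfolding runs_def
  proof clarify
    fix s :: store assume s: "s 0 = tcode (code x)"
    show "exle P s (2 * sz x + 9) (s(0 := tcode (code (x \<noteq> Lf))))"
    proof (cases x)
      case Lf
      have "exle (PUSH 0 False) (s(0 := [])) 2 (s(0 := [False]))" using exle_PUSH[of 2 0 False "s(0 := [])"] by simp
      then show ?thesis unfolding P_def using s Lf
        by (intro exle_CASE(2)[where w="[]"]) (auto simp: code_tree_def code_bool_def)
    next
      case (Nd a b)
      have 1: "exle (CLR 0) (s(0 := tcode a @ tcode b)) (2 * length (tcode a @ tcode b) + 1) (s(0 := []))"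
        by (intro exle_CLR) auto
      have 2: "exle (PUSHES 0 [True, False, False]) (s(0 := [])) 6 (s(0 := [True, False, False]))"
        by (intro exle_PUSHES) auto
      have "exle (CLR 0 ;; PUSHES 0 [True, False, False]) (s(0 := tcode a @ tcode b)) (2 * sz x + 7) (s(0 := [True, False, False]))"
        by (rule exle_SEQ[OF 1 2]) (simp add: Nd sz_def code_tree_def)
      then show ?thesis unfolding P_def using s Nd
        by (intro exle_CASE(3)[where w="tcode a @ tcode b"]) (auto simp: code_tree_def code_bool_def)
    qed
  qed
  moreover have "pbd (\<lambda>x :: tree. 2 * sz x + 9)" by (intro pbd_add pbd_mult pbd_const pbd_sz)
  ultimately show ?thesis unfolding pt_def by (intro exI[of _ P] exI[of _ 1]) auto
qed

text \<open>A copy of the initial value is the loop counter, one bit per round. The bound on all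
  iterates has to be assumed, since iterating a polynomial-time function can blow up the
  size.\<close>

lemma pt_iterate:
  fixes f :: "'b::enc \<Rightarrow> 'b" and i :: "'a::enc \<Rightarrow> 'b"
  assumes f: "pt f" and i: "pt i" and S: "pbd S" and b: "\<And>x j. j \<le> sz (i x) \<Longrightarrow> sz ((f ^^ j) (i x)) \<le> S x"
  shows "pt (\<lambda>x. (f ^^ sz (i x)) (i x))"
proof -
  obtain c0 m0 T0 where I: "0 < m0" "pbd T0" "\<And>x. runs c0 m0 (code x) (T0 x) (code (i x))" using i by (auto simp: pt_def)
  obtain c m1 T where F: "0 < m1" "pbd T" "\<And>x. runs c m1 (code x) (T x) (code (f x))" using f by (auto simp: pt_def)
  obtain k where k: "\<And>x. T x \<le> poly_bound k (sz x)" using F(2) by (auto simp: pbd_def)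
  define m where "m = max m0 m1"
  have m: "m0 \<le> m" "m1 \<le> m" "0 < m" using I by (auto simp: m_def)
  define P where "P = c0 ;; SAVE m ;; LOOP (m + 1) c c"
  define B where "B x = T0 x + ((10 * sz (i x) + 2) + (sz (i x) * (poly_bound k (S x) + 2) + 1))" for x
  have "runs P (m + 3) (code x) (B x) (code ((f ^^ sz (i x)) (i x)))" for x
    unfolding runs_def
  proof clarify
    fix s :: store assume s: "s 0 = tcode (code x)" "\<forall>i. 0 < i \<and> i < m + 3 \<longrightarrow> s i = []"
    let ?s0 = "s(0 := tcode (code (i x)))"
    let ?s1 = "?s0(m + 1 := tcode (code (i x)))"
    have 0: "exle c0 s (T0 x) ?s0" by (rule runs_exle[OF I(3)]) (use s m in auto)
    have 1: "exle (SAVE m) ?s0 (10 * sz (i x) + 2) ?s1" using s m by (intro exle_SAVE) (auto simp: sz_def)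
    have 2: "exle (LOOP (m + 1) c c) (s(0 := tcode (code ((f ^^ j) (i x))), m + 1 := w))
        (length w * (poly_bound k (S x) + 2) + 1) (s(0 := tcode (code ((f ^^ (j + length w)) (i x)))))"
      if "j + length w \<le> sz (i x)" for j w
      using that
    proof (induction w arbitrary: j)
      case Nil
      show ?case by (rule exle_LOOP_Nil) (use s m in \<open>auto simp: fun_eq_iff\<close>)
    next
      case (Cons a w)
      let ?y = "(f ^^ j) (i x)"
      have "T ?y \<le> poly_bound k (sz ?y)" by (rule k)
      also have "\<dots> \<le> poly_bound k (S x)" using Cons.prems b[of j x] by (intro poly_bound_mono) auto
      finally have T: "T ?y \<le> poly_bound k (S x)" .
      have "exle c (s(0 := tcode (code ?y), m + 1 := w)) (T ?y) (s(0 := tcode (code (f ?y)), m + 1 := w))"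
        by (rule runs_exle[OF F(3)]) (use s m in \<open>auto simp: fun_eq_iff\<close>)
      then have c: "exle (if a then c else c) ((s(0 := tcode (code ?y), m + 1 := a # w))(m + 1 := w)) (poly_bound k (S x))
          (s(0 := tcode (code ((f ^^ Suc j) (i x))), m + 1 := w))"
        using T exle_mono by auto
      have "Suc j + length w \<le> sz (i x)" using Cons.prems by simp
      have e: "Suc j + length w = j + length (a # w)" by simp
      show ?case
        by (rule exle_LOOP_Cons[where b=a and w=w, OF _ c Cons.IH[OF \<open>Suc j + length w \<le> sz (i x)\<close>, unfolded e]]) simp_all
    qed
    have "exle (LOOP (m + 1) c c) ?s1 (sz (i x) * (poly_bound k (S x) + 2) + 1) (s(0 := tcode (code ((f ^^ sz (i x)) (i x)))))"
      using 2[of 0 "tcode (code (i x))"] by (simp add: sz_def)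
    then show "exle P s (B x) (s(0 := tcode (code ((f ^^ sz (i x)) (i x)))))"
      unfolding P_def B_def by (rule exle_seq[OF 0 exle_seq[OF 1]])
  qed
  moreover have "pbd B" unfolding B_def
    by (intro pbd_add pbd_mult pbd_const pbd_sz I(2) pt_pbd[OF i] pbd_poly_bound S)
  ultimately show ?thesis unfolding pt_def by (intro exI[of _ P] exI[of _ "m + 3"] exI[of _ B]) auto
qed

subsection \<open>Words on tapes\<close>

lemma sz_bools: "sz (w :: bool list) \<le> 4 * length w + 1"
  using sz_bool by (induction w) (auto intro: order_trans[OF add_mono])

lemma length_le_sz: "length w \<le> sz w"
  by (induction w) auto

text \<open>The move leaves the last bit on top, so list cells are prepended in the right order. A
  cell is the node mark \<open>True\<close> followed by the code of the bit, which is
  \<open>[False]\<close> or \<open>[True, False, False]\<close>.\<close>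

definition READ :: com where
  "READ = MOV 0 1 ;; PUSH 0 False ;;
     LOOP 1 (PUSHES 0 [True, False]) (PUSHES 0 [True, True, False, False])"

definition WRITE :: com where
  "WRITE = LOOP 0 SKIP (CASE 0 SKIP (PUSH 1 False) (CASE 0 SKIP (CASE 0 SKIP (PUSH 1 True) SKIP) SKIP)) ;; MOV 1 0"

lemma exle_READ:
  assumes "s 0 = w" "s 1 = []"
  shows "exle READ s (14 * length w + 4) (s(0 := tcode (code w)))"
proof -
  let ?L = "LOOP 1 (PUSHES 0 [True, False]) (PUSHES 0 [True, True, False, False])"
  have loop: "exle ?L (s(0 := tcode (code v), 1 := rev u)) (10 * length u + 1) (s(0 := tcode (code (u @ v))))" for u v
  proof (induction u arbitrary: v rule: rev_induct)
    case Nil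
    show ?case by (rule exle_LOOP_Nil) (use assms in \<open>auto simp: fun_eq_iff\<close>)
  next
    case (snoc b u)
    have 1: "exle (if b then PUSHES 0 [True, True, False, False] else PUSHES 0 [True, False])
        ((s(0 := tcode (code v), 1 := b # rev u))(1 := rev u)) 8 (s(0 := tcode (code (b # v)), 1 := rev u))"
      by (cases b) (auto intro!: exle_PUSHES simp: code_bool_def fun_eq_iff)
    have "exle ?L (s(0 := tcode (code v), 1 := b # rev u)) (10 * length (u @ [b]) + 1) (s(0 := tcode (code (u @ b # v))))"
      by (rule exle_LOOP_Cons[OF _ 1 snoc[of "b # v"]]) auto
    then show ?case by (rule exle_cong) (auto simp: fun_eq_iff)
  qed
  have loop': "exle ?L (s(0 := tcode (code ([] :: bool list)), 1 := rev u)) (10 * length u + 1) (s(0 := tcode (code u)))" for u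
    using loop[of "[]" u] by (simp only: append_Nil2)
  have 1: "exle (MOV 0 1) s (4 * length w + 1) (s(0 := [], 1 := rev w))" using assms by (intro exle_MOV) auto
  have 2: "exle (PUSH 0 False) (s(0 := [], 1 := rev w)) 2 (s(0 := tcode (code ([] :: bool list)), 1 := rev w))"
    by (rule exle_PUSH') (auto simp: fun_eq_iff)
  show ?thesis unfolding READ_def
    by (rule exle_mono[OF exle_seq[OF 1 exle_seq[OF 2 loop'[of w]]]]) auto
qed

lemma exle_WRITE:
  assumes "s 0 = tcode (code w)" "s 1 = []"
  shows "exle WRITE s (14 * length w + 4) (s(0 := w))"
proof -
  let ?B = "CASE 0 SKIP (PUSH 1 False) (CASE 0 SKIP (CASE 0 SKIP (PUSH 1 True) SKIP) SKIP)"
  have loop: "exle (LOOP 0 SKIP ?B) (s(0 := tcode (code v), 1 := rev u)) (10 * length v + 3) (s(0 := [], 1 := rev (u @ v)))"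
    for u v :: "bool list"
  proof (induction v arbitrary: u)
    case Nil
    have L: "exle (LOOP 0 SKIP ?B) (s(0 := [], 1 := rev u)) 1 (s(0 := [], 1 := rev (u @ [])))" by (rule exle_LOOP_Nil) auto
    have 1: "exle SKIP (s(0 := [], 1 := rev u)) 0 (s(0 := [], 1 := rev u))" by (rule exle_SKIP)
    show ?case
      by (rule exle_LOOP_False[OF 1 L, where w="[]"]) (simp_all add: fun_eq_iff)
  next
    case (Cons b v)
    let ?s1 = "s(0 := tcode (code v), 1 := rev (u @ [b]))"
    have P: "exle (PUSH 1 b) (s(0 := tcode (code v), 1 := rev u)) 2 ?s1"
      by (rule exle_PUSH') (auto simp: fun_eq_iff)
    have B: "exle ?B (s(0 := tcode (code b) @ tcode (code v), 1 := rev u)) 8 ?s1"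
    proof (cases b)
      case False
      have "b = False" using False by simp
      show ?thesis
        by (rule exle_CASE_False[OF P[unfolded \<open>b = False\<close>], where w="tcode (code v)"])
          (use False in \<open>simp_all add: code_bool_def fun_eq_iff\<close>)
    next
      case True
      have "b = True" using True by simp
      have "exle (CASE 0 SKIP (PUSH 1 True) SKIP) (s(0 := False # tcode (code v), 1 := rev u)) 4 ?s1"
        by (rule exle_CASE_False[where w="tcode (code v)", OF P[unfolded \<open>b = True\<close>]]) (use True in \<open>simp_all add: fun_eq_iff\<close>)
      then have "exle (CASE 0 SKIP (CASE 0 SKIP (PUSH 1 True) SKIP) SKIP) (s(0 := False # False # tcode (code v), 1 := rev u)) 6 ?s1"
        by (rule exle_CASE_False[where w="False # tcode (code v)"]) (simp_all add: fun_eq_iff)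
      then show ?thesis
        by (rule exle_CASE_True[where w="False # False # tcode (code v)"]) (use True in \<open>simp_all add: code_bool_def fun_eq_iff\<close>)
    qed
    have "exle (LOOP 0 SKIP ?B) (s(0 := tcode (code (b # v)), 1 := rev u)) (10 * length (b # v) + 3)
        (s(0 := [], 1 := rev ((u @ [b]) @ v)))"
      by (rule exle_LOOP_True[OF B Cons.IH[of "u @ [b]"], where w="tcode (code b) @ tcode (code v)"]) (simp_all add: fun_eq_iff)
    then show ?case by (simp only: append.simps append_assoc)
  qed
  have 0: "s = s(0 := tcode (code w), 1 := rev [])" using assms by (auto simp: fun_eq_iff)
  have 1: "exle (LOOP 0 SKIP ?B) s (10 * length w + 3) (s(0 := [], 1 := rev w))"
    using loop[of w "[]"] by (rule exle_cong) (use 0 in auto)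
  have 2: "exle (MOV 1 0) (s(0 := [], 1 := rev w)) (4 * length w + 1) (s(0 := w))"
    using assms by (intro exle_MOV) (auto simp: fun_eq_iff)
  show ?thesis unfolding WRITE_def by (rule exle_SEQ[OF 1 2]) simp
qed

lemma poly_bound_linear: "\<exists>c'. \<forall>n. poly_bound c (a * n + b) \<le> poly_bound c' n"
proof -
  have le: "(n + 1) ^ c \<le> 2 ^ c * (n ^ c + 1)" for n :: nat
  proof (cases "n = 0")
    case False
    have "(n + 1) ^ c \<le> (2 * n) ^ c" using False by (intro power_mono) auto
    then show ?thesis by (simp add: power_mult_distrib distrib_left trans_le_add1)
  qed (simp add: trans_le_add1)
  define e where "e = c * (a + b) ^ c * 2 ^ c + c"
  have "poly_bound c (a * n + b) \<le> poly_bound e n" for n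
  proof -
    have "a * n + b \<le> (a + b) * (n + 1)" by (simp add: algebra_simps)
    then have "(a * n + b) ^ c \<le> ((a + b) * (n + 1)) ^ c" by (rule power_mono) simp
    also have "\<dots> = (a + b) ^ c * (n + 1) ^ c" by (rule power_mult_distrib)
    also have "\<dots> \<le> (a + b) ^ c * (2 ^ c * (n ^ c + 1))" using le by (rule mult_left_mono) simp
    finally have "c * (a * n + b) ^ c + c \<le> c * ((a + b) ^ c * (2 ^ c * (n ^ c + 1))) + c" by simp
    also have "\<dots> \<le> e * n ^ c + e" by (simp add: e_def algebra_simps)
    also have "\<dots> \<le> e * n ^ e + e"
    proof (cases "n = 0")
      case True
      have "c = 0 \<Longrightarrow> e = 0" by (simp add: e_def)
      then show ?thesis using True by (cases "c = 0") (simp_all add: power_0_left)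
    next
      case False
      then show ?thesis by (intro add_mono mult_mono power_increasing) (simp_all add: e_def)
    qed
    finally show ?thesis by (simp add: poly_bound_def)
  qed
  then show ?thesis by blast
qed

theorem pt_poly_time_fun:
  assumes f: "pt f"
  shows "poly_time_fun f"
proof -
  obtain c m T where F: "0 < m" "pbd T" "\<And>x. runs c m (code x) (T x) (code (f x))" using f by (auto simp: pt_def)
  have "pbd (\<lambda>x. T x + 16 * sz (f x))" using F(2) pt_pbd[OF f] by (intro pbd_add pbd_mult pbd_const)
  then obtain k where k: "\<And>x. T x + 16 * sz (f x) \<le> poly_bound k (sz x)" by (auto simp: pbd_def)
  obtain M where M: "turing_machine M" and run: "\<And>x t s'. exec (READ ;; c ;; WRITE) (\<lambda>r. if r = 0 then x else []) t s' \<Longrightarrow>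
      tm_outputs M x (s' 0) (t + 2 * length (s' 0) + 1)"
    by (rule com_turing_machine) blast
  obtain k' where k': "\<And>n. poly_bound k (4 * n + 1) \<le> poly_bound k' n" using poly_bound_linear[of k 4 1] by auto
  define e where "e = k' + 23"
  have "tm_outputs M x (f x) (poly_bound e (length x))" for x
  proof -
    let ?s = "\<lambda>r :: nat. if r = 0 then x else []"
    have 1: "exle READ ?s (14 * length x + 4) (?s(0 := tcode (code x)))" by (rule exle_READ) auto
    have 2: "exle c (?s(0 := tcode (code x))) (T x) (?s(0 := tcode (code (f x))))"
      by (rule runs_exle[OF F(3)]) auto
    have 3: "exle WRITE (?s(0 := tcode (code (f x)))) (14 * length (f x) + 4) ((?s(0 := tcode (code (f x))))(0 := f x))"
      by (rule exle_WRITE) auto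
    have "exle (READ ;; c ;; WRITE) ?s (14 * length x + 4 + (T x + (14 * length (f x) + 4))) ((?s(0 := tcode (code (f x))))(0 := f x))"
      by (rule exle_SEQ[OF 1 exle_SEQ[OF 2 3 order_refl] order_refl])
    then obtain t where t: "t \<le> 14 * length x + 4 + (T x + (14 * length (f x) + 4))"
      "exec (READ ;; c ;; WRITE) ?s t ((?s(0 := tcode (code (f x))))(0 := f x))" by (auto simp: exle_def)
    have "tm_outputs M x (f x) (t + 2 * length (f x) + 1)" using run[OF t(2)] by simp
    moreover have "t + 2 * length (f x) + 1 \<le> poly_bound e (length x)"
    proof -
      have "t + 2 * length (f x) + 1 \<le> 14 * length x + 9 + (T x + 16 * sz (f x))"
        using t(1) length_le_sz[of "f x"] by linarith
      also have "\<dots> \<le> 14 * length x + 9 + poly_bound k (sz x)" using k by simp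
      also have "\<dots> \<le> 14 * length x + 9 + poly_bound k (4 * length x + 1)"
        using sz_bools[of x] by (intro add_left_mono poly_bound_mono) auto
      also have "\<dots> \<le> 14 * length x + 9 + poly_bound k' (length x)" using k' by simp
      also have "\<dots> \<le> poly_bound e (length x)"
      proof (cases "length x = 0")
        case True
        have "poly_bound k' 0 \<le> k'" by (cases k') (auto simp: poly_bound_def)
        moreover have "e \<le> poly_bound e 0" by (simp add: poly_bound_def)
        ultimately show ?thesis using True by (simp add: e_def)
      next
        case False
        then have lx: "1 \<le> length x" by linarith
        have "length x ^ k' \<le> length x ^ e" using lx by (intro power_increasing) (simp_all add: e_def)
        moreover have "length x ^ 1 \<le> length x ^ e" using lx by (intro power_increasing) (simp_all add: e_def)
        ultimately have "k' * length x ^ k' + 14 * length x ^ 1 \<le> k' * length x ^ e + 14 * length x ^ e"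
          by (intro add_mono mult_left_mono) auto
        also have "\<dots> \<le> e * length x ^ e" by (simp add: e_def distrib_right)
        finally show ?thesis by (simp add: poly_bound_def e_def)
      qed
      finally show ?thesis .
    qed
    ultimately show ?thesis by (elim tm_outputs_mono) (simp only: of_nat_le_iff)
  qed
  then show ?thesis using M by (auto simp: poly_time_fun_def)
qed

subsection \<open>Pairs, booleans and lists\<close>

lemma pt_comp2: "pt (\<lambda>z. h (fst z) (snd z)) \<Longrightarrow> pt f \<Longrightarrow> pt g \<Longrightarrow> pt (\<lambda>x. h (f x) (g x))"
  by (drule pt_comp[OF _ pt_Pair]) simp_all

lemma pt_fst: "pt f \<Longrightarrow> pt (\<lambda>x. fst (f x))"
proof -
  have "pt (\<lambda>z :: 'b \<times> 'c. fst z)"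
    by (rule pt_coerce[OF pt_comp[OF pt_tfst pt_code]]) (simp add: code_prod_def code_tree_def)
  then show "pt f \<Longrightarrow> pt (\<lambda>x. fst (f x))" by (rule pt_comp)
qed

lemma pt_snd: "pt f \<Longrightarrow> pt (\<lambda>x. snd (f x))"
proof -
  have "pt (\<lambda>z :: 'b \<times> 'c. snd z)"
    by (rule pt_coerce[OF pt_comp[OF pt_tsnd pt_code]]) (simp add: code_prod_def code_tree_def)
  then show "pt f \<Longrightarrow> pt (\<lambda>x. snd (f x))" by (rule pt_comp)
qed

lemma pt_conj: "pt b \<Longrightarrow> pt c \<Longrightarrow> pt (\<lambda>x. b x \<and> c x)"
  by (rule pt_coerce[OF pt_if[of b c "\<lambda>_. False"]]) (simp_all add: pt_const)

lemma pt_disj: "pt b \<Longrightarrow> pt c \<Longrightarrow> pt (\<lambda>x. b x \<or> c x)"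
  by (rule pt_coerce[OF pt_if[of b "\<lambda>_. True" c]]) (simp_all add: pt_const)

lemma pt_not: "pt b \<Longrightarrow> pt (\<lambda>x. \<not> b x)"
  by (rule pt_coerce[OF pt_if[of b "\<lambda>_. False" "\<lambda>_. True"]]) (simp_all add: pt_const)

lemma pt_tl: "pt f \<Longrightarrow> pt (\<lambda>x. tl (f x))"
proof -
  have "pt (\<lambda>z :: 'b list. tl z)"
    by (rule pt_coerce[OF pt_comp[OF pt_tsnd pt_code]]) (case_tac x; simp add: code_tree_def)
  then show "pt f \<Longrightarrow> pt (\<lambda>x. tl (f x))" by (rule pt_comp)
qed

lemma pt_null: "pt f \<Longrightarrow> pt (\<lambda>x. f x = [])"
proof -
  have "pt (\<lambda>z :: 'b list. \<not> code z \<noteq> Lf)" by (intro pt_not pt_comp[OF pt_is_Nd pt_code])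
  then have "pt (\<lambda>z :: 'b list. z = [])"
    by (rule pt_coerce) (case_tac x; simp)
  then show "pt f \<Longrightarrow> pt (\<lambda>x. f x = [])" by (rule pt_comp)
qed

lemma pt_hd: "pt f \<Longrightarrow> pt (\<lambda>x. hd (f x))"
proof -
  \<comment> \<open>The head of the empty list is unspecified but fixed, so it can be built into the
    program as a constant.\<close>
  have "pt (\<lambda>z :: 'b list. if z = [] then code (hd [] :: 'b) else tfst (code z))"
    by (intro pt_if pt_const pt_null pt_id pt_comp[OF pt_tfst pt_code])
  then have "pt (\<lambda>z :: 'b list. hd z)"
    by (rule pt_coerce) (case_tac x; simp add: code_tree_def)
  then show "pt f \<Longrightarrow> pt (\<lambda>x. hd (f x))" by (rule pt_comp)
qed

lemma pt_Cons: "pt f \<Longrightarrow> pt g \<Longrightarrow> pt (\<lambda>x. f x # g x)"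
  by (rule pt_coerce[OF pt_Pair]) auto

lemmas pt_base = pt_const pt_id pt_fst pt_snd pt_Pair pt_if pt_conj pt_disj pt_not pt_tl pt_hd pt_null pt_Cons

lemma sz_drop: "sz (drop j l) \<le> sz l"
  by (induction l arbitrary: j) (auto simp: drop_Cons split: nat.split intro: le_SucI trans_le_add2)

lemma sz_elem: "e \<in> set l \<Longrightarrow> sz e \<le> sz l"
  by (induction l) auto

lemma sz_append: "sz (xs @ ys) \<le> sz xs + sz ys"
  by (induction xs) auto

lemma sz_hd_tl: "l \<noteq> [] \<Longrightarrow> sz l = 1 + sz (hd l) + sz (tl l)"
  by (cases l) auto

text \<open>The state of the iteration is the rest of the list, the accumulator and the parameter.
  There are more rounds than list elements, and the surplus ones are idle as the rest is then
  empty.\<close>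

lemma pt_foldl_bounded:
  assumes F: "pt (\<lambda>z. F (fst z) (fst (snd z)) (snd (snd z)))" and s: "pt s0" and l: "pt l" and S: "pbd S"
    and b: "\<And>x i. i \<le> length (l x) \<Longrightarrow> sz (foldl (F x) (s0 x) (take i (l x))) \<le> S x"
  shows "pt (\<lambda>x. foldl (F x) (s0 x) (l x))"
proof -
  define g where "g z = (if fst z = [] then z else (tl (fst z), F (snd (snd z)) (fst (snd z)) (hd (fst z)), snd (snd z)))" for z
  have g: "pt g" unfolding g_def
    by (intro pt_if pt_Pair pt_tl pt_null pt_fst pt_snd pt_id pt_comp[OF F, simplified] pt_hd)
       (rule pt_comp[OF F, of "\<lambda>z. (snd (snd z), fst (snd z), hd (fst z))", simplified], intro pt_base)
  have it: "(g ^^ j) (xs, s, x) = (drop j xs, foldl (F x) s (take j xs), x)" for j xs s x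
  proof (induction j arbitrary: xs s)
    case (Suc j)
    show ?case
    proof (cases xs)
      case Nil
      then have "g (xs, s, x) = (xs, s, x)" by (simp add: g_def)
      then show ?thesis using Nil Suc[of xs s] by (simp add: funpow_swap1)
    next
      case (Cons e ys)
      then have "g (xs, s, x) = (ys, F x s e, x)" by (simp add: g_def)
      then show ?thesis using Cons Suc[of ys "F x s e"] by (simp add: funpow_swap1)
    qed
  qed simp
  define i where "i x = (l x, s0 x, x)" for x
  have i: "pt i" unfolding i_def by (intro pt_Pair l s pt_id)
  have b': "sz (foldl (F x) (s0 x) (take j (l x))) \<le> S x" for j x
    using b[of j x] b[of "length (l x)" x] by (cases "j \<le> length (l x)") auto
  have "pt (\<lambda>x. (g ^^ sz (i x)) (i x))"
  proof (rule pt_iterate[OF g i])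
    show "pbd (\<lambda>x. 2 + sz (l x) + S x + sz x)" by (intro pbd_add pbd_const S pt_pbd[OF l] pbd_sz)
    show "sz ((g ^^ j) (i x)) \<le> 2 + sz (l x) + S x + sz x" for x j
      using b'[where j=j and x=x] sz_drop[of j "l x"] unfolding i_def it by simp
  qed
  then have "pt (\<lambda>x. fst (snd ((g ^^ sz (i x)) (i x))))" by (intro pt_fst pt_snd)
  moreover have "fst (snd ((g ^^ sz (i x)) (i x))) = foldl (F x) (s0 x) (l x)" for x
  proof -
    have "length (l x) \<le> sz (l x)" by (rule length_le_sz)
    then show ?thesis unfolding i_def it by simp
  qed
  ultimately show ?thesis by simp
qed

lemma foldl_measure:
  fixes \<mu> :: "'s \<Rightarrow> nat"
  assumes "\<And>s e. e \<in> set l \<Longrightarrow> \<mu> (F s e) \<le> \<mu> s + Q"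
  shows "\<mu> (foldl F s l) \<le> \<mu> s + length l * Q"
  using assms
proof (induction l arbitrary: s)
  case (Cons e l)
  have "\<mu> (foldl F (F s e) l) \<le> \<mu> (F s e) + length l * Q" by (rule Cons.IH) (use Cons.prems in auto)
  also have "\<mu> (F s e) \<le> \<mu> s + Q" using Cons.prems by simp
  finally show ?case by simp
qed simp

text \<open>The growth per step is additive and depends on the parameter and the element, never on
  the accumulator; summed over the list it stays polynomial. For numbers the measure is the bit
  length, so that even multiplication fits.\<close>

lemma pt_foldl_measure:
  fixes \<mu> :: "'s::enc \<Rightarrow> nat"
  assumes F: "pt (\<lambda>z. F (fst z) (fst (snd z)) (snd (snd z)))" and s: "pt s0" and l: "pt l"
    and \<mu>: "\<And>s. sz s \<le> c * \<mu> s + c" "pbd (\<lambda>x. \<mu> (s0 x))" and B: "pbd B"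
    and step: "\<And>x s e. e \<in> set (l x) \<Longrightarrow> \<mu> (F x s e) \<le> \<mu> s + B (x, e)"
  shows "pt (\<lambda>x. foldl (F x) (s0 x) (l x))"
proof -
  obtain k where k: "\<And>z. B z \<le> poly_bound k (sz z)" using B unfolding pbd_def by blast
  define Q where "Q x = poly_bound k (1 + sz x + sz (l x))" for x
  define S where "S x = c * (\<mu> (s0 x) + sz (l x) * Q x) + c" for x
  have S: "pbd S" unfolding S_def Q_def
    by (intro pbd_add pbd_mult pbd_const pbd_poly_bound \<mu>(2) pbd_sz pt_pbd[OF l])
  have "sz (foldl (F x) (s0 x) (take i (l x))) \<le> S x" for x i
  proof -
  have Q: "B (x, e) \<le> Q x" if "e \<in> set (l x)" for e
  proof -
    have "B (x, e) \<le> poly_bound k (sz (x, e))" by (rule k)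
    also have "\<dots> \<le> Q x" unfolding Q_def using sz_elem[OF that] by (intro poly_bound_mono) auto
    finally show ?thesis .
  qed
  have "\<mu> (foldl (F x) (s0 x) (take i (l x))) \<le> \<mu> (s0 x) + length (take i (l x)) * Q x"
  proof (rule foldl_measure)
    fix s e assume "e \<in> set (take i (l x))"
    then have "e \<in> set (l x)" by (rule in_set_takeD)
    from step[OF this, of s] Q[OF this] show "\<mu> (F x s e) \<le> \<mu> s + Q x" by linarith
  qed
  also have "\<dots> \<le> \<mu> (s0 x) + sz (l x) * Q x"
    using length_le_sz[of "l x"] by (intro add_left_mono mult_right_mono) auto
  finally have "c * \<mu> (foldl (F x) (s0 x) (take i (l x))) + c \<le> S x"
    unfolding S_def by (intro add_right_mono mult_left_mono) auto
  then show ?thesis using \<mu>(1) order_trans by blast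
  qed
  then show ?thesis by (intro pt_foldl_bounded[OF F s l S])
qed

lemma pt_foldl:
  assumes F: "pt (\<lambda>z. F (fst z) (fst (snd z)) (snd (snd z)))" and s: "pt s0" and l: "pt l" and B: "pbd B"
    and step: "\<And>x s e. e \<in> set (l x) \<Longrightarrow> sz (F x s e) \<le> sz s + B (x, e)"
  shows "pt (\<lambda>x. foldl (F x) (s0 x) (l x))"
  by (rule pt_foldl_measure[OF F s l _ pt_pbd[OF s] B step, of 1]) auto

lemma foldl_rev: "foldl (\<lambda>s e. f e # s) a l = rev (map f l) @ a"
  by (induction l arbitrary: a) auto

lemma pbd_snd: "pt f \<Longrightarrow> pbd (\<lambda>z. sz (f z) + n)"
  by (intro pbd_add pbd_const pt_pbd)

lemma pt_rev: "pt l \<Longrightarrow> pt (\<lambda>x. rev (l x))"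
proof -
  assume l: "pt l"
  have "pt (\<lambda>x. foldl (\<lambda>s e. e # s) [] (l x))"
    by (rule pt_foldl[where B="\<lambda>z. sz (snd z) + 1"]) (intro pt_base l pbd_snd | simp)+
  then show ?thesis by (simp add: foldl_rev[where f="\<lambda>e. e", simplified])
qed

lemma pt_map: "pt (\<lambda>z. f (fst z) (snd z)) \<Longrightarrow> pt l \<Longrightarrow> pt (\<lambda>x. map (f x) (l x))"
proof -
  assume f: "pt (\<lambda>z. f (fst z) (snd z))" and l: "pt l"
  have "pt (\<lambda>x. rev (foldl (\<lambda>s e. f x e # s) [] (l x)))"
    by (rule pt_rev, rule pt_foldl[where B="\<lambda>z. sz (f (fst z) (snd z)) + 1"]) (intro pt_base pt_comp2[OF f] l pbd_snd f | simp)+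
  then show ?thesis by (simp add: foldl_rev)
qed

lemma pt_append: "pt f \<Longrightarrow> pt g \<Longrightarrow> pt (\<lambda>x. f x @ g x)"
proof -
  assume f: "pt f" and g: "pt g"
  have "pt (\<lambda>x. foldl (\<lambda>s e. e # s) (g x) (rev (f x)))"
    by (rule pt_foldl[where B="\<lambda>z. sz (snd z) + 1"]) (intro pt_base f g pt_rev pbd_snd | simp)+
  then show ?thesis by (simp add: foldl_rev[where f="\<lambda>e. e", simplified])
qed

lemma pt_filter: "pt (\<lambda>z. P (fst z) (snd z)) \<Longrightarrow> pt l \<Longrightarrow> pt (\<lambda>x. filter (P x) (l x))"
proof -
  assume P: "pt (\<lambda>z. P (fst z) (snd z))" and l: "pt l"
  have P': "pt (\<lambda>z :: _ \<times> 'b list \<times> _. P (fst z) (snd (snd z)))" by (rule pt_comp2[OF P]) (intro pt_base)+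
  have "foldl (\<lambda>s e. if p e then e # s else s) a xs = rev (filter p xs) @ a" for p :: "'b \<Rightarrow> bool" and a xs
    by (induction xs arbitrary: a) auto
  moreover have "pt (\<lambda>x. rev (foldl (\<lambda>s e. if P x e then e # s else s) [] (l x)))"
    by (rule pt_rev, rule pt_foldl[where B="\<lambda>z. sz (snd z) + 1"]) (intro pt_base P' l pbd_snd | simp)+
  ultimately show ?thesis by simp
qed

lemma pt_concat: "pt l \<Longrightarrow> pt (\<lambda>x. concat (l x))"
proof -
  assume l: "pt l"
  have "foldl (\<lambda>s e. s @ e) a xs = a @ concat xs" for a and xs :: "'b list list"
    by (induction xs arbitrary: a) auto
  moreover have "pt (\<lambda>x. foldl (\<lambda>s e. s @ e) [] (l x))"
  proof (rule pt_foldl[where B="\<lambda>z. sz (snd z) + 0"])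
    show "sz (s @ e) \<le> sz s + (sz (snd (x, e)) + 0)" for s e :: "'b list" and x :: 'a using sz_append[of s e] by simp
  qed (intro pt_base l pbd_snd pt_append)+
  ultimately show ?thesis by simp
qed

lemma pt_bex: "pt (\<lambda>z. P (fst z) (snd z)) \<Longrightarrow> pt l \<Longrightarrow> pt (\<lambda>x. \<exists>e \<in> set (l x). P x e)"
proof -
  assume "pt (\<lambda>z. P (fst z) (snd z))" "pt l"
  then have "pt (\<lambda>x. filter (P x) (l x) \<noteq> [])" by (intro pt_not pt_null pt_filter)
  moreover have "(\<exists>e \<in> set (l x). P x e) \<longleftrightarrow> filter (P x) (l x) \<noteq> []" for x by (auto simp: filter_empty_conv)
  ultimately show ?thesis by simp
qed

lemma pt_ball: "pt (\<lambda>z. P (fst z) (snd z)) \<Longrightarrow> pt l \<Longrightarrow> pt (\<lambda>x. \<forall>e \<in> set (l x). P x e)"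
  using pt_not[OF pt_bex[OF pt_not]] by auto

lemma pt_zip: "pt f \<Longrightarrow> pt g \<Longrightarrow> pt (\<lambda>x. zip (f x) (g x))"
proof -
  assume f: "pt f" and g: "pt g"
  let ?F = "\<lambda>s e. if fst s = [] then s else (tl (fst s), (e, hd (fst s)) # snd s)"
  have e: "snd (foldl ?F (ys, a) xs) = rev (zip xs ys) @ a" for xs :: "'b list" and ys :: "'c list" and a
  proof (induction xs arbitrary: ys a)
    case (Cons x xs)
    have [simp]: "snd (foldl ?F ([], a) xs) = a" using Cons[of "[]" a] by simp
    show ?case using Cons by (cases ys) auto
  qed simp
  have "pt (\<lambda>x. rev (snd (foldl ?F (g x, []) (f x))))"
  proof (rule pt_rev, rule pt_snd, rule pt_foldl[where B="\<lambda>z. sz (snd z) + 1"])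
    show "sz (?F s e) \<le> sz s + (sz (snd (x, e)) + 1)" for s :: "'c list \<times> ('b \<times> 'c) list" and e :: 'b and x :: 'a
      using sz_hd_tl[of "fst s"] by (cases s) auto
  qed (intro pt_base f g pbd_snd)+
  then show ?thesis by (simp add: e)
qed

lemma pt_take_length: "pt f \<Longrightarrow> pt g \<Longrightarrow> pt (\<lambda>x. take (length (f x)) (g x))"
proof -
  assume "pt f" "pt g"
  then have "pt (\<lambda>x. map snd (zip (f x) (g x)))" by (intro pt_map[where f="\<lambda>_. snd"] pt_zip pt_base)
  then show ?thesis by (rule pt_coerce) (simp add: map_snd_zip_take min_def)
qed

lemma pt_drop_length: "pt f \<Longrightarrow> pt g \<Longrightarrow> pt (\<lambda>x. drop (length (f x)) (g x))"
proof -
  assume f: "pt f" and g: "pt g"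
  have "foldl (\<lambda>s e. tl s) ys xs = drop (length xs) ys" for xs :: "'b list" and ys :: "'c list"
    by (induction xs arbitrary: ys) (auto simp: drop_Suc)
  moreover have "pt (\<lambda>x. foldl (\<lambda>s e. tl s) (g x) (f x))"
  proof (rule pt_foldl[where B="\<lambda>_. 0"])
    show "sz (tl s) \<le> sz s + 0" for s :: "'c list" by (cases s) auto
  qed (intro pt_base f g pbd_const)+
  ultimately show ?thesis by simp
qed

section \<open>Equality tests and binary arithmetic\<close>

subsection \<open>Equality\<close>

text \<open>The second component is a stack of pairs that are still to be compared.\<close>

definition eq_step :: "bool \<times> (tree \<times> tree) list \<Rightarrow> bool \<times> (tree \<times> tree) list" where
  "eq_step z = (if snd z = [] then z
     else if fst (hd (snd z)) \<noteq> Lf then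
       if snd (hd (snd z)) \<noteq> Lf
       then (fst z, (tfst (fst (hd (snd z))), tfst (snd (hd (snd z)))) # (tsnd (fst (hd (snd z))), tsnd (snd (hd (snd z)))) # tl (snd z))
       else (False, [])
     else if snd (hd (snd z)) \<noteq> Lf then (False, []) else (fst z, tl (snd z)))"

lemma eq_step:
  fixes z :: "bool \<times> (tree \<times> tree) list"
  defines "m \<equiv> \<lambda>z :: bool \<times> (tree \<times> tree) list. sum_list (map (\<lambda>p. length (tcode (fst p))) (snd z))"
  shows "fst (eq_step z) \<and> (\<forall>p \<in> set (snd (eq_step z)). fst p = snd p) \<longleftrightarrow> fst z \<and> (\<forall>p \<in> set (snd z). fst p = snd p)"
    and "m (eq_step z) \<le> m z - 1" and "sz (eq_step z) \<le> sz z"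
proof -
  have [simp]: "sz Lf = 1" "sz (Nd a b) = 1 + sz a + sz b" for a b by (simp_all add: sz_def code_tree_def)
  have F: "sz False = 1" "1 \<le> sz b" for b :: bool by (simp_all add: sz_def code_bool_def)
  obtain b xs where z: "z = (b, xs)" by (cases z)
  show "fst (eq_step z) \<and> (\<forall>p \<in> set (snd (eq_step z)). fst p = snd p) \<longleftrightarrow> fst z \<and> (\<forall>p \<in> set (snd z). fst p = snd p)"
    and "m (eq_step z) \<le> m z - 1" and "sz (eq_step z) \<le> sz z"
  proof -
    show "fst (eq_step z) \<and> (\<forall>p \<in> set (snd (eq_step z)). fst p = snd p) \<longleftrightarrow> fst z \<and> (\<forall>p \<in> set (snd z). fst p = snd p)"
    proof (cases xs)
      case (Cons p ys)
      obtain a a' where p: "p = (a, a')" by (cases p)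
      show ?thesis unfolding z Cons p by (cases a; cases a') (auto simp: eq_step_def)
    qed (simp add: z eq_step_def)
    show "m (eq_step z) \<le> m z - 1"
    proof (cases xs)
      case (Cons p ys)
      obtain a a' where p: "p = (a, a')" by (cases p)
      show ?thesis unfolding z Cons p m_def by (cases a; cases a') (auto simp: eq_step_def)
    qed (simp add: z eq_step_def m_def)
    show "sz (eq_step z) \<le> sz z"
    proof (cases xs)
      case (Cons p ys)
      obtain a a' where p: "p = (a, a')" by (cases p)
      show ?thesis unfolding z Cons p using F(2)[of b] by (cases a; cases a') (auto simp: eq_step_def F(1))
    qed (simp add: z eq_step_def)
  qed
qed

lemma pt_eq_step: "pt eq_step"
  unfolding eq_step_def
  by (intro pt_base pt_comp[OF pt_is_Nd] pt_comp[OF pt_tfst] pt_comp[OF pt_tsnd])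

text \<open>Each step removes at least one symbol from the first components on the stack, so as many
  steps as the size of the initial state empty it.\<close>

lemma pt_eq: "pt f \<Longrightarrow> pt g \<Longrightarrow> pt (\<lambda>x. f x = g x)"
proof -
  assume f: "pt f" and g: "pt g"
  define i where "i x = (True, [(code (f x), code (g x))])" for x
  have i: "pt i" unfolding i_def by (intro pt_base pt_comp[OF pt_code] f g)
  define m where "m z = sum_list (map (\<lambda>p. length (tcode (fst p))) (snd z))" for z :: "bool \<times> (tree \<times> tree) list"
  have m: "m (eq_step z) \<le> m z - 1" for z unfolding m_def by (rule eq_step(2))
  have it: "(fst ((eq_step ^^ j) z) \<and> (\<forall>p \<in> set (snd ((eq_step ^^ j) z)). fst p = snd p) \<longleftrightarrow> fst z \<and> (\<forall>p \<in> set (snd z). fst p = snd p))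
      \<and> m ((eq_step ^^ j) z) \<le> m z - j \<and> sz ((eq_step ^^ j) z) \<le> sz z" for j z
  proof (induction j)
    case (Suc j)
    then show ?case using eq_step(1,3)[of "(eq_step ^^ j) z"] m[of "(eq_step ^^ j) z"] by auto
  qed simp
  have "pt (\<lambda>x. fst ((eq_step ^^ sz (i x)) (i x)))"
    by (rule pt_fst, rule pt_iterate[OF pt_eq_step i pt_pbd[OF i]]) (use it in blast)
  moreover have "fst ((eq_step ^^ sz (i x)) (i x)) \<longleftrightarrow> f x = g x" for x
  proof -
    let ?z = "(eq_step ^^ sz (i x)) (i x)"
    have "m (i x) \<le> sz (i x)" by (simp add: m_def i_def sz_def code_tree_def)
    then have "m ?z = 0" using it[of "sz (i x)" "i x"] by linarith
    moreover have "tcode t \<noteq> []" for t by (cases t) auto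
    ultimately have "snd ?z = []" by (cases "snd ?z") (auto simp: m_def)
    then show ?thesis using it[of "sz (i x)" "i x"] by (auto simp: i_def dest: code_inj)
  qed
  ultimately show ?thesis by simp
qed

lemma pt_mem: "pt f \<Longrightarrow> pt g \<Longrightarrow> pt (\<lambda>x. f x \<in> set (g x))"
proof -
  assume f: "pt f" and g: "pt g"
  have "pt (\<lambda>x. \<exists>e \<in> set (g x). e = f x)" by (intro pt_bex pt_eq pt_base g pt_comp[OF f])
  then show ?thesis by simp
qed

subsection \<open>Arithmetic\<close>

fun bval :: "bool list \<Rightarrow> nat" where
  "bval [] = 0"
| "bval (b # bs) = of_bool b + 2 * bval bs"

lemma bval_append: "bval (xs @ ys) = bval xs + 2 ^ length xs * bval ys"
  by (induction xs) (auto simp: algebra_simps)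

lemma bval_less: "bval xs < 2 ^ length xs"
  by (induction xs) auto

lemma nat_bits_0 [simp]: "nat_bits 0 = []"
  by (simp add: nat_bits.simps)

lemma nat_bits_Nil_iff [simp]: "nat_bits n = [] \<longleftrightarrow> n = 0"
  by (subst nat_bits.simps) simp

lemma bval_nat_bits [simp]: "bval (nat_bits n) = n"
proof (induction n rule: less_induct)
  case (less n)
  show ?case
  proof (cases "n = 0")
    case False
    then have "nat_bits n = odd n # nat_bits (n div 2)" by (subst nat_bits.simps) simp
    moreover have "of_bool (odd n) + 2 * (n div 2) = n" by (cases "even n") simp_all
    ultimately show ?thesis using less[of "n div 2"] False by simp
  qed simp
qed

lemma nat_bits_length_le: "n < 2 ^ k \<Longrightarrow> length (nat_bits n) \<le> k"
proof (induction k arbitrary: n)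
  case (Suc k)
  have "length (nat_bits (n div 2)) \<le> k" using Suc by auto
  then show ?case by (subst nat_bits.simps) simp
qed simp

lemma nat_bits_bval_Cons:
  "nat_bits (bval (b # bs)) = (if \<not> b \<and> nat_bits (bval bs) = [] then [] else b # nat_bits (bval bs))"
  by (subst nat_bits.simps) auto

instantiation nat :: enc begin
definition "code n = code (nat_bits n)"
instance by standard (metis code_nat_def code_inj bval_nat_bits)
end

instantiation int :: enc begin
definition "code i = code (i < 0, nat \<bar>i\<bar>)"
instance
proof
  fix i j :: int
  assume "code i = code j"
  then have "(i < 0, nat \<bar>i\<bar>) = (j < 0, nat \<bar>j\<bar>)" unfolding code_int_def by (rule code_inj)
  then show "i = j" by auto
qed
end

lemma sz_nat: "sz n \<le> 4 * length (nat_bits n) + 1"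
  using sz_bools[of "nat_bits n"] by (simp add: sz_def code_nat_def)

lemma length_nat_bits_le: "length (nat_bits n) \<le> n"
  by (rule nat_bits_length_le) simp

lemma length_nat_bits_sz: "length (nat_bits n) \<le> sz n"
  using length_le_sz[of "nat_bits n"] by (simp add: sz_def code_nat_def)

lemma pt_nat_bits: "pt f \<Longrightarrow> pt (\<lambda>x. nat_bits (f x))"
  by (rule pt_coerce[of f]) (simp_all add: code_nat_def)

lemma pt_bval: "pt f \<Longrightarrow> pt (\<lambda>x. bval (f x))"
proof -
  assume f: "pt f"
  let ?F = "\<lambda>s b. if \<not> b \<and> s = [] then [] else b # s"
  have e: "nat_bits (bval bs) = foldl ?F [] (rev bs)" for bs
  proof (induction bs)
    case (Cons b bs)
    show ?case unfolding nat_bits_bval_Cons Cons by simp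
  qed simp
  have "pt (\<lambda>x. foldl ?F [] (rev (f x)))"
    by (rule pt_foldl[where B="\<lambda>z. sz (snd z) + 1"]) (intro pt_base f pt_rev pbd_snd | simp)+
  then show ?thesis by (rule pt_coerce) (simp add: code_nat_def e)
qed

text \<open>Ripple-carry addition from the least significant bit. The sum is accumulated in front
  and therefore comes out most significant bit first.\<close>

definition adder :: "bool \<Rightarrow> bool list \<Rightarrow> bool list \<Rightarrow> bool \<times> bool list" where
  "adder c xs ys = foldl (\<lambda>s p. ((fst p \<and> snd p) \<or> (fst s \<and> (fst p \<or> snd p)), ((fst p \<noteq> snd p) \<noteq> fst s) # snd s)) (c, []) (zip xs ys)"

lemma adder:
  assumes "length xs = length ys"
  shows "bval (rev (snd (adder c xs ys))) + 2 ^ length xs * of_bool (fst (adder c xs ys)) = of_bool c + bval xs + bval ys"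
    and "length (snd (adder c xs ys)) = length xs"
proof -
  let ?F = "\<lambda>s p. ((fst p \<and> snd p) \<or> (fst s \<and> (fst p \<or> snd p)), ((fst p \<noteq> snd p) \<noteq> fst s) # snd s)"
  have "length xs = length ys \<Longrightarrow> length (snd (foldl ?F (c, out) (zip xs ys))) = length out + length xs \<and>
      bval (rev (snd (foldl ?F (c, out) (zip xs ys)))) + 2 ^ (length out + length xs) * of_bool (fst (foldl ?F (c, out) (zip xs ys))) =
      bval (rev out) + 2 ^ length out * (of_bool c + bval xs + bval ys)" for c out
  proof (induction xs ys arbitrary: c out rule: list_induct2')
    case (4 x xs y ys)
    let ?c = "(x \<and> y) \<or> (c \<and> (x \<or> y))" and ?o = "((x \<noteq> y) \<noteq> c) # out"
    have "2 * of_bool ?c + of_bool ((x \<noteq> y) \<noteq> c) = of_bool c + of_bool x + (of_bool y :: nat)" by auto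
    then have "2 ^ length out * (2 * of_bool ?c + of_bool ((x \<noteq> y) \<noteq> c)) = (2 ^ length out :: nat) * (of_bool c + of_bool x + of_bool y)"
      by (simp only:)
    then show ?case using 4(1)[of ?c ?o] 4(2) by (simp add: bval_append algebra_simps)
  qed auto
  from this[OF assms, of c "[]"] show "bval (rev (snd (adder c xs ys))) + 2 ^ length xs * of_bool (fst (adder c xs ys)) = of_bool c + bval xs + bval ys"
    and "length (snd (adder c xs ys)) = length xs" by (simp_all add: adder_def)
qed

lemma pt_adder: "pt f \<Longrightarrow> pt g \<Longrightarrow> pt h \<Longrightarrow> pt (\<lambda>x. adder (f x) (g x) (h x))"
proof -
  assume fgh: "pt f" "pt g" "pt h"
  have b: "sz (b :: bool) \<le> 3" "1 \<le> sz b" for b by (rule sz_bool, rule sz_ge_1)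
  show ?thesis unfolding adder_def
  proof (rule pt_foldl[where B="\<lambda>_. 6"])
    show "sz ((fst p \<and> snd p) \<or> (fst s \<and> (fst p \<or> snd p)), ((fst p \<noteq> snd p) \<noteq> fst s) # snd s) \<le> sz s + 6" for s :: "bool \<times> bool list" and p
      using b(1)[of "(fst p \<and> snd p) \<or> (fst s \<and> (fst p \<or> snd p))"] b(1)[of "(fst p \<noteq> snd p) \<noteq> fst s"] b(2)[of "fst s"]
      by (cases s) (simp del: One_nat_def)
  qed (intro pt_base pt_zip pt_eq fgh pbd_const)+
qed

lemma bval_map_False: "bval (map (\<lambda>_. False) xs) = 0"
  by (induction xs) auto

lemma bval_map_Not: "bval (map Not xs) + bval xs + 1 = 2 ^ length xs"
  by (induction xs) auto

lemma pt_add_nat: "pt f \<Longrightarrow> pt g \<Longrightarrow> pt (\<lambda>x. f x + g x :: nat)"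
proof -
  assume fg: "pt f" "pt g"
  let ?r = "\<lambda>m n. adder False (nat_bits m @ map (\<lambda>_. False) (nat_bits n)) (nat_bits n @ map (\<lambda>_. False) (nat_bits m))"
  have "pt (\<lambda>x. bval (rev (fst (?r (f x) (g x)) # snd (?r (f x) (g x)))))"
    by (intro pt_base pt_bval pt_rev pt_adder pt_append pt_map[where f="\<lambda>_ _. False"] pt_nat_bits fg)
  moreover have "bval (rev (fst (?r m n) # snd (?r m n))) = m + n" for m n
    using adder[of "nat_bits m @ map (\<lambda>_. False) (nat_bits n)" "nat_bits n @ map (\<lambda>_. False) (nat_bits m)" False]
    by (simp add: bval_append bval_map_False)
  ultimately show ?thesis by simp
qed

text \<open>Two's complement: after padding to a common length, add the negated bits of the
  subtrahend with an initial carry. The final carry is set exactly if the difference is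
  nonnegative.\<close>

lemma pt_minus_nat: "pt f \<Longrightarrow> pt g \<Longrightarrow> pt (\<lambda>x. f x - g x :: nat)"
proof -
  assume fg: "pt f" "pt g"
  let ?r = "\<lambda>m n. adder True (nat_bits m @ map (\<lambda>_. False) (nat_bits n)) (map Not (nat_bits n @ map (\<lambda>_. False) (nat_bits m)))"
  have "pt (\<lambda>x. if fst (?r (f x) (g x)) then bval (rev (snd (?r (f x) (g x)))) else 0)"
    by (intro pt_base pt_bval pt_rev pt_adder pt_append pt_map[where f="\<lambda>_ _. False"] pt_map[where f="\<lambda>_. Not"] pt_nat_bits fg)
  moreover have "(if fst (?r m n) then bval (rev (snd (?r m n))) else 0) = m - n" for m n
  proof -
    let ?x = "nat_bits m @ map (\<lambda>_. False) (nat_bits n)" and ?y = "nat_bits n @ map (\<lambda>_. False) (nat_bits m)"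
    have l: "length ?x = length (map Not ?y)" by simp
    have xy: "bval ?x = m" "bval ?y = n" by (simp_all only: bval_append bval_map_False bval_nat_bits mult_0_right add_0_right)
    have n: "bval (map Not ?y) + n + 1 = 2 ^ length ?x" using bval_map_Not[of ?y] unfolding xy by (simp add: add.commute)
    have "bval (rev (snd (?r m n))) < 2 ^ length ?x"
      using bval_less[of "rev (snd (?r m n))"] adder(2)[OF l, of True] by simp
    moreover have "bval (rev (snd (?r m n))) + 2 ^ length ?x * of_bool (fst (?r m n)) = 1 + m + bval (map Not ?y)"
      using adder(1)[OF l, of True] unfolding xy by simp
    ultimately show ?thesis using n by (cases "fst (?r m n)") (simp_all del: map_append length_append)
  qed
  ultimately show ?thesis by simp
qed

lemma pt_less_nat: "pt f \<Longrightarrow> pt g \<Longrightarrow> pt (\<lambda>x. f x < (g x :: nat))"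
proof -
  assume "pt f" "pt g"
  then have "pt (\<lambda>x. g x - f x \<noteq> 0)" by (intro pt_not pt_eq pt_minus_nat pt_base)
  moreover have "m < n \<longleftrightarrow> n - m \<noteq> 0" for m n :: nat by auto
  ultimately show ?thesis by simp
qed

lemma nat_bits_add: "length (nat_bits (m + n)) \<le> length (nat_bits m) + length (nat_bits n) + 1"
proof (rule nat_bits_length_le)
  have "m * 1 < 2 ^ length (nat_bits m) * 2 ^ length (nat_bits n)" by (intro mult_less_le_imp_less nat_bits_less) auto
  moreover have "1 * n < 2 ^ length (nat_bits m) * 2 ^ length (nat_bits n)" by (intro mult_le_less_imp_less nat_bits_less) auto
  ultimately show "m + n < 2 ^ (length (nat_bits m) + length (nat_bits n) + 1)" by (simp add: power_add)
qed

lemma nat_bits_mult: "length (nat_bits (m * n)) \<le> length (nat_bits m) + length (nat_bits n)"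
  by (rule nat_bits_length_le) (simp add: power_add mult_strict_mono nat_bits_less)

lemma pbd_nat_bits: "pt f \<Longrightarrow> pbd (\<lambda>x. length (nat_bits (f x)))"
  by (rule pbd_le[OF pt_pbd]) (auto intro: length_nat_bits_sz)

text \<open>Horner's scheme from the most significant bit; per step the bit length of the
  accumulator grows by an amount depending only on the first factor.\<close>

lemma pt_mult_nat: "pt f \<Longrightarrow> pt g \<Longrightarrow> pt (\<lambda>x. f x * g x :: nat)"
proof -
  assume fg: "pt f" "pt g"
  let ?F = "\<lambda>m acc b. acc + acc + (if b then m else 0)"
  have "foldl (?F m) 0 (rev bs) = m * bval bs" for m bs by (induction bs) auto
  then have e: "m * n = foldl (?F m) 0 (rev (nat_bits n))" for m n by simp
  have "pt (\<lambda>x. foldl (?F (f x)) 0 (rev (nat_bits (g x))))"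
  proof (rule pt_foldl_measure[where \<mu>="\<lambda>n. length (nat_bits n)" and c=4 and B="\<lambda>z. length (nat_bits (f (fst z))) + 2"])
    show "length (nat_bits (?F (f x) s b)) \<le> length (nat_bits s) + (length (nat_bits (f (fst (x, b)))) + 2)" for x s b
    proof (rule nat_bits_length_le)
      let ?s = "2 ^ length (nat_bits s) :: nat" and ?f = "2 ^ length (nat_bits (f x)) :: nat"
      have "s * 1 < ?s * ?f" by (intro mult_less_le_imp_less nat_bits_less) auto
      moreover have "1 * f x < ?s * ?f" by (intro mult_le_less_imp_less nat_bits_less) auto
      ultimately show "?F (f x) s b < 2 ^ (length (nat_bits s) + (length (nat_bits (f (fst (x, b)))) + 2))"
        by (simp add: power_add)
    qed
    show "sz n \<le> 4 * length (nat_bits n) + 4" for n using sz_nat[of n] by simp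
    show "pt (\<lambda>z. fst (snd z) + fst (snd z) + (if snd (snd z) then f (fst z) else 0))"
      by (intro pt_base pt_add_nat pt_comp[OF fg(1)])
  qed (intro pt_base pt_rev pt_nat_bits fg pbd_nat_bits pbd_add pbd_const pt_comp[OF fg(1)])+
  then show ?thesis by (simp add: e)
qed

lemma pt_length: "pt l \<Longrightarrow> pt (\<lambda>x. length (l x))"
proof -
  assume l: "pt l"
  have "foldl (\<lambda>s _. s + 1) a xs = a + length xs" for a and xs :: "'b list" by (induction xs arbitrary: a) auto
  moreover have "pt (\<lambda>x. foldl (\<lambda>s _. s + 1 :: nat) 0 (l x))"
  proof (rule pt_foldl_measure[where \<mu>="\<lambda>n. length (nat_bits n)" and c=4 and B="\<lambda>_. 2"])
    show "length (nat_bits (s + 1)) \<le> length (nat_bits s) + 2" for s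
      using nat_bits_add[of s 1] length_nat_bits_le[of 1] by linarith
    show "sz n \<le> 4 * length (nat_bits n) + 4" for n using sz_nat[of n] by simp
  qed (intro pt_base l pbd_const pt_add_nat | simp)+
  ultimately show ?thesis by simp
qed

lemma sz_list_le: "(\<And>e. e \<in> set l \<Longrightarrow> sz e \<le> q) \<Longrightarrow> sz l \<le> length l * (q + 1) + 1"
  by (induction l) force+

text \<open>The bound is given in unary, as a list; for a binary bound the result could be
  exponentially long.\<close>

lemma pt_upt_length: "pt l \<Longrightarrow> pt (\<lambda>x. [0..<length (l x)])"
proof -
  assume l: "pt l"
  have e: "foldl (\<lambda>s _. (fst s + 1, fst s # snd s)) (0, []) xs = (length xs, rev [0..<length xs])" for xs :: "'b list"
    by (induction xs rule: rev_induct) auto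
  have "pt (\<lambda>x. rev (snd (foldl (\<lambda>s _. (fst s + 1, fst s # snd s)) (0 :: nat, []) (l x))))"
  proof (rule pt_rev, rule pt_snd, rule pt_foldl_bounded)
    fix x i assume i: "i \<le> length (l x)"
    let ?n = "sz (l x)"
    have n: "sz j \<le> 4 * ?n + 1" if "j \<le> length (l x)" for j
      using sz_nat[of j] length_nat_bits_le[of j] length_le_sz[of "l x"] that by linarith
    have "sz (rev [0..<i]) \<le> length (rev [0..<i]) * (4 * ?n + 1 + 1) + 1"
      by (rule sz_list_le) (use i n in auto)
    also have "\<dots> \<le> ?n * (4 * ?n + 2) + 1" using i length_le_sz[of "l x"] by (intro add_right_mono mult_le_mono) auto
    finally show "sz (foldl (\<lambda>s _. (fst s + 1, fst s # snd s)) (0 :: nat, []) (take i (l x))) \<le> (4 * ?n + 1) + (?n * (4 * ?n + 2) + 1) + 1"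
      unfolding e using n[OF i] i by (simp add: min_def)
  qed (intro pt_base l pt_add_nat pbd_add pbd_mult pbd_const pt_pbd)+
  then show ?thesis by (simp only: e snd_conv rev_rev_ident)
qed

text \<open>The default value makes the function independent of the unspecified values of \<^const>\<open>nth\<close>.\<close>

definition nthd :: "'a \<Rightarrow> 'a list \<Rightarrow> nat \<Rightarrow> 'a" where
  "nthd d l i = (if i < length l then l ! i else d)"

lemma filter_zip_upt: "map snd (filter (\<lambda>p. fst p = i) (zip [0..<length l] l)) = (if i < length l then [l ! i] else [])"
  by (induction l rule: rev_induct) (auto simp: nth_append less_Suc_eq)

text \<open>All positions are scanned and compared with the index, so no loop is driven by a binary
  number.\<close>

lemma pt_nthd: "pt d \<Longrightarrow> pt l \<Longrightarrow> pt i \<Longrightarrow> pt (\<lambda>x. nthd (d x) (l x) (i x))"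
proof -
  assume dli: "pt d" "pt l" "pt i"
  have "pt (\<lambda>x. hd (map snd (filter (\<lambda>p. fst p = i x) (zip [0..<length (l x)] (l x))) @ [d x]))"
    by (intro pt_base pt_append pt_map[where f="\<lambda>_. snd"] pt_filter pt_eq pt_zip pt_upt_length dli pt_comp[OF dli(3)])
  then show ?thesis by (rule pt_coerce) (simp add: filter_zip_upt nthd_def)
qed

definition sint :: "bool \<Rightarrow> nat \<Rightarrow> int" where
  "sint s n = (if s then - int n else int n)"

lemma pt_sint: "pt f \<Longrightarrow> pt g \<Longrightarrow> pt (\<lambda>x. sint (f x) (g x))"
proof -
  assume "pt f" "pt g"
  \<comment> \<open>Zero must carry a positive sign, because the code of an integer records whether
    it is negative.\<close>
  then have "pt (\<lambda>x. (f x \<and> g x \<noteq> 0, g x))" by (intro pt_base pt_eq)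
  then show ?thesis by (rule pt_coerce) (auto simp: sint_def code_int_def)
qed

lemma pt_neg: "pt f \<Longrightarrow> pt (\<lambda>x. f x < (0 :: int))"
proof -
  assume "pt f"
  then have "pt (\<lambda>x. tfst (code (f x)))" by (intro pt_comp[OF pt_tfst] pt_comp[OF pt_code])
  then show ?thesis by (rule pt_coerce) (simp add: code_int_def code_tree_def)
qed

lemma pt_nat_abs: "pt f \<Longrightarrow> pt (\<lambda>x. nat \<bar>f x\<bar>)"
proof -
  assume "pt f"
  then have "pt (\<lambda>x. tsnd (code (f x)))" by (intro pt_comp[OF pt_tsnd] pt_comp[OF pt_code])
  then show ?thesis by (rule pt_coerce) (simp add: code_int_def code_tree_def)
qed

lemma pt_int: "pt f \<Longrightarrow> pt (\<lambda>x. int (f x))"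
  using pt_sint[OF pt_const[of False]] by (simp add: sint_def)

lemma pt_mult_int: "pt f \<Longrightarrow> pt g \<Longrightarrow> pt (\<lambda>x. f x * g x :: int)"
proof -
  assume "pt f" "pt g"
  then have "pt (\<lambda>x. sint ((f x < 0) \<noteq> (g x < 0)) (nat \<bar>f x\<bar> * nat \<bar>g x\<bar>))"
    by (intro pt_sint pt_not pt_eq pt_neg pt_mult_nat pt_nat_abs)
  moreover have "sint ((a < 0) \<noteq> (b < 0)) (nat \<bar>a\<bar> * nat \<bar>b\<bar>) = a * b" for a b :: int
    by (auto simp: sint_def)
  ultimately show ?thesis by simp
qed

lemma pt_add_int: "pt f \<Longrightarrow> pt g \<Longrightarrow> pt (\<lambda>x. f x + g x :: int)"
proof -
  assume "pt f" "pt g"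
  then have "pt (\<lambda>x. if (f x < 0) = (g x < 0) then sint (f x < 0) (nat \<bar>f x\<bar> + nat \<bar>g x\<bar>)
      else if nat \<bar>f x\<bar> < nat \<bar>g x\<bar> then sint (g x < 0) (nat \<bar>g x\<bar> - nat \<bar>f x\<bar>) else sint (f x < 0) (nat \<bar>f x\<bar> - nat \<bar>g x\<bar>))"
    by (intro pt_if pt_sint pt_eq pt_neg pt_add_nat pt_minus_nat pt_less_nat pt_nat_abs)
  moreover have "(if (a < 0) = (b < 0) then sint (a < 0) (nat \<bar>a\<bar> + nat \<bar>b\<bar>)
      else if nat \<bar>a\<bar> < nat \<bar>b\<bar> then sint (b < 0) (nat \<bar>b\<bar> - nat \<bar>a\<bar>) else sint (a < 0) (nat \<bar>a\<bar> - nat \<bar>b\<bar>)) = a + b" for a b :: int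
    by (auto simp: sint_def)
  ultimately show ?thesis by simp
qed

lemma pt_uminus_int: "pt f \<Longrightarrow> pt (\<lambda>x. - f x :: int)"
  using pt_mult_int[OF pt_const[of "-1"]] by simp

lemma pt_minus_int: "pt f \<Longrightarrow> pt g \<Longrightarrow> pt (\<lambda>x. f x - g x :: int)"
  using pt_add_int[OF _ pt_uminus_int] by simp

lemmas pt_intros = pt_base pt_rev pt_append pt_concat pt_zip pt_take_length pt_drop_length pt_eq pt_mem pt_nat_bits pt_bval
  pt_add_nat pt_minus_nat pt_mult_nat pt_less_nat pt_length pt_upt_length pt_nthd
  pt_sint pt_neg pt_nat_abs pt_int pt_mult_int pt_add_int pt_minus_int

section \<open>Serialization and parsing\<close>

subsection \<open>Encoders\<close>

lemma pt_enc_list: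
  assumes e: "pt e" and l: "pt l"
  shows "pt (\<lambda>x. enc_list e (l x))"
  unfolding enc_list_def by (intro pt_intros pt_map l pt_comp[OF e])

lemma pt_enc_word: "pt f \<Longrightarrow> pt (\<lambda>x. enc_word (f x))"
  unfolding enc_word_def by (intro pt_enc_list pt_intros)

lemma pt_enc_nat: "pt f \<Longrightarrow> pt (\<lambda>x. enc_nat (f x))"
  unfolding enc_nat_def by (intro pt_enc_word pt_nat_bits)

lemma pt_enc_int: "pt f \<Longrightarrow> pt (\<lambda>x. enc_int (f x))"
  unfolding enc_int_def by (intro pt_Cons pt_neg pt_enc_nat pt_nat_abs)

lemma enc_rat_of_int: "enc_rat (of_int z) = enc_int z @ enc_int 1"
  by (simp add: enc_rat_def)

subsection \<open>Parsers\<close>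

text \<open>\<open>parsable e g\<close>: the value \<open>g x\<close> can be read off from any word that starts with the code \<open>e x\<close>.
  On arbitrary words, the sizes of the result and of the remaining word are bounded linearly; the
  bound is additive, so that it can be iterated.\<close>

definition parser :: "(bool list \<Rightarrow> 'b::enc \<times> bool list) \<Rightarrow> bool" where
  "parser P \<longleftrightarrow> pt P \<and> (\<exists>c d. \<forall>w. sz (fst (P w)) + c * sz (snd (P w)) \<le> c * sz w + d \<and> sz (snd (P w)) \<le> sz w)"

definition parsable :: "('a \<Rightarrow> bool list) \<Rightarrow> ('a \<Rightarrow> 'b::enc) \<Rightarrow> bool" where
  "parsable e g \<longleftrightarrow> (\<exists>P. parser P \<and> (\<forall>x r. P (e x @ r) = (g x, r)))"

lemma parserI:
  assumes "pt P" "\<And>w. sz (fst (P w)) + c * sz (snd (P w)) \<le> c * sz w + d" "\<And>w. sz (snd (P w)) \<le> sz w"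
  shows "parser P"
  using assms unfolding parser_def by blast

text \<open>Since a parser never lengthens the rest, the weight may be increased; this gives several
  parsers, or several rounds of one parser, a common weight.\<close>

lemma parser_bound:
  assumes "parser P"
  obtains c d where "\<And>c' w. c \<le> c' \<Longrightarrow> sz (fst (P w)) + c' * sz (snd (P w)) \<le> c' * sz w + d" "\<And>w. sz (snd (P w)) \<le> sz w"
proof -
  obtain c d where cd: "\<And>w. sz (fst (P w)) + c * sz (snd (P w)) \<le> c * sz w + d" "\<And>w. sz (snd (P w)) \<le> sz w"
    using assms unfolding parser_def by blast
  have "sz (fst (P w)) + c' * sz (snd (P w)) \<le> c' * sz w + d" if "c \<le> c'" for c' w
  proof -
    have "(c' - c) * sz (snd (P w)) \<le> (c' - c) * sz w" using cd(2) by (rule mult_le_mono2)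
    then have "sz (fst (P w)) + (c + (c' - c)) * sz (snd (P w)) \<le> (c + (c' - c)) * sz w + d"
      using cd(1)[of w] by (simp only: distrib_right)
    then show ?thesis using that by simp
  qed
  then show thesis using cd(2) by (rule that)
qed

lemma parsable_bit: "parsable (\<lambda>b. [b]) (\<lambda>b. b)"
proof -
  define P where "P w = (if w = [] then (False, []) else (hd w, tl w))" for w :: "bool list"
  have "pt P" unfolding P_def by (intro pt_intros)
  moreover have "sz (fst (P w)) + 1 * sz (snd (P w)) \<le> 1 * sz w + 3 \<and> sz (snd (P w)) \<le> sz w" for w
    using sz_bool[of False] by (cases w) (auto simp: P_def)
  ultimately have "parser P" by (intro parserI[where c=1 and d=3]) auto
  moreover have "P ([b] @ r) = (b, r)" for b r by (simp add: P_def)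
  ultimately show ?thesis unfolding parsable_def by blast
qed

lemma parsable_seq:
  assumes "parsable e g" "parsable e' g'"
  shows "parsable (\<lambda>z. e (fst z) @ e' (snd z)) (\<lambda>z. (g (fst z), g' (snd z)))"
proof -
  obtain P Q where P: "parser P" "\<And>x r. P (e x @ r) = (g x, r)" and Q: "parser Q" "\<And>x r. Q (e' x @ r) = (g' x, r)"
    using assms unfolding parsable_def by metis
  define R where "R w = ((fst (P w), fst (Q (snd (P w)))), snd (Q (snd (P w))))" for w
  have pt: "pt P" "pt Q" using P Q by (auto simp: parser_def)
  have "pt R" unfolding R_def by (intro pt_intros pt pt_comp[OF pt(2)])
  obtain c d where c: "\<And>c' w. c \<le> c' \<Longrightarrow> sz (fst (P w)) + c' * sz (snd (P w)) \<le> c' * sz w + d" "\<And>w. sz (snd (P w)) \<le> sz w"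
    using parser_bound[OF P(1)] by blast
  obtain c2 d2 where c2: "\<And>c' w. c2 \<le> c' \<Longrightarrow> sz (fst (Q w)) + c' * sz (snd (Q w)) \<le> c' * sz w + d2" "\<And>w. sz (snd (Q w)) \<le> sz w"
    using parser_bound[OF Q(1)] by blast
  have "parser R"
  proof (rule parserI[OF \<open>pt R\<close>])
    fix w
    show "sz (fst (R w)) + (c + c2) * sz (snd (R w)) \<le> (c + c2) * sz w + (1 + d + d2)"
      using c(1)[of "c + c2" w] c2(1)[of "c + c2" "snd (P w)"] by (simp add: R_def)
    show "sz (snd (R w)) \<le> sz w" using c(2)[of w] c2(2)[of "snd (P w)"] by (simp add: R_def)
  qed
  moreover have "R ((e (fst z) @ e' (snd z)) @ r) = ((g (fst z), g' (snd z)), r)" for z r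
    by (simp add: R_def P(2) Q(2))
  ultimately show ?thesis unfolding parsable_def by blast
qed

lemma parsable_map:
  assumes "parsable e g" "pt h" "\<And>y. sz (h y) \<le> sz y + b"
  shows "parsable e (\<lambda>x. h (g x))"
proof -
  obtain P where P: "parser P" "\<And>x r. P (e x @ r) = (g x, r)"
    using assms unfolding parsable_def by metis
  define R where "R w = (h (fst (P w)), snd (P w))" for w
  have pt: "pt P" using P by (auto simp: parser_def)
  have "pt R" unfolding R_def by (intro pt_intros pt pt_comp[OF assms(2)])
  obtain c d where c: "\<And>c' w. c \<le> c' \<Longrightarrow> sz (fst (P w)) + c' * sz (snd (P w)) \<le> c' * sz w + d" "\<And>w. sz (snd (P w)) \<le> sz w"
    using parser_bound[OF P(1)] by blast
  have "parser R"
  proof (rule parserI[OF \<open>pt R\<close>])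
    fix w
    show "sz (fst (R w)) + c * sz (snd (R w)) \<le> c * sz w + (b + d)"
      using c(1)[of c w] assms(3)[of "fst (P w)"] by (simp add: R_def)
    show "sz (snd (R w)) \<le> sz w" using c(2)[of w] by (simp add: R_def)
  qed
  moreover have "R (e x @ r) = (h (g x), r)" for x r
    by (simp add: R_def P(2))
  ultimately show ?thesis unfolding parsable_def by blast
qed

lemma parsable_code: "parsable e g \<Longrightarrow> (\<And>x. e' x = e (f x)) \<Longrightarrow> (\<And>x. g' x = g (f x)) \<Longrightarrow> parsable e' g'"
  unfolding parsable_def by metis

lemma sz_rev: "sz (rev l) = sz l"
proof -
  have "sz (xs @ [x]) = sz xs + sz x + 1" for xs and x :: 'a by (induction xs) auto
  then show ?thesis by (induction l) auto
qed

lemma foldl_const: "foldl (\<lambda>s _. f s) a xs = (f ^^ length xs) a"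
  by (induction xs arbitrary: a) (simp_all add: funpow_swap1)

lemma parsable_list:
  assumes "parsable e g"
  shows "parsable (enc_list e) (map g)"
proof -
  obtain P where P: "parser P" "\<And>x r. P (e x @ r) = (g x, r)"
    using assms unfolding parsable_def by metis
  have ptP: "pt P" using P by (auto simp: parser_def)
  obtain c0 d where c0: "\<And>c' w. c0 \<le> c' \<Longrightarrow> sz (fst (P w)) + c' * sz (snd (P w)) \<le> c' * sz w + d" "\<And>w. sz (snd (P w)) \<le> sz w"
    using parser_bound[OF P(1)] by blast
  \<comment> \<open>Removing the flag bit in front of an element releases at least \<open>c\<close>,
    which pays for the new list cell and for the overhead \<open>d\<close> of the element parser.
    The weighted size then never increases, however often the step is repeated.\<close>
  define c where "c = c0 + d + 1"
  have c: "sz (fst (P w)) + c * sz (snd (P w)) \<le> c * sz w + d" for w by (rule c0(1)) (simp add: c_def)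
  define F where "F s = (if fst s \<or> snd (snd s) = [] then s
    else if hd (snd (snd s)) then (False, fst (P (tl (snd (snd s)))) # fst (snd s), snd (P (tl (snd (snd s)))))
    else (True, fst (snd s), tl (snd (snd s))))" for s
  define m where "m s = sz (fst (snd s)) + c * sz (snd (snd s))" for s :: "bool \<times> 'b list \<times> bool list"
  have [simp]: "sz True = 3" "sz False = 1" by (simp_all add: sz_def code_bool_def)
  have m: "m (F s) \<le> m s \<and> sz (snd (snd (F s))) \<le> sz (snd (snd s))" for s
  proof -
    obtain b out w where s: "s = (b, out, w)" by (cases s)
    show ?thesis
    proof (cases "b \<or> w = []")
      case False
      then obtain x v where w: "w = x # v" by (cases w) auto
      have "c * sz w = c + c * sz x + c * sz v" by (simp add: w distrib_left)
      moreover have "1 + d \<le> c" by (simp add: c_def)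
      ultimately show ?thesis using False c[of v] c0(2)[of v] by (auto simp: s w F_def m_def distrib_left)
    qed (auto simp: s F_def m_def)
  qed
  have m': "m ((F ^^ j) s) \<le> m s \<and> sz (snd (snd ((F ^^ j) s))) \<le> sz (snd (snd s))" for j s
  proof (induction j)
    case (Suc j)
    then show ?case using m[of "(F ^^ j) s"] by simp
  qed simp
  define i where "i w = (False, [] :: 'b list, w)" for w :: "bool list"
  \<comment> \<open>Every element consumes its flag bit, so one round per bit of the input is
    enough, and further rounds change nothing once the end mark has been read.\<close>
  define r where "r w = foldl (\<lambda>s _. F s) (i w) w" for w
  have ptF: "pt F" unfolding F_def by (intro pt_intros pt_comp[OF ptP])
  have ptr: "pt r" unfolding r_def
  proof (rule pt_foldl_bounded)
    show "pt (\<lambda>z. F (fst (snd z)))" by (intro pt_comp[OF ptF] pt_intros)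
    show "pt i" unfolding i_def by (intro pt_intros)
    show "pt (\<lambda>w. w)" by (rule pt_id)
    show "pbd (\<lambda>w. 6 + c * sz w)" by (intro pbd_add pbd_mult pbd_const pbd_sz)
    fix w j
    let ?s = "foldl (\<lambda>s _. F s) (i w) (take j w)"
    have "m ?s \<le> m (i w)" unfolding foldl_const using m' by blast
    also have "m (i w) = 1 + c * sz w" by (simp add: m_def i_def)
    finally have "sz (fst (snd ?s)) + 1 * sz (snd (snd ?s)) \<le> 1 + c * sz w"
      unfolding m_def by (rule order_trans[rotated]) (intro add_left_mono mult_right_mono; simp add: c_def)
    then show "sz ?s \<le> 6 + c * sz w" using sz_bool[of "fst ?s"] by (cases "?s") simp
  qed
  define R where "R w = (rev (fst (snd (r w))), snd (snd (r w)))" for w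
  have "parser R"
  proof (rule parserI)
    show "pt R" unfolding R_def by (intro pt_intros ptr)
    fix w
    show "sz (fst (R w)) + c * sz (snd (R w)) \<le> c * sz w + 1"
      using m'[of "length w" "i w"] by (simp add: R_def r_def foldl_const m_def i_def sz_rev)
    show "sz (snd (R w)) \<le> sz w"
      using m'[of "length w" "i w"] by (simp add: R_def r_def foldl_const i_def)
  qed
  moreover have "R (enc_list e xs @ v) = (map g xs, v)" for xs v
  proof -
    have stop: "(F ^^ j) (True, s) = (True, s)" for j s by (induction j) (auto simp: F_def)
    have run: "(F ^^ (length xs + 1 + j)) (False, out, enc_list e xs @ v) = (True, rev (map g xs) @ out, v)" for j out
    proof (induction xs arbitrary: out)
      case Nil
      have "F (False, out, False # v) = (True, out, v)" by (simp add: F_def)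
      then show ?case by (simp add: enc_list_def funpow_swap1 stop)
    next
      case (Cons x xs)
      have "enc_list e (x # xs) @ v = True # e x @ enc_list e xs @ v" by (simp add: enc_list_def)
      then have "F (False, out, enc_list e (x # xs) @ v) = (False, g x # out, enc_list e xs @ v)"
        by (simp add: F_def P(2))
      then show ?case using Cons[of "g x # out"] by (simp add: funpow_swap1)
    qed
    have "length xs + 1 \<le> length (enc_list e xs)" by (induction xs) (auto simp: enc_list_def)
    then obtain j where "length (enc_list e xs @ v) = length xs + 1 + j"
      using le_Suc_ex[of "length xs + 1" "length (enc_list e xs @ v)"] by auto
    then have "r (enc_list e xs @ v) = (True, rev (map g xs), v)"
      using run[of j "[]"] by (simp only: r_def foldl_const i_def append_Nil2)
    then show ?thesis by (simp add: R_def)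
  qed
  ultimately show ?thesis unfolding parsable_def by blast
qed

lemma parsable_word: "parsable enc_word (\<lambda>w. w)"
  by (rule parsable_code[OF parsable_list[OF parsable_bit], where f="\<lambda>w. w"]) (simp_all add: enc_word_def)

lemma sz_bval: "sz (bval bs) \<le> sz bs"
proof -
  have "sz (nat_bits (bval bs)) \<le> sz bs" by (induction bs) (simp_all del: bval.simps(2) add: nat_bits_bval_Cons sz_ge_1)
  then show ?thesis by (simp add: sz_def code_nat_def)
qed

lemma parsable_nat: "parsable enc_nat (\<lambda>n. n)"
proof (rule parsable_code[where f=nat_bits])
  show "parsable enc_word (\<lambda>w. bval w)"
    by (rule parsable_map[where b=0, OF parsable_word]) (simp_all add: pt_bval pt_id sz_bval)
qed (simp_all add: enc_nat_def)

lemma sz_sint: "sz (sint b n) \<le> sz (b, n)"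
proof -
  have "sz (b \<and> 0 < n) \<le> sz b" by (simp add: sz_def code_bool_def)
  moreover have "sz (sint b n) = sz (b \<and> 0 < n, n)"
    by (auto simp: sz_def code_int_def sint_def)
  ultimately show ?thesis by simp
qed

lemma parsable_int: "parsable enc_int (\<lambda>i. i)"
proof (rule parsable_code[where f="\<lambda>i. (i < 0, nat \<bar>i\<bar>)"])
  have "pt (\<lambda>z. sint (fst z) (snd z))" by (intro pt_sint pt_fst pt_snd pt_id)
  moreover have "sz (sint (fst z) (snd z)) \<le> sz z + 0" for z using sz_sint[of "fst z" "snd z"] by simp
  ultimately show "parsable (\<lambda>z. [fst z] @ enc_nat (snd z)) (\<lambda>z. sint (fst (fst z, snd z)) (snd (fst z, snd z)))"
    by (rule parsable_map[OF parsable_seq[OF parsable_bit parsable_nat]])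
qed (auto simp: enc_int_def sint_def)

lemma parsable_rat: "parsable enc_rat quotient_of"
  by (rule parsable_code[OF parsable_seq[OF parsable_int parsable_int], where f=quotient_of])
    (simp_all add: enc_rat_def split_beta)

lemma parsable_mat:
  "parsable enc_mat (\<lambda>A. ((dim_row A, dim_col A), map (map quotient_of) (mat_to_list A)))"
  by (rule parsable_code[OF parsable_seq[OF parsable_seq[OF parsable_nat parsable_nat]
        parsable_list[OF parsable_list[OF parsable_rat]]], where f="\<lambda>A. ((dim_row A, dim_col A), mat_to_list A)"])
    (simp_all add: enc_mat_def)

lemma parsable_cnf: "parsable enc_cnf (\<lambda>\<phi>. \<phi>)"
proof -
  have "parsable (\<lambda>z :: literal. fst z # enc_nat (snd z)) (\<lambda>z. z)"
    by (rule parsable_code[OF parsable_seq[OF parsable_bit parsable_nat], where f="\<lambda>z. z"]) simp_all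
  from parsable_list[OF parsable_list[OF this]] show ?thesis
    by (rule parsable_code[where f="\<lambda>z. z"]) (simp_all add: enc_cnf_def split_beta')
qed

section \<open>Integer matrices and the construction of the instance\<close>

subsection \<open>Sums, tables and matrices\<close>

text \<open>Chosen by existence: on codes the result is determined, on other words it is arbitrary
  but still computed in polynomial time.\<close>

definition parse :: "('a \<Rightarrow> bool list) \<Rightarrow> ('a \<Rightarrow> 'b::enc) \<Rightarrow> bool list \<Rightarrow> 'b \<times> bool list" where
  "parse e g = (SOME P. parser P \<and> (\<forall>x r. P (e x @ r) = (g x, r)))"

lemma parse:
  assumes "parsable e g"
  shows "pt (parse e g)" and "parse e g (e x @ r) = (g x, r)"
proof -
  have "parser (parse e g) \<and> (\<forall>x r. parse e g (e x @ r) = (g x, r))"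
    unfolding parse_def by (rule someI_ex[OF assms[unfolded parsable_def]])
  then show "pt (parse e g)" and "parse e g (e x @ r) = (g x, r)" by (auto simp: parser_def)
qed

abbreviation ibits :: "int \<Rightarrow> nat" where
  "ibits i \<equiv> length (nat_bits (nat \<bar>i\<bar>))"

lemma ibits_less: "\<bar>i\<bar> < 2 ^ ibits i"
proof -
  have "int (nat \<bar>i\<bar>) < int (2 ^ ibits i)" using nat_bits_less[of "nat \<bar>i\<bar>"] by (simp only: of_nat_less_iff)
  then show ?thesis by simp
qed

lemma ibits_le: "\<bar>i\<bar> < 2 ^ k \<Longrightarrow> ibits i \<le> k"
  by (rule nat_bits_length_le) (simp add: nat_less_iff)

lemma sz_int: "sz (i :: int) \<le> 4 * ibits i + 5"
proof -
  have "sz i = 1 + sz (i < 0) + sz (nat \<bar>i\<bar>)" by (simp add: sz_def code_int_def)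
  then show ?thesis using sz_bool[of "i < 0"] sz_nat[of "nat \<bar>i\<bar>"] by linarith
qed

lemma pbd_ibits: "pt f \<Longrightarrow> pbd (\<lambda>x. ibits (f x))"
  by (intro pbd_nat_bits pt_nat_abs)

lemma ibits_add: "ibits (i + j) \<le> ibits i + ibits j + 1"
proof (rule ibits_le)
  have "\<bar>i\<bar> * 1 < 2 ^ ibits i * 2 ^ ibits j" by (intro mult_less_le_imp_less ibits_less) auto
  moreover have "1 * \<bar>j\<bar> < 2 ^ ibits i * 2 ^ ibits j" by (intro mult_le_less_imp_less ibits_less) auto
  moreover have "\<bar>i + j\<bar> \<le> \<bar>i\<bar> + \<bar>j\<bar>" by (rule abs_triangle_ineq)
  ultimately show "\<bar>i + j\<bar> < 2 ^ (ibits i + ibits j + 1)" by (simp add: power_add)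
qed

lemma ibits_mult: "ibits (i * j) \<le> ibits i + ibits j"
  using nat_bits_mult[of "nat \<bar>i\<bar>" "nat \<bar>j\<bar>"] by (simp add: abs_mult nat_mult_distrib)

lemma pt_sum_list:
  fixes f :: "'a::enc \<Rightarrow> 'b::enc \<Rightarrow> int"
  assumes f: "pt (\<lambda>z. f (fst z) (snd z))" and l: "pt l"
  shows "pt (\<lambda>x. sum_list (map (f x) (l x)))"
proof -
  have "foldl (\<lambda>s e. s + g e) a xs = a + sum_list (map g xs)" for g :: "'b \<Rightarrow> int" and a xs
    by (induction xs arbitrary: a) auto
  moreover have "pt (\<lambda>x. foldl (\<lambda>s e. s + f x e) 0 (l x))"
  proof (rule pt_foldl_measure[where \<mu>=ibits and c=5 and B="\<lambda>z. ibits (f (fst z) (snd z)) + 1"])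
    show "sz s \<le> 5 * ibits s + 5" for s using sz_int[of s] by simp
    show "ibits (s + f x e) \<le> ibits s + (ibits (f (fst (x, e)) (snd (x, e))) + 1)" for s x e
      using ibits_add[of s "f x e"] by simp
  qed (intro pt_intros l pt_comp2[OF f] pbd_add pbd_const pbd_ibits f)+
  ultimately show ?thesis by simp
qed

lemma pt_power_length:
  fixes f :: "'a::enc \<Rightarrow> int"
  assumes f: "pt f" and l: "pt l"
  shows "pt (\<lambda>x. f x ^ length (l x))"
proof -
  have "foldl (\<lambda>s _. s * a) b xs = b * a ^ length xs" for a b :: int and xs :: "'b list"
    by (induction xs arbitrary: b) auto
  moreover have "pt (\<lambda>x. foldl (\<lambda>s _. s * f x) 1 (l x))"
  proof (rule pt_foldl_measure[where \<mu>=ibits and c=5 and B="\<lambda>z. ibits (f (fst z))"])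
    show "sz s \<le> 5 * ibits s + 5" for s using sz_int[of s] by simp
    show "ibits (s * f x) \<le> ibits s + ibits (f (fst (x, e)))" for s x and e :: 'b
      using ibits_mult[of s "f x"] by simp
  qed (intro pt_intros l pt_comp[OF f] pbd_const pbd_ibits f)+
  ultimately show ?thesis by simp
qed

definition tab :: "nat list \<Rightarrow> nat list \<Rightarrow> (nat \<Rightarrow> nat \<Rightarrow> 'a) \<Rightarrow> 'a list list" where
  "tab us vs m = map (\<lambda>i. map (m i) vs) us"

definition ent :: "int list list \<Rightarrow> nat \<Rightarrow> nat \<Rightarrow> int" where
  "ent M i j = nthd 0 (nthd [] M i) j"

lemma pt_tab:
  assumes m: "pt (\<lambda>z. m (fst z) (fst (snd z)) (snd (snd z)))" and us: "pt us" "pt vs"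
  shows "pt (\<lambda>x. tab (us x) (vs x) (m x))"
  unfolding tab_def
proof (rule pt_map[OF _ us(1)], rule pt_map)
  have "pt (\<lambda>z. (fst (fst z), snd (fst z), snd z))" by (intro pt_intros)
  from pt_comp[OF m this] show "pt (\<lambda>z. m (fst (fst z)) (snd (fst z)) (snd z))" by simp
qed (intro pt_comp[OF us(2)] pt_intros)

lemma pt_ent: "pt f \<Longrightarrow> pt g \<Longrightarrow> pt h \<Longrightarrow> pt (\<lambda>x. ent (f x) (g x) (h x))"
  unfolding ent_def by (intro pt_intros)

lemma ent_tab: "u < n \<Longrightarrow> v < m \<Longrightarrow> ent (tab [0..<n] [0..<m] f) u v = f u v"
  by (simp add: ent_def tab_def nthd_def)

definition imul :: "nat list \<Rightarrow> int list list \<Rightarrow> int list list \<Rightarrow> int list list" where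
  "imul us A B = tab us us (\<lambda>i j. \<Sum>l\<leftarrow>us. ent A i l * ent B l j)"

lemma pt_imul: "pt us \<Longrightarrow> pt f \<Longrightarrow> pt g \<Longrightarrow> pt (\<lambda>x. imul (us x) (f x) (g x))"
proof -
  assume a: "pt us" "pt f" "pt g"
  show ?thesis unfolding imul_def
    by (intro pt_tab pt_sum_list pt_mult_int pt_ent a pt_comp[OF a(1)] pt_comp[OF a(2)] pt_comp[OF a(3)] pt_intros)
qed

definition diag_diff :: "nat list \<Rightarrow> int \<Rightarrow> int list list \<Rightarrow> int list list" where
  "diag_diff us c M = tab us us (\<lambda>i j. (if i = j then c else 0) - ent M i j)"

lemma pt_diag_diff: "pt us \<Longrightarrow> pt f \<Longrightarrow> pt g \<Longrightarrow> pt (\<lambda>x. diag_diff (us x) (f x) (g x))"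
proof -
  assume a: "pt us" "pt f" "pt g"
  show ?thesis unfolding diag_diff_def
    by (intro pt_tab pt_minus_int pt_ent pt_if pt_eq a pt_comp[OF a(1)] pt_comp[OF a(2)] pt_comp[OF a(3)] pt_intros)
qed

definition bounded_by :: "nat \<Rightarrow> nat \<Rightarrow> int list list \<Rightarrow> bool" where
  "bounded_by N m M \<longleftrightarrow> length M \<le> N \<and> (\<forall>r \<in> set M. length r \<le> N \<and> (\<forall>e \<in> set r. \<bar>e\<bar> \<le> 2 ^ m))"

lemma sz_bounded_by: "bounded_by N m M \<Longrightarrow> sz M \<le> N * (N * (4 * m + 10) + 2) + 1"
proof -
  assume M: "bounded_by N m M"
  have e: "sz e \<le> 4 * m + 9" if "\<bar>e\<bar> \<le> 2 ^ m" for e :: int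
  proof -
    have "(2 :: int) ^ m < 2 ^ (m + 1)" by simp
    then have "ibits e \<le> m + 1" using that by (intro ibits_le) linarith
    then show ?thesis using sz_int[of e] by linarith
  qed
  have r: "sz r \<le> N * (4 * m + 10) + 1" if r: "r \<in> set M" for r
  proof -
    have "sz r \<le> length r * (4 * m + 9 + 1) + 1" by (rule sz_list_le) (use M r e in \<open>auto simp: bounded_by_def\<close>)
    also have "\<dots> \<le> N * (4 * m + 10) + 1"
      using M r by (intro add_right_mono mult_le_mono) (auto simp: bounded_by_def)
    finally show ?thesis .
  qed
  have "sz M \<le> length M * (N * (4 * m + 10) + 1 + 1) + 1" by (rule sz_list_le) (rule r)
  also have "\<dots> \<le> N * (N * (4 * m + 10) + 2) + 1"
    using M by (intro add_right_mono mult_le_mono) (auto simp: bounded_by_def)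
  finally show ?thesis .
qed

lemma bounded_by_ent: "bounded_by N m M \<Longrightarrow> \<bar>ent M i j\<bar> \<le> 2 ^ m"
  unfolding ent_def nthd_def bounded_by_def by (auto simp: all_set_conv_all_nth)

lemma bounded_by_tab: "length us \<le> N \<Longrightarrow> (\<And>i j. \<bar>f i j\<bar> \<le> 2 ^ m) \<Longrightarrow> bounded_by N m (tab us us f)"
  by (auto simp: bounded_by_def tab_def)

text \<open>Exponents of the entries add up, and \<open>L\<close> accounts for the number of
  summands.\<close>

lemma bounded_by_imul:
  assumes A: "bounded_by N m A" and B: "bounded_by N m' B" and us: "length us \<le> N" and N: "length us \<le> 2 ^ L"
  shows "bounded_by N (m + m' + L) (imul us A B)"
  unfolding imul_def
proof (rule bounded_by_tab[OF us])
  fix i j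
  have "\<bar>\<Sum>l\<leftarrow>vs. ent A i l * ent B l j\<bar> \<le> int (length vs) * 2 ^ (m + m')" for vs
  proof (induction vs)
    case (Cons l vs)
    have "\<bar>ent A i l * ent B l j\<bar> \<le> 2 ^ m * 2 ^ m'"
      unfolding abs_mult by (intro mult_mono bounded_by_ent[OF A] bounded_by_ent[OF B]) auto
    then have "\<bar>ent A i l * ent B l j\<bar> \<le> 2 ^ (m + m')" by (simp add: power_add)
    then show ?case using Cons by (simp add: distrib_right)
  qed simp
  from this[of us] have "\<bar>\<Sum>l\<leftarrow>us. ent A i l * ent B l j\<bar> \<le> int (length us) * 2 ^ (m + m')" .
  also have "\<dots> \<le> int (2 ^ L) * 2 ^ (m + m')" using N by (intro mult_right_mono) (simp_all only: of_nat_le_iff zero_le_power zero_le_numeral)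
  also have "\<dots> = 2 ^ (m + m' + L)" by (simp add: power_add)
  finally show "\<bar>\<Sum>l\<leftarrow>us. ent A i l * ent B l j\<bar> \<le> 2 ^ (m + m' + L)" .
qed

subsection \<open>The integer matrix of a graph\<close>

text \<open>On words that do not encode a graph, the number at the beginning may be exponentially large,
  hence the second bound.\<close>

definition verts :: "bool list \<Rightarrow> nat list" where
  "verts w = filter (\<lambda>i. i < fst (parse enc_nat (\<lambda>n. n) w)) [0..<length (snd (parse enc_nat (\<lambda>n. n) w))]"

definition adj :: "bool list \<Rightarrow> int list list" where
  "adj w = tab (verts w) (verts w) (\<lambda>i j. if nthd False (snd (parse enc_nat (\<lambda>n. n) w)) (i * length (verts w) + j) then 1 else 0)"

definition deg :: "bool list \<Rightarrow> int" where
  "deg w = (\<Sum>j\<leftarrow>verts w. ent (adj w) 0 j)"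

text \<open>A unary loop counter: its length is \<open>a\<close>. The length of
  \<open>steps2\<close> is \<open>1 + 2 a\<close>, and as many squarings give the exponent
  \<open>2 * 4^a = b\<close>.\<close>

definition steps :: "bool list \<Rightarrow> bool list" where
  "steps w = nat_bits (length (verts w)) @ nat_bits (length (verts w))"

definition steps2 :: "bool list \<Rightarrow> bool list" where
  "steps2 w = True # steps w @ steps w"

definition adj_power :: "bool list \<Rightarrow> int list list" where
  "adj_power w = foldl (\<lambda>M _. imul (verts w) M (adj w)) (tab (verts w) (verts w) (\<lambda>i j. if i = j then 1 else 0)) (steps w)"

definition high_pass :: "bool list \<Rightarrow> int list list" where
  "high_pass w = foldl (\<lambda>M _. imul (verts w) M M)
     (diag_diff (verts w) (deg w ^ length (steps w)) (adj_power w)) (steps2 w)"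

definition denom :: "bool list \<Rightarrow> int" where
  "denom w = foldl (\<lambda>s _. s * s) (deg w ^ length (steps w)) (steps2 w)"

definition low_pass :: "bool list \<Rightarrow> int list list" where
  "low_pass w = diag_diff (verts w) (denom w) (high_pass w)"

lemmas pt_parse = parse(1)[THEN pt_comp]

lemma pt_verts: "pt f \<Longrightarrow> pt (\<lambda>x. verts (f x))"
proof -
  have "pt verts" unfolding verts_def
    by (intro pt_filter pt_intros pt_parse parsable_nat)
  then show "pt f \<Longrightarrow> pt (\<lambda>x. verts (f x))" by (rule pt_comp)
qed

lemma pt_adj: "pt f \<Longrightarrow> pt (\<lambda>x. adj (f x))"
proof -
  have "pt adj" unfolding adj_def
    by (intro pt_tab pt_verts pt_intros pt_parse parsable_nat)
  then show "pt f \<Longrightarrow> pt (\<lambda>x. adj (f x))" by (rule pt_comp)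
qed

lemma pt_deg: "pt f \<Longrightarrow> pt (\<lambda>x. deg (f x))"
proof -
  have "pt deg" unfolding deg_def
    by (intro pt_sum_list pt_ent pt_adj pt_verts pt_intros)
  then show "pt f \<Longrightarrow> pt (\<lambda>x. deg (f x))" by (rule pt_comp)
qed

lemma pt_steps: "pt f \<Longrightarrow> pt (\<lambda>x. steps (f x))" "pt f \<Longrightarrow> pt (\<lambda>x. steps2 (f x))"
  unfolding steps2_def steps_def by (intro pt_verts pt_intros; assumption)+

lemma length_verts: "length (verts w) \<le> 2 ^ length (nat_bits (length (verts w)))"
  using nat_bits_less by (rule less_imp_le)

lemma pbd_length: "pt l \<Longrightarrow> pbd (\<lambda>x. length (l x))"
  by (rule pbd_le[OF pt_pbd length_le_sz])

lemma two_power_nat_bits: "2 ^ length (nat_bits n) \<le> 2 * n + 1"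
proof -
  have "0 < n \<Longrightarrow> 2 ^ length (nat_bits n) \<le> 2 * n" for n
  proof (induction n rule: less_induct)
    case (less n)
    have e: "nat_bits n = odd n # nat_bits (n div 2)" using less.prems by (subst nat_bits.simps) simp
    show ?case
    proof (cases "n div 2 = 0")
      case True
      then show ?thesis using less.prems by (simp add: e)
    next
      case False
      then have "2 ^ length (nat_bits (n div 2)) \<le> 2 * (n div 2)" using less.prems by (intro less.IH) auto
      moreover have "2 * (n div 2) \<le> n" by simp
      ultimately have "2 * 2 ^ length (nat_bits (n div 2)) \<le> 2 * n" by linarith
      then show ?thesis by (simp add: e)
    qed
  qed
  then show ?thesis by (cases "n = 0") (auto intro: le_SucI)
qed

text \<open>Squaring doubles the bit length of the entries, so \<open>2^i\<close> has to stay
  polynomial; it does, because \<open>a\<close> is only twice the bit length of the number of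
  vertices.\<close>

lemma two_power_steps2: "i \<le> length (steps2 w) \<Longrightarrow> 2 ^ i \<le> 2 * (2 * length (verts w) + 1) ^ 4"
proof -
  assume i: "i \<le> length (steps2 w)"
  let ?n = "length (verts w)"
  have "(2 :: nat) ^ i \<le> 2 ^ (1 + 4 * length (nat_bits ?n))" using i by (intro power_increasing) (auto simp: steps2_def steps_def)
  also have "\<dots> = 2 * (2 ^ length (nat_bits ?n)) ^ 4" by (simp add: power_mult[symmetric] mult.commute)
  also have "\<dots> \<le> 2 * (2 * ?n + 1) ^ 4" using two_power_nat_bits[of ?n] by (intro mult_left_mono power_mono) auto
  finally show ?thesis .
qed

lemma bounded_by_adj: "bounded_by (length (verts w)) 0 (adj w)"
  unfolding adj_def by (rule bounded_by_tab) auto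

lemma bounded_by_adj_power_foldl:
  "bounded_by (length (verts w)) (length xs * length (steps w))
     (foldl (\<lambda>M _. imul (verts w) M (adj w)) (tab (verts w) (verts w) (\<lambda>i j. if i = j then 1 else 0)) xs)"
proof (induction xs rule: rev_induct)
  case Nil
  show ?case by (simp, rule bounded_by_tab) auto
next
  case (snoc x xs)
  have "length (verts w) \<le> 2 ^ length (steps w)"
  proof -
    have "(2 :: nat) ^ length (nat_bits (length (verts w))) \<le> 2 ^ length (steps w)"
      by (intro power_increasing) (auto simp: steps_def)
    then show ?thesis using length_verts[of w] by linarith
  qed
  from bounded_by_imul[OF snoc bounded_by_adj order_refl this] show ?case by (simp add: add.commute)
qed

lemma pt_adj_power: "pt f \<Longrightarrow> pt (\<lambda>x. adj_power (f x))"
proof -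
  have "pt adj_power" unfolding adj_power_def
  proof (rule pt_foldl_bounded)
    let ?n = "\<lambda>w. length (verts w)" and ?a = "\<lambda>w. length (steps w)"
    show "pbd (\<lambda>w. ?n w * (?n w * (4 * (?a w * ?a w) + 10) + 2) + 1)"
      by (intro pbd_add pbd_mult pbd_const pbd_length pt_verts pt_steps pt_id)
    fix w i assume i: "i \<le> length (steps w)"
    have "i * ?a w \<le> ?a w * ?a w" using i by (rule mult_le_mono1)
    then have "?n w * (?n w * (4 * (i * ?a w) + 10) + 2) + 1 \<le> ?n w * (?n w * (4 * (?a w * ?a w) + 10) + 2) + 1"
      by (intro add_right_mono mult_le_mono2)
    moreover have "length (take i (steps w)) = i" using i by simp
    ultimately show "sz (foldl (\<lambda>M _. imul (verts w) M (adj w)) (tab (verts w) (verts w) (\<lambda>i j. if i = j then 1 else 0)) (take i (steps w)))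
        \<le> ?n w * (?n w * (4 * (?a w * ?a w) + 10) + 2) + 1"
      using order_trans[OF sz_bounded_by[OF bounded_by_adj_power_foldl[of w "take i (steps w)"]]] by (simp only: order_refl)
  qed (intro pt_imul pt_tab pt_verts pt_adj pt_steps pt_intros)+
  then show "pt f \<Longrightarrow> pt (\<lambda>x. adj_power (f x))" by (rule pt_comp)
qed

definition start_bits :: "bool list \<Rightarrow> nat" where
  "start_bits w = ibits (deg w ^ length (steps w)) + length (steps w) * length (steps w) + 1"

lemma pbd_start_bits: "pbd start_bits"
  unfolding start_bits_def
  by (intro pbd_add pbd_mult pbd_const pbd_length pbd_ibits pt_power_length pt_steps pt_deg pt_id)

lemma bounded_by_start: "bounded_by (length (verts w)) (start_bits w) (diag_diff (verts w) (deg w ^ length (steps w)) (adj_power w))"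
  unfolding diag_diff_def
proof (rule bounded_by_tab)
  fix i j :: nat
  let ?c = "deg w ^ length (steps w)" and ?m = "length (steps w) * length (steps w)"
  have "\<bar>if i = j then ?c else 0\<bar> \<le> \<bar>?c\<bar>" by simp
  also have "\<dots> < 2 ^ ibits ?c" by (rule ibits_less)
  also have "\<dots> \<le> 2 ^ (ibits ?c + ?m)" by (intro power_increasing) auto
  finally have 1: "\<bar>if i = j then ?c else 0\<bar> \<le> 2 ^ (ibits ?c + ?m)" by simp
  have "\<bar>ent (adj_power w) i j\<bar> \<le> 2 ^ ?m"
    unfolding adj_power_def by (rule bounded_by_ent[OF bounded_by_adj_power_foldl])
  also have "\<dots> \<le> 2 ^ (ibits ?c + ?m)" by (intro power_increasing) auto
  finally have "\<bar>(if i = j then ?c else 0) - ent (adj_power w) i j\<bar> \<le> 2 ^ (ibits ?c + ?m) + 2 ^ (ibits ?c + ?m)"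
    using 1 by linarith
  then show "\<bar>(if i = j then ?c else 0) - ent (adj_power w) i j\<bar> \<le> 2 ^ start_bits w" by (simp add: start_bits_def)
qed simp

text \<open>A squaring takes the exponent \<open>m\<close> to \<open>2 m + L\<close>, so
  \<open>m + L\<close> doubles exactly; the induction is on this quantity.\<close>

lemma bounded_by_high_pass_foldl:
  "bounded_by (length (verts w)) (2 ^ length xs * (start_bits w + length (steps w)))
     (foldl (\<lambda>M _. imul (verts w) M M) (diag_diff (verts w) (deg w ^ length (steps w)) (adj_power w)) xs)"
proof -
  let ?L = "length (steps w)" and ?n = "length (verts w)"
  let ?M = "\<lambda>xs. foldl (\<lambda>M _. imul (verts w) M M) (diag_diff (verts w) (deg w ^ length (steps w)) (adj_power w)) xs"
  have L: "?n \<le> 2 ^ ?L"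
  proof -
    have "(2 :: nat) ^ length (nat_bits (length (verts w))) \<le> 2 ^ length (steps w)"
      by (intro power_increasing) (auto simp: steps_def)
    then show ?thesis using length_verts[of w] by linarith
  qed
  have mono: "bounded_by ?n m M \<Longrightarrow> m \<le> m' \<Longrightarrow> bounded_by ?n m' M" for m m' M
    unfolding bounded_by_def by (meson order_trans power_increasing one_le_numeral)
  have "\<exists>m. m + ?L \<le> 2 ^ length xs * (start_bits w + ?L) \<and> bounded_by ?n m (?M xs)"
  proof (induction xs rule: rev_induct)
    case Nil
    show ?case using bounded_by_start[of w] by auto
  next
    case (snoc x xs)
    then obtain m where m: "m + ?L \<le> 2 ^ length xs * (start_bits w + ?L)" "bounded_by ?n m (?M xs)" by blast
    have "bounded_by ?n (m + m + ?L) (?M (xs @ [x]))"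
      using bounded_by_imul[OF m(2) m(2) order_refl L] by simp
    moreover have "m + m + ?L + ?L \<le> 2 ^ length (xs @ [x]) * (start_bits w + ?L)"
      using m(1) by (simp add: mult.assoc)
    ultimately show ?case by blast
  qed
  then show ?thesis using mono by (meson add_leD1)
qed

lemma pt_high_pass: "pt f \<Longrightarrow> pt (\<lambda>x. high_pass (f x))"
proof -
  have "pt high_pass" unfolding high_pass_def
  proof (rule pt_foldl_bounded)
    let ?n = "\<lambda>w. length (verts w)" and ?m = "\<lambda>w. 2 * (2 * length (verts w) + 1) ^ 4 * (start_bits w + length (steps w))"
    show "pbd (\<lambda>w. ?n w * (?n w * (4 * ?m w + 10) + 2) + 1)"
      by (intro pbd_add pbd_mult pbd_power pbd_const pbd_length pt_verts pt_steps pt_id pbd_start_bits)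
    fix w i assume i: "i \<le> length (steps2 w)"
    have "2 ^ i * (start_bits w + length (steps w)) \<le> ?m w" using two_power_steps2[OF i] by (intro mult_right_mono) auto
    then have "?n w * (?n w * (4 * (2 ^ i * (start_bits w + length (steps w))) + 10) + 2) + 1 \<le> ?n w * (?n w * (4 * ?m w + 10) + 2) + 1"
      by (intro add_right_mono mult_le_mono2)
    moreover have "length (take i (steps2 w)) = i" using i by simp
    ultimately show "sz (foldl (\<lambda>M _. imul (verts w) M M) (diag_diff (verts w) (deg w ^ length (steps w)) (adj_power w)) (take i (steps2 w)))
        \<le> ?n w * (?n w * (4 * ?m w + 10) + 2) + 1"
      using order_trans[OF sz_bounded_by[OF bounded_by_high_pass_foldl[of w "take i (steps2 w)"]]] by (simp only: order_refl)
  qed (intro pt_imul pt_diag_diff pt_power_length pt_deg pt_adj_power pt_verts pt_steps pt_intros)+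
  then show "pt f \<Longrightarrow> pt (\<lambda>x. high_pass (f x))" by (rule pt_comp)
qed

lemma foldl_square: "foldl (\<lambda>s _. s * s) a xs = (a :: int) ^ (2 ^ length xs)"
  by (induction xs arbitrary: a) (simp_all add: power_mult power2_eq_square[symmetric])

lemma pt_denom: "pt f \<Longrightarrow> pt (\<lambda>x. denom (f x))"
proof -
  have "pt denom" unfolding denom_def
  proof (rule pt_foldl_bounded)
    let ?m = "\<lambda>w. 2 * (2 * length (verts w) + 1) ^ 4 * start_bits w"
    show "pbd (\<lambda>w. 4 * ?m w + 5)"
      by (intro pbd_add pbd_mult pbd_power pbd_const pbd_length pt_verts pt_id pbd_start_bits)
    fix w i assume i: "i \<le> length (steps2 w)"
    let ?a = "deg w ^ length (steps w)"
    have "\<bar>?a\<bar> < 2 ^ start_bits w"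
    proof -
      have "\<bar>?a\<bar> < 2 ^ ibits ?a" by (rule ibits_less)
      also have "\<dots> \<le> 2 ^ start_bits w" by (intro power_increasing) (auto simp: start_bits_def)
      finally show ?thesis .
    qed
    then have "\<bar>?a ^ (2 ^ i)\<bar> < (2 ^ start_bits w) ^ (2 ^ i)"
      unfolding power_abs by (intro power_strict_mono) auto
    then have "ibits (?a ^ (2 ^ i)) \<le> start_bits w * 2 ^ i" by (intro ibits_le) (simp add: power_mult)
    also have "\<dots> \<le> start_bits w * (2 * (2 * length (verts w) + 1) ^ 4)"
      using two_power_steps2[OF i] by (intro mult_left_mono) auto
    finally have "ibits (?a ^ (2 ^ i)) \<le> ?m w" by (simp add: mult.commute)
    then have "sz (?a ^ (2 ^ i)) \<le> 4 * ?m w + 5" using sz_int[of "?a ^ (2 ^ i)"] by linarith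
    moreover have "length (take i (steps2 w)) = i" using i by simp
    ultimately show "sz (foldl (\<lambda>s _. s * s) ?a (take i (steps2 w))) \<le> 4 * ?m w + 5"
      unfolding foldl_square by simp
  qed (intro pt_power_length pt_deg pt_steps pt_intros)+
  then show "pt f \<Longrightarrow> pt (\<lambda>x. denom (f x))" by (rule pt_comp)
qed

lemma pt_low_pass: "pt f \<Longrightarrow> pt (\<lambda>x. low_pass (f x))"
  unfolding low_pass_def by (intro pt_diag_diff pt_verts pt_denom pt_high_pass)

text \<open>The dimensions arise as lengths of lists with \<open>2 n + n^2\<close> and
  \<open>2 n + 1\<close> elements, so that index ranges come from unary bounds. Each entry is
  followed by the denominator 1 of an integer.\<close>

definition instance_word :: "nat \<Rightarrow> bool list \<Rightarrow> bool list" where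
  "instance_word K w = (let us = verts w; rows = us @ us @ concat (map (\<lambda>_. us) us); cols = 0 # us @ us in
     enc_nat (length rows) @ enc_nat (length cols) @
     enc_list (enc_list (\<lambda>z. enc_int z @ enc_int 1))
       (tab [0..<length rows] [0..<length cols] (lp_entry (length us) K (denom w) (ent (low_pass w)))))"

lemma pt_instance_word: "pt (instance_word K)"
proof -
  have z: "pt (\<lambda>z :: int. enc_int z @ enc_int 1)" by (intro pt_append pt_enc_int pt_id pt_const)
  have e: "pt (\<lambda>z. lp_entry (length (verts (fst z))) K (denom (fst z)) (ent (low_pass (fst z))) (fst (snd z)) (snd (snd z)))"
  proof -
    define n where "n z = length (verts (fst z))" for z :: "bool list \<times> nat \<times> nat"
    define i where "i z = fst (snd z)" for z :: "bool list \<times> nat \<times> nat"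
    define j where "j z = snd (snd z)" for z :: "bool list \<times> nat \<times> nat"
    define S where "S z = ent (low_pass (fst z)) (i z - n z) (j z - n z)" for z
    define D where "D z = denom (fst z)" for z :: "bool list \<times> nat \<times> nat"
    have "pt n" "pt i" "pt j" "pt S" "pt D"
      unfolding n_def[abs_def] i_def[abs_def] j_def[abs_def] S_def[abs_def] D_def[abs_def]
      by (intro pt_length pt_verts pt_ent pt_low_pass pt_denom pt_minus_nat pt_fst pt_snd pt_id)+
    then have "pt (\<lambda>z. if i z < n z then (if j z = n z + i z then int K * (int (n z) * int (n z)) * D z else 0)
      else if i z < 2 * n z then (if j z < n z then (if j z = i z - n z then int K * (int (n z) * int (n z)) else 0)
        else if j z < 2 * n z then - (int K * (int (n z) * (int (n z) * int (n z))) * S z) else 0)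
      else if j z = 2 * n z then 1 else 0)"
      by (intro pt_if pt_less_nat pt_eq pt_add_nat pt_minus_nat pt_mult_nat pt_mult_int pt_uminus_int pt_int pt_const)
    then show ?thesis
      by (rule pt_coerce) (simp add: lp_entry_def n_def i_def j_def S_def D_def power2_eq_square power3_eq_cube mult.assoc)
  qed
  define rows where "rows w = verts w @ verts w @ concat (map (\<lambda>_. verts w) (verts w))" for w
  define cols where "cols w = 0 # verts w @ verts w" for w
  have r: "pt rows" unfolding rows_def
    by (intro pt_append pt_concat pt_map pt_verts pt_fst pt_id)
  have c: "pt cols" unfolding cols_def by (intro pt_Cons pt_append pt_verts pt_const pt_id)
  have l: "pt (\<lambda>w. [0..<length (rows w)])" "pt (\<lambda>w. [0..<length (cols w)])" by (intro pt_upt_length r c)+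
  have "pt (\<lambda>w. tab [0..<length (rows w)] [0..<length (cols w)] (lp_entry (length (verts w)) K (denom w) (ent (low_pass w))))"
    by (rule pt_tab[OF e l])
  then have "pt (\<lambda>w. enc_list (enc_list (\<lambda>z. enc_int z @ enc_int 1))
      (tab [0..<length (rows w)] [0..<length (cols w)] (lp_entry (length (verts w)) K (denom w) (ent (low_pass w)))))"
    by (intro pt_enc_list[OF pt_enc_list[OF z pt_id]])
  then have "pt (\<lambda>w. enc_nat (length (rows w)) @ enc_nat (length (cols w)) @ enc_list (enc_list (\<lambda>z. enc_int z @ enc_int 1))
      (tab [0..<length (rows w)] [0..<length (cols w)] (lp_entry (length (verts w)) K (denom w) (ent (low_pass w)))))"
    by (intro pt_append pt_enc_nat pt_length r c)
  then show ?thesis by (rule pt_coerce) (simp add: instance_word_def Let_def rows_def cols_def)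
qed

subsection \<open>Correctness of the integer matrix\<close>

lemma filter_less_upt: "filter (\<lambda>i. i < n) [0..<m] = [0..<min n m]"
proof (induction m)
  case (Suc m)
  then show ?case by (cases "m < n") (simp_all add: min_absorb1 min_absorb2 not_less)
qed simp

lemma parse_enc_graph:
  "parse enc_nat (\<lambda>n. n) (enc_graph n E) = (n, map (\<lambda>e. e \<in> E) (List.product [0..<n] [0..<n]))"
  unfolding enc_graph_def by (rule parse(2)[OF parsable_nat])

lemma verts_enc_graph: "verts (enc_graph n E) = [0..<n]"
  by (cases n) (simp_all add: verts_def parse_enc_graph filter_less_upt)

lemma ent_adj:
  assumes "u < n" "v < n"
  shows "ent (adj (enc_graph n E)) u v = of_bool ((u, v) \<in> E)"
proof -
  have "Suc u * n \<le> n * n" using assms by (intro mult_le_mono1) simp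
  then have i: "u * n + v < n * n" using assms by simp
  have "List.product [0..<n] [0..<n] ! (u * n + v) = (u, v)"
    using product_nth[of "u * n + v" "[0..<n]" "[0..<n]"] i assms by simp
  then have "nthd False (map (\<lambda>e. e \<in> E) (List.product [0..<n] [0..<n])) (u * n + v) \<longleftrightarrow> (u, v) \<in> E"
    using i by (simp add: nthd_def)
  then show ?thesis
    unfolding adj_def verts_enc_graph parse_enc_graph using assms by (subst ent_tab) simp_all
qed

definition reps :: "nat \<Rightarrow> int list list \<Rightarrow> ((nat \<Rightarrow> real) \<Rightarrow> nat \<Rightarrow> real) \<Rightarrow> bool" where
  "reps n M T \<longleftrightarrow> (\<forall>f. \<forall>u<n. (\<Sum>v<n. real_of_int (ent M u v) * f v) = T f u)"

lemma sum_list_upt: "(\<Sum>l\<leftarrow>[0..<n]. f l) = (\<Sum>l<n. f l)"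
  by (simp add: interv_sum_list_conv_sum_set_nat atLeast0LessThan)

lemma reps_imul:
  assumes "reps n A T" "reps n B T'"
  shows "reps n (imul [0..<n] A B) (\<lambda>f. T (T' f))"
  unfolding reps_def
proof (intro allI impI)
  fix f :: "nat \<Rightarrow> real" and u assume u: "u < n"
  have "(\<Sum>v<n. real_of_int (ent (imul [0..<n] A B) u v) * f v) = (\<Sum>v<n. \<Sum>l<n. real_of_int (ent A u l) * (real_of_int (ent B l v) * f v))"
    using u by (intro sum.cong refl) (simp add: imul_def ent_tab sum_list_upt sum_distrib_right mult.assoc)
  also have "\<dots> = (\<Sum>l<n. \<Sum>v<n. real_of_int (ent A u l) * (real_of_int (ent B l v) * f v))"
    by (rule sum.swap)
  also have "\<dots> = (\<Sum>l<n. real_of_int (ent A u l) * (\<Sum>v<n. real_of_int (ent B l v) * f v))"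
    by (simp add: sum_distrib_left)
  also have "\<dots> = (\<Sum>l<n. real_of_int (ent A u l) * T' f l)"
    using assms(2) by (intro sum.cong refl) (simp add: reps_def)
  also have "\<dots> = T (T' f) u" using assms(1) u by (simp add: reps_def)
  finally show "(\<Sum>v<n. real_of_int (ent (imul [0..<n] A B) u v) * f v) = T (T' f) u" .
qed

lemma reps_one: "reps n (tab [0..<n] [0..<n] (\<lambda>i j. if i = j then 1 else 0)) (\<lambda>f. f)"
  unfolding reps_def by (auto simp: ent_tab if_distrib[of real_of_int] if_distrib[of "\<lambda>c. c * _"] cong: if_cong)

lemma reps_diag_diff: "reps n M T \<Longrightarrow> reps n (diag_diff [0..<n] c M) (\<lambda>f u. real_of_int c * f u - T f u)"
proof -
  assume M: "reps n M T"
  have "(\<Sum>v<n. real_of_int (ent (diag_diff [0..<n] c M) u v) * f v) = real_of_int c * f u - T f u" if "u < n" for f u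
  proof -
    have "(\<Sum>v<n. real_of_int (ent (diag_diff [0..<n] c M) u v) * f v) =
        (\<Sum>v<n. (if v = u then real_of_int c * f u else 0) - real_of_int (ent M u v) * f v)"
      using that by (intro sum.cong refl) (auto simp: diag_diff_def ent_tab algebra_simps)
    also have "\<dots> = real_of_int c * f u - T f u" using M that by (simp add: sum_subtractf reps_def)
    finally show ?thesis .
  qed
  then show ?thesis by (simp add: reps_def)
qed

lemma reps_power:
  assumes "reps n A T" "reps n I (\<lambda>f. f)"
  shows "reps n (foldl (\<lambda>M _. imul [0..<n] M A) I xs) (T ^^ length xs)"
proof (induction xs rule: rev_induct)
  case Nil
  then show ?case using assms(2) by (simp add: id_def)
next
  case (snoc x xs)
  have "(\<lambda>f. (T ^^ length xs) (T f)) = T ^^ length (xs @ [x])" by (simp add: fun_eq_iff funpow_swap1)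
  then show ?case using reps_imul[OF snoc assms(1)] by (simp del: funpow.simps)
qed

lemma reps_square:
  assumes "reps n M T"
  shows "reps n (foldl (\<lambda>M _. imul [0..<n] M M) M xs) (T ^^ (2 ^ length xs))"
  using assms
proof (induction xs arbitrary: M T)
  case (Cons x xs)
  have "(\<lambda>f. T (T f)) = T ^^ 2" by (simp add: fun_eq_iff numeral_2_eq_2)
  then have "(\<lambda>f. T (T f)) ^^ (2 ^ length xs) = T ^^ (2 ^ length (x # xs))" by (simp add: funpow_mult)
  then show ?case using Cons.IH[OF reps_imul[OF Cons.prems Cons.prems]] by simp
qed simp

lemma funpow_scale:
  fixes H :: "(nat \<Rightarrow> real) \<Rightarrow> nat \<Rightarrow> real"
  assumes "\<And>c f. H (\<lambda>u. c * f u) = (\<lambda>u. c * H f u)"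
  shows "((\<lambda>f u. c * H f u) ^^ j) f = (\<lambda>u. c ^ j * (H ^^ j) f u)"
  by (induction j) (simp_all add: assms mult.assoc)

text \<open>The adjacency matrix represents \<open>k G\<close>, so \<open>k^a\<close> times the
  filter is an integer matrix. Its power with exponent \<open>b\<close> is the filter power scaled
  by \<open>k^(a b)\<close>, which is \<open>denom\<close>, and the same scaling applies to the
  identity.\<close>

lemma low_pass_correct:
  assumes reg: "regular_graph {..<n} E"
  shows "1 \<le> denom (enc_graph n E)"
    and "u < n \<Longrightarrow> approx_projection n E f u =
      (\<Sum>v<n. real_of_int (ent (low_pass (enc_graph n E)) u v) * f v) / real_of_int (denom (enc_graph n E))"
proof -
  let ?w = "enc_graph n E"
  define k where "k = card (E `` {0})"
  interpret regular_walk n k E using regular_graph_walk(1)[OF reg] by (simp add: k_def)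
  have n: "2 \<le> n" by (rule regular_graph_walk(2)[OF reg])
  have Esub: "E `` {u} \<subseteq> {..<n}" for u using E_sub by auto
  have deg: "deg ?w = int k"
  proof -
    have "deg ?w = (\<Sum>j<n. of_bool ((0, j) \<in> E))"
      unfolding deg_def verts_enc_graph sum_list_upt using n by (intro sum.cong refl ent_adj) auto
    also have "\<dots> = (\<Sum>j\<in>E `` {0}. 1)" using Esub[of 0] by (intro sum.mono_neutral_cong_right) auto
    finally show ?thesis by (simp add: k_def)
  qed
  define a where "a = length (steps ?w)"
  have a: "a = 2 * length (nat_bits n)" by (simp add: a_def steps_def verts_enc_graph)
  define b :: nat where "b = 2 ^ length (steps2 ?w)"
  have b: "b = 2 * 4 ^ a"
  proof -
    have "length (steps2 ?w) = 1 + 2 * a" by (simp add: steps2_def a_def)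
    then show ?thesis by (simp add: b_def power_mult)
  qed
  define c where "c = real k ^ a"
  have adj: "reps n (adj ?w) (\<lambda>f u. real k * G f u)"
    unfolding reps_def
  proof (intro allI impI)
    fix f :: "nat \<Rightarrow> real" and u assume u: "u < n"
    have "(\<Sum>v<n. real_of_int (ent (adj ?w) u v) * f v) = (\<Sum>v<n. if v \<in> E `` {u} then f v else 0)"
      using u by (intro sum.cong refl) (simp add: ent_adj)
    also have "\<dots> = (\<Sum>v\<in>E `` {u}. f v)" using Esub[of u] by (intro sum.mono_neutral_cong_right) auto
    also have "\<dots> = real k * G f u" using k_pos by (simp add: G_def)
    finally show "(\<Sum>v<n. real_of_int (ent (adj ?w) u v) * f v) = real k * G f u" .
  qed
  have "reps n (adj_power ?w) ((\<lambda>f u. real k * G f u) ^^ a)"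
    unfolding adj_power_def verts_enc_graph a_def by (rule reps_power[OF adj reps_one])
  also have "(\<lambda>f u. real k * G f u) ^^ a = (\<lambda>f u. c * (G ^^ a) f u)"
    unfolding c_def by (rule ext, rule funpow_scale, rule G_scale)
  finally have P: "reps n (adj_power ?w) (\<lambda>f u. c * (G ^^ a) f u)" .
  have ka: "real_of_int (deg ?w ^ length (steps ?w)) = c" by (simp add: deg c_def a_def)
  have "reps n (diag_diff [0..<n] (deg ?w ^ length (steps ?w)) (adj_power ?w)) (\<lambda>f u. c * f u - c * (G ^^ a) f u)"
    using reps_diag_diff[OF P, of "deg ?w ^ length (steps ?w)"] unfolding ka .
  also have "(\<lambda>f u. c * f u - c * (G ^^ a) f u) = (\<lambda>f u. c * Q a f u)"
    by (simp add: Q_def fun_eq_iff algebra_simps)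
  finally have "reps n (high_pass ?w) ((\<lambda>f u. c * Q a f u) ^^ b)"
    unfolding high_pass_def verts_enc_graph b_def by (rule reps_square)
  also have "(\<lambda>f u. c * Q a f u) ^^ b = (\<lambda>f u. c ^ b * (Q a ^^ b) f u)"
  proof (rule ext, rule funpow_scale)
    have Gp: "(G ^^ j) (\<lambda>u. d * g u) = (\<lambda>u. d * (G ^^ j) g u)" for j d g
      by (induction j) (simp_all add: G_scale)
    show "Q a (\<lambda>u. d * g u) = (\<lambda>u. d * Q a g u)" for d g by (simp add: Q_def Gp algebra_simps)
  qed
  finally have H: "reps n (high_pass ?w) (\<lambda>f u. c ^ b * (Q a ^^ b) f u)" .
  have D: "denom ?w = (deg ?w ^ length (steps ?w)) ^ b" unfolding denom_def foldl_square b_def ..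
  then have D': "real_of_int (denom ?w) = c ^ b" using ka by simp
  show "1 \<le> denom ?w" unfolding D deg using k_pos by (simp add: one_le_power)
  then have D0: "c ^ b \<noteq> 0" using D' by linarith
  show "approx_projection n E f u = (\<Sum>v<n. real_of_int (ent (low_pass ?w) u v) * f v) / real_of_int (denom ?w)" if "u < n"
  proof -
    have "(\<Sum>v<n. real_of_int (ent (low_pass ?w) u v) * f v) = c ^ b * f u - c ^ b * (Q a ^^ b) f u"
      using reps_diag_diff[OF H, of "denom ?w"] that unfolding low_pass_def verts_enc_graph reps_def D' by blast
    then show ?thesis using D0 unfolding D' approx_projection_def Let_def a[symmetric] b[symmetric] k_def[symmetric]
      by (simp add: field_simps)
  qed
qed

lemma enc_list_map: "enc_list e (map f xs) = enc_list (\<lambda>x. e (f x)) xs"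
  by (simp add: enc_list_def comp_def)

lemma instance_word_enc_graph:
  assumes "regular_graph {..<n} E"
  obtains A :: "rat mat" and D S where "instance_word K (enc_graph n E) = enc_mat A"
    "A \<in> carrier_mat (2 * n + n\<^sup>2) (2 * n + 1)" "map_mat real_of_rat A = lp_matrix n K D S" "1 \<le> D"
    "\<And>f u. u < n \<Longrightarrow> approx_projection n E f u = (\<Sum>v<n. real_of_int (S u v) * f v) / real_of_int D"
proof -
  let ?w = "enc_graph n E"
  let ?D = "denom ?w" and ?S = "ent (low_pass ?w)"
  define A :: "rat mat" where "A = mat (2 * n + n\<^sup>2) (2 * n + 1) (\<lambda>(i, j). of_int (lp_entry n K ?D ?S i j))"
  show thesis
  proof (rule that)
    have "length (concat (map (\<lambda>_. [0..<n]) [0..<n])) = n\<^sup>2"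
      by (simp add: length_concat comp_def sum_list_triv power2_eq_square)
    then have l: "length (verts ?w @ verts ?w @ concat (map (\<lambda>_. verts ?w) (verts ?w))) = 2 * n + n\<^sup>2"
      "length (0 # verts ?w @ verts ?w) = 2 * n + 1" "length (verts ?w) = n"
      by (simp_all add: verts_enc_graph)
    have "mat_to_list A = map (map of_int) (tab [0..<2 * n + n\<^sup>2] [0..<2 * n + 1] (lp_entry n K ?D ?S))"
      unfolding mat_to_list_def tab_def A_def by (auto simp: comp_def simp del: upt_Suc)
    then show "instance_word K ?w = enc_mat A"
      unfolding instance_word_def Let_def l enc_mat_def
      by (simp add: enc_list_map enc_rat_of_int A_def del: upt_Suc)
    show "A \<in> carrier_mat (2 * n + n\<^sup>2) (2 * n + 1)" by (simp add: A_def)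
    show "map_mat real_of_rat A = lp_matrix n K ?D ?S" by (auto simp: A_def lp_matrix_def)
  qed (use low_pass_correct[OF assms] in auto)
qed

section \<open>Exact rational evaluation of the output\<close>

subsection \<open>Reading the answer from approximate factors\<close>

text \<open>Fractions are not reduced: without greatest common divisors, bit lengths merely add up,
  and only the sign of the total is needed.\<close>

definition frac_add :: "int \<times> int \<Rightarrow> int \<times> int \<Rightarrow> int \<times> int" where
  "frac_add p q = (fst p * snd q + fst q * snd p, snd p * snd q)"

definition frac_mult :: "int \<times> int \<Rightarrow> int \<times> int \<Rightarrow> int \<times> int" where
  "frac_mult p q = (fst p * fst q, snd p * snd q)"

definition frac_val :: "int \<times> int \<Rightarrow> rat" where
  "frac_val p = of_int (fst p) / of_int (snd p)"

lemma frac_add: "0 < snd p \<Longrightarrow> 0 < snd q \<Longrightarrow> frac_val (frac_add p q) = frac_val p + frac_val q \<and> 0 < snd (frac_add p q)"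
  by (simp add: frac_add_def frac_val_def field_simps)

lemma frac_mult: "frac_val (frac_mult p q) = frac_val p * frac_val q"
  by (simp add: frac_mult_def frac_val_def)

lemma frac_sum:
  "(\<And>q. q \<in> set qs \<Longrightarrow> 0 < snd q) \<Longrightarrow> 0 < snd p \<Longrightarrow>
    frac_val (foldl frac_add p qs) = frac_val p + (\<Sum>q\<leftarrow>qs. frac_val q) \<and> 0 < snd (foldl frac_add p qs)"
  by (induction qs arbitrary: p) (auto simp: frac_add add.assoc)

lemma frac_val_quotient_of: "frac_val (quotient_of x) = x"
  using quotient_of_div[of x "fst (quotient_of x)" "snd (quotient_of x)"] by (simp add: frac_val_def)

lemma frac_val_pos: "0 < snd p \<Longrightarrow> 0 < fst p \<longleftrightarrow> 0 < frac_val p"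
  by (simp add: frac_val_def zero_less_divide_iff)

text \<open>\<open>V\<close> has \<open>2 n\<close> rows, so dropping \<open>length V\<close> rows
  of \<open>U\<close> leaves the last block, and position \<open>length V\<close> in a row of
  \<open>V\<close> is the last column. Each row contributes -1/2 besides its products, so all terms
  add up to the yardstick minus \<open>n^2 / 2\<close>.\<close>

definition score_terms :: "(int \<times> int) list list \<Rightarrow> (int \<times> int) list list \<Rightarrow> (int \<times> int) list" where
  "score_terms U V = concat (map (\<lambda>r. (-1, 2) # map (\<lambda>p. frac_mult (fst p) (snd p))
     (zip r (map (\<lambda>s. nthd (0, 1) s (length V)) V))) (drop (length V) U))"

definition pmat :: "bool list \<Rightarrow> ((nat \<times> nat) \<times> (int \<times> int) list list) \<times> bool list" where
  "pmat = parse enc_mat (\<lambda>A. ((dim_row A, dim_col A), map (map quotient_of) (mat_to_list A)))"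

text \<open>The number of rows of \<open>V\<close> reveals \<open>n\<close>, so graphs with fewer
  than \<open>n0\<close> vertices are rejected here.\<close>

definition verdict :: "nat \<Rightarrow> bool list \<Rightarrow> bool list" where
  "verdict n0 y = (let U = snd (fst (pmat y)); V = snd (fst (pmat (snd (pmat y)))) in
     [\<not> length V < 2 * n0 \<and> 0 < fst (foldl frac_add (0, 1) (score_terms U V))])"

lemma pt_verdict: "pt (verdict n0)"
proof -
  have pm: "pt f \<Longrightarrow> pt (\<lambda>x. pmat (f x))" for f :: "bool list \<Rightarrow> bool list"
    unfolding pmat_def by (intro pt_parse parsable_mat)
  define U where "U y = snd (fst (pmat y))" for y
  define V where "V y = snd (fst (pmat (snd (pmat y))))" for y
  have U: "pt U" and V: "pt V" unfolding U_def V_def by (intro pt_fst pt_snd pm pt_id)+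
  have mult: "pt (\<lambda>z. frac_mult (f z) (g z))" if "pt f" "pt g" for f g :: "'a::enc \<Rightarrow> _"
    unfolding frac_mult_def by (intro pt_Pair pt_mult_int pt_fst pt_snd that)
  have add: "pt (\<lambda>z. frac_add (f z) (g z))" if "pt f" "pt g" for f g :: "'a::enc \<Rightarrow> _"
    unfolding frac_add_def by (intro pt_Pair pt_mult_int pt_add_int pt_fst pt_snd that)
  have T: "pt (\<lambda>y. score_terms (U y) (V y))"
    unfolding score_terms_def
    by (intro pt_concat pt_map pt_Cons pt_zip mult pt_drop_length pt_nthd pt_length pt_const pt_fst pt_snd U
        pt_comp[OF V] V pt_id)
  have F: "pt (\<lambda>y. foldl frac_add (0, 1) (score_terms (U y) (V y)))"
  \<comment> \<open>The common bit length of numerator and denominator grows by that of the added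
    fraction plus one, thanks to the cross multiplication in \<open>frac_add\<close>.\<close>
  proof (rule pt_foldl_measure[where \<mu>="\<lambda>p. max (ibits (fst p)) (ibits (snd p))" and c=11
        and B="\<lambda>z. ibits (fst (snd z)) + ibits (snd (snd z)) + 1"])
    show "sz p \<le> 11 * max (ibits (fst p)) (ibits (snd p)) + 11" for p :: "int \<times> int"
      using sz_int[of "fst p"] sz_int[of "snd p"] by (cases p) (simp add: max_def)
    show "max (ibits (fst (frac_add p q))) (ibits (snd (frac_add p q)))
        \<le> max (ibits (fst p)) (ibits (snd p)) + (ibits (fst (snd (y, q))) + ibits (snd (snd (y, q))) + 1)" for p q and y :: "bool list"
    proof -
      obtain a b where p: "p = (a, b)" by (cases p)
      obtain c d where q: "q = (c, d)" by (cases q)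
      let ?m = "max (ibits a) (ibits b)" and ?e = "ibits c + ibits d"
      have *: "\<bar>x * y\<bar> < 2 ^ (?m + ?e)" if "ibits x \<le> ?m" "ibits y \<le> ?e" for x y
      proof -
        have "\<bar>x * y\<bar> < 2 ^ ibits (x * y)" by (rule ibits_less)
        also have "\<dots> \<le> 2 ^ (?m + ?e)" using ibits_mult[of x y] that by (intro power_increasing) auto
        finally show ?thesis .
      qed
      have "\<bar>a * d + c * b\<bar> \<le> \<bar>a * d\<bar> + \<bar>b * c\<bar>" by (metis abs_triangle_ineq mult.commute)
      also have "\<dots> < 2 ^ (?m + ?e) + 2 ^ (?m + ?e)" by (intro add_strict_mono *) auto
      finally have "ibits (a * d + c * b) \<le> ?m + ?e + 1" by (intro ibits_le) simp
      moreover have "ibits (b * d) \<le> ?m + ?e + 1" 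
        by (rule order_trans[OF ibits_mult trans_le_add1[OF add_mono]]) simp_all
      ultimately show ?thesis by (simp add: p q frac_add_def)
    qed
  qed (intro add T pbd_add pbd_const pbd_ibits pt_fst pt_snd pt_id pt_const)+
  have "pt (\<lambda>y. [\<not> length (V y) < 2 * n0 \<and> (\<not> fst (foldl frac_add (0, 1) (score_terms (U y) (V y))) < 0 \<and>
      fst (foldl frac_add (0, 1) (score_terms (U y) (V y))) \<noteq> 0)])"
    by (intro pt_Cons pt_conj pt_not pt_less_nat pt_length V pt_const pt_neg pt_eq pt_fst F)
  then show ?thesis
  proof (rule pt_coerce)
    have "0 < i \<longleftrightarrow> \<not> i < 0 \<and> i \<noteq> 0" for i :: int by auto
    then show "code (verdict n0 y) = code [\<not> length (V y) < 2 * n0 \<and>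
        (\<not> fst (foldl frac_add (0, 1) (score_terms (U y) (V y))) < 0 \<and> fst (foldl frac_add (0, 1) (score_terms (U y) (V y))) \<noteq> 0)]" for y
      unfolding verdict_def Let_def U_def V_def by (simp only:)
  qed
qed

lemma verdict_enc_mat:
  fixes U V :: "rat mat"
  assumes U: "U \<in> carrier_mat (2 * n + n\<^sup>2) (2 * n)" and V: "V \<in> carrier_mat (2 * n) (2 * n + 1)"
  shows "verdict n0 (enc_mat U @ enc_mat V) =
    [n0 \<le> n \<and> (real n)\<^sup>2 / 2 < yardstick n (map_mat real_of_rat U * map_mat real_of_rat V)]"
proof -
  let ?q = "\<lambda>M. map (map quotient_of) (mat_to_list M)"
  have p: "pmat (enc_mat M @ r) = (((dim_row M, dim_col M), ?q M), r)" for M r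
    unfolding pmat_def by (rule parse(2)[OF parsable_mat])
  have pV: "pmat (enc_mat V) = (((dim_row V, dim_col V), ?q V), [])" using p[of V "[]"] by simp
  have lV: "length (?q V) = 2 * n" using V by (simp add: mat_to_list_def)
  have col: "map (\<lambda>s. nthd (0, 1) s (length (?q V))) (?q V) = map (\<lambda>l. quotient_of (V $$ (l, 2 * n))) [0..<2 * n]"
    unfolding lV using V by (auto simp: mat_to_list_def nthd_def comp_def simp del: upt_Suc)
  have rows: "drop (length (?q V)) (?q U) = map (\<lambda>i. map (\<lambda>l. quotient_of (U $$ (i, l))) [0..<2 * n]) [2 * n..<2 * n + n\<^sup>2]"
    unfolding lV using U by (auto simp: mat_to_list_def drop_map comp_def)
  have T: "score_terms (?q U) (?q V) = concat (map (\<lambda>i. (-1, 2) #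
      map (\<lambda>l. frac_mult (quotient_of (U $$ (i, l))) (quotient_of (V $$ (l, 2 * n)))) [0..<2 * n]) [2 * n..<2 * n + n\<^sup>2])"
    unfolding score_terms_def col rows by (simp add: zip_map_map zip_same_conv_map comp_def)
  let ?s = "foldl frac_add (0, 1) (score_terms (?q U) (?q V))"
  have pos: "0 < snd q" if "q \<in> set (score_terms (?q U) (?q V))" for q
    using that unfolding T by (auto simp: frac_mult_def quotient_of_denom_pos' intro!: mult_pos_pos split: if_splits)
  have fs: "frac_val ?s = (\<Sum>q\<leftarrow>score_terms (?q U) (?q V). frac_val q)" "0 < snd ?s"
    using frac_sum[of "score_terms (?q U) (?q V)" "(0, 1)", OF pos] by (simp_all add: frac_val_def)
  have "(\<Sum>q\<leftarrow>score_terms (?q U) (?q V). frac_val q) =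
      (\<Sum>i\<leftarrow>[2 * n..<2 * n + n\<^sup>2]. (\<Sum>l\<leftarrow>[0..<2 * n]. U $$ (i, l) * V $$ (l, 2 * n)) - 1 / 2)"
  proof -
    have c: "sum_list (concat xss) = (\<Sum>xs\<leftarrow>xss. sum_list xs)" for xss :: "rat list list" by (induction xss) auto
    have "frac_val (-1, 2) = - 1 / 2" by (simp add: frac_val_def)
    then show ?thesis unfolding T map_concat c map_map comp_def
      by (simp add: frac_mult frac_val_quotient_of comp_def)
  qed
  also have "\<dots> = (\<Sum>i\<in>{2 * n..<2 * n + n\<^sup>2}. (\<Sum>l<2 * n. U $$ (i, l) * V $$ (l, 2 * n)) - 1 / 2)"
    by (simp add: interv_sum_list_conv_sum_set_nat atLeast0LessThan)
  also have "\<dots> = (\<Sum>t<n\<^sup>2. (\<Sum>l<2 * n. U $$ (2 * n + t, l) * V $$ (l, 2 * n)) - 1 / 2)"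
    by (rule sum.reindex_bij_witness[where i="\<lambda>t. 2 * n + t" and j="\<lambda>i. i - 2 * n"]) auto
  finally have s: "frac_val ?s = (\<Sum>t<n\<^sup>2. (\<Sum>l<2 * n. U $$ (2 * n + t, l) * V $$ (l, 2 * n)) - 1 / 2)"
    using fs(1) by simp
  have "yardstick n (map_mat real_of_rat U * map_mat real_of_rat V) =
      (\<Sum>t<n\<^sup>2. \<Sum>l<2 * n. real_of_rat (U $$ (2 * n + t, l)) * real_of_rat (V $$ (l, 2 * n)))"
    unfolding yardstick_def using U V
    by (intro sum.cong refl) (simp add: scalar_prod_def atLeast0LessThan)
  then have "real_of_rat (frac_val ?s) = yardstick n (map_mat real_of_rat U * map_mat real_of_rat V) - (real n)\<^sup>2 / 2"
    unfolding s by (simp add: of_rat_sum of_rat_diff of_rat_mult of_rat_divide of_rat_power sum_subtractf)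
  moreover have "0 < fst ?s \<longleftrightarrow> 0 < real_of_rat (frac_val ?s)"
    using frac_val_pos[OF fs(2)] by simp
  ultimately have "0 < fst ?s \<longleftrightarrow> (real n)\<^sup>2 / 2 < yardstick n (map_mat real_of_rat U * map_mat real_of_rat V)" by simp
  then show ?thesis unfolding verdict_def Let_def p using lV by (simp add: not_less pV)
qed

section \<open>Growth of running times under composition\<close>

subsection \<open>Polynomial bounds on running times\<close>

text \<open>On each tape, one step creates at most one new nonblank cell. Output lengths of unknown
  algorithms are bounded in this way.\<close>

lemma tm_outputs_length:
  assumes M: "turing_machine M" and o: "tm_outputs M x y t"
  shows "real (length y) \<le> real (length x) + t"
proof -
  have wt: "{i. word_tape w i \<noteq> 0} = int ` {..<length w}" for w
  proof (intro equalityI subsetI)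
    fix i assume "i \<in> {i. word_tape w i \<noteq> 0}"
    then have "0 \<le> i" "i < int (length w)" by (auto simp: word_tape_def split: if_splits)
    then show "i \<in> int ` {..<length w}" by (intro image_eqI[of _ _ "nat i"]) auto
  qed (auto simp: word_tape_def)
  define nz where "nz f = {i :: int. f i \<noteq> (0 :: nat)}" for f
  obtain s q ts where s: "real s \<le> t" "(tm_step M ^^ s) (tm_init M x) = (q, ts)" "fst (last ts) = word_tape y"
    using o by (auto simp: tm_outputs_def)
  have "\<forall>tp \<in> set (snd ((tm_step M ^^ j) (tm_init M x))). finite (nz (fst tp)) \<and> card (nz (fst tp)) \<le> length x + j" for j
  proof (induction j)
    case 0
    have "finite (nz (word_tape w)) \<and> card (nz (word_tape w)) = length w" for w
      unfolding nz_def wt by (simp add: card_image)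
    then show ?case by (auto simp: tm_init_def)
  next
    case (Suc j)
    obtain q ts where c: "(tm_step M ^^ j) (tm_init M x) = (q, ts)" by fastforce
    show ?case
    proof (cases "q = tm_states M")
      case True
      then show ?thesis using Suc by (auto simp: c tm_step_halted simp del: tm_step.simps intro: le_SucI)
    next
      case False
      obtain q' as where tr: "tm_trans M q (scan ts) = (q', as)" by fastforce
      have "finite (nz (fst tp)) \<and> card (nz (fst tp)) \<le> length x + Suc j" if tp: "tp \<in> set (map2 tape_act as ts)" for tp
      proof -
        obtain w m f h where "(f, h) \<in> set ts" and tp: "tp = tape_act (w, m) (f, h)"
          using tp by (auto dest!: set_zip_leftD set_zip_rightD elim!: in_set_zipE)
        then have f: "finite (nz f)" "card (nz f) \<le> length x + j" using Suc by (auto simp: c)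
        have sub: "nz (fst tp) \<subseteq> insert h (nz f)" by (auto simp: tp nz_def split: if_splits)
        then have "card (nz (fst tp)) \<le> card (insert h (nz f))" using f by (intro card_mono) auto
        also have "\<dots> \<le> Suc (card (nz f))" by (rule card_insert_le_m1) (use f in auto)
        finally show ?thesis using f sub finite_subset by auto
      qed
      then show ?thesis by (simp add: c tm_step_running[OF False tr] del: tm_step.simps)
    qed
  qed
  from this[of s] have "\<forall>tp \<in> set ts. card (nz (fst tp)) \<le> length x + s" by (simp add: s(2))
  moreover have "ts \<noteq> []"
  proof -
    have "wf_config M (tm_init M x)" using M by (rule wf_config_init)
    then have "wf_config M ((tm_step M ^^ s) (tm_init M x))" using M wf_config_steps by blast
    then show ?thesis using M unfolding s(2) by (auto simp: wf_config_def turing_machine_def)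
  qed
  ultimately have "card (nz (fst (last ts))) \<le> length x + s" using last_in_set by blast
  then have "card (nz (word_tape y)) \<le> length x + s" unfolding s(3) .
  moreover have "card (nz (word_tape y)) = length y" unfolding nz_def wt by (simp add: card_image)
  ultimately show ?thesis using s(1) by linarith
qed

text \<open>Polynomial growth in a parameter \<open>z\<close>, which may itself be superpolynomial in the input length.\<close>

lemma growth_add:
  fixes z :: real
  assumes "1 \<le> z" "a \<le> real C * z ^ C" "b \<le> real D * z ^ D"
  shows "a + b \<le> real (C + D) * z ^ (C + D)"
proof -
  have "real C * z ^ C \<le> real C * z ^ (C + D)" "real D * z ^ D \<le> real D * z ^ (C + D)"
    using assms(1) by (intro mult_left_mono power_increasing; simp)+
  then show ?thesis using assms by (simp add: distrib_right)
qed

lemma growth_mult: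
  fixes z :: real
  assumes "1 \<le> z" "a \<le> real C * z ^ C" "b \<le> real D * z ^ D" "0 \<le> a" "0 \<le> b"
  shows "a * b \<le> real (C * D + C + D) * z ^ (C * D + C + D)"
proof -
  have "a * b \<le> (real C * z ^ C) * (real D * z ^ D)" using assms by (intro mult_mono) auto
  also have "\<dots> = real (C * D) * z ^ (C + D)" by (simp add: power_add)
  also have "\<dots> \<le> real (C * D + C + D) * z ^ (C * D + C + D)"
    using assms by (intro mult_mono power_increasing) auto
  finally show ?thesis .
qed

lemma growth_poly_bound:
  fixes z :: real
  assumes z: "1 \<le> z" and n: "real n \<le> real C * z ^ C"
  shows "real (poly_bound c n) \<le> real (c * C ^ c + c + C * c) * z ^ (c * C ^ c + c + C * c)"
proof -
  have "real n ^ c \<le> (real C * z ^ C) ^ c" using n by (intro power_mono) auto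
  also have "\<dots> = real (C ^ c) * z ^ (C * c)" by (simp add: power_mult_distrib power_mult)
  finally have "real c * real n ^ c \<le> real c * (real (C ^ c) * z ^ (C * c))" by (intro mult_left_mono) auto
  moreover have "real c * 1 \<le> real c * z ^ (C * c)" using z by (intro mult_left_mono one_le_power) auto
  ultimately have "real (poly_bound c n) \<le> real (c * C ^ c + c) * z ^ (C * c)" by (simp add: poly_bound_def distrib_right)
  also have "\<dots> \<le> real (c * C ^ c + c + C * c) * z ^ (c * C ^ c + c + C * c)"
    using z by (intro mult_mono power_increasing) auto
  finally show ?thesis .
qed

lemma growth_poly_bound_length:
  obtains c where "\<And>n. real C * (real n + 1) ^ C \<le> real (poly_bound c n)"
proof -
  obtain c where c: "\<And>n. poly_bound C (1 * n + 1) \<le> poly_bound c n" using poly_bound_linear[of C 1 1] by blast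
  have "real C * (real n + 1) ^ C \<le> real (poly_bound C (1 * n + 1))" for n
    by (simp add: poly_bound_def add.commute)
  then show thesis using c that[of c] by (meson of_nat_le_iff order_trans)
qed

lemma growth_length: "real n \<le> real 1 * (real n + 1) ^ 1" "1 \<le> real n + 1"
  by simp_all

lemma growth_poly_length: "\<exists>C. \<forall>n. real (poly_bound c n) \<le> real C * (real n + 1) ^ C"
  using growth_poly_bound[OF growth_length(2) growth_length(1)] by blast

lemma growth_trans:
  fixes z :: real
  assumes "1 \<le> z" "1 \<le> y" "y \<le> real C * z ^ C" "a \<le> real D * y ^ D"
  shows "a \<le> real (D * C ^ D + D + C * D) * z ^ (D * C ^ D + D + C * D)"
proof -
  have "y ^ D \<le> (real C * z ^ C) ^ D" using assms by (intro power_mono) auto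
  then have "real D * y ^ D \<le> real D * (real C * z ^ C) ^ D" by (intro mult_left_mono) auto
  also have "\<dots> = real (D * C ^ D) * z ^ (C * D)" by (simp add: power_mult_distrib power_mult)
  also have "\<dots> \<le> real (D * C ^ D + D + C * D) * z ^ (D * C ^ D + D + C * D)"
    using assms(1) by (intro mult_mono power_increasing) auto
  finally show ?thesis using assms(4) by linarith
qed

lemma poly_time_fun_length:
  assumes "poly_time_fun f"
  obtains c where "\<And>x. length (f x) \<le> poly_bound c (length x)"
proof -
  obtain M c where M: "turing_machine M" "\<And>x. tm_outputs M x (f x) (poly_bound c (length x))"
    using assms by (auto simp: poly_time_fun_def)
  obtain C where C: "\<And>n. real (poly_bound c n) \<le> real C * (real n + 1) ^ C" using growth_poly_length by blast
  obtain d where d: "\<And>n. real (1 + C) * (real n + 1) ^ (1 + C) \<le> real (poly_bound d n)" using growth_poly_bound_length by blast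
  have "real (length (f x)) \<le> real (poly_bound d (length x))" for x
    using tm_outputs_length[OF M, of x] growth_add[OF growth_length(2) growth_length(1) C[of "length x"]] d[of "length x"]
    by linarith
  then show thesis by (intro that[of d]) (simp only: of_nat_le_iff)
qed

lemma poly_time_fun_comp:
  assumes f: "poly_time_fun f" and g: "poly_time_fun g"
  shows "poly_time_fun (\<lambda>x. g (f x))"
proof -
  obtain M1 c1 where M1: "turing_machine M1" "\<And>x. tm_outputs M1 x (f x) (poly_bound c1 (length x))"
    using f by (auto simp: poly_time_fun_def)
  obtain M2 c2 where M2: "turing_machine M2" "\<And>x. tm_outputs M2 x (g x) (poly_bound c2 (length x))"
    using g by (auto simp: poly_time_fun_def)
  obtain d where d: "\<And>x. length (f x) \<le> poly_bound d (length x)" using poly_time_fun_length[OF f] by blast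
  obtain M where M: "turing_machine M"
    "\<And>x y z t1 t2. tm_outputs M1 x y t1 \<Longrightarrow> tm_outputs M2 y z t2 \<Longrightarrow> tm_outputs M x z (2 * t1 + 2 + t2)"
    using tm_compose[OF M1(1) M2(1)] by blast
  obtain C1 where C1: "\<And>n. real (poly_bound c1 n) \<le> real C1 * (real n + 1) ^ C1" using growth_poly_length by blast
  obtain Cd where Cd: "\<And>n. real (poly_bound d n) \<le> real Cd * (real n + 1) ^ Cd" using growth_poly_length by blast
  define C2 where "C2 = c2 * Cd ^ c2 + c2 + Cd * c2"
  define C where "C = C1 + C1 + 2 + C2"
  obtain e where e: "\<And>n. real C * (real n + 1) ^ C \<le> real (poly_bound e n)" using growth_poly_bound_length by blast
  have "tm_outputs M x (g (f x)) (poly_bound e (length x))" for x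
  proof -
    let ?z = "real (length x) + 1"
    have "real (length (f x)) \<le> real Cd * ?z ^ Cd" using d[of x] Cd[of "length x"] by (meson of_nat_le_iff order_trans)
    then have 2: "real (poly_bound c2 (length (f x))) \<le> real C2 * ?z ^ C2"
      unfolding C2_def by (rule growth_poly_bound[OF growth_length(2)])
    have "2 \<le> real 2 * ?z ^ 2" using one_le_power[OF growth_length(2), of "length x" 2] by simp
    from growth_add[OF growth_length(2) growth_add[OF growth_length(2) growth_add[OF growth_length(2) C1 C1] this] 2]
    have "2 * real (poly_bound c1 (length x)) + 2 + real (poly_bound c2 (length (f x))) \<le> real C * ?z ^ C"
      by (simp add: C_def)
    then show ?thesis using e[of "length x"] by (intro tm_outputs_mono[OF M(2)[OF M1(2) M2(2)]]) linarith
  qed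
  then show ?thesis using M(1) by (auto simp: poly_time_fun_def)
qed

lemma class_P_subset_class_NP: "class_P \<subseteq> class_NP"
proof
  fix L assume "L \<in> class_P"
  then have L: "poly_time_fun (\<lambda>x. [x \<in> L])" by (simp add: class_P_def)
  define P where "P y = fst (parse enc_word (\<lambda>w. w) y)" for y
  have P: "P (enc_word x @ w) = x" for x w unfolding P_def by (simp add: parse(2)[OF parsable_word])
  have "pt P" unfolding P_def by (intro pt_fst pt_parse parsable_word pt_id)
  then have "poly_time_fun (\<lambda>y. [P y \<in> L])" by (rule poly_time_fun_comp[OF pt_poly_time_fun L])
  then have "{y. P y \<in> L} \<in> class_P" by (simp add: class_P_def)
  moreover have "x \<in> L \<longleftrightarrow> (\<exists>w. length w \<le> poly_bound 0 (length x) \<and> enc_word x @ w \<in> {y. P y \<in> L})" for x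
    by (auto simp: P intro: exI[of _ "[]"])
  ultimately show "L \<in> class_NP" unfolding class_NP_def by blast
qed

subsection \<open>Deciding a language with an approximation algorithm\<close>

definition instance_rows :: "bool list \<Rightarrow> nat" where
  "instance_rows y = 2 * length (verts y) + (length (verts y))\<^sup>2"

text \<open>A list of exactly this length is computable in polynomial time from the input, so its
  length is polynomially bounded.\<close>

lemma instance_rows_bound:
  assumes "poly_time_fun f"
  obtains c where "\<And>x. instance_rows (f x) \<le> poly_bound c (length x)"
proof -
  have "pt (\<lambda>y. verts y @ verts y @ concat (map (\<lambda>_. verts y) (verts y)))"
    by (intro pt_append pt_concat pt_map pt_verts pt_fst pt_id)
  then have "pt (\<lambda>y. map (\<lambda>_. True) (verts y @ verts y @ concat (map (\<lambda>_. verts y) (verts y))))"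
    by (intro pt_map pt_const)
  from poly_time_fun_comp[OF assms pt_poly_time_fun[OF this]]
  obtain c where "\<And>x. length (map (\<lambda>_. True) (verts (f x) @ verts (f x) @ concat (map (\<lambda>_. verts (f x)) (verts (f x))))) \<le> poly_bound c (length x)"
    using poly_time_fun_length by blast
  then have "\<And>x. instance_rows (f x) \<le> poly_bound c (length x)"
    by (simp add: instance_rows_def length_concat comp_def sum_list_triv power2_eq_square mult_2 add.assoc)
  then show thesis by (rule that)
qed

text \<open>Three machines in sequence: reduction, approximation, verdict. The output of the second
  may be as long as its running time, so all bounds are polynomial in the product of
  \<open>T\<close> and the input length; for exponential \<open>T\<close> the exponent is later only
  multiplied by a constant.\<close>

lemma decide_by_approximation:
  fixes p r \<epsilon> \<delta> :: real and K :: "real \<Rightarrow> nat" and T :: "nat \<Rightarrow> real"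
  assumes yes: "\<And>n E D S U V. regular_graph {..<n} E \<Longrightarrow> 1 \<le> \<delta> * real n \<Longrightarrow>
      small_set_expansion {..<n} E \<delta> \<le> \<epsilon> \<Longrightarrow> 1 \<le> D \<Longrightarrow>
      (\<And>f u. u < n \<Longrightarrow> approx_projection n E f u = (\<Sum>v<n. real_of_int (S u v) * f v) / real_of_int D) \<Longrightarrow>
      lp_approx p r (2 * n) (lp_matrix n (K \<delta>) D S) U V \<Longrightarrow>
      2 \<le> \<delta> * real n \<and> (real n)\<^sup>2 / 2 < yardstick n (U * V)"
    and no: "\<And>n E D S U V. regular_graph {..<n} E \<Longrightarrow> 2 \<le> \<delta> * real n \<Longrightarrow>
      1 - \<epsilon> \<le> small_set_expansion {..<n} E \<delta> \<Longrightarrow> 1 \<le> D \<Longrightarrow>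
      (\<And>f u. u < n \<Longrightarrow> approx_projection n E f u = (\<Sum>v<n. real_of_int (S u v) * f v) / real_of_int D) \<Longrightarrow>
      lp_approx p r (2 * n) (lp_matrix n (K \<delta>) D S) U V \<Longrightarrow>
      yardstick n (U * V) < (real n)\<^sup>2 / 2"
    and \<delta>: "0 < \<delta>" and f: "poly_time_fun f"
    and red: "\<And>x. x \<in> L \<Longrightarrow> f x \<in> SSE_yes \<epsilon> \<delta>" "\<And>x. x \<notin> L \<Longrightarrow> f x \<in> SSE_no \<epsilon> \<delta>"
    and alg: "lp_approx_alg_in_time p r T" and T1: "\<And>n. 1 \<le> n \<Longrightarrow> 1 \<le> T n"
  obtains M C where "turing_machine M"
    "\<And>x. tm_outputs M x [x \<in> L] (real C * (T (instance_rows (f x)) * (real (length x) + 1)) ^ C)"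
    "\<And>x. 1 \<le> instance_rows (f x)"
proof -
  \<comment> \<open>Below this size there are no yes-instances, and the no-instance bound does not
    apply.\<close>
  define n0 where "n0 = nat \<lceil>2 / \<delta>\<rceil>"
  have n0: "n0 \<le> n \<longleftrightarrow> 2 \<le> \<delta> * real n" for n
  proof -
    have "n0 \<le> n \<longleftrightarrow> 2 / \<delta> \<le> real n" unfolding n0_def by (rule nat_ceiling_le_eq)
    also have "\<dots> \<longleftrightarrow> 2 \<le> \<delta> * real n" using \<delta> by (simp add: field_simps)
    finally show ?thesis .
  qed
  have "poly_time_fun (\<lambda>x. instance_word (K \<delta>) (f x))"
    by (rule poly_time_fun_comp[OF f pt_poly_time_fun[OF pt_instance_word]])
  then obtain M1 c1 where M1: "turing_machine M1" "\<And>x. tm_outputs M1 x (instance_word (K \<delta>) (f x)) (poly_bound c1 (length x))"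
    by (auto simp: poly_time_fun_def)
  obtain M2 c2 where M2: "turing_machine M2" "\<And>n d A. 1 \<le> d \<Longrightarrow> d \<le> n \<Longrightarrow> A \<in> carrier_mat n d \<Longrightarrow>
      \<exists>U V. tm_outputs M2 (enc_mat A) (enc_mat U @ enc_mat V) (T n * poly_bound c2 (length (enc_mat A))) \<and>
        lp_approx p r (d - 1) (map_mat of_rat A) (map_mat of_rat U) (map_mat of_rat V)"
    using alg unfolding lp_approx_alg_in_time_def by blast
  obtain M3 c3 where M3: "turing_machine M3" "\<And>y. tm_outputs M3 y (verdict n0 y) (poly_bound c3 (length y))"
    using pt_poly_time_fun[OF pt_verdict[of n0]] by (auto simp: poly_time_fun_def)
  obtain M12 where M12: "turing_machine M12"
    "\<And>x y z t1 t2. tm_outputs M1 x y t1 \<Longrightarrow> tm_outputs M2 y z t2 \<Longrightarrow> tm_outputs M12 x z (2 * t1 + 2 + t2)"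
    using tm_compose[OF M1(1) M2(1)] by blast
  obtain M where M: "turing_machine M"
    "\<And>x y z t1 t2. tm_outputs M12 x y t1 \<Longrightarrow> tm_outputs M3 y z t2 \<Longrightarrow> tm_outputs M x z (2 * t1 + 2 + t2)"
    using tm_compose[OF M12(1) M3(1)] by blast
  obtain C1 where C1: "\<And>n. real (poly_bound c1 n) \<le> real C1 * (real n + 1) ^ C1" using growth_poly_length by blast
  define CA where "CA = 1 + C1"
  define C2 where "C2 = c2 * CA ^ c2 + c2 + CA * c2"
  define C2' where "C2' = 1 * C2 + 1 + C2"
  define C12 where "C12 = C1 + C1 + 2 + C2'"
  define CB where "CB = CA + C2'"
  define C3 where "C3 = c3 * CB ^ c3 + c3 + CB * c3"
  define C where "C = C12 + C12 + 2 + C3"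
  have rows: "1 \<le> instance_rows (f x)"
    and out: "tm_outputs M x [x \<in> L] (real C * (T (instance_rows (f x)) * (real (length x) + 1)) ^ C)" for x
  proof -
    obtain n E where G: "f x = enc_graph n E" "regular_graph {..<n} E"
      and inL: "x \<in> L \<Longrightarrow> 1 \<le> \<delta> * real n \<and> small_set_expansion {..<n} E \<delta> \<le> \<epsilon>"
      and notinL: "x \<notin> L \<Longrightarrow> 1 - \<epsilon> \<le> small_set_expansion {..<n} E \<delta>"
    proof (cases "x \<in> L")
      case True
      then show ?thesis using red(1)[OF True] that unfolding SSE_yes_def by blast
    next
      case False
      then show ?thesis using red(2)[OF False] that unfolding SSE_no_def by blast
    qed
    have n: "2 \<le> n" by (rule regular_graph_walk(2)[OF G(2)])
    have N: "instance_rows (f x) = 2 * n + n\<^sup>2" by (simp add: instance_rows_def G(1) verts_enc_graph)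
    then show "1 \<le> instance_rows (f x)" using n by simp
    then have T: "1 \<le> T (2 * n + n\<^sup>2)" using T1 N by simp
    obtain A :: "rat mat" and D S where A: "instance_word (K \<delta>) (enc_graph n E) = enc_mat A"
      "A \<in> carrier_mat (2 * n + n\<^sup>2) (2 * n + 1)" "map_mat real_of_rat A = lp_matrix n (K \<delta>) D S" "1 \<le> D"
      and S: "\<And>f u. u < n \<Longrightarrow> approx_projection n E f u = (\<Sum>v<n. real_of_int (S u v) * f v) / real_of_int D"
      by (rule instance_word_enc_graph[OF G(2), of "K \<delta>"]) (rule that; assumption)
    have "1 \<le> n\<^sup>2" using n by simp
    then have "2 * n + 1 \<le> 2 * n + n\<^sup>2" by simp
    from M2(2)[OF le_add2 this A(2), unfolded A(3) add_diff_cancel_right'] obtain U V where UV: "tm_outputs M2 (enc_mat A) (enc_mat U @ enc_mat V) (T (2 * n + n\<^sup>2) * poly_bound c2 (length (enc_mat A)))"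
      and app: "lp_approx p r (2 * n) (lp_matrix n (K \<delta>) D S) (map_mat of_rat U) (map_mat of_rat V)"
      by (elim exE conjE) (rule that; assumption)
    have car: "U \<in> carrier_mat (2 * n + n\<^sup>2) (2 * n)" "V \<in> carrier_mat (2 * n) (2 * n + 1)"
      using app[unfolded lp_approx_def, THEN conjunct1] app[unfolded lp_approx_def, THEN conjunct2, THEN conjunct1]
      by (simp_all add: lp_matrix_def)
    have "x \<in> L \<longleftrightarrow> n0 \<le> n \<and> (real n)\<^sup>2 / 2 < yardstick n (map_mat real_of_rat U * map_mat real_of_rat V)"
    proof (cases "x \<in> L")
      case True
      have "2 \<le> \<delta> * real n \<and> (real n)\<^sup>2 / 2 < yardstick n (map_mat real_of_rat U * map_mat real_of_rat V)"
        by (rule yes[where D=D and S=S, OF G(2) _ _ A(4) _ app]) (use inL[OF True] in \<open>blast intro: S\<close>)+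
      then show ?thesis using True n0 by simp
    next
      case False
      have "yardstick n (map_mat real_of_rat U * map_mat real_of_rat V) < (real n)\<^sup>2 / 2" if "2 \<le> \<delta> * real n"
        by (rule no[where D=D and S=S, OF G(2) that _ A(4) _ app]) (use notinL[OF False] in \<open>blast intro: S\<close>)+
      then show ?thesis using False n0 by (meson less_asym)
    qed
    then have v: "verdict n0 (enc_mat U @ enc_mat V) = [x \<in> L]" unfolding verdict_enc_mat[OF car] by simp
    let ?t1 = "real (poly_bound c1 (length x))" and ?t2 = "T (2 * n + n\<^sup>2) * real (poly_bound c2 (length (enc_mat A)))"
    let ?t3 = "real (poly_bound c3 (length (enc_mat U @ enc_mat V)))"
    have o1: "tm_outputs M1 x (enc_mat A) ?t1" using M1(2)[of x] by (simp only: A(1) G(1))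
    have o3: "tm_outputs M3 (enc_mat U @ enc_mat V) [x \<in> L] ?t3" using M3(2)[of "enc_mat U @ enc_mat V"] v by simp
    \<comment> \<open>Since \<open>T\<close> is at least 1 here, \<open>z\<close> dominates both of
      its factors and can replace them in every bound.\<close>
    define z where "z = T (2 * n + n\<^sup>2) * (real (length x) + 1)"
    have zT: "T (2 * n + n\<^sup>2) \<le> z" and zx: "real (length x) + 1 \<le> z"
      using T mult_left_mono[of 1 "real (length x) + 1" "T (2 * n + n\<^sup>2)"] mult_right_mono[OF T, of "real (length x) + 1"]
      by (simp_all add: z_def)
    have z1: "1 \<le> z" using zx by linarith
    have t1: "?t1 \<le> real C1 * z ^ C1"
    proof -
      have "(real (length x) + 1) ^ C1 \<le> z ^ C1" using zx by (intro power_mono) auto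
      then show ?thesis using C1[of "length x"] mult_left_mono[of "(real (length x) + 1) ^ C1" "z ^ C1" "real C1"] by simp
    qed
    have "real (length x) \<le> real 1 * z ^ 1" using zx by simp
    from growth_add[OF z1 this t1] have lA: "real (length (enc_mat A)) \<le> real CA * z ^ CA"
      using tm_outputs_length[OF M1(1) o1] by (simp add: CA_def)
    have "real (poly_bound c2 (length (enc_mat A))) \<le> real C2 * z ^ C2"
      unfolding C2_def by (rule growth_poly_bound[OF z1 lA])
    moreover have "T (2 * n + n\<^sup>2) \<le> real 1 * z ^ 1" using zT by simp
    ultimately have t2: "?t2 \<le> real C2' * z ^ C2'" unfolding C2'_def using T by (intro growth_mult[OF z1]) auto
    have two: "2 \<le> real 2 * z ^ 2" using one_le_power[OF z1, of 2] by simp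
    have t12: "2 * ?t1 + 2 + ?t2 \<le> real C12 * z ^ C12"
      using growth_add[OF z1 growth_add[OF z1 growth_add[OF z1 t1 t1] two] t2] by (simp add: C12_def)
    have "real (length (enc_mat U @ enc_mat V)) \<le> real CB * z ^ CB"
      using tm_outputs_length[OF M2(1) UV] growth_add[OF z1 lA t2] by (simp add: CB_def)
    then have t3: "?t3 \<le> real C3 * z ^ C3" unfolding C3_def by (rule growth_poly_bound[OF z1])
    have "2 * (2 * ?t1 + 2 + ?t2) + 2 + ?t3 \<le> real C * z ^ C"
      unfolding C_def mult_2[of "2 * ?t1 + 2 + ?t2"]
      by (rule growth_add[OF z1 growth_add[OF z1 growth_add[OF z1 t12 t12] two] t3])
    then show "tm_outputs M x [x \<in> L] (real C * (T (instance_rows (f x)) * (real (length x) + 1)) ^ C)"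
      using tm_outputs_mono[OF M(2)[OF M12(2)[OF o1 UV] o3]] unfolding N z_def[symmetric] by blast
  qed
  from that[OF M(1) out rows] show thesis .
qed

section \<open>Satisfiability with inputs polynomial in the number of variables\<close>

subsection \<open>Compressing formulas\<close>

definition rdups :: "'a list \<Rightarrow> 'a list" where
  "rdups l = foldl (\<lambda>s e. if e \<in> set s then s else e # s) [] l"

lemma rdups: "set (rdups l) = set l" "distinct (rdups l)"
proof -
  have "set (foldl (\<lambda>s e. if e \<in> set s then s else e # s) a l) = set a \<union> set l \<and>
      (distinct a \<longrightarrow> distinct (foldl (\<lambda>s e. if e \<in> set s then s else e # s) a l))" for a
    by (induction l arbitrary: a) auto
  from this[of "[]"] show "set (rdups l) = set l" "distinct (rdups l)" by (simp_all add: rdups_def)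
qed

lemma pt_rdups: "pt l \<Longrightarrow> pt (\<lambda>x. rdups (l x))"
  unfolding rdups_def
  by (rule pt_foldl[where B="\<lambda>z. sz (snd z) + 1"]) (intro pt_if pt_mem pt_Cons pt_fst pt_snd pt_id pt_const pbd_snd | simp)+

definition index :: "'a list \<Rightarrow> 'a \<Rightarrow> nat" where
  "index vs v = hd (map fst (filter (\<lambda>p. snd p = v) (zip [0..<length vs] vs)) @ [0])"

lemma index: "v \<in> set vs \<Longrightarrow> index vs v < length vs \<and> vs ! index vs v = v"
proof -
  assume "v \<in> set vs"
  let ?F = "filter (\<lambda>p. snd p = v) (zip [0..<length vs] vs)"
  obtain i where i: "i < length vs" "vs ! i = v" using \<open>v \<in> set vs\<close> by (auto simp: in_set_conv_nth)
  then have "(i, v) \<in> set ?F" by (auto simp: in_set_zip intro!: exI[of _ i])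
  then have F: "?F \<noteq> []" using length_pos_if_in_set by fastforce
  have "hd ?F \<in> set ?F" using F by (rule hd_in_set)
  then have "hd ?F \<in> set (zip [0..<length vs] vs)" "snd (hd ?F) = v" unfolding set_filter by blast+
  moreover have "index vs v = fst (hd ?F)" using F by (auto simp: index_def hd_append hd_map)
  ultimately show ?thesis by (auto simp: in_set_zip)
qed

lemma pt_index: "pt f \<Longrightarrow> pt g \<Longrightarrow> pt (\<lambda>x. index (f x) (g x))"
proof -
  assume f: "pt f" and g: "pt g"
  show ?thesis unfolding index_def
    by (intro pt_hd pt_append pt_map pt_filter pt_eq pt_zip pt_upt_length pt_Cons pt_fst pt_snd pt_id pt_const f g pt_comp[OF g])
qed

definition var_list :: "cnf \<Rightarrow> nat list" where
  "var_list \<phi> = rdups (concat (map (map snd) \<phi>))"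

definition compress :: "cnf \<Rightarrow> cnf" where
  "compress \<phi> = rdups (map (map (\<lambda>l. (fst l, index (var_list \<phi>) (snd l)))) \<phi>)"

lemma set_var_list: "set (var_list \<phi>) = cnf_vars \<phi>"
  by (auto simp: var_list_def rdups cnf_vars_def)

lemma card_cnf_vars: "card (cnf_vars \<phi>) = length (var_list \<phi>)"
  unfolding set_var_list[symmetric] by (rule distinct_card) (simp add: var_list_def rdups)

lemma set_compress: "set (compress \<phi>) = (\<lambda>C. map (\<lambda>l. (fst l, index (var_list \<phi>) (snd l))) C) ` set \<phi>"
  by (simp add: compress_def rdups)

lemma index_var_list:
  assumes "C \<in> set \<phi>" "l \<in> set C"
  shows "index (var_list \<phi>) (snd l) < length (var_list \<phi>)" "var_list \<phi> ! index (var_list \<phi>) (snd l) = snd l"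
  using index[of "snd l" "var_list \<phi>"] assms by (auto simp: set_var_list cnf_vars_def)

lemma cnf_sat_iff: "cnf_sat \<phi> \<longleftrightarrow> (\<exists>\<alpha>. \<forall>C \<in> set \<phi>. \<exists>l \<in> set C. \<alpha> (snd l) = fst l)"
  by (simp add: cnf_sat_def split_beta')

lemma compress_sat:
  "cnf_sat \<phi> \<longleftrightarrow> (\<exists>w. length w = length (var_list \<phi>) \<and>
     (\<forall>C \<in> set (compress \<phi>). \<exists>l \<in> set C. nthd False w (snd l) = fst l))"
proof
  assume "cnf_sat \<phi>"
  then obtain \<alpha> where \<alpha>: "\<And>C. C \<in> set \<phi> \<Longrightarrow> \<exists>l \<in> set C. \<alpha> (snd l) = fst l" unfolding cnf_sat_iff by blast
  let ?w = "map \<alpha> (var_list \<phi>)"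
  have "\<exists>l \<in> set C. nthd False ?w (snd l) = fst l" if C: "C \<in> set (compress \<phi>)" for C
  proof -
    obtain C0 where C0: "C0 \<in> set \<phi>" "C = map (\<lambda>l. (fst l, index (var_list \<phi>) (snd l))) C0"
      using C unfolding set_compress by blast
    obtain l where l: "l \<in> set C0" "\<alpha> (snd l) = fst l" using \<alpha>[OF C0(1)] by blast
    have "nthd False ?w (index (var_list \<phi>) (snd l)) = fst l"
      using index_var_list[OF C0(1) l(1)] l(2) by (simp add: nthd_def)
    then show ?thesis using l(1) C0(2) by force
  qed
  then show "\<exists>w. length w = length (var_list \<phi>) \<and> (\<forall>C \<in> set (compress \<phi>). \<exists>l \<in> set C. nthd False w (snd l) = fst l)"
    by (intro exI[of _ ?w]) simp
next
  assume "\<exists>w. length w = length (var_list \<phi>) \<and> (\<forall>C \<in> set (compress \<phi>). \<exists>l \<in> set C. nthd False w (snd l) = fst l)"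
  then obtain w where w: "\<And>C. C \<in> set (compress \<phi>) \<Longrightarrow> \<exists>l \<in> set C. nthd False w (snd l) = fst l" by blast
  have "\<exists>l \<in> set C. nthd False w (index (var_list \<phi>) (snd l)) = fst l" if C: "C \<in> set \<phi>" for C
  proof -
    have "map (\<lambda>l. (fst l, index (var_list \<phi>) (snd l))) C \<in> set (compress \<phi>)"
      unfolding set_compress using C by (rule imageI)
    from w[OF this] show ?thesis by simp
  qed
  then show "cnf_sat \<phi>" unfolding cnf_sat_iff by (intro exI[of _ "\<lambda>v. nthd False w (index (var_list \<phi>) v)"]) simp
qed

lemma length_enc_list_le:
  "(\<And>x. x \<in> set xs \<Longrightarrow> length (e x) \<le> b) \<Longrightarrow> length (enc_list e xs) \<le> length xs * (b + 1) + 1"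
  by (induction xs) (fastforce simp: enc_list_def)+

text \<open>Over \<open>2 v\<close> literals there are at most \<open>sum (2 v)^i\<close> clauses
  with \<open>i\<close> up to 3, and a clause takes linear space, so the degree is really 4. The
  constant 400 stands for coefficient and exponent alike, the form used by the growth
  lemmas.\<close>

lemma length_enc_compress:
  assumes "cnf3 \<phi>"
  shows "length (enc_cnf (compress \<phi>)) \<le> 400 * (length (var_list \<phi>) + 1) ^ 400"
proof -
  let ?v = "length (var_list \<phi>)"
  let ?A = "(UNIV :: bool set) \<times> {..<?v}"
  have C: "set C \<subseteq> ?A \<and> length C \<le> 3" if "C \<in> set (compress \<phi>)" for C
    using that assms index_var_list unfolding set_compress cnf3_def by fastforce
  have "card (set (compress \<phi>)) \<le> card {C. set C \<subseteq> ?A \<and> length C \<le> 3}"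
    using C by (intro card_mono finite_lists_length_le) auto
  also have "\<dots> = (\<Sum>i\<le>3. (2 * ?v) ^ i)" by (subst card_lists_length_le) (simp_all add: card_UNIV_bool)
  also have "\<dots> \<le> (\<Sum>i\<le>(3::nat). 8 * (?v + 1) ^ 3)"
  proof (rule sum_mono)
    fix i :: nat assume i: "i \<in> {..3}"
    have "(2 * ?v) ^ i \<le> (2 * (?v + 1)) ^ i" by (rule power_mono) auto
    also have "\<dots> \<le> (2 * (?v + 1)) ^ 3" using i by (intro power_increasing) auto
    also have "\<dots> = 8 * (?v + 1) ^ 3" by (simp only: power_mult_distrib) simp
    finally show "(2 * ?v) ^ i \<le> 8 * (?v + 1) ^ 3" .
  qed
  finally have "card (set (compress \<phi>)) \<le> 32 * (?v + 1) ^ 3" by simp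
  then have n: "length (compress \<phi>) \<le> 32 * (?v + 1) ^ 3"
    by (simp only: compress_def distinct_card[OF rdups(2)])
  have word: "length (enc_word w) = 2 * length w + 1" for w
    by (induction w) (auto simp: enc_word_def enc_list_def)
  have nat: "length (enc_nat i) \<le> 2 * ?v + 1" if "i < ?v" for i
    using length_nat_bits_le[of i] that by (simp add: enc_nat_def word)
  have clause: "length (enc_list (\<lambda>(b, v). b # enc_nat v) C) \<le> 3 * (2 * ?v + 3) + 1" if "C \<in> set (compress \<phi>)" for C
  proof -
    have "length (enc_list (\<lambda>(b, v). b # enc_nat v) C) \<le> length C * ((2 * ?v + 2) + 1) + 1"
      by (rule length_enc_list_le) (use C[OF that] nat in fastforce)
    also have "\<dots> \<le> 3 * (2 * ?v + 3) + 1" using C[OF that] by (intro add_right_mono mult_le_mono) auto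
    finally show ?thesis .
  qed
  have "length (enc_cnf (compress \<phi>)) \<le> length (compress \<phi>) * ((3 * (2 * ?v + 3) + 1) + 1) + 1"
    unfolding enc_cnf_def by (rule length_enc_list_le) (rule clause)
  also have "\<dots> \<le> 32 * (?v + 1) ^ 3 * (11 * (?v + 1)) + 1"
    using n by (intro add_right_mono mult_le_mono) auto
  also have "\<dots> \<le> 353 * (?v + 1) ^ 4"
  proof -
    have "1 \<le> (?v + 1) ^ 4" by simp
    moreover have "32 * m ^ 3 * (11 * m) = 352 * m ^ 4" for m :: nat by (simp add: power3_eq_cube power4_eq_xxxx)
    note this[of "?v + 1"]
    ultimately show ?thesis by linarith
  qed
  also have "\<dots> \<le> 400 * (?v + 1) ^ 400" by (intro mult_le_mono power_increasing) auto
  finally show ?thesis .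
qed

definition parse_cnf :: "bool list \<Rightarrow> cnf" where
  "parse_cnf w = fst (parse enc_cnf (\<lambda>\<phi>. \<phi>) w)"

lemma parse_cnf: "parse_cnf (enc_cnf \<phi> @ w) = \<phi>"
  by (simp add: parse_cnf_def parse(2)[OF parsable_cnf])

lemma pt_parse_cnf: "pt f \<Longrightarrow> pt (\<lambda>x. parse_cnf (f x))"
  unfolding parse_cnf_def by (intro pt_fst pt_parse parsable_cnf)

text \<open>The padding makes room for a satisfying assignment as a witness of at most the same length.\<close>

definition compressed_word :: "bool list \<Rightarrow> bool list" where
  "compressed_word w = enc_cnf (compress (parse_cnf w)) @ map (\<lambda>_. True) (var_list (parse_cnf w))"

lemma poly_time_compressed_word: "poly_time_fun compressed_word"
proof (rule pt_poly_time_fun)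
  have v: "pt f \<Longrightarrow> pt (\<lambda>x. var_list (f x))" for f :: "'a::enc \<Rightarrow> cnf"
    unfolding var_list_def by (intro pt_rdups pt_concat pt_map pt_snd pt_fst pt_id)
  have c: "pt (\<lambda>w. compress (parse_cnf w))"
    unfolding compress_def by (intro pt_rdups pt_map pt_Pair pt_index v pt_parse_cnf pt_snd pt_fst pt_id)
  have e: "pt (\<lambda>l :: literal. fst l # enc_nat (snd l))" by (intro pt_Cons pt_enc_nat pt_fst pt_snd pt_id)
  have "pt (\<lambda>w. enc_list (enc_list (\<lambda>l. fst l # enc_nat (snd l))) (compress (parse_cnf w)))"
    by (rule pt_enc_list[OF pt_enc_list[OF e pt_id] c])
  then have "pt (\<lambda>w. enc_cnf (compress (parse_cnf w)))" by (simp add: enc_cnf_def split_beta')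
  then have "pt (\<lambda>w. enc_cnf (compress (parse_cnf w)) @ map (\<lambda>_. True) (var_list (parse_cnf w)))"
    by (intro pt_append pt_map pt_const v pt_parse_cnf pt_id)
  then show "pt compressed_word" by (simp add: compressed_word_def[abs_def])
qed

definition sat_witness :: "bool list \<Rightarrow> bool list \<Rightarrow> bool" where
  "sat_witness x w \<longleftrightarrow> (\<forall>C \<in> set (parse_cnf x). \<exists>l \<in> set C. nthd False w (snd l) = fst l)"

definition SAT_lang :: lang where
  "SAT_lang = {x. \<exists>w. length w \<le> poly_bound 1 (length x) \<and> sat_witness x w}"

lemma SAT_lang_NP: "SAT_lang \<in> class_NP"
proof -
  let ?P = "parse enc_word (\<lambda>w. w)"
  have "pt (\<lambda>z. sat_witness (fst z) (snd z))" unfolding sat_witness_def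
    by (intro pt_ball pt_bex pt_eq pt_nthd pt_parse_cnf pt_snd pt_fst pt_id pt_const)
  then have "pt (\<lambda>y. sat_witness (fst (?P y)) (snd (?P y)))"
    by (rule pt_comp[OF _ parse(1)[OF parsable_word]])
  then have "pt (\<lambda>y. [y \<in> {y. sat_witness (fst (?P y)) (snd (?P y))}])"
    unfolding mem_Collect_eq by (intro pt_Cons pt_const)
  from pt_poly_time_fun[OF this] have "{y. sat_witness (fst (?P y)) (snd (?P y))} \<in> class_P"
    unfolding class_P_def by blast
  moreover have "x \<in> SAT_lang \<longleftrightarrow> (\<exists>w. length w \<le> poly_bound 1 (length x) \<and>
      enc_word x @ w \<in> {y. sat_witness (fst (?P y)) (snd (?P y))})" for x
    by (simp add: SAT_lang_def parse(2)[OF parsable_word])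
  ultimately show ?thesis unfolding class_NP_def by blast
qed

lemma compressed_word_SAT: "compressed_word (enc_cnf \<phi>) \<in> SAT_lang \<longleftrightarrow> cnf_sat \<phi>"
proof -
  let ?x = "compressed_word (enc_cnf \<phi>)"
  have \<phi>: "parse_cnf (enc_cnf \<phi>) = \<phi>" using parse_cnf[of \<phi> "[]"] by simp
  have x: "parse_cnf ?x = compress \<phi>" unfolding compressed_word_def \<phi> by (rule parse_cnf)
  have l: "length (var_list \<phi>) \<le> poly_bound 1 (length ?x)" unfolding compressed_word_def \<phi> by (simp add: poly_bound_def)
  show ?thesis
  proof
    assume "cnf_sat \<phi>"
    then obtain w where "length w = length (var_list \<phi>)" "sat_witness ?x w" unfolding compress_sat sat_witness_def x by blast
    then show "?x \<in> SAT_lang" using l unfolding SAT_lang_def by (intro CollectI exI[of _ w]) simp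
  next
    assume "?x \<in> SAT_lang"
    then obtain w where "sat_witness ?x w" unfolding SAT_lang_def by blast
    then have w: "\<forall>C \<in> set (compress \<phi>). \<exists>l \<in> set C. nthd False w (snd l) = fst l"
      unfolding sat_witness_def x .
    \<comment> \<open>A witness may have any admissible length; it is cut or padded with
      \<open>False\<close> to one bit per variable, which changes no variable that occurs.\<close>
    let ?w = "map (nthd False w) [0..<length (var_list \<phi>)]"
    have "\<exists>l \<in> set C. nthd False ?w (snd l) = fst l" if C: "C \<in> set (compress \<phi>)" for C
    proof -
      obtain l where l: "l \<in> set C" "nthd False w (snd l) = fst l" using w C by blast
      have "snd l < length (var_list \<phi>)" using C l(1) index_var_list(1) unfolding set_compress by fastforce
      then have "nthd False ?w (snd l) = nthd False w (snd l)" by (simp add: nthd_def[of False ?w])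
      then show ?thesis using l by auto
    qed
    then show "cnf_sat \<phi>" unfolding compress_sat by (intro exI[of _ ?w]) simp
  qed
qed

lemma length_compressed_word:
  assumes "cnf3 \<phi>"
  shows "real (length (compressed_word (enc_cnf \<phi>))) \<le> 401 * (real (card (cnf_vars \<phi>)) + 1) ^ 401"
proof -
  let ?v = "length (var_list \<phi>)"
  have \<phi>: "parse_cnf (enc_cnf \<phi>) = \<phi>" using parse_cnf[of \<phi> "[]"] by simp
  have "?v \<le> (?v + 1) ^ 1" by simp
  also have "\<dots> \<le> (?v + 1) ^ 401" by (intro power_increasing) auto
  finally have "length (compressed_word (enc_cnf \<phi>)) \<le> 400 * (?v + 1) ^ 400 + (?v + 1) ^ 401"
    unfolding compressed_word_def \<phi> using length_enc_compress[OF assms] by simp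
  also have "\<dots> \<le> 400 * (?v + 1) ^ 401 + (?v + 1) ^ 401" by (intro add_right_mono mult_left_mono power_increasing) auto
  also have "\<dots> = 401 * (?v + 1) ^ 401" by simp
  finally have "real (length (compressed_word (enc_cnf \<phi>))) \<le> real (401 * (?v + 1) ^ 401)" by (simp only: of_nat_le_iff)
  then show ?thesis by (simp add: card_cnf_vars add.commute)
qed

section \<open>Both consequences of the reduction\<close>

subsection \<open>The theorem\<close>

lemma powr_smallo:
  fixes a b :: real
  assumes "0 \<le> a" "real c * \<delta> < 1" "0 < \<delta>"
  shows "(\<lambda>n. b * (a * (real n + 1) ^ c) powr \<delta>) \<in> o(\<lambda>n. real n)"
proof -
  define e where "e = real c * \<delta>"
  have e: "0 \<le> e" "e < 1" using assms by (auto simp: e_def)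
  have "(\<lambda>n :: nat. (real n + 1) powr e) \<in> o(\<lambda>n. real n)" using e by real_asymp
  then have "(\<lambda>n. (b * a powr \<delta>) * (real n + 1) powr e) \<in> o(\<lambda>n. real n)" by (cases "b * a powr \<delta> = 0") simp_all
  moreover have "(b * a powr \<delta>) * (real n + 1) powr e = b * (a * (real n + 1) ^ c) powr \<delta>" for n
    using assms by (simp add: powr_mult powr_powr e_def powr_realpow[symmetric] add_pos_nonneg)
  ultimately show ?thesis by simp
qed

theorem theorem5p1:
  fixes p r :: real
  assumes "1 < p" and "p < 2" and "r > 1" and SSEH
  shows "(class_P \<noteq> class_NP \<longrightarrow> \<not> (\<exists>e :: nat. lp_approx_alg_in_time p r (\<lambda>n. real n ^ e))) \<and>
         (ETH \<longrightarrow> (\<exists>\<delta> > 0. \<not> lp_approx_alg_in_time p r (\<lambda>n. 2 powr (real n powr \<delta>))))"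
proof (rule sse_gap[OF assms(1-3)])
  fix \<epsilon> :: real and K :: "real \<Rightarrow> nat"
  assume \<epsilon>: "0 < \<epsilon>"
    and yes: "\<And>\<delta> n E D S U V. 0 < \<delta> \<Longrightarrow> regular_graph {..<n} E \<Longrightarrow> 1 \<le> \<delta> * real n \<Longrightarrow>
      small_set_expansion {..<n} E \<delta> \<le> \<epsilon> \<Longrightarrow> 1 \<le> D \<Longrightarrow>
      (\<And>f u. u < n \<Longrightarrow> approx_projection n E f u = (\<Sum>v<n. real_of_int (S u v) * f v) / real_of_int D) \<Longrightarrow>
      lp_approx p r (2 * n) (lp_matrix n (K \<delta>) D S) U V \<Longrightarrow>
      2 \<le> \<delta> * real n \<and> (real n)\<^sup>2 / 2 < yardstick n (U * V)"
    and no: "\<And>\<delta> n E D S U V. 0 < \<delta> \<Longrightarrow> regular_graph {..<n} E \<Longrightarrow> 2 \<le> \<delta> * real n \<Longrightarrow>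
      1 - \<epsilon> \<le> small_set_expansion {..<n} E \<delta> \<Longrightarrow> 1 \<le> D \<Longrightarrow>
      (\<And>f u. u < n \<Longrightarrow> approx_projection n E f u = (\<Sum>v<n. real_of_int (S u v) * f v) / real_of_int D) \<Longrightarrow>
      lp_approx p r (2 * n) (lp_matrix n (K \<delta>) D S) U V \<Longrightarrow>
      yardstick n (U * V) < (real n)\<^sup>2 / 2"
  \<comment> \<open>The gap fixes \<open>\<epsilon>\<close> first; \<open>K\<close> is a function,
    since the scale of the matrix may depend on the \<open>\<delta>\<close> obtained now.\<close>
  obtain \<delta> where \<delta>: "0 < \<delta>" and hard: "NP_hard_promise (SSE_yes \<epsilon> \<delta>) (SSE_no \<epsilon> \<delta>)"
    using \<open>SSEH\<close> \<epsilon> unfolding SSEH_def by blast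
  have red: "\<exists>f. poly_time_fun f \<and> (\<forall>x. (x \<in> L \<longrightarrow> f x \<in> SSE_yes \<epsilon> \<delta>) \<and> (x \<notin> L \<longrightarrow> f x \<in> SSE_no \<epsilon> \<delta>))" if "L \<in> class_NP" for L
    using hard that unfolding NP_hard_promise_def by blast
  have decide: "\<exists>M C. turing_machine M \<and> (\<forall>x. tm_outputs M x [x \<in> L] (real C * (T (instance_rows (f x)) * (real (length x) + 1)) ^ C)) \<and>
      (\<forall>x. 1 \<le> instance_rows (f x))"
    if f: "poly_time_fun f" "\<forall>x. (x \<in> L \<longrightarrow> f x \<in> SSE_yes \<epsilon> \<delta>) \<and> (x \<notin> L \<longrightarrow> f x \<in> SSE_no \<epsilon> \<delta>)"
      and alg: "lp_approx_alg_in_time p r T" and T: "\<And>n. 1 \<le> n \<Longrightarrow> 1 \<le> T n" for f L T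
  proof -
    have r: "x \<in> L \<Longrightarrow> f x \<in> SSE_yes \<epsilon> \<delta>" "x \<notin> L \<Longrightarrow> f x \<in> SSE_no \<epsilon> \<delta>" for x using f(2) by auto
    show ?thesis
      by (rule decide_by_approximation[of \<delta> \<epsilon> p r K f L T])
        (fact yes[OF \<delta>] no[OF \<delta>] \<delta> f(1) r alg T | blast)+
  qed
  show ?thesis
  proof (intro conjI impI notI)
    assume ne: "class_P \<noteq> class_NP" and "\<exists>e :: nat. lp_approx_alg_in_time p r (\<lambda>n. real n ^ e)"
    then obtain e :: nat where alg: "lp_approx_alg_in_time p r (\<lambda>n. real n ^ e)" by blast
    have "L \<in> class_P" if "L \<in> class_NP" for L
    proof -
      obtain f where f: "poly_time_fun f" "\<forall>x. (x \<in> L \<longrightarrow> f x \<in> SSE_yes \<epsilon> \<delta>) \<and> (x \<notin> L \<longrightarrow> f x \<in> SSE_no \<epsilon> \<delta>)"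
        using red[OF \<open>L \<in> class_NP\<close>] by blast
      obtain M C where M: "turing_machine M"
        "\<And>x. tm_outputs M x [x \<in> L] (real C * (real (instance_rows (f x)) ^ e * (real (length x) + 1)) ^ C)"
        "\<And>x. 1 \<le> instance_rows (f x)"
        using decide[OF f alg] by (auto simp: one_le_power)
      obtain c where c: "\<And>x. instance_rows (f x) \<le> poly_bound c (length x)" using instance_rows_bound[OF f(1)] by blast
      obtain c' where c': "\<And>n. real (poly_bound c n) \<le> real c' * (real n + 1) ^ c'" using growth_poly_length by blast
      define B where "B = (e + 1) * c' ^ (e + 1) + (e + 1) + c' * (e + 1)"
      define B1 where "B1 = B * 1 + B + 1"
      define B2 where "B2 = C * B1 ^ C + C + B1 * C"
      obtain d where d: "\<And>n. real B2 * (real n + 1) ^ B2 \<le> real (poly_bound d n)" using growth_poly_bound_length by blast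
      have "tm_outputs M x [x \<in> L] (poly_bound d (length x))" for x
      proof -
        let ?z = "real (length x) + 1" and ?N = "real (instance_rows (f x))"
        note z = growth_length(2)[of "length x"]
        have N: "1 \<le> ?N" using M(3)[of x] by simp
        have Nz: "?N \<le> real c' * ?z ^ c'" using c[of x] c'[of "length x"] by (meson of_nat_le_iff order_trans)
        \<comment> \<open>The exponent is raised by one so that it can double as a coefficient: for
          \<open>e = 0\<close> the coefficient would vanish.\<close>
        have "?N ^ e \<le> ?N ^ (e + 1)" using N by (intro power_increasing) auto
        also have "\<dots> \<le> real (e + 1) * ?N ^ (e + 1)" using N by (simp add: distrib_right)
        finally have "?N ^ e \<le> real B * ?z ^ B" unfolding B_def by (rule growth_trans[OF z N Nz])
        moreover have "?z \<le> real 1 * ?z ^ 1" by simp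
        ultimately have "?N ^ e * ?z \<le> real B1 * ?z ^ B1" unfolding B1_def by (intro growth_mult[OF z]) auto
        moreover have "1 \<le> ?N ^ e * ?z" using mult_mono[OF one_le_power[OF N, of e] z] by simp
        ultimately have "real C * (?N ^ e * ?z) ^ C \<le> real B2 * ?z ^ B2"
          unfolding B2_def by (intro growth_trans[OF z]) auto
        then show ?thesis using d[of "length x"] by (intro tm_outputs_mono[OF M(2)]) linarith
      qed
      then show ?thesis using M(1) unfolding class_P_def poly_time_fun_def by blast
    qed
    then show False using ne class_P_subset_class_NP by blast
  next
    assume ETH
    obtain f where f: "poly_time_fun f" "\<forall>x. (x \<in> SAT_lang \<longrightarrow> f x \<in> SSE_yes \<epsilon> \<delta>) \<and> (x \<notin> SAT_lang \<longrightarrow> f x \<in> SSE_no \<epsilon> \<delta>)"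
      using red[OF SAT_lang_NP] by blast
    obtain c where c: "\<And>x. instance_rows (f x) \<le> poly_bound c (length x)" using instance_rows_bound[OF f(1)] by blast
    \<comment> \<open>Composes the row bound of the reduction with the length bound 401 of
      compressed formulas: the instance has at most \<open>a (v + 1)^a\<close> rows.\<close>
    define a where "a = c * 401 ^ c + c + 401 * c"
    \<comment> \<open>Any value below \<open>1 / a\<close> makes the exponent sublinear in the
      number of variables; adding 1 also covers \<open>a = 0\<close>.\<close>
    define \<delta>' where "\<delta>' = 1 / (real a + 1)"
    have \<delta>': "0 < \<delta>'" "real a * \<delta>' < 1" by (auto simp: \<delta>'_def)
    have "\<not> lp_approx_alg_in_time p r (\<lambda>n. 2 powr (real n powr \<delta>'))"
    proof
      assume alg: "lp_approx_alg_in_time p r (\<lambda>n. 2 powr (real n powr \<delta>'))"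
      obtain M C where M: "turing_machine M"
        "\<And>x. tm_outputs M x [x \<in> SAT_lang] (real C * (2 powr (real (instance_rows (f x)) powr \<delta>') * (real (length x) + 1)) ^ C)"
      proof -
        have "1 \<le> (2 :: real) powr (real n powr \<delta>')" for n by (rule ge_one_powr_ge_zero) auto
        from decide[OF f alg this] show thesis using that by blast
      qed
      obtain M0 c0 where M0: "turing_machine M0" "\<And>w. tm_outputs M0 w (compressed_word w) (poly_bound c0 (length w))"
        using poly_time_compressed_word by (auto simp: poly_time_fun_def)
      obtain c1 where c1: "\<And>w. length (compressed_word w) \<le> poly_bound c1 (length w)"
        using poly_time_fun_length[OF poly_time_compressed_word] by blast
      obtain M' where M': "turing_machine M'"
        "\<And>x y z t1 t2. tm_outputs M0 x y t1 \<Longrightarrow> tm_outputs M y z t2 \<Longrightarrow> tm_outputs M' x z (2 * t1 + 2 + t2)"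
        using tm_compose[OF M0(1) M(1)] by blast
      define g where "g v = real C * (real a * (real v + 1) ^ a) powr \<delta>'" for v
      have g: "g \<in> o(\<lambda>n. real n)" unfolding g_def by (rule powr_smallo) (use \<delta>' in auto)
      obtain C0 where C0: "\<And>n. real (poly_bound c0 n) \<le> real C0 * (real n + 1) ^ C0" using growth_poly_length by blast
      obtain C1 where C1: "\<And>n. real (poly_bound c1 n) \<le> real C1 * (real n + 1) ^ C1" using growth_poly_length by blast
      define B where "B = C * (C1 + 1) ^ C + C + (C1 + 1) * C"
      define B' where "B' = C0 + C0 + 2 + B"
      obtain d where d: "\<And>n. real B' * (real n + 1) ^ B' \<le> real (poly_bound d n)" using growth_poly_bound_length by blast
      have "tm_outputs M' (enc_cnf \<phi>) [cnf_sat \<phi>] (2 powr g (card (cnf_vars \<phi>)) * poly_bound d (length (enc_cnf \<phi>)))"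
        if \<phi>: "cnf3 \<phi>" for \<phi>
      proof -
        let ?x = "compressed_word (enc_cnf \<phi>)" and ?l = "length (enc_cnf \<phi>)" and ?v = "real (card (cnf_vars \<phi>)) + 1"
        let ?N = "real (instance_rows (f ?x))" and ?z = "real (length (enc_cnf \<phi>)) + 1"
        let ?G = "2 powr g (card (cnf_vars \<phi>))"
        note z = growth_length(2)[of ?l]
        have "real (length ?x) \<le> real 401 * ?v ^ 401" using length_compressed_word[OF \<phi>] by simp
        then have "real (poly_bound c (length ?x)) \<le> real a * ?v ^ a"
          unfolding a_def by (intro growth_poly_bound) simp_all
        then have N: "?N \<le> real a * ?v ^ a" using c[of ?x] by (meson of_nat_le_iff order_trans)
        \<comment> \<open>The polynomial overhead of the composed machine only multiplies the
          exponent by the constant \<open>C\<close>, which \<open>g\<close> absorbs.\<close>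
        have "(2 powr (?N powr \<delta>')) ^ C = 2 powr (real C * (?N powr \<delta>'))"
          by (simp add: powr_realpow[symmetric] powr_powr mult.commute)
        also have "\<dots> \<le> ?G" unfolding g_def using N \<delta>'(1)
          by (intro powr_mono mult_left_mono powr_mono2) auto
        finally have T: "(2 powr (?N powr \<delta>')) ^ C \<le> ?G" .
        have "0 \<le> g (card (cnf_vars \<phi>))" by (simp add: g_def)
        then have G: "1 \<le> ?G" by (intro ge_one_powr_ge_zero) auto
        have "real (length ?x) \<le> real C1 * ?z ^ C1" using c1[of "enc_cnf \<phi>"] C1[of ?l] by (meson of_nat_le_iff order_trans)
        from growth_add[OF z this, of 1 1] have x: "real (length ?x) + 1 \<le> real (C1 + 1) * ?z ^ (C1 + 1)" by simp
        have b: "real C * (real (length ?x) + 1) ^ C \<le> real B * ?z ^ B"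
          unfolding B_def by (rule growth_trans[OF z _ x]) simp_all
        have two: "2 \<le> real 2 * ?z ^ 2" using one_le_power[OF z, of 2] by simp
        have sum: "real (poly_bound c0 ?l) + real (poly_bound c0 ?l) + 2 + real B * ?z ^ B \<le> real (poly_bound d ?l)"
          using growth_add[OF z growth_add[OF z growth_add[OF z C0 C0] two] order_refl, of B] d[of ?l] by (simp add: B'_def)
        have "real C * (2 powr (?N powr \<delta>') * (real (length ?x) + 1)) ^ C =
            (2 powr (?N powr \<delta>')) ^ C * (real C * (real (length ?x) + 1) ^ C)" by (simp add: power_mult_distrib)
        also have "\<dots> \<le> ?G * (real B * ?z ^ B)" by (rule mult_mono[OF T b]) auto
        finally have "2 * real (poly_bound c0 ?l) + 2 + real C * (2 powr (?N powr \<delta>') * (real (length ?x) + 1)) ^ C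
            \<le> 1 * (2 * real (poly_bound c0 ?l) + 2) + ?G * (real B * ?z ^ B)" by simp
        also have "\<dots> \<le> ?G * (2 * real (poly_bound c0 ?l) + 2) + ?G * (real B * ?z ^ B)"
          using G by (intro add_right_mono mult_right_mono) auto
        also have "\<dots> = ?G * (real (poly_bound c0 ?l) + real (poly_bound c0 ?l) + 2 + real B * ?z ^ B)" by (simp add: algebra_simps)
        also have "\<dots> \<le> ?G * real (poly_bound d ?l)" using sum by (intro mult_left_mono) auto
        finally have "2 * real (poly_bound c0 ?l) + 2 + real C * (2 powr (?N powr \<delta>') * (real (length ?x) + 1)) ^ C
            \<le> ?G * real (poly_bound d ?l)" .
        moreover have "tm_outputs M ?x [cnf_sat \<phi>] (real C * (2 powr (?N powr \<delta>') * (real (length ?x) + 1)) ^ C)"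
          using M(2)[of ?x] unfolding compressed_word_SAT .
        ultimately show ?thesis using tm_outputs_mono[OF M'(2)[OF M0(2)]] by blast
      qed
      then show False using \<open>ETH\<close> M'(1) g unfolding ETH_def by blast
    qed
    then show "\<exists>\<delta> > 0. \<not> lp_approx_alg_in_time p r (\<lambda>n. 2 powr (real n powr \<delta>))" using \<delta>'(1) by blast
  qed
qed

end
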